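(* Let $K\in\mathbb R$, $N\in(-\infty,0)$ and $\bar k\in\mathbb N$. Let $\{(X_n,d_n,\mathfrak m_n,\mathcal S_{\mathfrak m_n},p_n)\}_{n\in\mathbb N}\subset\mathcal M^{qR}_{\bar k}$ be a sequence converging in the $\mathsf{iKRW}$-distance to $(X_\infty,d_\infty,\mathfrak m_\infty,\mathcal S_{\mathfrak m_\infty},p_\infty)\in\mathcal M^{qR}_{\bar k}$, i.e. $\mathsf d_{\mathsf{iKRW}}(\mathbb X_n,\mathbb X_\infty)\to0$. Assume further that: (i) $(X_n,d_n,\mathfrak m_n)$ is a $\mathsf{CD}(K,N)$ space for every $n\in\mathbb N$; (ii) there exists a single function $\omega:\mathbb N\times\mathbb N\times\mathbb R^+\to[0,1]$ such that $(X_n,d_n,\mathfrak m_n)$ is $\omega$-uniformly convex for every $n\in\mathbb N$; (iii) if $K<0$, then $\sup_{i\in\mathbb N\cup\{\infty\}}\operatorname{diam}(X_i,d_i)<\pi\sqrt{1/|K|}$. Then $(X_\infty,d_\infty,\mathfrak m_\infty)$ is a $\mathsf{CD}(K,N)$ space.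
   Context: **Measures.** A Polish space is a complete separable metric space $(X,d)$. A Borel measure is Radon if it is complete, locally finite and inner regular with respect to compact sets; it is quasi-Radon if it is complete, inner regular with respect to closed sets and effectively locally finite (for every measurable $A$ of positive measure there is an open $U$ of finite measure with $\mathfrak m(A\cap U)>0$). For a closed set $S\subset X$ with empty interior (possibly $S=\emptyset$), a neighbourhood of $S$ is a Borel set containing an open set that contains $S$; $\mathscr M_S(X)$ is the set of quasi-Radon measures $\mathfrak m$ with $\mathfrak m(S)=0$ such that for every neighbourhood $U$ of $S$ the restriction $\mathfrak m|_{X\setminus U}$ is a Radon measure finite on bounded sets. $\mathscr M^{qR}(X)$ is the union of the $\mathscr M_S(X)$ over such $S$. The singular set of $\mathfrak m$ is $\mathcal S_{\mathfrak m}=\{x\in X:\mathfrak m(U)=\infty\text{ for every open }U\ni x\}$; it is closed and $\mathfrak m$-null, and every $\mathfrak m\in\mathscr M^{qR}(X)$ is taken to satisfy $\mathfrak m\in\mathscr M_{\mathcal S_{\mathfrak m}}(X)$. **Spaces.** A pointed generalized metric measure space is $\mathbb X=(X,d,\mathfrak m,\mathcal C,p)$ with $(X,d)$ a complete separable length metric space, $0\neq\mathfrak m\in\mathscr M^{qR}(X)$, $\mathcal C\subset X$ closed with empty interior and $\mathfrak m(\mathcal C)=0$, $p\in\operatorname{supp}\mathfrak m$; one assumes $\operatorname{supp}\mathfrak m=X$. Throughout $\mathcal C=\mathcal S_{\mathfrak m}$. Spaces are considered up to isomorphism (isometric embedding of the support preserving measure, closed set and point). **Cuts and regular sets.** Fix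 a Lipschitz $f_{\mathsf{cut}}:[0,\infty]\to[0,1]$ with $f_{\mathsf{cut}}=1$ on $[0,1]$ and $f_{\mathsf{cut}}=0$ on $[2,\infty]$. The $k$-th cut of $\mathbb X$ is $\mathbb X^k=(X,d,\mathfrak m^k,\mathcal C,p)$, $\mathfrak m^k=f^k\mathfrak m$, where $f^k(x)=f_{\mathsf{cut}}(d(x,p)2^{-k})\,(1-f_{\mathsf{cut}}(d(x,\mathcal S_{\mathfrak m})2^k))$ if $\mathcal S_{\mathfrak m}\ne\emptyset$ and $f^k(x)=f_{\mathsf{cut}}(d(x,p)2^{-k})$ if $\mathcal S_{\mathfrak m}=\emptyset$. One has $\mathfrak m^k(X)<\infty$. $\mathcal M^{qR}_{\bar k}$ is the class of pointed generalized metric measure spaces with $\mathfrak m^{\bar k}(X)>0$. The $k$-regular set is $\mathcal R^k=B_{2^{k+1}}(p)\setminus\mathcal N_{2^{-(k+1)}}(\mathcal S_{\mathfrak m})$, with $B_r(p)$ the closed ball and $\mathcal N_\varepsilon(\mathcal S_{\mathfrak m})$ the open $\varepsilon$-neighbourhood. **Distance.** Fix $\mathsf c\in C([0,\infty])$ non-constant, concave, $\mathsf c(0)=0$, $\lim_{s\to\infty}\mathsf c(s)<\infty$. For Borel probability measures $\mu,\nu$ on a metric space $(Z,d_Z)$ let $W_{\mathsf c}(\mu,\nu)=\inf_\gamma\int\mathsf c(d_Z(x,y))\,d\gamma$ over couplings $\gamma$. For spaces of finite positive mass, $$\mathsf d^{fm}_{\mathsf{iKRW}}(\mathbb X_1,\mathbb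 X_2)=\Big|\log\tfrac{\mathfrak m_1(X_1)}{\mathfrak m_2(X_2)}\Big|+\inf\{d(i_1(p_1),i_2(p_2))+d_H(i_1(\mathcal C_1),i_2(\mathcal C_2))+W_{\mathsf c}((i_1)_\sharp\bar{\mathfrak m}_1,(i_2)_\sharp\bar{\mathfrak m}_2)\},$$ the infimum over isometric embeddings $i_j:X_j\to X$ into a complete separable metric space $(X,d)$; $\bar{\mathfrak m}_j=\mathfrak m_j/\mathfrak m_j(X_j)$; $d_H$ is the Hausdorff distance, with $d_H(\emptyset,\emptyset)=0$ and $d_H(\emptyset,A)=+\infty$ for $A\ne\emptyset$. On $\mathcal M^{qR}_{\bar k}$, $\mathsf d_{\mathsf{iKRW}}(\mathbb X_1,\mathbb X_2)=\sum_{k\ge\bar k}2^{-k}\min\{1,\mathsf d^{fm}_{\mathsf{iKRW}}(\mathbb X_1^k,\mathbb X_2^k)\}$. **Entropy and CD.** $\mathscr P_2(X)$: Borel probability measures with finite second moment, with the distance $W_2$; $\mathscr P_2^{ac}(X)$: those absolutely continuous with respect to $\mathfrak m$. For $N<0$, $S_{N,\mathfrak m}(\mu)=\int\rho^{(N-1)/N}d\mathfrak m$ if $\mu=\rho\mathfrak m$, and $+\infty$ otherwise. For $N<0$, $\theta\ge0$, $t\in[0,1]$: $\sigma^{(t)}_{K,N}(\theta)=\infty$ if $K\theta^2\le N\pi^2$; $=\frac{\sin(t\theta\sqrt{K/N})}{\sin(\theta\sqrt{K/N})}$ if $N\pi^2<K\theta^2<0$; $=t$ if $K\theta^2=0$;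 $=\frac{\sinh(t\theta\sqrt{-K/N})}{\sinh(\theta\sqrt{-K/N})}$ if $K\theta^2>0$. $\tau^{(t)}_{K,N}(\theta)=t^{1/N}\sigma^{(t)}_{K,N-1}(\theta)^{(N-1)/N}$ (at $t=0$: the limit $t\downarrow0$). For a coupling $\pi$ of $\mu_i=\rho_i\mathfrak m$, $i=0,1$, $$T^{(t)}_{K,N}(\pi|\mathfrak m)=\int_{X\times X}\big[\tau^{(1-t)}_{K,N}(d(x,y))\rho_0(x)^{-1/N}+\tau^{(t)}_{K,N}(d(x,y))\rho_1(y)^{-1/N}\big]d\pi(x,y).$$ $(X,d,\mathfrak m)$ is a $\mathsf{CD}(K,N)$ space if for each pair $\mu_0,\mu_1\in\mathscr P_2^{ac}(X)$ there are a $W_2$-optimal coupling $\pi$ of $\mu_0,\mu_1$ and a $W_2$-geodesic $(\mu_t)_{t\in[0,1]}\subset\mathscr P_2(X)$ from $\mu_0$ to $\mu_1$ such that $S_{N',\mathfrak m}(\mu_t)\le T^{(t)}_{K,N'}(\pi|\mathfrak m)$ for every $t\in[0,1]$ and every $N'\in[N,0)$ with $S_{N',\mathfrak m}(\mu_0),S_{N',\mathfrak m}(\mu_1)<\infty$. **$\omega$-uniform convexity** (with the same fixed $N$). $(X,d,\mathfrak m)$ (pointed at $p$) is $\omega$-uniformly convex, for $\omega:\mathbb N\times\mathbb N\times\mathbb R^+\to[0,1]$, if (a) for any $\mu_0,\mu_1\in\mathscr P_2(X)$ with $S_{N,\mathfrak m}(\mu_0),S_{N,\mathfrak m}(\mu_1)\le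 M$ and $\operatorname{supp}\mu_0,\operatorname{supp}\mu_1\subset\mathcal R^k$, every $t$-middle point $\mu_t$ of any $W_2$-geodesic from $\mu_0$ to $\mu_1$ satisfies $\mu_t(\mathcal R^h)\ge1-\omega(k,h,M)$; and (b) $\lim_{h\to\infty}\omega(k,h,M)=0$ for all $k\in\mathbb N$, $M\in\mathbb R^+$. *)

theory Defs
  imports "HOL-Probability.Probability"
begin

text \<open>
  A metric space is an element of the library type \<^typ>\<open>'a metric\<close>, i.e. a carrier set
  in \<^typ>\<open>'a\<close> with a distance, so that the members of one sequence of spaces may differ.
  Measures may have a \<open>\<sigma>\<close>-algebra strictly larger than the Borel one (they are complete).
\<close>

section \<open>Measures on topological spaces\<close>

definition borel_of :: "'a topology \<Rightarrow> 'a measure" where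
  "borel_of T = sigma (topspace T) {U. openin T U}"

definition complete_borel_measure :: "'a topology \<Rightarrow> 'a measure \<Rightarrow> bool" where
  "complete_borel_measure T m \<longleftrightarrow>
     space m = topspace T \<and> sets (borel_of T) \<subseteq> sets m \<and> complete_measure m"

definition inner_regular :: "('a set \<Rightarrow> bool) \<Rightarrow> 'a measure \<Rightarrow> bool" where
  "inner_regular P m \<longleftrightarrow>
     (\<forall>A\<in>sets m. emeasure m A = (SUP F\<in>{F\<in>sets m. P F \<and> F \<subseteq> A}. emeasure m F))"

definition radon_measure :: "'a topology \<Rightarrow> 'a measure \<Rightarrow> bool" where
  "radon_measure T m \<longleftrightarrow>
     complete_borel_measure T m \<and>
     (\<forall>x\<in>topspace T. \<exists>U. openin T U \<and> x \<in> U \<and> emeasure m U < \<infinity>) \<and>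
     inner_regular (compactin T) m"

definition quasi_radon_measure :: "'a topology \<Rightarrow> 'a measure \<Rightarrow> bool" where
  "quasi_radon_measure T m \<longleftrightarrow>
     complete_borel_measure T m \<and>
     inner_regular (closedin T) m \<and>
     (\<forall>A\<in>sets m. emeasure m A > 0 \<longrightarrow>
        (\<exists>U. openin T U \<and> emeasure m U < \<infinity> \<and> emeasure m (A \<inter> U) > 0))"

definition msupport :: "'a topology \<Rightarrow> 'a measure \<Rightarrow> 'a set" where
  "msupport T m = {x \<in> topspace T. \<forall>U. openin T U \<and> x \<in> U \<longrightarrow> emeasure m U > 0}"

definition singular_set :: "'a topology \<Rightarrow> 'a measure \<Rightarrow> 'a set" where
  "singular_set T m = {x \<in> topspace T. \<forall>U. openin T U \<and> x \<in> U \<longrightarrow> emeasure m U = \<infinity>}"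

definition borel_nbhd :: "'a topology \<Rightarrow> 'a set \<Rightarrow> 'a set \<Rightarrow> bool" where
  "borel_nbhd T S U \<longleftrightarrow> U \<in> sets (borel_of T) \<and> (\<exists>V. openin T V \<and> S \<subseteq> V \<and> V \<subseteq> U)"

text \<open>
  The class \<open>\<M>\<^sub>S(X)\<close>. The restriction of \<open>m\<close> to \<open>X - U\<close> is the subspace measure, living on the
  subspace \<open>X - U\<close>; extended by zero to the \<open>\<sigma>\<close>-algebra of \<open>m\<close> it would fail to be complete.
\<close>
definition meas_off :: "'a metric \<Rightarrow> 'a set \<Rightarrow> 'a measure set" where
  "meas_off X S = {m.
     closedin (mtopology_of X) S \<and> (mtopology_of X) interior_of S = {} \<and>
     quasi_radon_measure (mtopology_of X) m \<and> emeasure m S = 0 \<and>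
     (\<forall>U. borel_nbhd (mtopology_of X) S U \<longrightarrow>
        (let R = restrict_space m (mspace X - U) in
           radon_measure (subtopology (mtopology_of X) (mspace X - U)) R \<and>
           (\<forall>A\<in>sets R. Metric_space.mbounded (mspace X) (mdist X) A \<longrightarrow> emeasure R A < \<infinity>)))}"

text \<open>
  The class \<open>\<M>\<^sup>q\<^sup>R(X)\<close>, including the standing convention that the singular set of a member
  is itself an admissible choice of \<open>S\<close>.
\<close>
definition meas_qR :: "'a metric \<Rightarrow> 'a measure set" where
  "meas_qR X = {m \<in> (\<Union>S. meas_off X S). m \<in> meas_off X (singular_set (mtopology_of X) m)}"

section \<open>Pointed generalized metric measure spaces\<close>

definition curve_length :: "'a metric \<Rightarrow> (real \<Rightarrow> 'a) \<Rightarrow> ennreal" where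
  "curve_length X \<gamma> =
     (SUP (n, t)\<in>{(n, t). mono_on {..n} t \<and> t ` {..n} \<subseteq> {0..1}}.
        \<Sum>i<(n::nat). ennreal (mdist X (\<gamma> (t i)) (\<gamma> (t (Suc i)))))"

definition length_space :: "'a metric \<Rightarrow> bool" where
  "length_space X \<longleftrightarrow>
     (\<forall>x\<in>mspace X. \<forall>y\<in>mspace X.
        ennreal (mdist X x y) =
          (INF \<gamma>\<in>{\<gamma>. continuous_map (top_of_set {0..1}) (mtopology_of X) \<gamma> \<and> \<gamma> 0 = x \<and> \<gamma> 1 = y}.
             curve_length X \<gamma>))"

record 'a pgmms =
  metr :: "'a metric"
  meas :: "'a measure"
  sing :: "'a set"
  pnt  :: 'a

definition pgmm_space :: "'a pgmms \<Rightarrow> bool" where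
  "pgmm_space X \<longleftrightarrow>
     (let T = mtopology_of (metr X) in
       mcomplete_of (metr X) \<and> separable_space T \<and> length_space (metr X) \<and>
       meas X \<in> meas_qR (metr X) \<and> emeasure (meas X) (space (meas X)) \<noteq> 0 \<and>
       closedin T (sing X) \<and> T interior_of (sing X) = {} \<and> emeasure (meas X) (sing X) = 0 \<and>
       sing X = singular_set T (meas X) \<and>
       pnt X \<in> msupport T (meas X) \<and> msupport T (meas X) = mspace (metr X))"

text \<open>
  Cut-off profiles are defined on \<open>[0,\<infinity>]\<close> with value \<open>0\<close> on \<open>[2,\<infinity>]\<close>; only real arguments are
  ever used, since the case of an empty singular set is treated separately.
\<close>
definition cut_profile :: "(real \<Rightarrow> real) \<Rightarrow> bool" where
  "cut_profile f \<longleftrightarrow>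
     (\<exists>L. L-lipschitz_on {0..} f) \<and> (\<forall>s\<ge>0. f s \<in> {0..1}) \<and>
     (\<forall>s\<in>{0..1}. f s = 1) \<and> (\<forall>s\<ge>2. f s = 0)"

definition cut_fun :: "(real \<Rightarrow> real) \<Rightarrow> 'a pgmms \<Rightarrow> nat \<Rightarrow> 'a \<Rightarrow> real" where
  "cut_fun f X k x =
     f (mdist (metr X) x (pnt X) / 2 ^ k) *
     (if sing X = {} then 1
      else 1 - f ((INF s\<in>sing X. mdist (metr X) x s) * 2 ^ k))"

definition cut :: "(real \<Rightarrow> real) \<Rightarrow> 'a pgmms \<Rightarrow> nat \<Rightarrow> 'a pgmms" where
  "cut f X k = X\<lparr>meas := density (meas X) (\<lambda>x. ennreal (cut_fun f X k x))\<rparr>"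

definition pgmm_class :: "(real \<Rightarrow> real) \<Rightarrow> nat \<Rightarrow> 'a pgmms set" where
  "pgmm_class f k = {X. pgmm_space X \<and> emeasure (meas (cut f X k)) (mspace (metr X)) > 0}"

definition regular_set :: "'a pgmms \<Rightarrow> nat \<Rightarrow> 'a set" where
  "regular_set X k =
     {x \<in> mspace (metr X). mdist (metr X) (pnt X) x \<le> 2 ^ (k + 1)} -
     {x \<in> mspace (metr X). \<exists>s\<in>sing X. mdist (metr X) x s < 1 / 2 ^ (k + 1)}"

section \<open>Transport costs and the iKRW distance\<close>

definition couplings :: "'a metric \<Rightarrow> 'a measure \<Rightarrow> 'a measure \<Rightarrow> ('a \<times> 'a) measure set" where
  "couplings X \<mu> \<nu> =
     (let B = borel_of (mtopology_of X) in
       {\<gamma>. sets \<gamma> = sets (B \<Otimes>\<^sub>M B) \<and> distr \<gamma> B fst = \<mu> \<and> distr \<gamma> B snd = \<nu>})"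

definition plan_cost :: "'a metric \<Rightarrow> (real \<Rightarrow> real) \<Rightarrow> ('a \<times> 'a) measure \<Rightarrow> ennreal" where
  "plan_cost X c \<gamma> = (\<integral>\<^sup>+ (x, y). ennreal (c (mdist X x y)) \<partial>\<gamma>)"

definition transport_cost :: "'a metric \<Rightarrow> (real \<Rightarrow> real) \<Rightarrow> 'a measure \<Rightarrow> 'a measure \<Rightarrow> ennreal" where
  "transport_cost X c \<mu> \<nu> = (INF \<gamma>\<in>couplings X \<mu> \<nu>. plan_cost X c \<gamma>)"

text \<open>
  A continuous real function on \<open>[0,\<infinity>]\<close> is the same as one on \<open>[0,\<infinity>)\<close> with a finite limit at \<open>\<infinity>\<close>.
\<close>
definition cost_profile :: "(real \<Rightarrow> real) \<Rightarrow> bool" where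
  "cost_profile c \<longleftrightarrow>
     continuous_on {0..} c \<and> concave_on {0..} c \<and> c 0 = 0 \<and>
     \<not> c constant_on {0..} \<and> (\<exists>l. (c \<longlongrightarrow> l) at_top)"

text \<open>
  With the conventions of \<^typ>\<open>ennreal\<close> (empty supremum \<open>0\<close>, empty infimum \<open>\<infinity>\<close>) the distance is
  \<open>0\<close> if both sets are empty and \<open>\<infinity>\<close> if exactly one is.
\<close>
definition hausdorff_dist :: "'a metric \<Rightarrow> 'a set \<Rightarrow> 'a set \<Rightarrow> ennreal" where
  "hausdorff_dist X A B =
     max (SUP a\<in>A. INF b\<in>B. ennreal (mdist X a b)) (SUP b\<in>B. INF a\<in>A. ennreal (mdist X a b))"

lemma hausdorff_dist_empty:
  "hausdorff_dist X {} {} = 0"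
  "A \<noteq> {} \<Longrightarrow> hausdorff_dist X {} A = \<infinity>"
  "A \<noteq> {} \<Longrightarrow> hausdorff_dist X A {} = \<infinity>"
  by (auto simp: hausdorff_dist_def bot_ennreal)

definition isometric_embedding :: "'a metric \<Rightarrow> 'b metric \<Rightarrow> ('a \<Rightarrow> 'b) \<Rightarrow> bool" where
  "isometric_embedding X Z i \<longleftrightarrow>
     i ` mspace X \<subseteq> mspace Z \<and>
     (\<forall>x\<in>mspace X. \<forall>y\<in>mspace X. mdist Z (i x) (i y) = mdist X x y)"

definition normalized :: "'a measure \<Rightarrow> 'a measure" where
  "normalized m = scale_measure (inverse (emeasure m (space m))) m"

text \<open>
  A complete separable metric space has at most the cardinality of the continuum, hence is isometric
  to one whose carrier is a set of reals (with an arbitrary distance on it). Ranging over all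
  \<^typ>\<open>real metric\<close> is therefore ranging over all complete separable metric spaces.
\<close>
definition iKRW_fm :: "(real \<Rightarrow> real) \<Rightarrow> 'a pgmms \<Rightarrow> 'b pgmms \<Rightarrow> ennreal" where
  "iKRW_fm c X Y =
     ennreal \<bar>ln (measure (meas X) (space (meas X)) / measure (meas Y) (space (meas Y)))\<bar> +
     (INF (Z, i, j)\<in>{(Z :: real metric, i, j).
           mcomplete_of Z \<and> separable_space (mtopology_of Z) \<and>
           isometric_embedding (metr X) Z i \<and> isometric_embedding (metr Y) Z j}.
        ennreal (mdist Z (i (pnt X)) (j (pnt Y))) +
        hausdorff_dist Z (i ` sing X) (j ` sing Y) +
        transport_cost Z c
          (distr (normalized (meas X)) (borel_of (mtopology_of Z)) i)
          (distr (normalized (meas Y)) (borel_of (mtopology_of Z)) j))"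

text \<open>The summation index is shifted: \<open>k\<close> stands for the cut number \<open>k + kb\<close>.\<close>
definition iKRW :: "(real \<Rightarrow> real) \<Rightarrow> (real \<Rightarrow> real) \<Rightarrow> nat \<Rightarrow> 'a pgmms \<Rightarrow> 'b pgmms \<Rightarrow> real" where
  "iKRW f c kb X Y =
     (\<Sum>k. (1 / 2 ^ (k + kb)) * enn2real (min 1 (iKRW_fm c (cut f X (k + kb)) (cut f Y (k + kb)))))"

section \<open>Wasserstein geodesics and entropy\<close>

definition P2 :: "'a metric \<Rightarrow> 'a measure set" where
  "P2 X = {\<mu>. sets \<mu> = sets (borel_of (mtopology_of X)) \<and> prob_space \<mu> \<and>
     (\<exists>x\<^sub>0\<in>mspace X. (\<integral>\<^sup>+ x. ennreal ((mdist X x x\<^sub>0)\<^sup>2) \<partial>\<mu>) < \<infinity>)}"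

definition W2 :: "'a metric \<Rightarrow> 'a measure \<Rightarrow> 'a measure \<Rightarrow> real" where
  "W2 X \<mu> \<nu> = sqrt (enn2real (transport_cost X (\<lambda>s. s\<^sup>2) \<mu> \<nu>))"

definition W2_optimal :: "'a metric \<Rightarrow> 'a measure \<Rightarrow> 'a measure \<Rightarrow> ('a \<times> 'a) measure \<Rightarrow> bool" where
  "W2_optimal X \<mu> \<nu> \<pi> \<longleftrightarrow>
     \<pi> \<in> couplings X \<mu> \<nu> \<and> plan_cost X (\<lambda>s. s\<^sup>2) \<pi> = transport_cost X (\<lambda>s. s\<^sup>2) \<mu> \<nu>"

definition W2_geodesic ::
    "'a metric \<Rightarrow> 'a measure \<Rightarrow> 'a measure \<Rightarrow> (real \<Rightarrow> 'a measure) \<Rightarrow> bool" where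
  "W2_geodesic X \<mu> \<nu> \<mu>t \<longleftrightarrow>
     (\<forall>t\<in>{0..1}. \<mu>t t \<in> P2 X) \<and> \<mu>t 0 = \<mu> \<and> \<mu>t 1 = \<nu> \<and>
     (\<forall>s\<in>{0..1}. \<forall>t\<in>{0..1}. W2 X (\<mu>t s) (\<mu>t t) = \<bar>s - t\<bar> * W2 X \<mu> \<nu>)"

text \<open>
  Elements of \<^const>\<open>P2\<close> live on the Borel \<open>\<sigma>\<close>-algebra, so they are compared with the
  restriction of \<open>m\<close> to it.
\<close>
definition borel_part :: "'a metric \<Rightarrow> 'a measure \<Rightarrow> 'a measure" where
  "borel_part X m = restr_to_subalg m (borel_of (mtopology_of X))"

definition P2_ac :: "'a metric \<Rightarrow> 'a measure \<Rightarrow> 'a measure set" where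
  "P2_ac X m = {\<mu> \<in> P2 X. absolutely_continuous (borel_part X m) \<mu>}"

definition dens :: "'a metric \<Rightarrow> 'a measure \<Rightarrow> 'a measure \<Rightarrow> 'a \<Rightarrow> ennreal" where
  "dens X m \<mu> = RN_deriv (borel_part X m) \<mu>"

text \<open>Only used with exponents \<open>a > 0\<close>.\<close>
definition epowr :: "ennreal \<Rightarrow> real \<Rightarrow> ennreal" where
  "epowr x a = (if x = \<infinity> then \<infinity> else ennreal (enn2real x powr a))"

definition renyi :: "'a metric \<Rightarrow> 'a measure \<Rightarrow> real \<Rightarrow> 'a measure \<Rightarrow> ennreal" where
  "renyi X m N \<mu> =
     (if \<exists>\<rho>\<in>borel_measurable (borel_part X m). \<mu> = density (borel_part X m) \<rho>
      then (\<integral>\<^sup>+ x. epowr (dens X m \<mu> x) ((N - 1) / N) \<partial>borel_part X m)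
      else \<infinity>)"

section \<open>Curvature-dimension condition for negative dimension\<close>

definition sigma_coeff :: "real \<Rightarrow> real \<Rightarrow> real \<Rightarrow> real \<Rightarrow> ennreal" where
  "sigma_coeff K N t \<theta> =
     (if K * \<theta>\<^sup>2 \<le> N * pi\<^sup>2 then \<infinity>
      else if K * \<theta>\<^sup>2 < 0 then ennreal (sin (t * \<theta> * sqrt (K / N)) / sin (\<theta> * sqrt (K / N)))
      else if K * \<theta>\<^sup>2 = 0 then ennreal t
      else ennreal (sinh (t * \<theta> * sqrt (- (K / N))) / sinh (\<theta> * sqrt (- (K / N)))))"

definition tau_pos :: "real \<Rightarrow> real \<Rightarrow> real \<Rightarrow> real \<Rightarrow> ennreal" where
  "tau_pos K N t \<theta> = ennreal (t powr (1 / N)) * epowr (sigma_coeff K (N - 1) t \<theta>) ((N - 1) / N)"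

definition tau_coeff :: "real \<Rightarrow> real \<Rightarrow> real \<Rightarrow> real \<Rightarrow> ennreal" where
  "tau_coeff K N t \<theta> =
     (if t = 0 then Lim (at_right 0) (\<lambda>s. tau_pos K N s \<theta>) else tau_pos K N t \<theta>)"

definition T_fun :: "'a metric \<Rightarrow> 'a measure \<Rightarrow> real \<Rightarrow> real \<Rightarrow> real \<Rightarrow>
    'a measure \<Rightarrow> 'a measure \<Rightarrow> ('a \<times> 'a) measure \<Rightarrow> ennreal" where
  "T_fun X m K N t \<mu>\<^sub>0 \<mu>\<^sub>1 \<pi> =
     (\<integral>\<^sup>+ (x, y). tau_coeff K N (1 - t) (mdist X x y) * epowr (dens X m \<mu>\<^sub>0 x) (- 1 / N) +
                 tau_coeff K N t (mdist X x y) * epowr (dens X m \<mu>\<^sub>1 y) (- 1 / N) \<partial>\<pi>)"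

definition CD_space :: "real \<Rightarrow> real \<Rightarrow> 'a metric \<Rightarrow> 'a measure \<Rightarrow> bool" where
  "CD_space K N X m \<longleftrightarrow>
     (\<forall>\<mu>\<^sub>0\<in>P2_ac X m. \<forall>\<mu>\<^sub>1\<in>P2_ac X m.
        \<exists>\<pi> \<mu>t. W2_optimal X \<mu>\<^sub>0 \<mu>\<^sub>1 \<pi> \<and> W2_geodesic X \<mu>\<^sub>0 \<mu>\<^sub>1 \<mu>t \<and>
          (\<forall>t\<in>{0..1}. \<forall>N'\<in>{N..<0}.
             renyi X m N' \<mu>\<^sub>0 < \<infinity> \<and> renyi X m N' \<mu>\<^sub>1 < \<infinity> \<longrightarrow>
             renyi X m N' (\<mu>t t) \<le> T_fun X m K N' t \<mu>\<^sub>0 \<mu>\<^sub>1 \<pi>))"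

definition uniformly_convex_space ::
    "real \<Rightarrow> (nat \<Rightarrow> nat \<Rightarrow> real \<Rightarrow> real) \<Rightarrow> 'a pgmms \<Rightarrow> bool" where
  "uniformly_convex_space N \<omega> X \<longleftrightarrow>
     (\<forall>k h. \<forall>M>0. \<omega> k h M \<in> {0..1}) \<and>
     (\<forall>k h. \<forall>M>0. \<forall>\<mu>\<^sub>0\<in>P2 (metr X). \<forall>\<mu>\<^sub>1\<in>P2 (metr X). \<forall>\<mu>t.
        renyi (metr X) (meas X) N \<mu>\<^sub>0 \<le> ennreal M \<and> renyi (metr X) (meas X) N \<mu>\<^sub>1 \<le> ennreal M \<and>
        msupport (mtopology_of (metr X)) \<mu>\<^sub>0 \<subseteq> regular_set X k \<and>
        msupport (mtopology_of (metr X)) \<mu>\<^sub>1 \<subseteq> regular_set X k \<and>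
        W2_geodesic (metr X) \<mu>\<^sub>0 \<mu>\<^sub>1 \<mu>t \<longrightarrow>
        (\<forall>t\<in>{0..1}. measure (\<mu>t t) (regular_set X h) \<ge> 1 - \<omega> k h M)) \<and>
     (\<forall>k. \<forall>M>0. (\<lambda>h. \<omega> k h M) \<longlonglongrightarrow> 0)"

definition mdiam :: "'a metric \<Rightarrow> ennreal" where
  "mdiam X = (SUP x\<in>mspace X. SUP y\<in>mspace X. ennreal (mdist X x y))"

end

theory Submission
 imports Defs
begin

text \<open>
 Near-optimal couplings of the cuts of \<open>X n\<close> and of the limit \<open>Y\<close> yield, for every \<open>L\<close> and
 \<open>de\<close>, a countable partition \<open>C i\<close> of the \<open>L\<close>-regular set of \<open>X n\<close> and densities \<open>h i\<close> on \<open>Y\<close>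
 whose kernels move measures between the two spaces, changing distances by at most \<open>de\<close> and
 almost preserving mass. Marginals of finite entropy on \<open>Y\<close> are carried to \<open>X n\<close>, where the curvature
 condition supplies a plan and a geodesic; these are pushed back to \<open>Y\<close>. Uniform convexity keeps
 the intermediate measures away from the singular set, so the \<open>L^p\<close> bounds with \<open>p = (N - 1) / N > 1\<close>
 give setwise limits along an ultrafilter, and entropy is lower semicontinuous along them. Plans
 converge on rectangles, which suffices because cost and distortion functional are handled through
 countable unions of rectangles and Lipschitz minorants of the coefficients. For marginals of
 infinite entropy only a geodesic is required; it is glued from countably many pieces of an optimal
 plan with bounded marginal densities.
\<close>

text \<open>The spaces \<open>X n\<close> and the limit \<open>Y\<close> share no ambient space: the
  embeddings behind \<open>iKRW_fm\<close> change with \<open>n\<close> and with the cut. Hence all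
  convergence is stated on \<open>Y\<close> alone, and what a coupling yields is stored in
  \<open>transfer\<close>, which no longer mentions \<open>Z\<close>. A transfer leaks mass
  \<open>de\<close> of the reference measure, which bounds the leak of a probability measure only
  where its density is bounded; hence the truncation of marginals at density \<open>j\<close> with
  \<open>j * de\<close> tending to 0, and the \<open>L^p\<close> bound at intermediate times. At the
  endpoints the returned measures must converge to the given marginals themselves, so the way back
  is there the reversal of the way forth and not the kernel of intermediate times. The right-hand
  side of the curvature inequality calls for upper semicontinuity, while limits of plans give only
  lower semicontinuity; the coefficients are bounded by some \<open>C\<close> (for
  \<open>K < 0\<close> by the diameter bound), and \<open>C\<close> minus the coefficient is treated
  instead. One ultrafilter serves all times and all exponents, so a single plan and a single
  geodesic satisfy all inequalities at once.\<close>

abbreviation "em == emeasure"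
abbreviation "en == ennreal"
abbreviation "ind == indicator"
abbreviation "bm == borel_measurable"
abbreviation "reg == regular_set"
syntax "_nni" :: "pttrn => ennreal => 'a measure => ennreal" ("II((2 _./ _)/ ||_)" [60,61] 110)
abbreviation lims (infix "---->" 60) where "f ----> l == filterlim f (nhds l) sequentially"
notation (input) tendsto (infixr "--->" 55)
translations "II x. f || M" => "CONST nn_integral M (%x. f)"

subsection \<open>Ultrafilter limits and powers of extended reals\<close>

text \<open>Zorn's lemma for the reversed order of filters, since finer means smaller. The infimum
  of a chain is proper because every nonempty finite subset of the chain has its infimum in the
  chain. A minimal proper filter decides every \<open>P\<close>: meeting it with
  \<open>principal {x. P x}\<close> gives either \<open>bot\<close> or the filter itself.\<close>

lemma ex_ultrafilter:
 fixes G :: "'i filter"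
 assumes "G ~= bot"
 obtains F where "F <= G" "F ~= bot" "!!P. eventually P F | eventually (%x. ~ P x) F"
proof -
 let ?A = "{F. F <= G & F ~= bot}"
 have "EX M:?A. ALL a:?A. M >= a --> a = M"
 proof (rule predicate_Zorn)
  show "partial_order_on ?A (relation_of (>=) ?A)"
   by (rule partial_order_on_relation_ofI) auto
  fix C assume C: "C : Chains (relation_of (>=) ?A)"
  have sub: "C <= ?A" using Chains_relation_of[OF C] .
  have lin: "x <= y | y <= x" if "x : C" "y : C" for x y
   using C that unfolding Chains_def relation_of_def by blast
  show "EX u:?A. ALL a:C. a >= u"
  proof (cases "C = {}")
   case True thus ?thesis using assms by auto
  next
   case False
   have fin: "Inf X ~= bot" if "X <= C" "finite X" for X
   proof -
    have "X = {} | Inf X : X" using that(2,1)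
    proof (induction X rule: finite_induct)
     case (insert x Y)
     show ?case
     proof (cases "Y = {}")
      case False
      hence "Inf Y : Y" using insert by auto
      hence "x <= Inf Y | Inf Y <= x" using lin insert by auto
      thus ?thesis using \<open>Inf Y : Y\<close> by (auto simp: inf_absorb1 inf_absorb2)
     qed auto
    qed auto
    thus ?thesis
    proof
     assume "X = {}"
     hence "G <= Inf X" by (simp only: Inf_empty top_greatest)
     thus ?thesis using assms by (auto simp only: bot_unique)
    next
     assume "Inf X : X"
     thus ?thesis using that(1) sub by blast
    qed
   qed
   have "Inf C ~= bot" by (rule Inf_filter_not_bot) (rule fin)
   moreover have "Inf C <= G" using False sub by (auto intro: Inf_lower2)
   ultimately show ?thesis by (intro bexI[of _ "Inf C"]) (auto intro: Inf_lower)
  qed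
 qed
 then obtain F where F: "F <= G" "F ~= bot" and max: "!!a. a <= G ==> a ~= bot ==> a <= F ==> a = F" by blast
 show thesis
 proof (rule that[OF F])
  fix P
  show "eventually P F | eventually (%x. ~ P x) F"
  proof (cases "inf F (principal {x. P x}) = bot")
   case True
   hence "eventually (%x. ~ P x) F"
    by (simp add: trivial_limit_def eventually_inf_principal)
   thus ?thesis ..
  next
   case False
   hence "inf F (principal {x. P x}) = F" using max F by (meson inf.cobounded1 order_trans)
   moreover have "eventually P (inf F (principal {x. P x}))"
    by (simp add: eventually_inf_principal)
   ultimately have "eventually P F" by (simp only:)
   thus ?thesis ..
  qed
 qed
qed

text \<open>A value strictly between \<open>Liminf\<close> and \<open>Limsup\<close> would have to
  bound \<open>f\<close> eventually from above or from below, and each alternative contradicts one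
  of the two.\<close>

lemma ultrafilter_tendsto_Liminf:
 fixes f :: "'i => 'a :: {complete_linorder, linorder_topology, dense_order}"
 assumes "F ~= bot" "!!P. eventually P F | eventually (%x. ~ P x) F"
 shows "(f ---> Liminf F f) F"
proof -
 have "Limsup F f <= Liminf F f"
 proof (rule ccontr)
  assume "~ ?thesis"
  then obtain y where y: "Liminf F f < y" "y < Limsup F f" using dense by (meson not_le)
  from assms(2)[of "%n. f n <= y"] show False
  proof
   assume "eventually (%n. f n <= y) F"
   hence "Limsup F f <= y" by (rule Limsup_bounded)
   thus False using y by simp
  next
   assume "eventually (%n. ~ f n <= y) F"
   hence "eventually (%n. y <= f n) F" by eventually_elim auto
   hence "y <= Liminf F f" by (rule Liminf_bounded)
   thus False using y by simp
  qed
 qed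
 thus ?thesis using Liminf_le_Limsup[OF assms(1), of f] assms(1)
  by (intro Liminf_eq_Limsup) auto
qed

text \<open>\<open>le_sequentially\<close> makes the ultrafilter free, so that ordinary limits and
  eventual properties survive. Limits of \<open>ennreal\<close> sequences always exist, and writing
  them as \<open>Liminf F\<close> gives a total operation that is monotone and additive.\<close>

locale ultrafilter =
 fixes F :: "nat filter"
 assumes nonbot [simp]: "F ~= bot"
  and le_sequentially: "F <= sequentially"
  and ultra: "!!P. eventually P F | eventually (%x. ~ P x) F"
begin

abbreviation ulim :: "(nat => ennreal) => ennreal" where
 "ulim == Liminf F"

lemma ulim: "(f ---> ulim f) F"
 by (rule ultrafilter_tendsto_Liminf) (use ultra in auto)

lemma ulimI: "(f ---> l) F ==> ulim f = l"
 using tendsto_unique[OF nonbot ulim] by metis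

lemma ulim_sequentially: "f ----> l ==> (f ---> l) F"
 using le_sequentially by (rule tendsto_mono)

lemma eventually_sequentially_F: "eventually P sequentially ==> eventually P F"
 using le_sequentially by (rule filter_leD)

lemma ulim_add: "ulim (%n. f n + g n) = ulim f + ulim g"
 by (intro ulimI tendsto_add ulim)

lemma ulim_const: "ulim (%n. c) = c"
 by (intro ulimI tendsto_const)

lemma ulim_mono: "eventually (%n. f n <= g n) F ==> ulim f <= ulim g"
 by (intro tendsto_le[OF nonbot ulim ulim])

lemma ulim_sum: "ulim (%n. \<Sum>i\<in>I. f i n) = (\<Sum>i\<in>I. ulim (f i))"
 by (intro ulimI tendsto_sum ulim)

end

lemma ex_ultrafilter_nat: "EX F. ultrafilter F"
 by (rule ex_ultrafilter[OF sequentially_bot]) (auto intro!: exI simp: ultrafilter_def)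

section \<open>Powers of extended nonnegative reals\<close>

lemma epowr_ennreal: "0 <= r ==> epowr (en r) a = en (r powr a)"
 by (simp add: epowr_def)

lemma epowr_top [simp]: "epowr top a = top"
 by (simp add: epowr_def)

lemma epowr_0 [simp]: "epowr 0 a = 0"
 by (simp add: epowr_def)

lemma epowr_1 [simp]: "epowr 1 a = 1"
 by (simp add: epowr_def)

lemma epowr_eq_top_iff [simp]: "epowr x a = top \<longleftrightarrow> x = top"
 by (simp add: epowr_def)

lemma epowr_less_top_iff [simp]: "epowr x a < top \<longleftrightarrow> x < top"
 by (simp add: less_top[symmetric])

lemma epowr_one_right [simp]: "epowr x 1 = x"
 by (cases x) (auto simp: epowr_def)

lemma epowr_eq_0_iff [simp]: "epowr x a = 0 \<longleftrightarrow> x = 0"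
 by (cases x) (auto simp: epowr_def ennreal_eq_0_iff)

lemma epowr_mono: "0 <= a ==> x <= y ==> epowr x a <= epowr y a"
 by (cases x; cases y) (auto simp: epowr_def top_unique intro!: powr_mono2 ennreal_leI)

lemma measurable_epowr [measurable]: "(%x. epowr x a) : bm borel"
 unfolding epowr_def by measurable

lemma epowr_mult: "0 < a ==> epowr (x*y) a = epowr x a*epowr y a"
 by (cases x; cases y)
   (auto simp: epowr_def ennreal_mult_top ennreal_top_mult powr_mult ennreal_mult'[symmetric] enn2real_mult
    ennreal_mult_eq_top_iff)

lemma epowr_add: "0 < a ==> 0 < b ==> epowr x (a + b) = epowr x a*epowr x b"
 by (cases x) (auto simp: epowr_def powr_add ennreal_mult)

lemma epowr_powr: "epowr (epowr x a) b = epowr x (a*b)"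
 by (cases x) (auto simp: epowr_def powr_powr)

text \<open>The power is an order isomorphism of \<open>ennreal\<close> whose inverse has exponent
  \<open>1/a\<close>; monotonicity of the inverse gives the nontrivial inequality.\<close>

lemma epowr_SUP:
 assumes "0 < a" "incseq f"
 shows "epowr (SUP n. f n) a = (SUP n. epowr (f n) a)"
proof (rule antisym)
 show "(SUP n. epowr (f n) a) <= epowr (SUP n. f n) a"
  using assms by (intro SUP_least epowr_mono SUP_upper) auto
 have "(SUP n. f n) = (SUP n. epowr (epowr (f n) a) (1/a))"
  using assms by (simp add: epowr_powr)
 also have "... <= epowr (SUP n. epowr (f n) a) (1/a)"
  using assms by (intro SUP_least epowr_mono SUP_upper) auto
 finally have "epowr (SUP n. f n) a <= epowr (epowr (SUP n. epowr (f n) a) (1/a)) a"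
  using assms by (intro epowr_mono) auto
 thus "epowr (SUP n. f n) a <= (SUP n. epowr (f n) a)"
  using assms by (simp add: epowr_powr)
qed

text \<open>The tangent inequality of the \<open>p\<close>-th power at \<open>a\<close>, arranged so
  that nothing is subtracted in \<open>ennreal\<close>. It is Young's inequality for the exponents
  \<open>p\<close> and \<open>p/(p - 1)\<close>, and serves both Jensen's inequality and lower
  semicontinuity.\<close>

lemma epowr_Young:
 assumes "1 < p"
 shows "en p*(u*epowr a (p - 1)) <= epowr u p + en (p - 1)*epowr a p"
proof (cases "u = top | a = top")
 case True thus ?thesis using assms by (auto simp: ennreal_mult_top)
next
 case False
 then obtain x y where [simp]: "u = en x" "a = en y" and xy: "0 <= x" "0 <= y"
  by (metis ennreal_cases infinity_ennreal_def)
 have "x*y powr (p-1) <= x powr p/p + (y powr (p-1)) powr (p/(p-1))/(p/(p-1))"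
  using assms xy by (intro Youngs_inequality) (auto simp: field_simps)
 also have "(y powr (p-1)) powr (p/(p-1)) = y powr p"
  using assms by (simp add: powr_powr)
 finally have "p*(x*y powr (p-1)) <= p*(x powr p/p + y powr p/(p/(p-1)))"
  using assms by (intro mult_left_mono) auto
 also have "... = x powr p + (p-1)*y powr p"
  using assms by (simp add: field_simps)
 finally have "en (p*(x*y powr (p-1))) <= en (x powr p + (p-1)*y powr p)"
  by (rule ennreal_leI)
 thus ?thesis using assms xy
  by (simp add: epowr_ennreal ennreal_mult ennreal_plus)
qed

text \<open>Integrating the tangent inequality at the mean value \<open>a = I/H\<close> gives
  \<open>a^p * H <= J\<close>, with \<open>H\<close> the total mass, \<open>I\<close> the integral
  of \<open>u\<close> and \<open>J\<close> that of \<open>u^p\<close>. Multiplication by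
  \<open>H^(p - 1)\<close> gives a homogeneous form for every finite total mass.\<close>

lemma epowr_Jensen:
 assumes p: "1 < p" and [measurable]: "u : bm M" and fin: "em M (space M) < \<infinity>"
 shows "epowr (II x. u x ||M) p <= (II x. epowr (u x) p ||M)*epowr (em M (space M)) (p - 1)"
proof -
 let ?H = "em M (space M)" and ?I = "II x. u x ||M" and ?J = "II x. epowr (u x) p ||M"
 show ?thesis
 proof (cases "?H = 0 | ?J = top")
  case True
  thus ?thesis
  proof
   assume "?H = 0"
   hence "AE x in M. u x = 0"
    by (intro AE_I[of _ _ "space M"]) auto
   hence "?I = 0" by (simp add: nn_integral_0_iff_AE)
   thus ?thesis by simp
  next
   assume J: "?J = top"
   have Jtop: "?H ~= 0"
   proof
    assume "?H = 0"
    hence "AE x in M. u x = 0" by (intro AE_I[of _ _ "space M"]) auto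
    hence "?J = 0" by (simp add: nn_integral_0_iff_AE)
    thus False using J by simp
   qed
   from J show ?thesis
    using Jtop by (simp add: ennreal_top_mult)
  qed
 next
  case False
  hence H0: "?H ~= 0" "?H ~= top" and J: "?J ~= top" using fin by auto
  \<comment> \<open>Finiteness of the mean, without which the common term could not be cancelled
    below.\<close>
  have "?I <= (II x. 1 + epowr (u x) p ||M)"
  proof (rule nn_integral_mono)
   fix x show "u x <= 1 + epowr (u x) p"
   proof (cases "u x <= 1")
    case True thus ?thesis by (simp add: add_increasing2)
   next
    case False
    hence "epowr (u x) 1*1 <= epowr (u x) 1*epowr (u x) (p - 1)"
     using p epowr_mono[of "p-1" 1 "u x"] by (intro mult_left_mono) auto
    also have "... = epowr (u x) p" using p by (subst epowr_add[symmetric]) auto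
    finally show ?thesis by (simp add: add_increasing)
   qed
  qed
  also have "... = ?H + ?J" by (subst nn_integral_add) auto
  finally have I: "?I ~= top" using H0 J by (metis ennreal_add_eq_top top_unique)
  define a where "a = ?I/?H"
  have a: "a ~= top" unfolding a_def using I H0 by (simp add: ennreal_divide_eq_top_iff)
  have aH: "a*?H = ?I" unfolding a_def using H0 by (simp add: ennreal_divide_times less_top)
  have "en p*(?I*epowr a (p-1)) = (II x. en p*(u x*epowr a (p-1)) ||M)"
   by (simp add: nn_integral_cmult nn_integral_multc)
  also have "... <= (II x. epowr (u x) p + en (p - 1)*epowr a p ||M)"
   by (intro nn_integral_mono epowr_Young p)
  also have "... = ?J + en (p-1)*epowr a p*?H"
   by (subst nn_integral_add) auto
  finally have *: "en p*(?I*epowr a (p-1)) <= ?J + en (p-1)*epowr a p*?H" .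
  have eq: "?I*epowr a (p-1) = epowr a p*?H"
  proof -
   have "epowr a p = epowr a 1*epowr a (p-1)" using p by (subst epowr_add[symmetric]) auto
   thus ?thesis using aH by (simp add: ac_simps flip: aH)
  qed
  have pp: "en p = 1 + en (p-1)" using p by (simp flip: ennreal_1 ennreal_plus)
  have "epowr a p*?H <= ?J"
  proof -
   define y where "y = epowr a p*?H"
   have y: "y ~= top" unfolding y_def using a H0 by (simp add: ennreal_mult_eq_top_iff)
   have "y + en (p-1)*y <= ?J + en (p-1)*y"
   proof -
    have "en p*y = y + en (p-1)*y" unfolding pp by (simp only: distrib_right mult_1)
    thus ?thesis using * unfolding eq y_def[symmetric] by (simp add: mult.assoc y_def[symmetric])
   qed
   hence "en (p-1)*y + y <= en (p-1)*y + ?J" by (simp only: add.commute)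
   hence "y <= ?J" using y
    by (simp add: ennreal_add_left_cancel_le ennreal_mult_eq_top_iff)
   thus ?thesis by (simp add: y_def)
  qed
  hence "epowr a p*?H*epowr ?H (p-1) <= ?J*epowr ?H (p-1)"
   by (rule mult_right_mono) auto
  also have "epowr a p*?H*epowr ?H (p-1) = epowr a p*(epowr ?H 1*epowr ?H (p-1))"
   by (simp add: ac_simps)
  also have "... = epowr ?I p" using p by (subst epowr_add[symmetric]) (auto simp: epowr_mult[symmetric] aH)
  finally show ?thesis .
 qed
qed

text \<open>Above the level \<open>a\<close> the factor \<open>(u/a)^(p - 1)\<close> is at least 1.
  Integrated over a set, this is the uniform integrability that an \<open>L^p\<close> bound
  provides, with an explicit rate in \<open>a\<close>.\<close>

lemma le_plus_epowr:
 assumes "1 < p" "0 < a"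
 shows "u <= en a + en (a powr (1 - p))*epowr u p"
proof (cases u)
 case (real x)
 have "x <= a + a powr (1 - p)*x powr p"
 proof (cases "x <= a")
  case True thus ?thesis by (simp add: add_increasing2)
 next
  case False
  hence "a powr (1-p)*x powr p = x*(x/a) powr (p - 1)"
   using assms by (simp add: powr_divide powr_diff field_simps)
  also have "... >= x*1"
   using False assms by (intro mult_left_mono ge_one_powr_ge_zero) auto
  finally show ?thesis using assms by simp
 qed
 hence "en x <= en (a + a powr (1 - p)*x powr p)" by (rule ennreal_leI)
 thus ?thesis using real assms by (simp add: epowr_ennreal ennreal_mult ennreal_plus)
qed (use assms in \<open>auto simp: ennreal_mult_top\<close>)

lemma emeasure_density_Lp_le:
 assumes "1 < p" "0 < a" and [measurable]: "s : bm M" "A : sets M"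
 shows "em (density M s) A <=
  en a*em M A + en (a powr (1 - p))*(II x. epowr (s x) p*ind A x ||M)"
proof -
 have "em (density M s) A = (II x. s x*ind A x ||M)"
  by (simp add: emeasure_density)
 also have "... <= (II x. en a*ind A x +
   en (a powr (1 - p))*(epowr (s x) p*ind A x) ||M)"
  using le_plus_epowr[OF assms(1,2)] by (intro nn_integral_mono) (auto simp: indicator_def)
 also have "... = en a*em M A + en (a powr (1 - p))*(II x. epowr (s x) p*ind A x ||M)"
  by (simp add: nn_integral_add nn_integral_cmult)
 finally show ?thesis .
qed

lemma epowr_indicator: "epowr (s*ind A x) p = epowr s p*ind A x"
 by (auto simp: indicator_def)

section \<open>Countable sums of measures\<close>

definition msum :: "(nat => 'a measure) => 'a measure" where
 "msum m = measure_of (space (m 0)) (sets (m 0)) (%A. \<Sum>i. em (m i) A)"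

lemma sets_msum [simp, measurable_cong]: "sets (msum m) = sets (m 0)"
 by (simp add: msum_def)

lemma space_msum [simp]: "space (msum m) = space (m 0)"
 by (simp add: msum_def)

lemma suminf_ennreal_swap: "(\<Sum>j. \<Sum>i. f i j) = (\<Sum>i. \<Sum>j. f i j :: ennreal)"
proof -
 have "(\<Sum>j. \<Sum>i. f i j) = (II j. (\<Sum>i. f i j) ||count_space UNIV)"
  by (simp add: nn_integral_count_space_nat)
 also have "... = (\<Sum>i. II j. f i j ||count_space UNIV)"
  by (rule nn_integral_suminf) auto
 finally show ?thesis by (simp add: nn_integral_count_space_nat)
qed

lemma emeasure_msum:
 assumes "!!i. sets (m i) = sets (m 0)" "A : sets (m 0)"
 shows "em (msum m) A = (\<Sum>i. em (m i) A)"
 unfolding msum_def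
proof (rule emeasure_measure_of_sigma)
 show "sigma_algebra (space (m 0)) (sets (m 0))" ..
 show "positive (sets (m 0)) (%A. \<Sum>i. em (m i) A)" by (simp add: positive_def)
 show "countably_additive (sets (m 0)) (%A. \<Sum>i. em (m i) A)"
 proof (rule countably_additiveI)
  fix A :: "nat => 'a set" assume A: "range A <= sets (m 0)" "disjoint_family A"
  have "(\<Sum>j. \<Sum>i. em (m i) (A j)) = (\<Sum>i. \<Sum>j. em (m i) (A j))"
   by (rule suminf_ennreal_swap)
  also have "... = (\<Sum>i. em (m i) (UN j. A j))"
   using A assms(1) by (intro suminf_cong suminf_emeasure) auto
  finally show "(\<Sum>j. \<Sum>i. em (m i) (A j)) = (\<Sum>i. em (m i) (UN j. A j))" .
 qed
qed fact

lemma nn_integral_msum: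
 assumes s: "!!i. sets (m i) = sets (m 0)" and "f : bm (m 0)"
 shows "(II x. f x ||msum m) = (\<Sum>i. II x. f x ||m i)"
 using assms(2)
proof (induction f rule: borel_measurable_induct)
 case (cong f g)
 have "space (m i) = space (m 0)" for i using s by (rule sets_eq_imp_space_eq)
 with cong show ?case by (metis (mono_tags, lifting) nn_integral_cong space_msum suminf_cong)
next
 case (set A)
 hence "A : sets (m i)" for i using s[of i] by simp
 thus ?case using s by (simp add: emeasure_msum nn_integral_indicator)
next
 case (mult u c)
 have [measurable]: "u : bm (m i)" for i using mult(2) s[of i] by (simp cong: measurable_cong_sets)
 have [measurable]: "u : bm (msum m)" using mult(2) by (simp cong: measurable_cong_sets)
 show ?case using mult by (simp add: nn_integral_cmult)
next
 case (add u v)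
 have [measurable]: "u : bm (m i)" "v : bm (m i)" for i
  using add(1,3) s[of i] by (simp_all cong: measurable_cong_sets)
 have [measurable]: "u : bm (msum m)" "v : bm (msum m)"
  using add(1,3) by (simp_all cong: measurable_cong_sets)
 show ?case using add by (simp add: nn_integral_add suminf_add)
next
 case (seq U)
 have [measurable]: "U j : bm (m i)" for i j using seq(1) s[of i] by (simp cong: measurable_cong_sets)
 have [measurable]: "U j : bm (msum m)" for j using seq(1) by (simp cong: measurable_cong_sets)
 have inc: "incseq U" by fact
 have "(II x. (SUP i. U i) x ||msum m) = (SUP j. II x. U j x ||msum m)"
  unfolding SUP_apply by (rule nn_integral_monotone_convergence_SUP[OF inc]) simp
 also have "... = (SUP j. \<Sum>i. II x. U j x ||m i)" using seq by simp
 also have "... = (\<Sum>i. SUP j. II x. U j x ||m i)"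
  using inc by (intro ennreal_suminf_SUP_eq[symmetric]) (auto simp: incseq_def le_fun_def intro!: nn_integral_mono)
 also have "... = (\<Sum>i. II x. (SUP j. U j) x ||m i)"
  unfolding SUP_apply by (intro suminf_cong nn_integral_monotone_convergence_SUP[OF inc, symmetric]) simp
 finally show ?case .
qed

section \<open>Setwise limits of measures\<close>

context ultrafilter
begin

text \<open>Setwise limits along an ultrafilter are in general only finitely additive: unit masses
  at \<open>n\<close> on the naturals give limit 0 to every finite set and limit 1 to the whole
  space. Hypothesis \<open>equi\<close> is continuity of the limit at the empty set, which together
  with finiteness turns finite into countable additivity.\<close>

lemma setwise_limit_measure:
 assumes sets: "!!n. sets (m n) = sets M"
  and fin: "ulim (%n. em (m n) (space M)) < top"
  and equi: "!!A e. range A <= sets M ==> decseq A ==> (INT i. A i) = {} ==> 0 < e ==>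
    EX i. ulim (%n. em (m n) (A i)) <= en e"
 obtains nu where "sets nu = sets M" "!!A. A : sets M ==> em nu A = ulim (%n. em (m n) A)"
proof -
 let ?f = "%A. ulim (%n. em (m n) A)"
 have pos: "positive (sets M) ?f" by (simp add: positive_def ulim_const)
 have mono: "?f A <= ?f B" if "A <= B" "B : sets M" for A B
  using that sets by (intro ulim_mono always_eventually) (auto intro: emeasure_mono)
 have add: "additive (sets M) ?f"
  unfolding additive_def
 proof (intro ballI impI)
  fix A B assume "A : sets M" "B : sets M" "A Int B = {}"
  hence "em (m n) (A Un B) = em (m n) A + em (m n) B" for n
   using sets by (intro plus_emeasure[symmetric]) auto
  thus "?f (A Un B) = ?f A + ?f B" by (simp add: ulim_add)
 qed
 have "countably_additive (sets M) ?f"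
 proof (rule sets.empty_continuous_imp_countably_additive[OF pos add])
  show "ALL A:sets M. ?f A ~= \<infinity>"
  proof
   fix A assume "A : sets M"
   hence "?f A <= ?f (space M)" by (intro mono sets.sets_into_space) auto
   also have "... < \<infinity>" using fin by simp
   finally show "?f A ~= \<infinity>" by simp
  qed
  show "(%i. ?f (A i)) ----> 0" if A: "range A <= sets M" "decseq A" "(INT i. A i) = {}" for A
  proof (rule order_tendstoI)
   fix a :: ennreal assume "0 < a"
   then obtain e where e: "0 < e" "en e < a"
   proof -
    obtain b where b: "0 < b" "b < a" using dense[OF \<open>0 < a\<close>] by blast
    hence "b ~= top" by (auto simp: top_unique)
    thus thesis using b by (intro that[of "enn2real b"]) (auto simp: enn2real_positive_iff less_top)
   qed
   obtain i where "?f (A i) <= en e" using equi[OF A e(1)] by auto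
   moreover have "?f (A j) <= ?f (A i)" if "i <= j" for j
    using A that by (intro mono) (auto simp: decseq_def)
   ultimately show "eventually (%j. ?f (A j) < a) sequentially"
    using e(2) by (intro eventually_sequentiallyI[of i]) (auto intro: le_less_trans)
  qed auto
 qed
 thus ?thesis
  by (intro that[of "measure_of (space M) (sets M) ?f"] emeasure_measure_of_sigma[OF _ pos])
    (auto intro: sets.sigma_algebra_axioms)
qed

text \<open>On the sets \<open>R h\<close> of finite measure the \<open>L^p\<close> bound makes the
  measures uniformly absolutely continuous; outside of them \<open>tight\<close> makes the limit
  mass small. So the limit is continuous at the empty set, and null sets of \<open>M\<close> stay
  null.\<close>

lemma Lp_setwise_limit:
 assumes p: "1 < p" and s [measurable]: "!!n. s n : bm M"
  and bound: "eventually (%n. (II x. epowr (s n x) p ||M) <= en C) F"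
  and R [measurable]: "!!h. R h : sets M" and Rfin: "!!h. em M (R h) < top"
  and fin: "ulim (%n. em (density M (s n)) (space M)) < top"
  and tight: "!!e. 0 < e ==> EX h::nat. ulim (%n. em (density M (s n)) (space M - R h)) <= en e"
 obtains nu where "sets nu = sets M" "!!A. A : sets M ==> em nu A = ulim (%n. em (density M (s n)) A)"
  "absolutely_continuous M nu"
proof -
 have C: "0 <= C | en C = 0" by (metis ennreal_neg linorder_le_cases)
 have equi: "EX i. ulim (%n. em (density M (s n)) (A i)) <= en e"
  if A: "range A <= sets M" "decseq A" "(INT i. A i) = {}" and e: "0 < e" for A e
 proof -
  have [measurable]: "A i : sets M" for i using A by auto
  obtain h where h: "ulim (%n. em (density M (s n)) (space M - R h)) <= en (e/3)"
   using tight[of "e/3"] e by auto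
  \<comment> \<open>The level \<open>a\<close> is fixed so that the part of the densities above it
    has mass below \<open>e/3\<close>, for eventually all \<open>n\<close>; the part below
    \<open>a\<close> is then handled by taking \<open>i\<close> large.\<close>
  have "((%a. a powr (1 - p)*\<bar>C\<bar>) ---> 0*\<bar>C\<bar>) at_top"
   using p by (intro tendsto_mult tendsto_neg_powr filterlim_ident) auto
  hence "eventually (%a. a powr (1 - p)*\<bar>C\<bar> < e/3 & 0 < a) at_top"
   using e by (intro eventually_conj order_tendstoD(2)[where y=0] eventually_gt_at_top) auto
  then obtain a where a: "a powr (1 - p)*\<bar>C\<bar> < e/3" "0 < a"
   by (metis (mono_tags, lifting) eventually_happens trivial_limit_at_top_linorder)
  have "(%i. em M (A i Int R h)) ----> em M (INT i. A i Int R h)"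
  proof (rule Lim_emeasure_decseq)
   show "em M (A i Int R h) ~= \<infinity>" for i
    using emeasure_mono[of "A i Int R h" "R h" M] Rfin[of h] by (auto simp: top_unique)
  qed (use A in \<open>auto simp: decseq_def\<close>)
  hence "(%i. em M (A i Int R h)) ----> 0" using A(3) by simp
  hence "eventually (%i. em M (A i Int R h) < en (e/3/a)) sequentially"
   using a e by (intro order_tendstoD(2)[where y=0]) (auto simp: ennreal_zero_less_divide)
  then obtain i where i: "em M (A i Int R h) < en (e/3/a)"
   using eventually_happens' sequentially_bot by blast
  have "eventually (%n. em (density M (s n)) (A i) <=
    en (e/3) + en (e/3) + em (density M (s n)) (space M - R h)) F"
   using bound
  proof eventually_elim
   case (elim n)
   have "A i <= (A i Int R h) Un (space M - R h)" using sets.sets_into_space[of "A i" M] by auto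
   hence "em (density M (s n)) (A i) <= em (density M (s n)) ((A i Int R h) Un (space M - R h))"
    by (intro emeasure_mono) auto
   also have "... <= em (density M (s n)) (A i Int R h) + em (density M (s n)) (space M - R h)"
    by (intro emeasure_subadditive) auto
   also have "em (density M (s n)) (A i Int R h) <= en (e/3) + en (e/3)"
   proof -
    have "(II x. epowr (s n x) p*ind (A i Int R h) x ||M) <= en C"
     by (rule order_trans[OF nn_integral_mono elim]) (auto simp: indicator_def)
    also have "en C <= en \<bar>C\<bar>" by (intro ennreal_leI) auto
    finally have *: "(II x. epowr (s n x) p*ind (A i Int R h) x ||M) <= en \<bar>C\<bar>" .
    have "em (density M (s n)) (A i Int R h) <= en a*em M (A i Int R h) +
      en (a powr (1 - p))*(II x. epowr (s n x) p*ind (A i Int R h) x ||M)"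
     using p a by (intro emeasure_density_Lp_le) auto
    also have "... <= en a*en (e/3/a) + en (a powr (1 - p))*en \<bar>C\<bar>"
     using i * by (intro add_mono mult_left_mono) auto
    also have "... <= en (e/3) + en (e/3)"
     using a e by (intro add_mono) (auto simp: ennreal_mult'[symmetric] intro!: ennreal_leI)
    finally show ?thesis .
   qed
   finally show ?case by (simp add: add_right_mono)
  qed
  hence "ulim (%n. em (density M (s n)) (A i)) <=
    ulim (%n. en (e/3) + en (e/3) + em (density M (s n)) (space M - R h))"
   by (rule ulim_mono)
  also have "... = en (e/3) + en (e/3) + ulim (%n. em (density M (s n)) (space M - R h))"
   by (simp add: ulim_add ulim_const)
  also have "... <= en (e/3) + en (e/3) + en (e/3)"
   by (intro add_left_mono h)
  also have "... = en e" using e by (simp flip: ennreal_plus)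
  finally show ?thesis by blast
 qed
 obtain nu where nu: "sets nu = sets M" "!!A. A : sets M ==> em nu A = ulim (%n. em (density M (s n)) A)"
  by (rule setwise_limit_measure[of "%n. density M (s n)" M, OF _ fin equi]) (simp, blast+)
 have "absolutely_continuous M nu"
  unfolding absolutely_continuous_def
 proof
  fix A assume A: "A : null_sets M"
  hence "em (density M (s n)) A = 0" for n
   using absolutely_continuousI_density[OF s, of n] by (auto simp: absolutely_continuous_def)
  thus "A : null_sets nu" using A nu by (auto simp: null_sets_def ulim_const)
 qed
 with nu show ?thesis by (rule that)
qed

text \<open>The \<open>p\<close>-th power is a supremum of affine functions. Both sides are tested
  with \<open>a^(p - 1)\<close> for a simple \<open>a <= r\<close>; setwise comparison applies on
  its level sets, and Young's inequality bounds \<open>p * s * a^(p - 1)\<close> by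
  \<open>s^p + (p - 1) * a^p\<close>. The integral of the last term cancels because it is
  finite.\<close>

lemma Lp_lsc:
 assumes p: "1 < p" and [measurable]: "!!n. s n : bm M" "r : bm M"
  and fin: "(II x. r x ||M) < top"
  and le: "!!A. A : sets M ==> em (density M r) A <= ulim (%n. em (density M (s n)) A)"
 shows "(II x. epowr (r x) p ||M) <= ulim (%n. II x. epowr (s n x) p ||M)"
proof -
 obtain f where f: "!!i. simple_function M (f i)" "incseq f" "!!i x. f i x < top"
   "!!x. (SUP i. f i x) = r x"
  using borel_measurable_implies_simple_function_sequence'[OF assms(3)] by (metis image_cong)
 have [measurable]: "f i : bm M" for i using f(1) by (rule borel_measurable_simple_function)
 have "(II x. epowr (r x) p ||M) = (II x. (SUP i. epowr (f i x) p) ||M)"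
  using p f(2) by (intro nn_integral_cong) (auto simp: f(4)[symmetric] epowr_SUP incseq_def le_fun_def)
 also have "... = (SUP i. II x. epowr (f i x) p ||M)"
  using p f(2) by (intro nn_integral_monotone_convergence_SUP) (auto simp: incseq_def le_fun_def epowr_mono)
 also have "... <= ulim (%n. II x. epowr (s n x) p ||M)"
 proof (rule SUP_least)
  fix i
  let ?a = "f i" and ?b = "%x. epowr (f i x) (p - 1)"
  have ar: "?a x <= r x" for x using f(4)[of x] by (metis SUP_upper UNIV_I)
  have sb: "simple_function M ?b" using f(1) by (rule simple_function_compose1)
  have sb': "simple_function (density M g) ?b" for g
   using sb by (simp add: simple_function_def)
  \<comment> \<open>Against a simple function the integral is a finite combination of masses of
    sets, which are the only quantities that \<open>le\<close> compares.\<close>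
  have eq: "(II x. g x*?b x ||M) = (\<Sum>v\<in>?b ` space M. v * em (density M g) (?b -` {v} Int space M))"
   if [measurable]: "g : bm M" for g
  proof -
   have "(II x. g x*?b x ||M) = (II x. ?b x ||density M g)"
    by (simp add: nn_integral_density)
   also have "... = simple_integral (density M g) ?b" by (rule nn_integral_eq_simple_integral[OF sb'])
   finally show ?thesis by (simp add: simple_integral_def)
  qed
  have "(II x. r x*?b x ||M) <= (\<Sum>v\<in>?b ` space M. v * ulim (%n. em (density M (s n)) (?b -` {v} Int space M)))"
   unfolding eq[OF assms(3)] by (intro sum_mono mult_left_mono le simple_functionD(2)[OF sb]) auto
  also have "... <= (\<Sum>v\<in>?b ` space M. ulim (%n. v * em (density M (s n)) (?b -` {v} Int space M)))"
  proof (intro sum_mono)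
   fix v assume "v : ?b ` space M"
   hence "v < top" using f(3) by auto
   hence "((%n. v * em (density M (s n)) (?b -` {v} Int space M)) --->
     v * ulim (%n. em (density M (s n)) (?b -` {v} Int space M))) F"
    by (intro ennreal_tendsto_cmult ulim)
   thus "v * ulim (%n. em (density M (s n)) (?b -` {v} Int space M)) <=
     ulim (%n. v * em (density M (s n)) (?b -` {v} Int space M))"
    by (simp add: ulimI)
  qed
  also have "... = ulim (%n. II x. s n x*?b x ||M)"
   by (subst ulim_sum[symmetric]) (simp add: eq)
  finally have 1: "(II x. r x*?b x ||M) <= ulim (%n. II x. s n x*?b x ||M)" .
  define y where "y = (II x. epowr (?a x) p ||M)"
  define S where "S = ulim (%n. II x. epowr (s n x) p ||M)"
  have ay: "epowr (?a x) p = ?a x*?b x" for x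
   using p epowr_add[of 1 "p-1" "?a x"] by simp
  \<comment> \<open>A simple function with finite values makes \<open>?b\<close> bounded, and
    \<open>r\<close> is integrable; this is the finiteness that permits the cancellation at the
    end.\<close>
  have yfin: "y < top"
  proof -
   obtain B where B: "B < top" "!!x. x : space M ==> ?b x <= B"
   proof -
    have fi: "finite (?b ` space M)" using simple_functionD(1)[OF sb] .
    show ?thesis
    proof (cases "space M = {}")
     case False
     show ?thesis
     proof (rule that[of "Max (?b ` space M)"])
      have "Max (?b ` space M) : ?b ` space M" using fi False by (intro Max_in) auto
      thus "Max (?b ` space M) < top" using f(3) by auto
     qed (use fi in auto)
    qed (auto intro: that[of 0])
   qed
   have "y <= (II x. r x*B ||M)"
    unfolding y_def ay by (intro nn_integral_mono mult_mono ar B) auto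
   also have "... = (II x. r x ||M)*B" by (simp add: nn_integral_multc)
   also have "... < top" using fin B(1) by (simp add: ennreal_mult_less_top)
   finally show ?thesis .
  qed
  have "en p*y <= en p*(II x. r x*?b x ||M)"
   unfolding y_def ay by (intro mult_left_mono nn_integral_mono mult_right_mono ar) auto
  also have "... <= en p*ulim (%n. II x. s n x*?b x ||M)" by (intro mult_left_mono 1) auto
  also have "... = ulim (%n. en p*(II x. s n x*?b x ||M))"
   by (intro ulimI[symmetric] ennreal_tendsto_cmult ulim) auto
  also have "... <= ulim (%n. (II x. epowr (s n x) p ||M) + en (p - 1)*y)"
  proof (intro ulim_mono always_eventually allI)
   fix n
   have "en p*(II x. s n x*?b x ||M) = (II x. en p*(s n x*?b x) ||M)"
    by (simp add: nn_integral_cmult)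
   also have "... <= (II x. epowr (s n x) p + en (p - 1)*epowr (?a x) p ||M)"
    by (intro nn_integral_mono epowr_Young p)
   also have "... = (II x. epowr (s n x) p ||M) + en (p - 1)*y"
    unfolding y_def by (simp add: nn_integral_add nn_integral_cmult)
   finally show "en p*(II x. s n x*?b x ||M) <= (II x. epowr (s n x) p ||M) + en (p - 1)*y" .
  qed
  also have "... = S + en (p - 1)*y" by (simp add: ulim_add ulim_const S_def)
  finally have "en p*y <= S + en (p - 1)*y" .
  moreover have "en p*y = y + en (p - 1)*y"
  proof -
   have "en p = 1 + en (p-1)" using p by (simp flip: ennreal_1 ennreal_plus)
   thus ?thesis by (simp add: distrib_right)
  qed
  ultimately have "en (p - 1)*y + y <= en (p - 1)*y + S" by (simp add: add.commute)
  thus "y <= S"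
   using yfin by (auto simp: ennreal_add_left_cancel_le ennreal_mult_eq_top_iff)
 qed
 finally show ?thesis .
qed

end

subsection \<open>Limits of measures on rectangles\<close>

text \<open>Limits of plans are controlled on rectangles only; countable unions of rectangles are
  the sets to which one-sided control extends by continuity from below. They take the place of the
  open sets of the product.\<close>

definition rect_union :: "'a measure => 'b measure => ('a \<times> 'b) set => bool" where
 "rect_union M N E \<longleftrightarrow> (EX A B. (ALL i::nat. A i : sets M & B i : sets N) & E = (UN i. A i \<times> B i))"

lemma rect_union_sets: "rect_union M N E ==> E : sets (M \<Otimes>\<^sub>M N)"
 by (auto simp: rect_union_def)

lemma rect_unionI_countable:
 assumes "countable I" "!!i. i : I ==> A i : sets M" "!!i. i : I ==> B i : sets N"
 shows "rect_union M N (\<Union>i\<in>I. A i \<times> B i)"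
proof (cases "I = {}")
 case True
 thus ?thesis unfolding rect_union_def by (intro exI[of _ "%_. {}"]) auto
next
 case False
 have "(\<Union>i\<in>I. A i \<times> B i) = (UN k. A (from_nat_into I k) \<times> B (from_nat_into I k))"
  by (subst range_from_nat_into[OF False assms(1), symmetric]) simp
 thus ?thesis unfolding rect_union_def
  using assms(2,3) from_nat_into[OF False]
  by (intro exI[of _ "%k. A (from_nat_into I k)"] exI[of _ "%k. B (from_nat_into I k)"]) auto
qed

lemma rect_union_UN:
 assumes "!!j::nat. rect_union M N (E j)"
 shows "rect_union M N (UN j. E j)"
proof -
 have "ALL j. EX A B. (ALL i::nat. A i : sets M & B i : sets N) & E j = (UN i. A i \<times> B i)"
  using assms unfolding rect_union_def by simp
 from choice[OF this] obtain A where
  "ALL j. EX B. (ALL i::nat. A j i : sets M & B i : sets N) & E j = (UN i. A j i \<times> B i)" by blast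
 from choice[OF this] obtain B where
  "ALL j. (ALL i::nat. A j i : sets M & B j i : sets N) & E j = (UN i. A j i \<times> B j i)" by blast
 hence AB: "!!j i. A j i : sets M & B j i : sets N" "!!j. E j = (\<Union>i::nat. A j i \<times> B j i)"
  by blast+
 have "(UN j. E j) = (\<Union>(j,i)\<in>UNIV. A j i \<times> B j i)" using AB(2) by auto
 thus ?thesis
  using rect_unionI_countable[of UNIV "%(j,i). A j i" M "%(j,i). B j i" N] AB(1) by (auto simp: split_beta)
qed

lemma rect_union_Times: "A : sets M ==> B : sets N ==> rect_union M N (A \<times> B)"
 unfolding rect_union_def by (intro exI[of _ "%_. A"] exI[of _ "%_. B"]) auto

lemma rect_union_Int:
 assumes "rect_union M N E" "A : sets M" "B : sets N"
 shows "rect_union M N (E Int A \<times> B)"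
proof -
 obtain C D where CD: "!!i::nat. C i : sets M & D i : sets N" "E = (UN i. C i \<times> D i)"
  using assms(1) unfolding rect_union_def by blast
 thus ?thesis unfolding rect_union_def using assms(2,3)
  by (intro exI[of _ "%i. C i Int A"] exI[of _ "%i. D i Int B"]) auto
qed

lemma semiring_of_rectangles:
 "semiring_of_sets (space M \<times> space N) {A \<times> B | A B. A : sets M & B : sets N}"
proof
 let ?S = "{A \<times> B | A B. A : sets M & B : sets N}"
 show "?S <= Pow (space M \<times> space N)" by (auto dest: sets.sets_into_space)
 show "{} : ?S" by auto
 show "a Int b : ?S" if ab: "a : ?S" "b : ?S" for a b
 proof -
  obtain A B C D where *: "a = A \<times> B" "b = C \<times> D" "A : sets M" "B : sets N" "C : sets M" "D : sets N"
   using ab by blast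
  hence "a Int b = (A Int C) \<times> (B Int D)" by blast
  thus ?thesis using * by blast
 qed
 show "EX C<=?S. finite C & disjoint C & a - b = \<Union>C" if ab: "a : ?S" "b : ?S" for a b
 proof -
  obtain A B C D where *: "a = A \<times> B" "b = C \<times> D" "A : sets M" "B : sets N" "C : sets M" "D : sets N"
   using ab by blast
  show ?thesis
  proof (intro exI[of _ "{(A - C) \<times> B, (A Int C) \<times> (B - D)}"] conjI)
   show "{(A - C) \<times> B, (A Int C) \<times> (B - D)} <= ?S" using * by blast
   show "disjoint {(A - C) \<times> B, (A Int C) \<times> (B - D)}" by (auto simp: disjoint_def)
  qed (auto simp: *)
 qed
qed

text \<open>Finite intersection property inside \<open>K 0\<close>; the Hausdorff property makes the
  compact sets closed. It is applied to sets that are chosen independently and need not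
  decrease.\<close>

lemma decreasing_compact_Int_empty:
 assumes "Hausdorff_space T" "!!n::nat. compactin T (K n)" "(INT n. K n) = {}"
 obtains m where "(\<Inter>n\<le>m. K n) = {}"
proof (rule ccontr)
 assume "~ thesis"
 hence ne: "(\<Inter>n\<le>m. K n) ~= {}" for m using that by blast
 have cl: "closedin T (K n)" for n using assms compactin_imp_closedin by blast
 have fin: "K 0 Int \<Inter>\<F> ~= {}" if F: "finite \<F>" "\<F> <= range K" for \<F>
 proof -
  obtain I where I: "finite I" "\<F> = K ` I" using finite_subset_image[OF F] by blast
  then obtain m where "ALL i:I. i <= m" using finite_nat_set_iff_bounded_le[of I] by blast
  hence "(\<Inter>n\<le>m. K n) <= K 0 Int \<Inter>\<F>" using I by auto
  thus ?thesis using ne[of m] by (metis subset_empty)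
 qed
 have "K 0 Int \<Inter>(range K) ~= {}"
 proof -
  have "ALL \<U>. (ALL C:\<U>. closedin T C) & (ALL \<F>. finite \<F> & \<F> <= \<U> --> K 0 Int \<Inter>\<F> ~= {}) --> K 0 Int \<Inter>\<U> ~= {}"
   using assms(2)[of 0] unfolding compactin_fip by (rule conjunct2)
  from spec[OF this, of "range K"] show ?thesis using cl fin by simp
 qed
 thus False using assms(3) by auto
qed

context ultrafilter
begin

text \<open>On the whole product sigma-algebra the setwise limit need not be a measure. On the ring
  of finite unions of rectangles it is a content, which approximation of both marginals by compact
  sets makes continuous at the empty set, so that Caratheodory's theorem extends it. The extension
  agrees with the limit on rectangles and stays below it on their countable unions. Mass spread on
  diagonals shifted by \<open>1/n\<close> shows that the latter may be strict: the complement of the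
  diagonal keeps full mass along the sequence and has none in the limit.\<close>

lemma bimeasure_limit:
 fixes P :: "nat => ('a \<times> 'b) measure"
 assumes H: "Hausdorff_space T1" "Hausdorff_space T2"
  and sP: "!!n. sets (P n) = sets (M \<Otimes>\<^sub>M N)"
  and fin: "ulim (%n. em (P n) (space M \<times> space N)) < top"
  and t1: "!!A e. A : sets M ==> 0 < e ==>
   EX K<=A. K : sets M & compactin T1 K & ulim (%n. em (P n) ((A - K) \<times> space N)) <= en e"
  and t2: "!!A e. A : sets N ==> 0 < e ==>
   EX K<=A. K : sets N & compactin T2 K & ulim (%n. em (P n) (space M \<times> (A - K))) <= en e"
 obtains Q where "sets Q = sets (M \<Otimes>\<^sub>M N)"
  "!!A B. A : sets M ==> B : sets N ==> em Q (A \<times> B) = ulim (%n. em (P n) (A \<times> B))"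
  "!!E. rect_union M N E ==> em Q E <= ulim (%n. em (P n) E)"
proof -
 let ?MN = "sets (M \<Otimes>\<^sub>M N)" and ?T = "prod_topology T1 T2"
 let ?\<Omega> = "space M \<times> space N" and ?S = "{A \<times> B | A B. A : sets M & B : sets N}"
 interpret S: semiring_of_sets ?\<Omega> ?S by (rule semiring_of_rectangles)
 let ?R = "S.generated_ring"
 interpret R: ring_of_sets ?\<Omega> ?R by (rule S.generating_ring)
 let ?f = "%E. ulim (%n. em (P n) E)"
 have sig: "sigma_sets ?\<Omega> ?R = ?MN"
  unfolding S.sigma_sets_generated_ring_eq sets_pair_measure ..
 have RS: "E : ?MN" if "E : ?R" for E
  unfolding sig[symmetric] using that by (rule sigma_sets.Basic)
 have mono: "?f A <= ?f B" if "A <= B" "B : ?MN" for A B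
  using that sP by (intro ulim_mono always_eventually) (auto intro: emeasure_mono)
 have sub: "?f (A Un B) <= ?f A + ?f B" if "A : ?MN" "B : ?MN" for A B
  unfolding ulim_add[symmetric] using that sP
  by (intro ulim_mono always_eventually) (auto intro: emeasure_subadditive)
 have sub_fin: "?f (\<Union>i\<in>I. A i) <= (\<Sum>i\<in>I. ?f (A i))" if "finite I" "!!i. i : I ==> A i : ?MN" for I A
  unfolding ulim_sum[symmetric] using that sP
  by (intro ulim_mono always_eventually) (auto intro: emeasure_subadditive_finite)
 have f0: "?f {} = 0" by (simp add: ulim_const)
 have ffin: "?f E ~= \<infinity>" if "E : ?R" for E
 proof -
  have "?f E <= ?f ?\<Omega>" using that RS[OF that] sets.sets_into_space[of E "M \<Otimes>\<^sub>M N"]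
   by (intro mono) (auto simp: space_pair_measure)
  also have "... < \<infinity>" using fin by simp
  finally show ?thesis by simp
 qed
 \<comment> \<open>The errors of the two factors add up on a rectangle, and those of finitely many
   rectangles on their union; compact sets are stable under both operations.\<close>
 have approx: "EX K<=E. K : ?MN & compactin ?T K & ?f (E - K) <= en e"
  if "E : ?R" "0 < e" for E e
 proof -
  have rect: "EX K<=E. K : ?MN & compactin ?T K & ?f (E - K) <= en e"
   if E: "E : ?S" and e: "0 < e" for E e
  proof -
   obtain A B where AB: "E = A \<times> B" "A : sets M" "B : sets N" using E by auto
   obtain K where K: "K <= A" "K : sets M" "compactin T1 K"
     "ulim (%n. em (P n) ((A - K) \<times> space N)) <= en (e/2)"
    using t1[OF AB(2), of "e/2"] e by auto
   obtain L where L: "L <= B" "L : sets N" "compactin T2 L"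
     "ulim (%n. em (P n) (space M \<times> (B - L))) <= en (e/2)"
    using t2[OF AB(3), of "e/2"] e by auto
   have "?f (E - K \<times> L) <= ?f ((A - K) \<times> space N Un space M \<times> (B - L))"
    using AB K L sets.sets_into_space[OF AB(2)] sets.sets_into_space[OF AB(3)] by (intro mono) auto
   also have "... <= ?f ((A - K) \<times> space N) + ?f (space M \<times> (B - L))"
    using AB K L by (intro sub) auto
   also have "... <= en (e/2) + en (e/2)" by (intro add_mono K L)
   also have "... = en e" using e by (simp flip: ennreal_plus)
   finally show ?thesis using K L AB by (intro exI[of _ "K \<times> L"]) (auto simp: compactin_Times)
  qed
  obtain C where C: "finite C" "C <= ?S" "E = \<Union>C" using \<open>E : ?R\<close> by (rule S.generated_ringE) auto
  from C(1,2) have "!!e. 0 < e ==> EX K<=\<Union>C. K : ?MN & compactin ?T K & ?f (\<Union>C - K) <= en e"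
  proof (induction C rule: finite_induct)
   case empty
   show ?case by (intro exI[of _ "{}"]) (auto simp: ulim_const)
  next
   case (insert E C)
   obtain K where K: "K <= E" "K : ?MN" "compactin ?T K" "?f (E - K) <= en (e/2)"
    using rect[of E "e/2"] insert by auto
   have "EX L<=\<Union>C. L : ?MN & compactin ?T L & ?f (\<Union>C - L) <= en (e/2)"
    using insert.prems by (intro insert.IH) auto
   then obtain L where L: "L <= \<Union>C" "L : ?MN" "compactin ?T L" "?f (\<Union>C - L) <= en (e/2)"
    by blast
   have EC: "E : ?MN" "\<Union>C \<in> ?MN"
    using insert.prems insert.hyps(1) by (auto intro!: sets.finite_Union)
   have "?f (\<Union>(insert E C) - (K Un L)) <= ?f ((E - K) Un (\<Union>C - L))"
    using K L EC by (intro mono) auto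
   also have "... <= ?f (E - K) + ?f (\<Union>C - L)" using K L EC by (intro sub) auto
   also have "... <= en (e/2) + en (e/2)" by (intro add_mono K L)
   also have "... = en e" using insert.prems by (simp flip: ennreal_plus)
   finally show ?case using K L by (intro exI[of _ "K Un L"]) (auto simp: compactin_Un)
  qed
  thus ?thesis using that C by auto
 qed
 have pos: "positive ?R ?f" using f0 by (simp add: positive_def)
 have add: "additive ?R ?f"
  unfolding additive_def
 proof (intro ballI impI)
  fix A B assume "A : ?R" "B : ?R" "A Int B = {}"
  hence "em (P n) (A Un B) = em (P n) A + em (P n) B" for n
   using sP RS by (intro plus_emeasure[symmetric]) auto
  thus "?f (A Un B) = ?f A + ?f B" by (simp add: ulim_add)
 qed
 have cont: "(%i. ?f (E i)) ----> 0" if E: "range E <= ?R" "decseq E" "(INT i. E i) = {}" for E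
 proof (rule order_tendstoI)
  fix a :: ennreal assume "0 < a"
  obtain e where e: "0 < e" "en e < a"
  proof -
   obtain b where b: "0 < b" "b < a" using dense[OF \<open>0 < a\<close>] by blast
   hence "b ~= top" by (auto simp: top_unique)
   thus thesis using b by (intro that[of "enn2real b"]) (auto simp: enn2real_positive_iff less_top)
  qed
  \<comment> \<open>The compact sets are chosen separately for each \<open>n\<close>. Finitely many
    of them already have empty intersection, so \<open>E m\<close> is covered by the differences
    \<open>E n - K n\<close> with \<open>n <= m\<close>, whose limit masses sum to at most
    \<open>e\<close>.\<close>
  have "EX K. K <= E n & K : ?MN & compactin ?T K & ?f (E n - K) <= en (e*(1/2)^Suc n)" for n
   using approx[of "E n" "e*(1/2)^Suc n"] E e by (auto simp: image_subset_iff)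
  then obtain K where K: "!!n. K n <= E n" "!!n. K n : ?MN"
    "!!n. compactin ?T (K n)" "!!n. ?f (E n - K n) <= en (e*(1/2)^Suc n)"
   by metis
  have "(INT n. K n) <= (INT n. E n)" using K(1) by (auto dest: subsetD)
  hence K0: "(INT n. K n) = {}" using E(3) by (metis subset_empty)
  have "Hausdorff_space (prod_topology T1 T2)" using H by (simp add: Hausdorff_space_prod_topology)
  then obtain m where m: "(\<Inter>n\<le>m. K n) = {}"
   by (rule decreasing_compact_Int_empty[OF _ K(3) K0])
  have ES: "E n : ?MN" for n using E(1) RS by (auto simp: image_subset_iff)
  have "E m <= (\<Union>n\<in>{..m}. E n - K n)"
  proof
   fix x assume x: "x : E m"
   obtain n where n: "n <= m" "x ~: K n" using m by blast
   hence "x : E n" using x decseqD[OF E(2) n(1)] by blast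
   thus "x : (\<Union>n\<in>{..m}. E n - K n)" using n by auto
  qed
  hence "?f (E m) <= ?f (\<Union>n\<in>{..m}. E n - K n)" using K ES by (intro mono) auto
  also have "... <= (\<Sum>n\<in>{..m}. ?f (E n - K n))" using K ES by (intro sub_fin) auto
  also have "... <= (\<Sum>n\<in>{..m}. en (e*(1/2)^Suc n))" by (intro sum_mono K)
  also have "... = en (\<Sum>n\<in>{..m}. e*(1/2)^Suc n)" using e by (intro sum_ennreal) auto
  also have "(\<Sum>n\<in>{..m}. e*(1/2)^Suc n) <= e"
  proof -
   have "(\<Sum>n\<in>{..m}. e*(1/2)^Suc n) = e*(1 - (1/2)^Suc m)"
    by (induction m) (auto simp: field_simps)
   also have "... <= e*1" using e by (intro mult_left_mono) auto
   finally show ?thesis by simp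
  qed
  finally have *: "?f (E m) <= en e" by (simp add: ennreal_leI)
  show "eventually (%i. ?f (E i) < a) sequentially"
  proof (rule eventually_sequentiallyI[of m])
   fix i assume "m <= i"
   hence "?f (E i) <= ?f (E m)" using E(2) ES by (intro mono) (auto simp: decseq_def)
   also have "... < a" using * e(2) by (rule le_less_trans)
   finally show "?f (E i) < a" .
  qed
 qed auto
 obtain mu where mu: "ALL s:?R. mu s = ?f s" "measure_space ?\<Omega> (sigma_sets ?\<Omega> ?R) mu"
  using R.caratheodory_empty_continuous[OF pos add ffin cont] by blast
 define Q where "Q = measure_of ?\<Omega> (?MN) mu"
 have sQ: "sets Q = ?MN"
  unfolding Q_def space_pair_measure[symmetric] by (rule sets.sets_measure_of_eq)
 have eQ: "em Q E = ?f E" if "E : ?R" for E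
 proof -
  have "em Q E = mu E"
   unfolding Q_def using mu(2) RS[OF that] unfolding sig
   by (intro emeasure_measure_of_sigma) (auto simp: measure_space_def)
  thus ?thesis using mu(1) that by simp
 qed
 have SR: "A \<times> B : ?R" if "A : sets M" "B : sets N" for A B
  using that by (intro S.generated_ringI_Basic) auto
 show ?thesis
 proof (rule that[OF sQ])
  fix A B assume "A : sets M" "B : sets N"
  thus "em Q (A \<times> B) = ?f (A \<times> B)" by (intro eQ SR)
 next
  fix E assume "rect_union M N E"
  then obtain A B where AB: "!!i::nat. A i : sets M & B i : sets N" "E = (UN i. A i \<times> B i)"
   unfolding rect_union_def by blast
  let ?U = "%m. \<Union>i<m. A i \<times> B i"
  have UR: "?U m : ?R" for m using AB(1) by (intro R.finite_UN) (auto intro: SR)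
  have ES: "E : ?MN" using AB by auto
  have "em Q E = (SUP m. em Q (?U m))"
  proof -
   have "E = (UN m. ?U m)" unfolding AB(2) by blast
   moreover have "range ?U <= sets Q" using UR RS sQ by auto
   moreover have "incseq ?U"
    unfolding incseq_def by (intro allI impI UN_mono) auto
   ultimately show ?thesis using SUP_emeasure_incseq[of ?U Q] by simp
  qed
  also have "... <= ?f E"
  proof (rule SUP_least)
   fix m
   show "em Q (?U m) <= ?f E"
    unfolding eQ[OF UR] by (intro mono ES) (auto simp: AB(2))
  qed
  finally show "em Q E <= ?f E" .
 qed
qed

text \<open>The sum counts, in steps of height \<open>de\<close>, the thresholds strictly below
  \<open>x\<close>. It is a lower Riemann sum for the layer-cake formula, built from strict
  superlevel sets only, with error at most \<open>de\<close> up to the height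
  \<open>K * de\<close>.\<close>

lemma staircase_le:
 fixes x de :: ennreal
 shows "(\<Sum>k<K. if of_nat (Suc k)*de < x then de else 0) <= x" (is "?S K <= x")
  "min x (of_nat K*de) <= (\<Sum>k<K. if of_nat (Suc k)*de < x then de else 0) + de"
proof -
 have full: "?S K = of_nat K*de" if "of_nat K*de < x" for K
  using that
 proof (induction K)
  case (Suc K)
  have "of_nat K*de <= of_nat (Suc K)*de" by (intro mult_right_mono) auto
  hence "of_nat K*de < x" using Suc.prems by (rule le_less_trans)
  thus ?case using Suc by (simp add: distrib_right add.commute)
 qed simp
 show "?S K <= x"
 proof (induction K)
  case (Suc K)
  show ?case
  proof (cases "of_nat (Suc K)*de < x")
   case True thus ?thesis using full[OF True] by simp
  next
   case False thus ?thesis using Suc by simp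
  qed
 qed simp
 show "min x (of_nat K*de) <= ?S K + de"
 proof (induction K)
  case (Suc K)
  show ?case
  proof (cases "of_nat (Suc K)*de < x")
   case True thus ?thesis using full[OF True] by (simp add: min.coboundedI2)
  next
   case False
   hence S: "?S (Suc K) = ?S K" by simp
   show ?thesis
   proof (cases "of_nat K*de < x")
    case True
    thus ?thesis unfolding S full[OF True] using False
     by (simp add: distrib_right add.commute min.coboundedI1 not_less)
   next
    case False
    thus ?thesis unfolding S using Suc by (metis min.absorb1 min.coboundedI1 not_less)
   qed
  qed
 qed simp
qed

text \<open>The inequality on superlevel sets is summed through the staircase; then the mesh tends
  to 0 and the truncation height to infinity. Finiteness of \<open>Q\<close> absorbs the mesh
  error.\<close>

lemma rect_lsc_integral:
 assumes sP: "!!n. sets (P n) = sets (M \<Otimes>\<^sub>M N)" and sQ: "sets Q = sets (M \<Otimes>\<^sub>M N)"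
  and Q: "!!E. rect_union M N E ==> em Q E <= ulim (%n. em (P n) E)"
  and fin: "em Q (space Q) < top"
  and ph: "!!s. s < top ==> rect_union M N {z : space M \<times> space N. s < ph z}"
 shows "(II z. ph z ||Q) <= ulim (%n. II z. ph z ||P n)"
proof -
 let ?c = "ulim (%n. II z. ph z ||P n)"
 define E where "E s = {z : space M \<times> space N. s < ph z}" for s
 have spP: "space (P n) = space M \<times> space N" for n
  using sets_eq_imp_space_eq[OF sP[of n]] by (simp add: space_pair_measure)
 have spQ: "space Q = space M \<times> space N"
  using sets_eq_imp_space_eq[OF sQ] by (simp add: space_pair_measure)
 have E: "E s : sets (M \<Otimes>\<^sub>M N)" if "s < top" for s
  unfolding E_def by (rule rect_union_sets[OF ph[OF that]])
 have meas: "ph : bm (M \<Otimes>\<^sub>M N)"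
 proof (rule borel_measurableI_greater)
  fix s :: ennreal
  show "{z : space (M \<Otimes>\<^sub>M N). s < ph z} : sets (M \<Otimes>\<^sub>M N)"
   using E[of s] by (cases "s = top") (auto simp: E_def space_pair_measure less_top)
 qed
 have [measurable]: "ph : bm Q" "ph : bm (P n)" for n
  using meas sP[of n] sQ by (simp_all cong: measurable_cong_sets)
 \<comment> \<open>\<open>(m + 1)^2\<close> steps of height \<open>1/(m + 1)\<close> reach the
   height \<open>m + 1\<close>, so one index drives mesh and truncation.\<close>
 define K where "K m = Suc m*Suc m" for m :: nat
 define de where "de m = en (1/Suc m)" for m :: nat
 have de: "de m < top" for m by (simp add: de_def)
 have Kd: "of_nat (K m)*de m = en (Suc m)" for m
 proof -
  have "real (K m)*(1/real (Suc m)) = real (Suc m)"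
   unfolding K_def of_nat_mult by (simp del: of_nat_Suc)
  thus ?thesis
   unfolding de_def ennreal_of_nat_eq_real_of_nat by (subst ennreal_mult[symmetric]) (simp_all del: of_nat_Suc)
 qed
 have lt: "of_nat k*de m < top" for k m
  using de by (simp add: ennreal_mult_less_top ennreal_of_nat_eq_real_of_nat)
 define ps where "ps m z = (\<Sum>k<K m. if of_nat (Suc k)*de m < ph z then de m else 0)" for m z
 have int: "(II z. ps m z ||R) = (\<Sum>k<K m. de m*em R (E (of_nat (Suc k)*de m)))"
  if sR: "sets R = sets (M \<Otimes>\<^sub>M N)" for R m
 proof -
  have [measurable]: "E (of_nat k*de m) : sets R" for k using E[OF lt] sR by auto
  have sp: "space R = space M \<times> space N"
   using sets_eq_imp_space_eq[OF sR] by (simp add: space_pair_measure)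
  have "(II z. ps m z ||R) = (II z. (\<Sum>k<K m. de m*ind (E (of_nat (Suc k)*de m)) z) ||R)"
   unfolding ps_def using sp by (intro nn_integral_cong sum.cong) (auto simp: E_def indicator_def)
  also have "... = (\<Sum>k<K m. II z. de m*ind (E (of_nat (Suc k)*de m)) z ||R)"
   by (intro nn_integral_sum) measurable
  also have "... = (\<Sum>k<K m. de m*em R (E (of_nat (Suc k)*de m)))"
   by (intro sum.cong) (auto simp: nn_integral_cmult_indicator simp del: of_nat_Suc)
  finally show ?thesis .
 qed
 have step: "(II z. ps m z ||Q) <= ?c" for m
 proof -
  have "(II z. ps m z ||Q) <= (\<Sum>k<K m. de m*ulim (%n. em (P n) (E (of_nat (Suc k)*de m))))"
   unfolding int[OF sQ] E_def by (intro sum_mono mult_left_mono Q ph lt) auto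
  also have "... = (\<Sum>k<K m. ulim (%n. de m*em (P n) (E (of_nat (Suc k)*de m))))"
   by (intro sum.cong refl ulimI[symmetric] ennreal_tendsto_cmult ulim de)
  also have "... = ulim (%n. II z. ps m z ||P n)"
   unfolding int[OF sP] by (rule ulim_sum[symmetric])
  also have "... <= ?c"
   unfolding ps_def by (intro ulim_mono always_eventually allI nn_integral_mono staircase_le)
  finally show ?thesis .
 qed
 have bound: "(II z. min (ph z) (en (Suc m)) ||Q) <= ?c + de m*em Q (space Q)" for m
 proof -
  have [measurable]: "ps m : bm Q" unfolding ps_def by measurable
  have "(II z. min (ph z) (en (Suc m)) ||Q) <= (II z. ps m z + de m ||Q)"
   unfolding Kd[symmetric] ps_def by (intro nn_integral_mono staircase_le)
  also have "... = (II z. ps m z ||Q) + de m*em Q (space Q)"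
   by (simp add: nn_integral_add)
  finally show ?thesis using step[of m] by (meson add_right_mono order_trans)
 qed
 have "de ----> 0"
  unfolding de_def using tendsto_ennrealI[OF LIMSEQ_inverse_real_of_nat]
  by (simp add: inverse_eq_divide)
 hence "(%m. em Q (space Q)*de m) ----> em Q (space Q)*0"
  by (intro ennreal_tendsto_cmult fin)
 hence "(%m. de m*em Q (space Q)) ----> 0" by (simp add: mult.commute)
 hence lim: "(%m. ?c + de m*em Q (space Q)) ----> ?c + 0"
  by (intro tendsto_add) auto
 have inc: "incseq (%m z. min (ph z) (en (Suc m)))"
  unfolding incseq_def le_fun_def by (intro allI impI min.mono order_refl ennreal_leI) simp
 have "(II z. ph z ||Q) = (II z. (SUP m. min (ph z) (en (Suc m))) ||Q)"
 proof (intro nn_integral_cong)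
  fix z
  have "(SUP m. en (Suc m)) = top"
  proof -
   have "(SUP m. en (real m)) <= (SUP m. en (Suc m))"
   proof (rule SUP_mono)
    fix m show "EX k:UNIV. en (real m) <= en (Suc k)"
     by (intro bexI[of _ m] ennreal_leI) auto
   qed
   moreover have "(SUP m. en (real m)) = top"
    using ennreal_SUP_of_nat_eq_top by (simp only: ennreal_of_nat_eq_real_of_nat)
   ultimately show ?thesis by (simp only: top_unique)
  qed
  hence "ph z = inf (ph z) (SUP m. en (Suc m))" by (simp only: inf_top_right)
  also have "... = (SUP m. inf (ph z) (en (Suc m)))" by (rule inf_SUP)
  finally show "ph z = (SUP m. min (ph z) (en (Suc m)))" by (simp only: inf_min)
 qed
 also have "... = (SUP m. II z. min (ph z) (en (Suc m)) ||Q)"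
  by (intro nn_integral_monotone_convergence_SUP inc) measurable
 also have "... <= ?c"
 proof -
  have lim': "(%m. ?c + de m*em Q (space Q)) ----> ?c" using lim by simp
  show ?thesis
  proof (rule SUP_least)
   fix m
   \<comment> \<open>The truncation \<open>m\<close> stays fixed while the mesh index
     \<open>n\<close> goes to infinity.\<close>
   have "(II z. min (ph z) (en (Suc m)) ||Q) <= ?c + de n*em Q (space Q)" if "m <= n" for n
    using incseqD[OF inc that] by (intro order_trans[OF nn_integral_mono bound]) (auto simp: le_fun_def)
   thus "(II z. min (ph z) (en (Suc m)) ||Q) <= ?c"
    by (intro LIMSEQ_le_const[OF lim'] exI[of _ m]) auto
  qed
 qed
 finally show ?thesis .
qed

end

subsection \<open>Couplings and transport costs\<close>

lemma space_borel_of [simp]: "space (borel_of T) = topspace T"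
 by (simp add: borel_of_def space_measure_of_conv)

lemma sets_borel_of: "sets (borel_of T) = sigma_sets (topspace T) {U. openin T U}"
 unfolding borel_of_def by (rule sets_measure_of) (auto dest: openin_subset)

lemma borel_of_open: "openin T U ==> U : sets (borel_of T)"
 unfolding sets_borel_of by (rule sigma_sets.Basic) simp

lemma borel_of_closed:
 assumes "closedin T C" shows "C : sets (borel_of T)"
proof -
 have "topspace T - (topspace T - C) : sets (borel_of T)"
  using assms by (intro sets.Diff borel_of_open) (auto simp: closedin_def intro: sets.top[of "borel_of T", simplified])
 thus ?thesis using closedin_subset[OF assms] by (simp add: double_diff)
qed

lemma measurable_continuous_map:
 assumes "continuous_map T T' f"
 shows "f : borel_of T \<rightarrow>\<^sub>M borel_of T'"
proof (rule measurable_sigma_sets[OF sets_borel_of])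
 show "{U. openin T' U} <= Pow (topspace T')" by (auto dest: openin_subset)
 show "f : space (borel_of T) \<rightarrow> topspace T'" using continuous_map_funspace[OF assms] by simp
 show "f -` U Int space (borel_of T) : sets (borel_of T)" if "U : {U. openin T' U}" for U
 proof -
  have "openin T {x : topspace T. f x : U}" using openin_continuous_map_preimage[OF assms] that by simp
  thus ?thesis by (intro borel_of_open) (simp add: vimage_def Int_def conj_commute)
 qed
qed

definition madd :: "'a measure => 'a measure => 'a measure" where
 "madd a b = msum (%i. if i = 0 then a else if i = 1 then b else null_measure a)"

lemma sets_madd [simp, measurable_cong]: "sets (madd a b) = sets a"
 by (simp add: madd_def)

lemma space_madd [simp]: "space (madd a b) = space a"
 by (simp add: madd_def)

lemma suminf_two: "(!!i. 2 <= i ==> f i = 0) ==> (\<Sum>i. f i :: ennreal) = f 0 + f 1"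
 using suminf_finite[of "{..<2}" f] by (auto simp: numeral_2_eq_2 not_less)

lemma emeasure_madd:
 assumes "sets b = sets a" "A : sets a"
 shows "em (madd a b) A = em a A + em b A"
proof -
 have "em (madd a b) A = (\<Sum>i. em (if i = 0 then a else if i = 1 then b else null_measure a) A)"
  unfolding madd_def using assms by (subst emeasure_msum) auto
 thus ?thesis by (simp add: suminf_two)
qed

lemma nn_integral_madd:
 assumes "sets b = sets a" "f : bm a"
 shows "(II x. f x ||madd a b) = (II x. f x ||a) + (II x. f x ||b)"
proof -
 have "(II x. f x ||madd a b) = (\<Sum>i. integral\<^sup>N (if i = 0 then a else if i = 1 then b else null_measure a) f)"
  unfolding madd_def using assms by (subst nn_integral_msum) auto
 thus ?thesis by (simp add: suminf_two)
qed

section \<open>Borel sets, couplings and quadratic transport cost on a Polish space\<close>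

locale polish =
 fixes X :: "'a metric"
 assumes complete: "mcomplete_of X"
  and separable: "separable_space (mtopology_of X)"
  and nonempty: "mspace X ~= {}"
begin

abbreviation T where "T == mtopology_of X"
abbreviation B where "B == borel_of T"
abbreviation d where "d == mdist X"
abbreviation S where "S == mspace X"
abbreviation dd where "dd x y == en ((d x y)^2)"
abbreviation sq where "sq z == dd (fst z) (snd z)"
abbreviation cost where "cost g == II z. sq z ||g"
abbreviation cpl where "cpl == couplings X"
abbreviation BB where "BB == B \<Otimes>\<^sub>M B"

sublocale MS: Metric_space S d
 by (rule Metric_space_mspace_mdist)

lemma mtop: "T = MS.mtopology"
 by (simp add: mtopology_of_def)

lemma space_B [simp]: "space B = S" by simp

lemma S_in_B [simp, measurable]: "S : sets B"
 using sets.top[of B] by simp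

lemma d_nonneg [simp]: "0 <= d x y" by simp

lemma d_triangle: "x : S ==> y : S ==> z : S ==> d x z <= d x y + d y z"
 by (rule MS.triangle)

lemma d_commute: "d x y = d y x"
 by (rule MS.commute)

lemma openin_ball: "openin T (MS.mball x r)"
 unfolding mtop by (rule MS.openin_mball)

lemma ball_in_B [measurable]: "MS.mball x r : sets B"
 by (intro borel_of_open openin_ball)

lemma dense_seq: "EX e :: nat => 'a. range e <= S & (ALL x:S. ALL r>0. EX k. d (e k) x < r)"
proof -
 obtain C where C: "countable C" "C <= S" "T closure_of C = S"
  using separable unfolding separable_space_def by auto
 have "C ~= {}" using C(3) nonempty by (metis closure_of_empty)
 show ?thesis
 proof (rule exI[of _ "from_nat_into C"], intro conjI ballI allI impI)
  show "range (from_nat_into C) <= S" using range_from_nat_into[OF \<open>C ~= {}\<close> C(1)] C(2) by simp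
  fix x r assume x: "x : S" and r: "0 < (r::real)"
  have "x : T closure_of C" using C(3) x by simp
  hence "EX y:C. y : MS.mball x r"
   unfolding in_closure_of using x r openin_ball[of x r] by (metis MS.centre_in_mball_iff)
  then obtain y where y: "y : C" "d x y < r" by (auto simp: MS.in_mball)
  then obtain k where "from_nat_into C k = y"
   using range_from_nat_into[OF \<open>C ~= {}\<close> C(1)] by (metis imageE)
  thus "EX k. d (from_nat_into C k) x < r" using y d_commute by metis
 qed
qed

definition dseq :: "nat => 'a" where
 "dseq = (SOME e. range e <= S & (ALL x:S. ALL r>0. EX k. d (e k) x < r))"

lemma dseq_in: "dseq k : S" and dseq_dense: "x : S ==> 0 < r ==> EX k. d (dseq k) x < r"
proof -
 have "range dseq <= S & (ALL x:S. ALL r>0. EX k. d (dseq k) x < r)"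
  unfolding dseq_def by (rule someI_ex[OF dense_seq])
 thus "dseq k : S" "x : S ==> 0 < r ==> EX k. d (dseq k) x < r" by auto
qed

lemma small_partition:
 assumes "0 < r"
 obtains C :: "nat => 'a set" where "!!i. C i : sets B" "disjoint_family C" "(UN i. C i) = S"
  "!!i x y. x : C i ==> y : C i ==> d x y < r"
proof -
 define b where "b k = MS.mball (dseq k) (r/2)" for k
 have "range b <= sets B" unfolding b_def by auto
 hence "range (disjointed b) <= sets B" by (rule sets.range_disjointed_sets)
 moreover have "(UN k. b k) = S"
 proof (intro equalityI subsetI)
  fix x assume x: "x : S"
  then obtain k where "d (dseq k) x < r/2" using dseq_dense[of x "r/2"] assms by auto
  hence "x : b k" using x dseq_in unfolding b_def by (simp add: MS.in_mball)
  thus "x : (UN k. b k)" by auto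
 qed (auto simp: b_def)
 moreover have "d x y < r" if "x : disjointed b i" "y : disjointed b i" for i x y
 proof -
  have "x : b i" "y : b i" using that disjointed_subset[of b i] by auto
  hence "x : S" "y : S" "d (dseq i) x < r/2" "d (dseq i) y < r/2"
   unfolding b_def by (auto simp: MS.in_mball)
  thus ?thesis using d_triangle[of x "dseq i" y] dseq_in d_commute[of x "dseq i"] by auto
 qed
 ultimately show ?thesis
  by (intro that[of "disjointed b"]) (auto simp: UN_disjointed_eq disjoint_family_disjointed)
qed

text \<open>Around each point of the set a product of two small balls with centres in the dense
  sequence lies inside it, and there are only countably many such products. So the set lies in the
  product of the Borel sigma-algebras, and one-sided limits of plans apply to it.\<close>

lemma rect_union_dist:
 assumes "open G"
 shows "rect_union B B {z : S \<times> S. d (fst z) (snd z) : G}"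
proof -
 let ?I = "{(k,l,q). ALL x:MS.mball (dseq k) (1/real (Suc q)). ALL y:MS.mball (dseq l) (1/real (Suc q)). d x y : G}"
 have "rect_union B B (\<Union>i\<in>?I. (case i of (k,l,q) => MS.mball (dseq k) (1/real (Suc q))) \<times>
   (case i of (k,l,q) => MS.mball (dseq l) (1/real (Suc q))))"
  by (rule rect_unionI_countable) auto
 also have "(\<Union>i\<in>?I. (case i of (k,l,q) => MS.mball (dseq k) (1/real (Suc q))) \<times>
   (case i of (k,l,q) => MS.mball (dseq l) (1/real (Suc q)))) = {z : S \<times> S. d (fst z) (snd z) : G}" (is "?L = ?R")
 proof (intro equalityI subsetI)
  fix z assume "z : ?L"
  thus "z : ?R" by (auto simp: MS.in_mball)
 next
  fix z assume "z : ?R"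
  then obtain x y where z: "z = (x,y)" "x : S" "y : S" "d x y : G" by (cases z) auto
  obtain r where r: "0 < r" "!!s. dist s (d x y) < r ==> s : G"
   using assms z(4) unfolding open_dist by blast
  \<comment> \<open>Each coordinate moves by less than \<open>2/(q + 1)\<close>, so the distance
    changes by less than \<open>4/(q + 1) < r\<close>.\<close>
  obtain q where q: "1/real (Suc q) < r/4"
   using reals_Archimedean[of "r/4"] r by (auto simp: inverse_eq_divide)
  obtain k l where kl: "d (dseq k) x < 1/real (Suc q)" "d (dseq l) y < 1/real (Suc q)"
   using dseq_dense[OF z(2), of "1/real (Suc q)"] dseq_dense[OF z(3), of "1/real (Suc q)"] by auto
  have "d x' y' : G" if x': "x' : MS.mball (dseq k) (1/real (Suc q))" and y': "y' : MS.mball (dseq l) (1/real (Suc q))" for x' y'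
  proof (rule r(2))
   have *: "x' : S" "y' : S" "d (dseq k) x' < 1/real (Suc q)" "d (dseq l) y' < 1/real (Suc q)"
    using x' y' by (auto simp: MS.in_mball)
   have "d x x' <= d (dseq k) x + d (dseq k) x'" "d y y' <= d (dseq l) y + d (dseq l) y'"
    using d_triangle[of x "dseq k" x'] d_triangle[of y "dseq l" y'] z * dseq_in
     d_commute[of x "dseq k"] d_commute[of y "dseq l"] by auto
   moreover have "d x y <= d x x' + d x' y' + d y y'" "d x' y' <= d x x' + d x y + d y y'"
    using d_triangle[of x x' y] d_triangle[of x' y' y] d_triangle[of x' x y'] d_triangle[of x y y'] z *
     d_commute[of x x'] d_commute[of y y'] by auto
   ultimately show "dist (d x' y') (d x y) < r"
    using * kl q unfolding dist_real_def by linarith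
  qed
  hence "(k,l,q) : ?I" by blast
  moreover have "x : MS.mball (dseq k) (1/real (Suc q))" "y : MS.mball (dseq l) (1/real (Suc q))"
   using kl z dseq_in by (auto simp: MS.in_mball)
  ultimately show "z : ?L" unfolding z(1) by blast
 qed
 finally show ?thesis .
qed

lemma measurable_mdist_pair: "(%z. d (fst z) (snd z)) : bm BB"
proof (rule borel_measurableI)
 fix G :: "real set" assume "open G"
 hence "{z : S \<times> S. d (fst z) (snd z) : G} : sets BB"
  by (intro rect_union_sets rect_union_dist)
 thus "(%z. d (fst z) (snd z)) -` G Int space BB : sets BB"
  by (simp add: space_pair_measure vimage_def Int_def conj_commute)
qed

lemma measurable_mdist [measurable (raw)]:
 assumes "f : M \<rightarrow>\<^sub>M B" "g : M \<rightarrow>\<^sub>M B"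
 shows "(%x. d (f x) (g x)) : bm M"
 using measurable_compose[OF measurable_Pair[OF assms] measurable_mdist_pair] by simp

lemma couplingsI:
 assumes "sets ga = sets BB" "sets mu = sets B" "sets nu = sets B"
  and "!!A. A : sets B ==> em ga (A \<times> S) = em mu A"
  and "!!A. A : sets B ==> em ga (S \<times> A) = em nu A"
 shows "ga : cpl mu nu"
proof -
 have sp: "space ga = S \<times> S" using sets_eq_imp_space_eq[OF assms(1)] by (simp add: space_pair_measure)
 have [measurable]: "fst : ga \<rightarrow>\<^sub>M B" "snd : ga \<rightarrow>\<^sub>M B"
  using assms(1) by (simp_all cong: measurable_cong_sets)
 have "distr ga B fst = mu"
 proof (rule measure_eqI)
  fix A assume A: "A : sets (distr ga B fst)"
  have "fst -` A Int space ga = A \<times> S" using A sets.sets_into_space[of A B] sp by auto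
  thus "em (distr ga B fst) A = em mu A" using A assms(4) by (simp add: emeasure_distr)
 qed (use assms in simp)
 moreover have "distr ga B snd = nu"
 proof (rule measure_eqI)
  fix A assume A: "A : sets (distr ga B snd)"
  have "snd -` A Int space ga = S \<times> A" using A sets.sets_into_space[of A B] sp by auto
  thus "em (distr ga B snd) A = em nu A" using A assms(5) by (simp add: emeasure_distr)
 qed (use assms in simp)
 ultimately show ?thesis using assms(1) by (simp add: couplings_def Let_def)
qed

lemma couplingsD:
 assumes "ga : cpl mu nu"
 shows "sets ga = sets BB" "space ga = S \<times> S" "sets mu = sets B" "sets nu = sets B" "space mu = S" "space nu = S"
  "!!A. A : sets B ==> em ga (A \<times> S) = em mu A"
  "!!A. A : sets B ==> em ga (S \<times> A) = em nu A"
  "!!f. f : bm B ==> (II z. f (fst z) ||ga) = (II x. f x ||mu)"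
  "!!f. f : bm B ==> (II z. f (snd z) ||ga) = (II x. f x ||nu)"
proof -
 have s: "sets ga = sets BB" and f: "distr ga B fst = mu" and g: "distr ga B snd = nu"
  using assms by (auto simp: couplings_def Let_def)
 show "sets ga = sets BB" by fact
 show sp: "space ga = S \<times> S" using sets_eq_imp_space_eq[OF s] by (simp add: space_pair_measure)
 show "sets mu = sets B" "sets nu = sets B" "space mu = S" "space nu = S" using f g by auto
 have [measurable]: "fst : ga \<rightarrow>\<^sub>M B" "snd : ga \<rightarrow>\<^sub>M B"
  using s by (simp_all cong: measurable_cong_sets)
 show "em ga (A \<times> S) = em mu A" if "A : sets B" for A
 proof -
  have "fst -` A Int space ga = A \<times> S" using that sets.sets_into_space[of A B] sp by auto
  thus ?thesis using that unfolding f[symmetric] by (simp add: emeasure_distr)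
 qed
 show "em ga (S \<times> A) = em nu A" if "A : sets B" for A
 proof -
  have "snd -` A Int space ga = S \<times> A" using that sets.sets_into_space[of A B] sp by auto
  thus ?thesis using that unfolding g[symmetric] by (simp add: emeasure_distr)
 qed
 show "(II z. h (fst z) ||ga) = (II x. h x ||mu)" if "h : bm B" for h
  using that unfolding f[symmetric] by (subst nn_integral_distr) auto
 show "(II z. h (snd z) ||ga) = (II x. h x ||nu)" if "h : bm B" for h
  using that unfolding g[symmetric] by (subst nn_integral_distr) auto
qed

abbreviation TC :: "'a measure => 'a measure => ennreal" where
 "TC == transport_cost X (%s. s^2)"

lemma plan_cost_sq: "plan_cost X (%s. s^2) ga = (cost ga)"
 by (simp add: plan_cost_def case_prod_unfold)

lemma TC_le: "ga : cpl mu nu ==> TC mu nu <= (cost ga)"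
 unfolding transport_cost_def plan_cost_sq[symmetric] by (rule INF_lower)

lemma TC_approx:
 assumes "TC mu nu < c"
 obtains ga where "ga : cpl mu nu" "(cost ga) < c"
 using assms unfolding transport_cost_def plan_cost_sq by (auto simp: INF_less_iff)

lemma couplings_swap:
 assumes "ga : cpl mu nu"
 shows "EX ga':cpl nu mu. ALL f:bm BB.
  (II z. f z ||ga') = (II z. f (snd z, fst z) ||ga)"
proof -
 note c = couplingsD[OF assms]
 have [measurable]: "(%z. (snd z, fst z)) : ga \<rightarrow>\<^sub>M BB"
  using c(1) by (simp cong: measurable_cong_sets)
 let ?g = "distr ga BB (%z. (snd z, fst z))"
 have "?g : cpl nu mu"
 proof (rule couplingsI)
  fix A assume A[measurable]: "A : sets B"
  have "(%z. (snd z, fst z)) -` (A \<times> S) Int space ga = S \<times> A" "(%z. (snd z, fst z)) -` (S \<times> A) Int space ga = A \<times> S"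
   using sets.sets_into_space[OF A] c(2) by auto
  thus "em ?g (A \<times> S) = em nu A" "em ?g (S \<times> A) = em mu A"
   using c by (simp_all add: emeasure_distr)
 qed (use c in simp_all)
 moreover have "(II z. f z ||?g) = (II z. f (snd z, fst z) ||ga)" if "f : bm BB" for f
  using that by (subst nn_integral_distr) auto
 ultimately show ?thesis by blast
qed

lemma measurable_cost [measurable]: "(%z. sq z) : bm BB"
 by measurable

lemma TC_commute_le: "TC nu mu <= TC mu nu"
 unfolding transport_cost_def[of X _ mu nu] plan_cost_sq
proof (rule INF_greatest)
 fix ga assume "ga : cpl mu nu"
 then obtain ga' where g: "ga' : cpl nu mu"
  "!!f. f : bm BB ==> (II z. f z ||ga') = (II z. f (snd z, fst z) ||ga)"
  using couplings_swap by blast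
 have "TC nu mu <= (cost ga')" by (rule TC_le[OF g(1)])
 also have "... = (cost ga)"
  by (subst g(2)) (simp_all add: d_commute)
 finally show "TC nu mu <= (cost ga)" .
qed

lemma TC_commute: "TC nu mu = TC mu nu"
 by (intro antisym TC_commute_le)

lemma W2_commute: "W2 X nu mu = W2 X mu nu"
 by (simp add: W2_def TC_commute[of nu mu])

end

section \<open>Quadratic splitting of distances\<close>

lemma square_split_le:
 fixes a b :: real
 assumes "0 < t" "t < 1" shows "(a + b)^2 <= a^2/t + b^2/(1 - t)"
proof -
 have "a^2/t + b^2/(1 - t) - (a + b)^2 = (a*(1 - t) - b*t)^2/(t*(1 - t))"
  using assms by (simp add: field_simps power2_eq_square)
 also have "... >= 0" using assms by simp
 finally show ?thesis by simp
qed

text \<open>Equality case of Cauchy-Schwarz: the defect is the square of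
  \<open>a*(1 - t) - b*t\<close> divided by \<open>t*(1 - t)\<close>. It is what identifies
  \<open>t\<close>-intermediate points.\<close>

lemma square_split_eq:
 fixes a b D :: real
 assumes t: "0 < t" "t < 1" and D: "D^2 = a^2/t + b^2/(1 - t)" "0 <= D" "D <= a + b" "0 <= a" "0 <= b"
 shows "a = t*D" "b = (1 - t)*D"
proof -
 have "D^2 <= (a + b)^2" using D by (intro power_mono) auto
 hence *: "D^2 = (a + b)^2" using square_split_le[OF t, of a b] D by linarith
 hence s: "D = a + b" using D by (simp add: power2_eq_iff_nonneg)
 have "(a*(1 - t) - b*t)^2/(t*(1 - t)) = a^2/t + b^2/(1 - t) - (a + b)^2"
  using t by (simp add: field_simps power2_eq_square)
 hence "(a*(1 - t) - b*t)^2/(t*(1 - t)) = 0" using * D by simp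
 hence "a*(1 - t) = b*t" using t by simp
 thus "a = t*D" "b = (1 - t)*D" unfolding s by (simp_all add: algebra_simps)
qed

text \<open>The right-hand side is least at \<open>t = a/(a + b)\<close>, where it equals
  \<open>(a + b)^2\<close>. Both numbers are enlarged by \<open>e\<close> so that this
  \<open>t\<close> stays strictly between 0 and 1.\<close>

lemma le_add_of_square_split:
 fixes a b D :: real
 assumes "0 <= a" "0 <= b" "0 <= D" and le: "!!t. 0 < t ==> t < 1 ==> D^2 <= a^2/t + b^2/(1 - t)"
 shows "D <= a + b"
proof (rule field_le_epsilon)
 fix e' :: real assume "0 < e'"
 define e where "e = e'/2"
 have e: "0 < e" using \<open>0 < e'\<close> by (simp add: e_def)
 let ?s = "a + b + 2*e"
 define t where "t = (a + e)/?s"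
 have s: "0 < ?s" using assms e by simp
 have t: "0 < t" "t < 1" "1 - t = (b + e)/?s"
  unfolding t_def using assms e s by (auto simp: field_simps)
 have "a^2/t = ?s*(a^2/(a + e))" unfolding t_def using s by simp
 also have "... <= ?s*(a + e)"
 proof (intro mult_left_mono)
  have "a^2 <= (a + e)^2" using assms e by (intro power_mono) auto
  thus "a^2/(a + e) <= a + e" using assms e by (simp add: divide_le_eq power2_eq_square)
 qed (use s in simp)
 finally have 1: "a^2/t <= ?s*(a + e)" .
 have "b^2/(1 - t) = ?s*(b^2/(b + e))" unfolding t(3) using s by simp
 also have "... <= ?s*(b + e)"
 proof (intro mult_left_mono)
  have "b^2 <= (b + e)^2" using assms e by (intro power_mono) auto
  thus "b^2/(b + e) <= b + e" using assms e by (simp add: divide_le_eq power2_eq_square)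
 qed (use s in simp)
 finally have 2: "b^2/(1 - t) <= ?s*(b + e)" .
 have "D^2 <= ?s*(a + e) + ?s*(b + e)" using le[OF t(1,2)] 1 2 by linarith
 also have "... = ?s^2" by (simp add: power2_eq_square algebra_simps)
 finally have "D^2 <= ?s^2" .
 hence "D <= ?s" by (rule power2_le_imp_le[OF _ less_imp_le[OF s]])
 thus "D <= a + b + e'" by (simp add: e_def)
qed

text \<open>Triangle inequality with a gap \<open>e'\<close> in the middle: the factor
  \<open>1 + h\<close> pays for splitting off the gap, the term \<open>(1 + 1/h)*e^2\<close> for the
  gap itself.\<close>

lemma square_split3_le:
 fixes a b c :: real
 assumes t: "0 < t" "t < 1" and "0 < h" and "D <= a + e' + b" "0 <= D" "e' <= e" "0 <= e'"
 shows "D^2 <= (1 + h)*(a^2/t + b^2/(1 - t)) + (1 + 1/h)*e^2"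
proof -
 have "D^2 <= ((a + b) + e)^2" using assms by (intro power_mono) auto
 also have "... <= (1 + h)*(a + b)^2 + (1 + 1/h)*e^2"
 proof -
  have "(1 + h)*(a + b)^2 + (1 + 1/h)*e^2 - ((a + b) + e)^2 = (h*(a + b) - e)^2/h"
   using \<open>0 < h\<close> by (simp add: field_simps power2_eq_square)
  also have "... >= 0" using \<open>0 < h\<close> by simp
  finally show ?thesis by simp
 qed
 also have "... <= (1 + h)*(a^2/t + b^2/(1 - t)) + (1 + 1/h)*e^2"
  using square_split_le[OF t, of a b] \<open>0 < h\<close> by (intro add_right_mono mult_left_mono) auto
 finally show ?thesis .
qed

context polish
begin

text \<open>Approximate form of the gluing lemma. The product of the two plans is reweighted by
  \<open>w\<close>, which charges only pairs whose middle points lie in the same cell and divides by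
  the mass of that cell. Both projections of the reweighted measure are the given plans, and the
  middle points are within \<open>e\<close>, so the outer coordinates form a coupling of nearly the
  glued cost.\<close>

lemma approx_glue:
 assumes g1: "ga1 : cpl al ze" and g2: "ga2 : cpl ze be"
  and fin: "em ze S < top" and t: "0 < t" "t < 1" and e: "0 < e" and h: "0 < h"
 shows "EX ga:cpl al be. (cost ga) <=
   en (1 + h)*(en (1/t)*(cost ga1) +
    en (1/(1 - t))*(cost ga2)) +
   en ((1 + 1/h)*e^2)*em ze S"
proof -
 note c1 = couplingsD[OF g1] and c2 = couplingsD[OF g2]
 obtain C :: "nat => 'a set" where C: "!!i. C i : sets B" "disjoint_family C" "(UN i. C i) = S"
  "!!i x y. x : C i ==> y : C i ==> d x y < e"
  using small_partition[OF e] by blast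
 \<comment> \<open>Cells of measure zero get weight 0; their union \<open>N0\<close> is null, so the
   projections are correct almost everywhere.\<close>
 define q where "q i = (if em ze (C i) = 0 then 0 else inverse (em ze (C i)))" for i
 define w where "w z z' = (\<Sum>i. q i*(ind (C i) z*ind (C i) z'))" for z z' :: 'a
 note [measurable] = C(1)
 note sg [measurable_cong] = c1(1) c2(1)
 have finC: "em ze (C i) ~= top" for i
 proof -
  have "em ze (C i) <= em ze S"
   using C(1)[of i] sets.sets_into_space[OF C(1)[of i]] c1(4) by (intro emeasure_mono) auto
  thus ?thesis using fin by (auto simp: top_unique)
 qed
 have g2fin: "finite_measure ga2"
 proof
  show "em ga2 (space ga2) ~= \<infinity>" using c2(7)[of S] c2(2) fin by simp
 qed
 have g1fin: "finite_measure ga1"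
 proof
  show "em ga1 (space ga1) ~= \<infinity>" using c1(8)[of S] c1(2) fin by simp
 qed
 interpret G1: finite_measure ga1 by fact
 interpret G2: finite_measure ga2 by fact
 interpret P: pair_sigma_finite ga1 ga2 ..
 have q1: "q i*em ze (C i) = (if em ze (C i) = 0 then 0 else 1)" for i
  using finC[of i] by (simp add: q_def ennreal_inverse_mult mult.commute ennreal_divide_self[symmetric] divide_ennreal_def less_top)
 have marg_sum: "(\<Sum>i. q i*(ind (C i) z*em ze (C i))) = (\<Sum>i. (if em ze (C i) = 0 then 0 else 1)*ind (C i) z)" for z
  by (rule suminf_cong) (simp only: q1[symmetric] mult.assoc mult.commute mult.left_commute)
 define N0 where "N0 = (\<Union>i\<in>{i. em ze (C i) = 0}. C i)"
 have N0: "N0 : null_sets ze"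
  unfolding N0_def using c1(4) C(1) by (intro null_sets_UN') (auto simp: null_sets_def)
 have one: "(\<Sum>i. (if em ze (C i) = 0 then 0 else 1)*ind (C i) z) = (1 :: ennreal)" if z: "z : S - N0" for z
 proof -
  obtain i where i: "z : C i" using z C(3) by auto
  hence ne: "em ze (C i) ~= 0" using z unfolding N0_def by auto
  have "z ~: C j" if "j ~= i" for j using C(2) i that by (auto simp: disjoint_family_on_def)
  hence "(\<Sum>j. (if em ze (C j) = 0 then 0 else 1)*ind (C j) z) =
    (\<Sum>j\<in>{i}. (if em ze (C j) = 0 then 0 else 1)*ind (C j) z :: ennreal)"
   by (intro suminf_finite) auto
  thus ?thesis using i ne by simp
 qed
 have [measurable]: "(%z. w (snd (fst z)) (fst (snd z))) : bm (ga1 \<Otimes>\<^sub>M ga2)"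
  unfolding w_def by measurable
 have wc: "w x y = w y x" for x y by (simp add: w_def mult.commute)
 \<comment> \<open>Stated for arbitrary maps \<open>p\<close> and \<open>r\<close> onto the common
   marginal, so that it serves integration over either plan.\<close>
 have w1: "AE z in g. (II v. w (p z) (r v) ||g') = 1"
  if dp: "distr g B p = ze" "distr g' B r = ze" and [measurable]: "p : g \<rightarrow>\<^sub>M B" "r : g' \<rightarrow>\<^sub>M B" for g g' p r
 proof -
  have I: "(II v. ind (C i) (r v) ||g') = em ze (C i)" for i
   unfolding dp(2)[symmetric] by (simp flip: nn_integral_indicator add: nn_integral_distr)
  have "(II v. w x (r v) ||g') = (\<Sum>i. II v. q i*(ind (C i) x*ind (C i) (r v)) ||g')" for x
   unfolding w_def by (rule nn_integral_suminf) measurable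
  hence W: "(II v. w x (r v) ||g') = (\<Sum>i. (if em ze (C i) = 0 then 0 else 1)*ind (C i) x)" for x
   by (simp add: nn_integral_cmult I marg_sum)
  have "AE x in ze. x : S - N0" using AE_not_in[OF N0] AE_space[of ze] c1(6) by auto
  hence "AE z in g. p z : S - N0"
   by (intro AE_distrD[OF that(3)]) (simp only: dp(1))
  thus ?thesis by eventually_elim (simp only: W one)
 qed
 have dz: "distr ga1 B snd = ze" "distr ga2 B fst = ze" using g1 g2 by (auto simp: couplings_def Let_def)
 define \<Theta> where "\<Theta> = density (ga1 \<Otimes>\<^sub>M ga2) (%z. w (snd (fst z)) (fst (snd z)))"
 have T1: "(II z. f (fst z) ||\<Theta>) = (II u. f u ||ga1)" if [measurable]: "f : bm BB" for f
 proof -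
  have "(II z. f (fst z) ||\<Theta>) = (II u. II v. w (snd u) (fst v)*f u ||ga2 ||ga1)"
   unfolding \<Theta>_def by (subst nn_integral_density) (auto simp: G2.nn_integral_fst[symmetric])
  also have "... = (II u. (II v. w (snd u) (fst v) ||ga2)*f u ||ga1)"
   by (intro nn_integral_cong nn_integral_multc) (auto simp: w_def)
  also have "... = (II u. f u ||ga1)"
  proof (rule nn_integral_cong_AE)
   show "AE u in ga1. (II v. w (snd u) (fst v) ||ga2)*f u = f u"
    using w1[OF dz] by (auto elim!: eventually_mono)
  qed
  finally show ?thesis .
 qed
 have T2: "(II z. f (snd z) ||\<Theta>) = (II v. f v ||ga2)" if [measurable]: "f : bm BB" for f
 proof -
  have "(II z. f (snd z) ||\<Theta>) = (II z. w (snd (fst z)) (fst (snd z))*f (snd z) ||(ga1 \<Otimes>\<^sub>M ga2))"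
   unfolding \<Theta>_def by (subst nn_integral_density) auto
  also have "... = (II v. II u. w (snd u) (fst v)*f v ||ga1 ||ga2)"
   by (subst P.nn_integral_snd[symmetric]) auto
  also have "... = (II v. (II u. w (snd u) (fst v) ||ga1)*f v ||ga2)"
   by (intro nn_integral_cong nn_integral_multc) (auto simp: w_def)
  also have "... = (II v. f v ||ga2)"
  proof (rule nn_integral_cong_AE)
   show "AE v in ga2. (II u. w (snd u) (fst v) ||ga1)*f v = f v"
    using w1[OF dz(2,1)] unfolding wc[of "fst _"] by (auto elim!: eventually_mono)
  qed
  finally show ?thesis .
 qed
 define ga where "ga = distr \<Theta> BB (%z. (fst (fst z), snd (snd z)))"
 have sT [measurable_cong]: "sets \<Theta> = sets (BB \<Otimes>\<^sub>M BB)"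
  unfolding \<Theta>_def using sg by (simp cong: sets_pair_measure_cong)
 have spT: "space \<Theta> = (S \<times> S) \<times> (S \<times> S)"
  using sets_eq_imp_space_eq[OF sT] by (simp only: space_pair_measure space_B)
 have [measurable]: "(%z. (fst (fst z), snd (snd z))) : \<Theta> \<rightarrow>\<^sub>M BB" by measurable
 have I: "(II z. f z ||ga) = (II z. f (fst (fst z), snd (snd z)) ||\<Theta>)" if [measurable]: "f : bm BB" for f
  unfolding ga_def by (rule nn_integral_distr) measurable
 have "ga : cpl al be"
 proof (rule couplingsI)
  fix A assume A [measurable]: "A : sets B"
  have "em ga (A \<times> S) = (II z. ind (A \<times> S) z ||ga)" unfolding ga_def by simp
  also have "... = (II z. ind (A \<times> S) (fst (fst z), snd (snd z)) ||\<Theta>)" by (rule I) measurable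
  also have "... = (II z. ind A (fst (fst z)) ||\<Theta>)"
   by (rule nn_integral_cong) (auto simp: spT indicator_def)
  also have "... = (II u. ind A (fst u) ||ga1)" by (rule T1) measurable
  also have "... = em al A" using c1(9)[of "ind A"] c1(3) by simp
  finally show "em ga (A \<times> S) = em al A" .
  have "em ga (S \<times> A) = (II z. ind (S \<times> A) z ||ga)" unfolding ga_def by simp
  also have "... = (II z. ind (S \<times> A) (fst (fst z), snd (snd z)) ||\<Theta>)" by (rule I) measurable
  also have "... = (II z. ind A (snd (snd z)) ||\<Theta>)"
   by (rule nn_integral_cong) (auto simp: spT indicator_def)
  also have "... = (II v. ind A (snd v) ||ga2)" by (rule T2) measurable
  also have "... = em be A" using c2(10)[of "ind A"] c2(4) by simp
  finally show "em ga (S \<times> A) = em be A" .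
 qed (use c1 c2 in \<open>auto simp: ga_def\<close>)
 moreover have "(cost ga) <=
   en (1 + h)*(en (1/t)*(cost ga1) +
    en (1/(1 - t))*(cost ga2)) +
   en ((1 + 1/h)*e^2)*em ze S"
 proof -
  have AEw: "AE z in \<Theta>. d (snd (fst z)) (fst (snd z)) < e"
   unfolding \<Theta>_def
  proof (subst AE_density)
   show "AE z in ga1 \<Otimes>\<^sub>M ga2. 0 < w (snd (fst z)) (fst (snd z)) --> d (snd (fst z)) (fst (snd z)) < e"
   proof (intro AE_I2 impI)
    fix z :: "('a \<times> 'a) \<times> ('a \<times> 'a)" assume "0 < w (snd (fst z)) (fst (snd z))"
    hence "EX i. q i*(ind (C i) (snd (fst z))*ind (C i) (fst (snd z))) ~= 0"
    proof (rule contrapos_pp)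
     assume "~ (EX i. q i*(ind (C i) (snd (fst z))*ind (C i) (fst (snd z))) ~= 0)"
     hence "(%i. q i*(ind (C i) (snd (fst z))*ind (C i) (fst (snd z)))) = (%_. 0)"
      by (simp only: not_ex not_not fun_eq_iff simp_thms)
     thus "~ 0 < w (snd (fst z)) (fst (snd z))" unfolding w_def by simp
    qed
    then obtain i where "snd (fst z) : C i" "fst (snd z) : C i" by (auto simp: indicator_def split: if_splits)
    thus "d (snd (fst z)) (fst (snd z)) < e" by (rule C(4))
   qed
  qed simp
  have "(cost ga) = (II z. en ((d (fst (fst z)) (snd (snd z)))^2) ||\<Theta>)"
   by (subst I) simp_all
  also have "... <= (II z. (en (1 + h)*(en (1/t)*en ((d (fst (fst z)) (snd (fst z)))^2) +
    en (1/(1 - t))*en ((d (fst (snd z)) (snd (snd z)))^2)) + en ((1 + 1/h)*e^2)) ||\<Theta>)"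
  proof (rule nn_integral_mono_AE)
   show "AE z in \<Theta>. en ((d (fst (fst z)) (snd (snd z)))^2) <= en (1 + h)*(en (1/t)*en ((d (fst (fst z)) (snd (fst z)))^2) +
    en (1/(1 - t))*en ((d (fst (snd z)) (snd (snd z)))^2)) + en ((1 + 1/h)*e^2)"
    using AEw AE_space
   proof eventually_elim
    case (elim z)
    obtain x y x' y' where z: "z = ((x,y),(x',y'))" by (metis prod.collapse)
    have S: "x : S" "y : S" "x' : S" "y' : S"
     using elim(2) unfolding z spT by auto
    have "d x y' <= d x y + d y x' + d x' y'"
     using d_triangle[of x y y'] d_triangle[of y x' y'] S by auto
    hence "(d x y')^2 <= (1 + h)*((d x y)^2/t + (d x' y')^2/(1 - t)) + (1 + 1/h)*e^2"
     using elim(1) t h by (intro square_split3_le[where e' = "d y x'"]) (auto simp: z)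
    hence "dd x y' <= en ((1 + h)*((1/t)*(d x y)^2 + (1/(1 - t))*(d x' y')^2) + (1 + 1/h)*e^2)"
     by (intro ennreal_leI) simp
    also have "... = en (1 + h)*(en (1/t)*dd x y + en (1/(1 - t))*dd x' y') + en ((1 + 1/h)*e^2)"
     using t h by (simp add: ennreal_plus ennreal_mult del: times_divide_eq_left)
    finally show ?case by (simp add: z)
   qed
  qed
  also have "... = en (1 + h)*(en (1/t)*(II z. en ((d (fst (fst z)) (snd (fst z)))^2) ||\<Theta>) +
    en (1/(1 - t))*(II z. en ((d (fst (snd z)) (snd (snd z)))^2) ||\<Theta>)) + en ((1 + 1/h)*e^2)*em \<Theta> (space \<Theta>)"
   by (simp add: nn_integral_add nn_integral_cmult)
  also have "em \<Theta> (space \<Theta>) = em ze S"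
   using T1[of "%_. 1"] c1(8)[of S] c1(2) by simp
  also have "(II z. en ((d (fst (fst z)) (snd (fst z)))^2) ||\<Theta>) = (cost ga1)"
   by (rule T1) measurable
  also have "(II z. en ((d (fst (snd z)) (snd (snd z)))^2) ||\<Theta>) = (cost ga2)"
   by (rule T2) measurable
  finally show ?thesis .
 qed
 ultimately show ?thesis by blast
qed

end

lemma square_add_le: "((a::real) + b)^2 <= 2*a^2 + 2*b^2"
proof -
 have "2*a^2 + 2*b^2 - (a + b)^2 = (a - b)^2" by (simp add: power2_eq_square algebra_simps)
 also have "... >= 0" by simp
 finally show ?thesis by simp
qed

context polish
begin

text \<open>Gluing with gap \<open>e = h\<close> costs the factor \<open>1 + h\<close> and the term
  \<open>(h^2 + h) * z\<close>; both effects disappear as \<open>h\<close> tends to 0. Keeping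
  \<open>t\<close> free yields the triangle inequality by optimisation and the equality case used in
  \<open>restrict_geodesic\<close>.\<close>

lemma TC_split:
 assumes fin: "em ze S < top" and t: "0 < t" "t < 1"
 shows "TC al be <= en (1/t)*TC al ze + en (1/(1 - t))*TC ze be"
proof -
 let ?c = "%ga. II z. sq z ||ga"
 have step: "TC al be <= en (1/t)*?c ga1 + en (1/(1 - t))*?c ga2"
  if g: "ga1 : cpl al ze" "ga2 : cpl ze be" for ga1 ga2
 proof (cases "en (1/t)*?c ga1 + en (1/(1 - t))*?c ga2")
  case (real a)
  obtain z where z: "em ze S = en z" "0 <= z" using fin by (cases "em ze S") auto
  have "TC al be <= en ((1 + h)*a + (h^2 + h)*z)" if h: "0 < h" for h
  proof -
   obtain ga where ga: "ga : cpl al be"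
    "?c ga <= en (1 + h)*en a + en ((1 + 1/h)*h^2)*en z"
    using approx_glue[OF g fin t h h] unfolding real(2) z(1) by blast
   have "TC al be <= ?c ga" by (rule TC_le[OF ga(1)])
   also note ga(2)
   also have "en (1 + h)*en a + en ((1 + 1/h)*h^2)*en z = en ((1 + h)*a + (1 + 1/h)*h^2*z)"
    using h real z by (simp add: ennreal_plus ennreal_mult)
   also have "(1 + 1/h)*h^2 = h^2 + h" using h by (simp add: field_simps power2_eq_square)
   finally show ?thesis .
  qed
  moreover have "((%h. en ((1 + h)*a + (h^2 + h)*z)) ---> en ((1 + 0)*a + (0^2 + 0)*z)) (at_right 0)"
   by (intro tendsto_ennrealI tendsto_intros)
  ultimately have "TC al be <= en ((1 + 0)*a + (0^2 + 0)*z)"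
   by (intro tendsto_lowerbound[where F="at_right 0"]) (auto simp: eventually_at_filter)
  thus ?thesis using real(2) by simp
 next
  case top
  thus ?thesis by (simp only: top_greatest)
 qed
 show ?thesis
 proof (cases "TC al ze < top & TC ze be < top")
  case False
  hence "TC al ze = top | TC ze be = top" by (auto simp: less_top[symmetric])
  thus ?thesis using t by (auto simp: ennreal_mult_top)
 next
  case True
  show ?thesis
  proof (rule ennreal_le_epsilon)
   fix e :: real assume e: "0 < e"
   define e1 where "e1 = e/2*t"
   define e2 where "e2 = e/2*(1 - t)"
   have e12: "0 < e1" "0 < e2" using e t by (auto simp: e1_def e2_def)
   have lt: "TC al ze < TC al ze + en e1" "TC ze be < TC ze be + en e2"
    using True e12 by (auto simp: less_top ennreal_add_left_cancel_less[of _ 0, simplified])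
   obtain ga1 where g1: "ga1 : cpl al ze" "?c ga1 < TC al ze + en e1"
    by (rule TC_approx[OF lt(1)])
   obtain ga2 where g2: "ga2 : cpl ze be" "?c ga2 < TC ze be + en e2"
    by (rule TC_approx[OF lt(2)])
   note g = g1 g2
   have "TC al be <= en (1/t)*?c ga1 + en (1/(1 - t))*?c ga2" by (rule step[OF g(1,3)])
   also have "... <= en (1/t)*(TC al ze + en e1) + en (1/(1 - t))*(TC ze be + en e2)"
    using g by (intro add_mono mult_left_mono) auto
   also have "... = en (1/t)*TC al ze + en (1/(1 - t))*TC ze be + (en (1/t)*en e1 + en (1/(1 - t))*en e2)"
    by (simp only: distrib_left add.assoc add.commute add.left_commute)
   also have "en (1/t)*en e1 + en (1/(1 - t))*en e2 = en (1/t*e1 + 1/(1 - t)*e2)"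
    using t e12 by (simp add: ennreal_mult'[symmetric])
   also have "1/t*e1 + 1/(1 - t)*e2 = e" using t by (simp add: e1_def e2_def)
   finally show "TC al be <= en (1/t)*TC al ze + en (1/(1 - t))*TC ze be + en e" .
  qed
 qed
qed

lemma W2_nonneg [simp]: "0 <= W2 X mu nu"
 by (simp add: W2_def)

lemma TC_W2: "TC mu nu < top ==> TC mu nu = en ((W2 X mu nu)^2)"
 by (simp add: W2_def less_top)

lemma W2_le: "TC mu nu <= en (r^2) ==> 0 <= r ==> W2 X mu nu <= r"
 unfolding W2_def using enn2real_mono[of "TC mu nu" "en (r^2)"]
 by (intro real_le_lsqrt) auto

text \<open>Optimisation of \<open>TC_split\<close> over \<open>t\<close>. The middle measure may
  have any finite mass, since pieces of plans are compared before they are normalised.\<close>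

lemma W2_triangle:
 assumes fin: "em nu S < top" and "TC mu nu < top" "TC nu si < top"
 shows "TC mu si < top" "W2 X mu si <= W2 X mu nu + W2 X nu si"
proof -
 have *: "TC mu si <= en ((W2 X mu nu)^2/t + (W2 X nu si)^2/(1 - t))" if t: "0 < t" "t < 1" for t
 proof -
  have "TC mu si <= en (1/t)*en ((W2 X mu nu)^2) + en (1/(1 - t))*en ((W2 X nu si)^2)"
   using TC_split[OF fin t, of mu si] TC_W2[OF assms(2)] TC_W2[OF assms(3)] by simp
  also have "... = en ((W2 X mu nu)^2/t + (W2 X nu si)^2/(1 - t))"
   using t by (simp add: ennreal_mult'[symmetric] ennreal_plus[symmetric] del: ennreal_plus)
  finally show ?thesis .
 qed
 have "TC mu si <= en ((W2 X mu nu)^2/(1/2) + (W2 X nu si)^2/(1 - 1/2))" by (rule *) auto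
 also have "... < top" by simp
 finally show fin': "TC mu si < top" .
 show "W2 X mu si <= W2 X mu nu + W2 X nu si"
 proof (rule le_add_of_square_split)
  fix t :: real assume t: "0 < t" "t < 1"
  show "(W2 X mu si)^2 <= (W2 X mu nu)^2/t + (W2 X nu si)^2/(1 - t)"
   using *[OF t] t unfolding TC_W2[OF fin'] by (subst (asm) ennreal_le_iff) auto
 qed auto
qed

lemma P2D:
 assumes "mu : P2 X"
 shows "sets mu = sets B" "space mu = S" "prob_space mu" "em mu S = 1"
  "!!x0. x0 : S ==> (II x. dd x x0 ||mu) < top"
proof -
 show s: "sets mu = sets B" and p: "prob_space mu" using assms by (auto simp: P2_def)
 show sp: "space mu = S" using sets_eq_imp_space_eq[OF s] by simp
 show m1: "em mu S = 1" using prob_space.emeasure_space_1[OF p] sp by simp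
 obtain y where y: "y : S" "(II x. dd x y ||mu) < top"
  using assms by (auto simp: P2_def)
 fix x0 assume x0: "x0 : S"
 note [measurable_cong] = s
 have "(II x. dd x x0 ||mu) <= (II x. 2*dd x y + en (2*(d y x0)^2) ||mu)"
 proof (rule nn_integral_mono)
  fix x assume "x : space mu"
  hence "x : S" using sp by simp
  hence "d x x0 <= d x y + d y x0" using x0 y by (intro d_triangle)
  hence "(d x x0)^2 <= (d x y + d y x0)^2" by (intro power_mono) auto
  also have "... <= 2*(d x y)^2 + 2*(d y x0)^2" by (rule square_add_le)
  finally have "dd x x0 <= en (2*(d x y)^2 + 2*(d y x0)^2)" by (rule ennreal_leI)
  thus "dd x x0 <= 2*dd x y + en (2*(d y x0)^2)"
   by (simp add: ennreal_plus ennreal_mult)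
 qed
 also have "... = 2*(II x. dd x y ||mu) + en (2*(d y x0)^2)"
  using y m1 sp by (simp add: nn_integral_add nn_integral_cmult)
 also have "... < top" using y by (simp add: ennreal_mult_less_top)
 finally show "(II x. dd x x0 ||mu) < top" .
qed

lemma P2I:
 assumes "sets mu = sets B" "em mu S = 1" "x0 : S" "(II x. dd x x0 ||mu) < top"
 shows "mu : P2 X"
proof -
 have "space mu = S" using sets_eq_imp_space_eq[OF assms(1)] by simp
 hence "prob_space mu" using assms(2) by (intro prob_spaceI) simp
 thus ?thesis using assms by (auto simp: P2_def)
qed

lemma TC_finite:
 assumes "mu : P2 X" "nu : P2 X"
 shows "TC mu nu < top"
proof -
 note m = P2D[OF assms(1)] and n = P2D[OF assms(2)]
 obtain x0 where x0: "x0 : S" using nonempty by auto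
 interpret M: prob_space mu by fact
 interpret N: prob_space nu by fact
 note [measurable_cong] = m(1) n(1)
 let ?g = "mu \<Otimes>\<^sub>M nu"
 have "?g : cpl mu nu"
 proof (rule couplingsI)
  show "em ?g (A \<times> S) = em mu A" if "A : sets B" for A
   using that m n by (subst N.emeasure_pair_measure_Times) auto
  show "em ?g (S \<times> A) = em nu A" if "A : sets B" for A
   using that m n by (subst N.emeasure_pair_measure_Times) auto
 qed (use m n in \<open>auto intro: sets_pair_measure_cong\<close>)
 hence "TC mu nu <= (cost ?g)" by (rule TC_le)
 also have "... <= (II z. (2*dd (fst z) x0 + 2*dd (snd z) x0) ||?g)"
 proof (rule nn_integral_mono)
  fix z assume "z : space ?g"
  hence "fst z : S" "snd z : S" using m n by (auto simp: space_pair_measure)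
  hence "d (fst z) (snd z) <= d (fst z) x0 + d (snd z) x0"
   using d_triangle[of "fst z" x0 "snd z"] x0 d_commute[of "snd z" x0] by simp
  hence "(d (fst z) (snd z))^2 <= (d (fst z) x0 + d (snd z) x0)^2" by (intro power_mono) auto
  also have "... <= 2*(d (fst z) x0)^2 + 2*(d (snd z) x0)^2" by (rule square_add_le)
  finally have "sq z <= en (2*(d (fst z) x0)^2 + 2*(d (snd z) x0)^2)" by (rule ennreal_leI)
  thus "sq z <= 2*dd (fst z) x0 + 2*dd (snd z) x0"
   by (simp add: ennreal_plus ennreal_mult)
 qed
 also have "... = 2*(II z. dd (fst z) x0 ||?g) + 2*(II z. dd (snd z) x0 ||?g)"
  using x0 by (simp add: nn_integral_add nn_integral_cmult)
 also have "(II z. dd (fst z) x0 ||?g) = (II x. dd x x0 ||mu)"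
  using couplingsD(9)[OF \<open>?g : cpl mu nu\<close>, of "%x. dd x x0"] x0 by simp
 also have "(II z. dd (snd z) x0 ||?g) = (II x. dd x x0 ||nu)"
  using couplingsD(10)[OF \<open>?g : cpl mu nu\<close>, of "%x. dd x x0"] x0 by simp
 also have "2*(II x. dd x x0 ||mu) + 2*(II x. dd x x0 ||nu) < top"
  using m(5)[OF x0] n(5)[OF x0] by (simp add: ennreal_mult_less_top)
 finally show ?thesis .
qed

lemma P2_of_coupling:
 assumes "mu : P2 X" "ga : cpl mu nu" "(cost ga) < top"
 shows "nu : P2 X"
proof -
 note m = P2D[OF assms(1)] and c = couplingsD[OF assms(2)]
 note [measurable_cong] = c(1)
 obtain x0 where x0: "x0 : S" using nonempty by auto
 have "(II x. dd x x0 ||nu) = (II z. dd (snd z) x0 ||ga)"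
  using c(10)[of "%x. dd x x0"] x0 by simp
 also have "... <= (II z. (2*dd (fst z) x0 + 2 * sq z) ||ga)"
 proof (rule nn_integral_mono)
  fix z assume "z : space ga"
  hence "fst z : S" "snd z : S" unfolding c(2) by (simp_all add: mem_Times_iff)
  hence "d (snd z) x0 <= d (fst z) x0 + d (fst z) (snd z)"
   using d_triangle[of "snd z" "fst z" x0] x0 d_commute[of "snd z" "fst z"] by simp
  hence "(d (snd z) x0)^2 <= (d (fst z) x0 + d (fst z) (snd z))^2" by (intro power_mono) auto
  also have "... <= 2*(d (fst z) x0)^2 + 2*(d (fst z) (snd z))^2" by (rule square_add_le)
  finally have "dd (snd z) x0 <= en (2*(d (fst z) x0)^2 + 2*(d (fst z) (snd z))^2)" by (rule ennreal_leI)
  thus "dd (snd z) x0 <= 2*dd (fst z) x0 + 2 * sq z"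
   by (simp add: ennreal_plus ennreal_mult)
 qed
 also have "... = 2*(II z. dd (fst z) x0 ||ga) + 2*(cost ga)"
  using x0 by (simp add: nn_integral_add nn_integral_cmult)
 also have "(II z. dd (fst z) x0 ||ga) = (II x. dd x x0 ||mu)"
  using c(9)[of "%x. dd x x0"] x0 by simp
 also have "2*(II x. dd x x0 ||mu) + 2*(cost ga) < top"
  using m(5)[OF x0] assms(3) by (simp add: ennreal_mult_less_top)
 finally show ?thesis
  using c(7)[of S] c(8)[of S] m(4) by (intro P2I[OF c(4) _ x0]) simp_all
qed

lemma P2_le_scale:
 assumes "mu : P2 X" "sets nu = sets B" "em nu S = 1" "!!A. A : sets B ==> em nu A <= c*em mu A" "c < top"
 shows "nu : P2 X"
proof -
 note m = P2D[OF assms(1)]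
 obtain x0 where x0: "x0 : S" using nonempty by auto
 have sc: "sets (scale_measure c mu) = sets nu" using m assms by simp
 have "(II x. dd x x0 ||nu) <= (II x. dd x x0 ||scale_measure c mu)"
  by (rule nn_integral_mono_measure) (use assms m in \<open>auto simp: le_measure\<close>)
 also have "... = c*(II x. dd x x0 ||mu)"
  using m(1) x0 by (subst nn_integral_scale_measure) (auto cong: measurable_cong_sets)
 also have "... < top" using m(5)[OF x0] assms(5) by (simp add: ennreal_mult_less_top)
 finally show ?thesis by (rule P2I[OF assms(2,3) x0])
qed

text \<open>Upper bounds suffice: for \<open>0 <= s <= t <= 1\<close> the bounds on the three
  segments add up to the full distance, so by the triangle inequality none of them can be
  strict.\<close>

lemma W2_geodesicI:
 assumes P2: "!!s. s : {0..1} ==> mut s : P2 X" and ends: "mut 0 = mu" "mut 1 = nu"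
  and le: "!!s t. 0 <= s ==> s < t ==> t <= 1 ==> W2 X (mut s) (mut t) <= (t - s)*W2 X mu nu"
 shows "W2_geodesic X mu nu mut"
proof -
 have self: "W2 X m m = 0" if "m : P2 X" for m
 proof -
  note c = P2D[OF that]
  let ?g = "distr m BB (%x. (x, x))"
  have [measurable]: "(%x. (x, x)) : m \<rightarrow>\<^sub>M BB" using c(1) by (simp cong: measurable_cong_sets)
  have "?g : cpl m m"
  proof (rule couplingsI)
   fix A assume A: "A : sets B"
   hence "(%x. (x, x)) -` (A \<times> S) Int space m = A" "(%x. (x, x)) -` (S \<times> A) Int space m = A"
    using sets.sets_into_space[OF A] c(2) by auto
   thus "em ?g (A \<times> S) = em m A" "em ?g (S \<times> A) = em m A"
    using A by (simp_all add: emeasure_distr)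
  qed (use c in simp_all)
  hence "TC m m <= (cost ?g)" by (rule TC_le)
  also have "... = (II x. dd x x ||m)" by (subst nn_integral_distr) simp_all
  also have "... = (II x. 0 ||m)" using c(2) by (intro nn_integral_cong) simp
  finally have "TC m m <= en (0^2)" by simp
  hence "W2 X m m <= 0" by (rule W2_le) simp
  thus ?thesis using W2_nonneg[of m m] by linarith
 qed
 have tri: "W2 X (mut r) (mut t) <= W2 X (mut r) (mut s) + W2 X (mut s) (mut t)"
  if "r : {0..1}" "s : {0..1}" "t : {0..1}" for r s t
 proof (rule W2_triangle(2))
  show "em (mut s) S < top" using P2D(4)[OF P2[OF that(2)]] by simp
 qed (intro TC_finite P2 that)+
 have le': "W2 X (mut s) (mut t) <= (t - s)*W2 X mu nu" if "0 <= s" "s <= t" "t <= 1" for s t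
  using le[of s t] that self[OF P2, of s] by (cases "s = t") auto
 have eq: "W2 X (mut s) (mut t) = (t - s)*W2 X mu nu" if st: "0 <= s" "s <= t" "t <= 1" for s t
 proof (rule antisym)
  show "W2 X (mut s) (mut t) <= (t - s)*W2 X mu nu" using le' st by simp
  have "W2 X mu nu <= W2 X (mut 0) (mut s) + W2 X (mut s) (mut t) + W2 X (mut t) (mut 1)"
   using tri[of 0 s 1] tri[of s t 1] st ends by simp
  also have "... <= s*W2 X mu nu + W2 X (mut s) (mut t) + (1 - t)*W2 X mu nu"
   using le'[of 0 s] le'[of t 1] st by simp
  finally show "(t - s)*W2 X mu nu <= W2 X (mut s) (mut t)" by (simp add: algebra_simps)
 qed
 have "W2 X (mut s) (mut t) = \<bar>s - t\<bar>*W2 X mu nu" if "s : {0..1}" "t : {0..1}" for s t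
 proof (cases "s <= t")
  case True thus ?thesis using eq[of s t] that by simp
 next
  case False thus ?thesis using eq[of t s] W2_commute[of "mut s" "mut t"] that by simp
 qed
 thus ?thesis using P2 ends by (auto simp: W2_geodesic_def)
qed

section \<open>Sums and multiples of couplings\<close>

lemma couplings_msum:
 assumes "!!i. ga i : cpl (al i) (be i)"
 shows "msum ga : cpl (msum al) (msum be)"
proof -
 note c = couplingsD[OF assms]
 show ?thesis
 proof (rule couplingsI)
  fix A assume "A : sets B"
  thus "em (msum ga) (A \<times> S) = em (msum al) A" "em (msum ga) (S \<times> A) = em (msum be) A"
   using c by (simp_all add: emeasure_msum)
 qed (use c in simp_all)
qed

lemma couplings_scale:
 assumes "ga : cpl al be"
 shows "scale_measure r ga : cpl (scale_measure r al) (scale_measure r be)"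
 using couplingsD[OF assms] by (intro couplingsI) simp_all

lemma TC_scale_le:
 assumes r: "0 < r" "r < top" shows "TC (scale_measure r al) (scale_measure r be) <= r*TC al be"
proof (cases "TC al be = top")
 case True
 thus ?thesis using r by (simp add: ennreal_mult_top)
next
 case False
 show ?thesis
 proof (rule ennreal_le_epsilon)
  fix e :: real assume e: "0 < e"
  obtain r' where r': "r = en r'" "0 < r'" using r by (cases r) auto
  have "TC al be < TC al be + en (e/r')"
   using False e r' by (simp add: ennreal_add_left_cancel_less[of _ 0, simplified])
  then obtain ga where g: "ga : cpl al be" "(cost ga) < TC al be + en (e/r')"
   by (rule TC_approx)
  have "TC (scale_measure r al) (scale_measure r be) <= (II z. sq z ||scale_measure r ga)"
   by (intro TC_le couplings_scale g)
  also have "... = r*(cost ga)"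
   using couplingsD(1)[OF g(1)] by (intro nn_integral_scale_measure) (simp cong: measurable_cong_sets)
  also have "... <= r*(TC al be + en (e/r'))" using g by (intro mult_left_mono) auto
  also have "... = r*TC al be + en e"
   using r' e by (simp add: distrib_left ennreal_mult'[symmetric])
  finally show "TC (scale_measure r al) (scale_measure r be) <= r*TC al be + en e" .
 qed
qed

lemma TC_scale:
 assumes r: "0 < r" "r < top" shows "TC (scale_measure r al) (scale_measure r be) = r*TC al be"
proof (rule antisym[OF TC_scale_le[OF r]])
 obtain r' where r': "r = en r'" "0 < r'" using r by (cases r) auto
 have i: "0 < inverse r" "inverse r < top" and id: "inverse r*r = 1" "r*inverse r = 1"
  using r'(2) unfolding r'(1) by (simp_all add: inverse_ennreal ennreal_mult'[symmetric])
 have "TC al be <= inverse r*TC (scale_measure r al) (scale_measure r be)"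
  using TC_scale_le[OF i, of "scale_measure r al" "scale_measure r be"] by (simp add: id)
 hence "r*TC al be <= r*(inverse r*TC (scale_measure r al) (scale_measure r be))" by (rule mult_left_mono) auto
 thus "r*TC al be <= TC (scale_measure r al) (scale_measure r be)"
  by (simp add: mult.assoc[symmetric] id)
qed

lemma TC_madd:
 assumes "sets al = sets B" "sets al' = sets B" "sets be = sets B" "sets be' = sets B"
 shows "TC (madd al al') (madd be be') <= TC al be + TC al' be'"
proof (cases "TC al be = top | TC al' be' = top")
 case False
 show ?thesis
 proof (rule ennreal_le_epsilon)
  fix e :: real assume e: "0 < e"
  have lt: "TC al be < TC al be + en (e/2)" "TC al' be' < TC al' be' + en (e/2)"
   using False e by (simp_all add: ennreal_add_left_cancel_less[of _ 0, simplified])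
  obtain g where g1: "g : cpl al be" "(cost g) < TC al be + en (e/2)"
   by (rule TC_approx[OF lt(1)])
  obtain g' where g2: "g' : cpl al' be'" "(cost g') < TC al' be' + en (e/2)"
   by (rule TC_approx[OF lt(2)])
  note g = g1 g2
  note c = couplingsD[OF g(1)] and c' = couplingsD[OF g(3)]
  have s: "sets g' = sets g" using c(1) c'(1) by simp
  have "madd g g' : cpl (madd al al') (madd be be')"
  proof (rule couplingsI)
   fix A assume "A : sets B"
   thus "em (madd g g') (A \<times> S) = em (madd al al') A" "em (madd g g') (S \<times> A) = em (madd be be') A"
    using c c' assms by (simp_all add: emeasure_madd)
  qed (use c assms in simp_all)
  hence "TC (madd al al') (madd be be') <= (II z. sq z ||madd g g')" by (rule TC_le)
  also have "... = (cost g) + (cost g')"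
   using c(1) by (intro nn_integral_madd s) (simp cong: measurable_cong_sets)
  also have "... <= (TC al be + en (e/2)) + (TC al' be' + en (e/2))" using g by (intro add_mono) auto
  also have "... = TC al be + TC al' be' + (en (e/2) + en (e/2))" by (simp only: ac_simps)
  also have "en (e/2) + en (e/2) = en e" using e by (simp flip: ennreal_plus)
  finally show "TC (madd al al') (madd be be') <= TC al be + TC al' be' + en e" .
 qed
qed auto

end

subsection \<open>Absolutely continuous measures and entropies\<close>

text \<open>Two forms of \<open>(1 - x)*(1 - y) >= 0\<close>. They bound the mass lost when two
  sub-probability kernels act on the two coordinates of a plan.\<close>

lemma ennreal_product_defect:
 fixes x y :: ennreal
 assumes "x <= 1" "y <= 1"
 shows "1 <= x*y + ((1 - x) + (1 - y))" "x + y <= x*y + 1"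
proof -
 obtain u v where u: "x = en u" "0 <= u" "u <= 1" and v: "y = en v" "0 <= v" "v <= 1"
  using assms by (cases x; cases y) (auto simp: top_unique)
 have *: "0 <= (1 - u)*(1 - v)" using u v by simp
 hence "en 1 <= en (u * v + ((1 - u) + (1 - v)))" by (intro ennreal_leI) (simp add: algebra_simps)
 moreover have "1 - x = en (1 - u)" "1 - y = en (1 - v)"
  using u v ennreal_minus[of u 1] ennreal_minus[of v 1] by simp_all
 moreover have "en (u * v + ((1 - u) + (1 - v))) = en u*en v + (en (1 - u) + en (1 - v))"
  using u v by (simp only: ennreal_plus ennreal_mult mult_nonneg_nonneg add_nonneg_nonneg diff_ge_0_iff_ge)
 ultimately show "1 <= x*y + ((1 - x) + (1 - y))" unfolding u(1) v(1) by (simp only: ennreal_1)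
 have "en (u + v) <= en (u * v + 1)" using * by (intro ennreal_leI) (simp add: algebra_simps)
 thus "x + y <= x*y + 1" unfolding u(1) v(1) using u v by (simp add: ennreal_plus ennreal_mult)
qed

text \<open>The bound \<open>f x <= 1\<close> holds at every point and not only almost everywhere,
  because the derivative is replaced by its minimum with 1. Products of such densities then carry no
  exceptional sets.\<close>

lemma bounded_Radon_Nikodym:
 assumes fin: "finite_measure mu" and s: "sets ph = sets mu"
  and le: "!!A. A : sets mu ==> em ph A <= em mu A"
 shows "EX f:bm mu. (ALL x. f x <= 1) & ph = density mu f"
proof -
 interpret finite_measure mu by fact
 have ac: "absolutely_continuous mu ph"
  unfolding absolutely_continuous_def
 proof
  fix A assume "A : null_sets mu"
  thus "A : null_sets ph" using le[of A] s by (auto simp: null_sets_def)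
 qed
 obtain f where f [measurable]: "f : bm mu" and d: "density mu f = ph"
  using Radon_Nikodym[OF ac s] by blast
 define D where "D = {x : space mu. 1 < f x}"
 have [measurable]: "D : sets mu" unfolding D_def by measurable
 have "(II x. (f x - 1)*ind D x ||mu) + em mu D = (II x. (f x - 1)*ind D x + ind D x ||mu)"
  by (subst nn_integral_add) auto
 also have "... = (II x. f x*ind D x ||mu)"
  by (intro nn_integral_cong) (auto simp: D_def indicator_def diff_add_cancel_ennreal)
 also have "... = em ph D" unfolding d[symmetric] by (simp add: emeasure_density)
 also have "... <= em mu D" by (rule le) simp
 finally have "em mu D + (II x. (f x - 1)*ind D x ||mu) <= em mu D + 0"
  by (simp add: add.commute)
 hence "(II x. (f x - 1)*ind D x ||mu) = 0"
  by (subst (asm) ennreal_add_left_cancel_le) (simp add: emeasure_finite)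
 hence "AE x in mu. (f x - 1)*ind D x = 0" by (simp add: nn_integral_0_iff_AE)
 hence AE: "AE x in mu. f x = min (f x) 1"
  using AE_space
 proof eventually_elim
  case (elim x)
  show ?case
  proof (rule ccontr)
   assume "f x ~= min (f x) 1"
   hence "1 < f x" by (auto simp: min_def split: if_splits)
   hence "x : D" "f x - 1 ~= 0" using elim by (auto simp: D_def diff_eq_0_iff_ennreal)
   thus False using elim by simp
  qed
 qed
 have "ph = density mu (%x. min (f x) 1)"
  unfolding d[symmetric] by (rule density_cong[OF _ _ AE]) measurable
 thus ?thesis by (intro bexI[of _ "%x. min (f x) 1"]) auto
qed

context polish
begin

lemma couplings_distr: "sets ga = sets BB ==> ga : cpl (distr ga B fst) (distr ga B snd)"
 by (simp add: couplings_def Let_def)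

lemma distr_marginal:
 assumes "sets ga = sets BB" "A : sets B"
 shows "em (distr ga B fst) A = (II z. ind A (fst z) ||ga)"
  "em (distr ga B snd) A = (II z. ind A (snd z) ||ga)"
proof -
 have [measurable]: "fst : ga \<rightarrow>\<^sub>M B" "snd : ga \<rightarrow>\<^sub>M B"
  using assms(1) by (simp_all cong: measurable_cong_sets)
 have "em (distr ga B fst) A = (II x. ind A x ||distr ga B fst)" using assms(2) by simp
 also have "... = (II z. ind A (fst z) ||ga)" using assms(2) by (intro nn_integral_distr) auto
 finally show "em (distr ga B fst) A = (II z. ind A (fst z) ||ga)" .
 have "em (distr ga B snd) A = (II x. ind A x ||distr ga B snd)" using assms(2) by simp
 also have "... = (II z. ind A (snd z) ||ga)" using assms(2) by (intro nn_integral_distr) auto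
 finally show "em (distr ga B snd) A = (II z. ind A (snd z) ||ga)" .
qed

lemma split_plan:
 assumes s: "sets ga = sets BB" and w: "w : bm BB" "!!z. w z <= 1"
  and f: "f : bm BB"
 shows "(II z. f z ||density ga w) + (II z. f z ||density ga (%z. 1 - w z)) = (II z. f z ||ga)"
proof -
 have [measurable]: "w : bm ga" "f : bm ga"
  using s w f by (simp_all cong: measurable_cong_sets)
 have "(II z. f z ||density ga w) + (II z. f z ||density ga (%z. 1 - w z)) =
   (II z. w z*f z + (1 - w z)*f z ||ga)"
  by (simp add: nn_integral_density nn_integral_add)
 also have "... = (II z. f z ||ga)"
  using w(2) by (intro nn_integral_cong) (simp add: distrib_right[symmetric] add_diff_inverse_ennreal)
 finally show ?thesis .
qed

lemma W2_scale:
 assumes r: "0 < r" and "TC al be < top"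
 shows "W2 X (scale_measure (en r) al) (scale_measure (en r) be) = sqrt r*W2 X al be"
 using assms by (simp add: W2_def TC_scale enn2real_mult real_sqrt_mult)

text \<open>By \<open>W\<close> the point \<open>b\<close> lies at proportion \<open>t\<close>
  between \<open>a\<close> and \<open>c\<close>, so both halves have the same speed after
  reparametrisation; across the joint, the triangle inequality through \<open>b\<close> adds up to
  the exact bound.\<close>

lemma W2_geodesic_concat:
 assumes g1: "W2_geodesic X a b et1" and g2: "W2_geodesic X b c et2" and t: "0 < t" "t < 1"
  and W: "W2 X a b = t*W2 X a c" "W2 X b c = (1 - t)*W2 X a c"
 shows "W2_geodesic X a c (%s. if s <= t then et1 (s/t) else et2 ((s - t)/(1 - t)))" (is "W2_geodesic X a c ?et")
proof (rule W2_geodesicI)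
 have P1: "et1 s : P2 X" and P2': "et2 s : P2 X" if "s : {0..1}" for s
  using g1 g2 that by (auto simp: W2_geodesic_def)
 have e: "et1 0 = a" "et1 1 = b" "et2 0 = b" "et2 1 = c" using g1 g2 by (auto simp: W2_geodesic_def)
 have d1: "W2 X (et1 s) (et1 s') = (s' - s)*(t*W2 X a c)" if "0 <= s" "s <= s'" "s' <= 1" for s s'
  using g1 that W by (auto simp: W2_geodesic_def)
 have d2: "W2 X (et2 s) (et2 s') = (s' - s)*((1 - t)*W2 X a c)" if "0 <= s" "s <= s'" "s' <= 1" for s s'
  using g2 that W by (auto simp: W2_geodesic_def)
 have i1: "s/t : {0..1}" if "0 <= s" "s <= t" for s using that t by (simp add: divide_le_eq)
 have i2: "(s - t)/(1 - t) : {0..1}" if "t <= s" "s <= 1" for s using that t by (simp add: divide_le_eq)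
 show "?et s : P2 X" if "s : {0..1}" for s
  using that i1[of s] i2[of s] P1[of "s/t"] P2'[of "(s - t)/(1 - t)"] by (cases "s <= t") auto
 show "?et 0 = a" "?et 1 = c" using t e by auto
 fix s s' :: real assume s: "0 <= s" "s < s'" "s' <= 1"
 consider "s' <= t" | "s <= t" "t < s'" | "t < s" by linarith
 thus "W2 X (?et s) (?et s') <= (s' - s)*W2 X a c"
 proof cases
  case 1
  hence "W2 X (?et s) (?et s') = (s'/t - s/t)*(t*W2 X a c)"
   using s t i1[of s] i1[of s'] d1[of "s/t" "s'/t"] by (simp add: divide_right_mono)
  also have "... = (s' - s)*W2 X a c" using t by (simp add: field_simps)
  finally show ?thesis by simp
 next
  case 2
  have "W2 X (?et s) (?et s') <= W2 X (et1 (s/t)) b + W2 X b (et2 ((s' - t)/(1 - t)))"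
  proof -
   have b: "b : P2 X" using P1[of 1] e by simp
   have p: "et1 (s/t) : P2 X" "et2 ((s' - t)/(1 - t)) : P2 X"
    using 2 s i1[of s] i2[of s'] P1 P2' by auto
   have "em b S < top" using P2D(4)[OF b] by simp
   from W2_triangle(2)[OF this TC_finite[OF p(1) b] TC_finite[OF b p(2)]] show ?thesis using 2 by simp
  qed
  also have "W2 X (et1 (s/t)) b = (1 - s/t)*(t*W2 X a c)"
   using d1[of "s/t" 1] i1[of s] 2 s e by simp
  also have "W2 X b (et2 ((s' - t)/(1 - t))) = ((s' - t)/(1 - t) - 0)*((1 - t)*W2 X a c)"
   using d2[of 0 "(s' - t)/(1 - t)"] i2[of s'] 2 s e by simp
  also have "(1 - s/t)*(t*W2 X a c) + ((s' - t)/(1 - t) - 0)*((1 - t)*W2 X a c) = (s' - s)*W2 X a c"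
  proof -
   have "(1 - s/t)*(t*W2 X a c) = (t - s)*W2 X a c" using t by (simp add: field_simps)
   moreover have "((s' - t)/(1 - t) - 0)*((1 - t)*W2 X a c) = (s' - t)*W2 X a c" using t by simp
   ultimately show ?thesis by (simp add: algebra_simps)
  qed
  finally show ?thesis .
 next
  case 3
  hence "W2 X (?et s) (?et s') = ((s' - t)/(1 - t) - (s - t)/(1 - t))*((1 - t)*W2 X a c)"
   using s t i2[of s] i2[of s'] d2[of "(s - t)/(1 - t)" "(s' - t)/(1 - t)"] by (simp add: divide_right_mono)
  also have "... = (s' - s)*W2 X a c" using t by (simp add: diff_divide_distrib[symmetric])
  finally show ?thesis by simp
 qed
qed

end

section \<open>Densities and entropies relative to the Borel part of a measure\<close>

locale mms = polish X for X :: "'a metric" +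
 fixes m :: "'a measure"
 assumes space_m: "space m = S" and sets_m: "sets B <= sets m"
  and sf: "sigma_finite_measure (borel_part X m)"
begin

abbreviation M where "M == borel_part X m"
abbreviation ren where "ren == renyi X m"
abbreviation P2ac where "P2ac == P2_ac X m"
abbreviation dns where "dns == dens X m"

lemma subalg: "subalgebra m B"
 using space_m sets_m by (simp add: subalgebra_def)

lemma sets_M [simp, measurable_cong]: "sets M = sets B"
 unfolding borel_part_def by (rule sets_restr_to_subalg[OF subalg])

lemma space_M [simp]: "space M = S"
 using sets_eq_imp_space_eq[OF sets_M] by simp

lemma emeasure_M: "A : sets B ==> em M A = em m A"
 unfolding borel_part_def by (rule emeasure_restr_to_subalg[OF subalg])

sublocale sigma_finite_measure M by (rule sf)

lemma measurable_dens [measurable]: "dns mu : bm B"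
 using borel_measurable_RN_deriv[of M mu] by (simp add: dens_def cong: measurable_cong_sets)

lemma density_dens:
 assumes "mu : P2ac" shows "density M (dns mu) = mu"
proof -
 have "absolutely_continuous M mu" "sets mu = sets M"
  using assms P2D(1) by (auto simp: P2_ac_def)
 thus ?thesis unfolding dens_def by (rule density_RN_deriv)
qed

lemma dens_density:
 assumes "f : bm B" shows "AE x in M. dns (density M f) x = f x"
proof -
 have "f : bm M" using assms by (simp cong: measurable_cong_sets)
 hence "AE x in M. f x = RN_deriv M (density M f) x" by (rule RN_deriv_unique) simp
 thus ?thesis unfolding dens_def by eventually_elim simp
qed

lemma renyi_density:
 assumes "f : bm B"
 shows "ren N (density M f) = (II x. epowr (f x) ((N - 1)/N) ||M)"
proof -
 have f: "f : bm M" using assms by (simp cong: measurable_cong_sets)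
 hence "EX rh:bm M. density M f = density M rh" by blast
 hence "ren N (density M f) = (II x. epowr (dns (density M f) x) ((N - 1)/N) ||M)"
  by (simp add: renyi_def)
 also have "... = (II x. epowr (f x) ((N - 1)/N) ||M)"
  using dens_density[OF assms] by (intro nn_integral_cong_AE) (auto elim!: eventually_mono)
 finally show ?thesis .
qed

lemma P2_ac_density:
 assumes "f : bm B" "density M f : P2 X"
 shows "density M f : P2ac"
proof -
 have "f : bm M" using assms by (simp cong: measurable_cong_sets)
 thus ?thesis using assms(2) absolutely_continuousI_density by (auto simp: P2_ac_def)
qed

lemma renyi_finite_P2_ac:
 assumes "ren N mu < top" "mu : P2 X"
 shows "mu : P2ac"
proof -
 obtain f where f: "f : bm M" "mu = density M f"
  using assms(1) by (auto simp: renyi_def split: if_splits)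
 thus ?thesis using P2_ac_density[of f] assms(2) by (simp cong: measurable_cong_sets)
qed

lemma P2_ac_le:
 assumes "mu : P2ac" "nu : P2 X" "!!A. A : sets B ==> em nu A <= c*em mu A"
 shows "nu : P2ac"
proof -
 have "absolutely_continuous M nu"
  unfolding absolutely_continuous_def
 proof
  fix A assume A: "A : null_sets M"
  hence "A : null_sets mu" using assms(1) by (auto simp: P2_ac_def absolutely_continuous_def)
  hence "em nu A <= c*0" using assms(3)[of A] A by (auto simp: null_sets_def)
  thus "A : null_sets nu" using A P2D(1)[OF assms(2)] by (auto simp: null_sets_def)
 qed
 thus ?thesis using assms(2) by (simp add: P2_ac_def)
qed

text \<open>On the set \<open>D\<close> where the claim fails, the integrals of the two densities
  are in the opposite order by \<open>le\<close>. The integral of the right-hand side over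
  \<open>D\<close> is finite, so it can be cancelled and \<open>D\<close> is null.\<close>

lemma dens_le:
 assumes ac: "mu : P2ac" "nu : P2ac" and le: "!!A. A : sets B ==> em nu A <= c*em mu A" and c: "c < top"
 shows "AE x in M. dns nu x <= c*dns mu x"
proof -
 let ?f = "dns nu" and ?g = "%x. c*dns mu x"
 define D where "D = {x : S. ?g x < ?f x}"
 have [measurable]: "?f : bm M" "?g : bm M" by measurable
 have D [measurable]: "D : sets B"
 proof -
  have "{x : space M. ?g x < ?f x} : sets M" by measurable
  thus ?thesis by (simp add: D_def)
 qed
 have "(II x. ?f x*ind D x ||M) = em nu D"
  using D by (subst density_dens[OF ac(2), symmetric]) (simp add: emeasure_density)
 also have "... <= c*em mu D" by (rule le[OF D])
 also have "em mu D = (II x. dns mu x*ind D x ||M)"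
  using D by (subst density_dens[OF ac(1), symmetric]) (simp add: emeasure_density)
 also have "c * ... = (II x. ?g x*ind D x ||M)"
  by (subst nn_integral_cmult[symmetric]) (auto simp: mult.assoc)
 finally have le': "(II x. ?f x*ind D x ||M) <= (II x. ?g x*ind D x ||M)" .
 have gfin: "(II x. ?g x*ind D x ||M) < top"
 proof -
  have "(II x. ?g x*ind D x ||M) = c*em mu D"
   using D by (subst (2) density_dens[OF ac(1), symmetric])
    (simp add: emeasure_density nn_integral_cmult[symmetric] mult.assoc)
  also have "... <= c*em mu S"
   using ac(1) D sets.sets_into_space[OF D] P2D(1)[of mu] by (intro mult_left_mono emeasure_mono) (auto simp: P2_ac_def)
  also have "... < top" using c P2D(4)[of mu] ac(1) by (simp add: P2_ac_def)
  finally show ?thesis .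
 qed
 have split: "(II x. (?f x - ?g x)*ind D x ||M) + (II x. ?g x*ind D x ||M) = (II x. ?f x*ind D x ||M)"
  by (subst nn_integral_add[symmetric])
    (auto intro!: nn_integral_cong simp: D_def indicator_def diff_add_cancel_ennreal)
 have "(II x. ?g x*ind D x ||M) + (II x. (?f x - ?g x)*ind D x ||M) <= (II x. ?g x*ind D x ||M) + 0"
  using le' split by (simp add: add.commute)
 hence "(II x. (?f x - ?g x)*ind D x ||M) = 0"
  using gfin by (subst (asm) ennreal_add_left_cancel_le) auto
 hence "AE x in M. (?f x - ?g x)*ind D x = 0" by (subst (asm) nn_integral_0_iff_AE) auto
 thus ?thesis
  using AE_space
 proof eventually_elim
  case (elim x)
  show ?case
  proof (rule ccontr)
   assume "~ ?f x <= ?g x"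
   hence "x : D" "?f x - ?g x ~= 0" using elim by (auto simp: D_def diff_eq_0_iff_ennreal less_top)
   thus False using elim by simp
  qed
 qed
qed

lemma renyi_eq: "mu : P2ac ==> ren N mu = (II x. epowr (dns mu x) ((N - 1)/N) ||M)"
 using renyi_density[of "dns mu" N] density_dens[of mu] by simp

lemma renyi_le_scale:
 assumes ac: "mu : P2ac" "nu : P2ac" and le: "!!A. A : sets B ==> em nu A <= c*em mu A" and c: "c < top"
  and N: "N < 0"
 shows "ren N nu <= epowr c ((N - 1)/N)*ren N mu"
proof -
 have p: "0 < (N - 1)/N" using N by (simp add: zero_less_divide_iff)
 have ae: "AE x in M. dns nu x <= c*dns mu x"
  by (rule dens_le[OF ac _ c]) (rule le)
 have "ren N nu <= (II x. epowr c ((N - 1)/N)*epowr (dns mu x) ((N - 1)/N) ||M)"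
  unfolding renyi_eq[OF ac(2)]
 proof (rule nn_integral_mono_AE)
  show "AE x in M. epowr (dns nu x) ((N - 1)/N) <= epowr c ((N - 1)/N)*epowr (dns mu x) ((N - 1)/N)"
   using ae by eventually_elim (use p in \<open>auto simp: epowr_mult[symmetric] intro!: epowr_mono\<close>)
 qed
 also have "... = epowr c ((N - 1)/N)*ren N mu"
  unfolding renyi_eq[OF ac(1)] by (rule nn_integral_cmult) measurable
 finally show ?thesis .
qed

end

subsection \<open>Restricting geodesics to regular sets\<close>

context mms
begin

text \<open>\<open>f\<close> is the conditional probability, given the value of \<open>q\<close>,
  that \<open>p\<close> lies in \<open>A\<close>; it arises as the density of a restricted plan. Its
  integral deficit is the mass of \<open>mu\<close> outside \<open>A\<close>.\<close>

lemma marginal_density: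
 assumes p: "p : ga \<rightarrow>\<^sub>M B" "q : ga \<rightarrow>\<^sub>M B" and d: "distr ga B p = mu" "distr ga B q = nu"
  and P: "prob_space mu" "prob_space nu" and A: "A : sets B"
 obtains f where "f : bm B" "!!x. f x <= 1" "(II x. 1 - f x ||nu) = em mu (S - A)"
  "!!h. h : bm B ==> (II z. ind A (p z)*h (q z) ||ga) = (II x. f x*h x ||nu)"
proof -
 note [measurable] = p A
 have s: "sets mu = sets B" "sets nu = sets B" and sp: "space mu = S" "space nu = S" using d by auto
 note [measurable_cong] = s
 interpret mu: prob_space mu by fact
 interpret nu: prob_space nu by fact
 define ph where "ph = distr (density ga (%z. ind A (p z))) B q"
 have I: "(II x. h x ||ph) = (II z. ind A (p z)*h (q z) ||ga)" if [measurable]: "h : bm B" for h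
  unfolding ph_def by (simp add: nn_integral_distr nn_integral_density)
 have "EX f:bm nu. (ALL x. f x <= 1) & ph = density nu f"
 proof (rule bounded_Radon_Nikodym[OF nu.finite_measure_axioms])
  fix E assume "E : sets nu"
  hence E [measurable]: "E : sets B" using s by simp
  have "em ph E = (II x. ind E x ||ph)" by (simp add: ph_def)
  also have "... = (II z. ind A (p z)*ind E (q z) ||ga)" by (rule I) measurable
  also have "... <= (II z. ind E (q z) ||ga)" by (intro nn_integral_mono) (auto simp: indicator_def)
  also have "... = (II x. ind E x ||nu)" unfolding d(2)[symmetric] by (subst nn_integral_distr) auto
  finally show "em ph E <= em nu E" by simp
 qed (simp add: ph_def s)
 then obtain f where f: "f : bm B" "!!x. f x <= 1" "ph = density nu f"
  using s by (auto cong: measurable_cong_sets)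
 note [measurable] = f(1)
 have F: "(II z. ind A (p z)*h (q z) ||ga) = (II x. f x*h x ||nu)" if [measurable]: "h : bm B" for h
  unfolding I[OF that, symmetric] f(3) by (subst nn_integral_density) auto
 have "em mu A = (II x. ind A x ||mu)" by simp
 also have "... = (II z. ind A (p z) ||ga)" unfolding d(1)[symmetric] by (subst nn_integral_distr) auto
 also have "... = (II x. f x ||nu)" using F[of "%_. 1"] by simp
 finally have "em mu A + (II x. 1 - f x ||nu) = (II x. f x + (1 - f x) ||nu)"
  by (subst nn_integral_add) auto
 also have "... = (II x. 1 ||nu)" using f(2) by (intro nn_integral_cong) (simp add: add_diff_inverse_ennreal)
 also have "... = em mu S" using mu.emeasure_space_1 nu.emeasure_space_1 sp by simp
 also have "... = em mu A + em mu (S - A)"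
  using sets.sets_into_space[OF A] by (subst plus_emeasure) (auto intro!: arg_cong[where f="em mu"])
 finally have "(II x. 1 - f x ||nu) = em mu (S - A)"
  by (subst (asm) ennreal_add_left_cancel) auto
 with f(1,2) F show ?thesis by (intro that) auto
qed

text \<open>Uniform convexity speaks of marginals supported in a regular set, while those at hand
  only have most of their mass there. So a \<open>t\<close>-intermediate measure is cut down: of the
  two optimal plans through it only mass whose start and end both lie in \<open>A\<close> is kept.
  The conditional probabilities \<open>f\<close> and \<open>g\<close> give the two kept pieces a
  common middle marginal, with density \<open>f * g\<close> relative to \<open>muta\<close>. Kept
  and discarded pieces together have exactly the optimal cost, so the kept ones satisfy the
  quadratic splitting with equality, and their middle marginal is again
  \<open>t\<close>-intermediate.\<close>

lemma restrict_geodesic: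
 assumes ex: "!!mu nu. mu : P2ac ==> nu : P2ac ==>
   (EX pl. W2_optimal X mu nu pl) & (EX et. W2_geodesic X mu nu et)"
  and ac: "mu0 : P2ac" "mu1 : P2ac" "muta : P2ac" and t: "0 < t" "t < 1"
  and W: "W2 X mu0 muta = t*W2 X mu0 mu1" "W2 X muta mu1 = (1 - t)*W2 X mu0 mu1"
  and A: "A : sets B" and e: "0 <= e" "e <= 1/4"
  and mA: "em mu0 (S - A) <= en e" "em mu1 (S - A) <= en e"
 shows "EX nu0 nu1 et. W2_geodesic X nu0 nu1 et & nu0 : P2ac & nu1 : P2ac &
   em nu0 (S - A) = 0 & em nu1 (S - A) = 0 &
   (ALL E:sets B. em nu0 E <= 2*em mu0 E & em nu1 E <= 2*em mu1 E &
    en (1 - 2*e)*em (et t) E <= em muta E)"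
proof -
 note [measurable] = A
 have P: "mu0 : P2 X" "mu1 : P2 X" "muta : P2 X" using ac by (auto simp: P2_ac_def)
 note p0 = P2D[OF P(1)] and p1 = P2D[OF P(2)] and pt = P2D[OF P(3)]
 let ?W = "W2 X mu0 mu1"
 let ?c = "%ga. II z. sq z ||ga"
 obtain ga1 where g1: "ga1 : cpl mu0 muta" "?c ga1 = TC mu0 muta"
  using ex[OF ac(1,3)] unfolding W2_optimal_def plan_cost_sq by auto
 obtain ga2 where g2: "ga2 : cpl muta mu1" "?c ga2 = TC muta mu1"
  using ex[OF ac(3,2)] unfolding W2_optimal_def plan_cost_sq by auto
 note c1 = couplingsD[OF g1(1)] and c2 = couplingsD[OF g2(1)]
 note [measurable_cong] = c1(1) c2(1) pt(1)
 have [simp]: "fst : ga1 \<rightarrow>\<^sub>M B" "snd : ga1 \<rightarrow>\<^sub>M B" "fst : ga2 \<rightarrow>\<^sub>M B" "snd : ga2 \<rightarrow>\<^sub>M B" by measurable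
 interpret MT: prob_space muta by (rule pt(3))

 have ds: "distr ga1 B fst = mu0" "distr ga1 B snd = muta" "distr ga2 B fst = muta" "distr ga2 B snd = mu1"
  using g1(1) g2(1) by (auto simp: couplings_def Let_def)
 obtain f where f: "f : bm B" "!!x. f x <= 1" "(II x. 1 - f x ||muta) = em mu0 (S - A)"
  "!!h. h : bm B ==> (II z. ind A (fst z)*h (snd z) ||ga1) = (II x. f x*h x ||muta)"
  by (rule marginal_density[OF _ _ ds(1,2) p0(3) pt(3) A]) simp_all
 obtain g where g: "g : bm B" "!!x. g x <= 1" "(II x. 1 - g x ||muta) = em mu1 (S - A)"
  "!!h. h : bm B ==> (II z. ind A (snd z)*h (fst z) ||ga2) = (II x. g x*h x ||muta)"
  by (rule marginal_density[OF _ _ ds(4,3) p1(3) pt(3) A]) simp_all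
 note [measurable] = f(1) g(1)

 \<comment> \<open>\<open>w1\<close> requires the start to be in \<open>A\<close> and weights the
   middle point by its chance of an end in \<open>A\<close>; \<open>w2\<close> does the same from
   the other side.\<close>
 define w1 where "w1 z = ind A (fst z)*g (snd z)" for z :: "'a \<times> 'a"
 define w2 where "w2 z = f (fst z)*ind A (snd z)" for z :: "'a \<times> 'a"
 have w [measurable]: "w1 : bm BB" "w2 : bm BB"
  unfolding w1_def w2_def by measurable
 have wle: "w1 z <= 1" "w2 z <= 1" for z
  using f(2)[of "fst z"] g(2)[of "snd z"] by (auto simp: w1_def w2_def indicator_def)
 define \<Pi>1 where "\<Pi>1 = density ga1 w1"
 define \<Pi>1' where "\<Pi>1' = density ga1 (%z. 1 - w1 z)"
 define \<Pi>2 where "\<Pi>2 = density ga2 w2"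
 define \<Pi>2' where "\<Pi>2' = density ga2 (%z. 1 - w2 z)"
 have s: "sets \<Pi>1 = sets BB" "sets \<Pi>1' = sets BB" "sets \<Pi>2 = sets BB" "sets \<Pi>2' = sets BB"
  using c1(1) c2(1) by (simp_all add: \<Pi>1_def \<Pi>1'_def \<Pi>2_def \<Pi>2'_def)
 have sp1: "(II z. h z ||\<Pi>1) + (II z. h z ||\<Pi>1') = (II z. h z ||ga1)" if "h : bm BB" for h
  unfolding \<Pi>1_def \<Pi>1'_def by (rule split_plan[OF c1(1) w(1) wle(1) that])
 have sp2: "(II z. h z ||\<Pi>2) + (II z. h z ||\<Pi>2') = (II z. h z ||ga2)" if "h : bm BB" for h
  unfolding \<Pi>2_def \<Pi>2'_def by (rule split_plan[OF c2(1) w(2) wle(2) that])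
 define al where "al = distr \<Pi>1 B fst"
 define al' where "al' = distr \<Pi>1' B fst"
 define be where "be = distr \<Pi>2 B snd"
 define be' where "be' = distr \<Pi>2' B snd"
 define ze where "ze = distr \<Pi>1 B snd"
 define ze' where "ze' = distr \<Pi>1' B snd"
 have sets_ab [simp]: "sets al = sets B" "sets al' = sets B" "sets be = sets B" "sets be' = sets B" "sets ze = sets B" "sets ze' = sets B"
  by (simp_all add: al_def al'_def be_def be'_def ze_def ze'_def)

 have al_sum: "em al E + em al' E = em mu0 E" if [measurable]: "E : sets B" for E
  unfolding al_def al'_def distr_marginal(1)[OF s(1) that] distr_marginal(1)[OF s(2) that]
  using sp1[of "%z. ind E (fst z)"] c1(9)[of "ind E"] that p0(1) by simp
 have be_sum: "em be E + em be' E = em mu1 E" if [measurable]: "E : sets B" for E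
  unfolding be_def be'_def distr_marginal(2)[OF s(3) that] distr_marginal(2)[OF s(4) that]
  using sp2[of "%z. ind E (snd z)"] c2(10)[of "ind E"] that p1(1) by simp
 have ze_sum: "em ze E + em ze' E = em muta E" if [measurable]: "E : sets B" for E
  unfolding ze_def ze'_def distr_marginal(2)[OF s(1) that] distr_marginal(2)[OF s(2) that]
  using sp1[of "%z. ind E (snd z)"] c1(10)[of "ind E"] that pt(1) by simp
 have ze2_sum: "em (distr \<Pi>2 B fst) E + em (distr \<Pi>2' B fst) E = em muta E" if [measurable]: "E : sets B" for E
  unfolding distr_marginal(1)[OF s(3) that] distr_marginal(1)[OF s(4) that]
  using sp2[of "%z. ind E (fst z)"] c2(9)[of "ind E"] that pt(1) by simp
 have ze_eq: "em ze E = (II x. (f x*g x)*ind E x ||muta)" if [measurable]: "E : sets B" for E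
 proof -
  have "em ze E = (II z. ind A (fst z)*(g (snd z)*ind E (snd z)) ||ga1)"
   unfolding ze_def distr_marginal(2)[OF s(1) that] unfolding \<Pi>1_def
   by (subst nn_integral_density) (auto simp: w1_def mult.assoc)
  also have "... = (II x. f x*(g x*ind E x) ||muta)" by (rule f(4)) measurable
  finally show ?thesis by (simp add: mult_ac)
 qed
 have ze2_eq: "em (distr \<Pi>2 B fst) E = (II x. (f x*g x)*ind E x ||muta)" if [measurable]: "E : sets B" for E
 proof -
  have "em (distr \<Pi>2 B fst) E = (II z. ind A (snd z)*(f (fst z)*ind E (fst z)) ||ga2)"
   unfolding distr_marginal(1)[OF s(3) that] unfolding \<Pi>2_def
   by (subst nn_integral_density) (auto simp: w2_def mult_ac)
  also have "... = (II x. g x*(f x*ind E x) ||muta)" by (rule g(4)) measurable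
  finally show ?thesis by (simp add: mult_ac)
 qed
 have ze2: "distr \<Pi>2 B fst = ze"
  by (rule measure_eqI) (simp_all add: ze_eq ze2_eq)
 have zefin: "em ze E ~= top" if "E : sets B" for E
  using ze_sum[OF that] MT.emeasure_finite[of E] by (metis ennreal_add_eq_top infinity_ennreal_def)
 have ze'2: "distr \<Pi>2' B fst = ze'"
 proof (rule measure_eqI)
  fix E assume "E : sets (distr \<Pi>2' B fst)"
  hence E: "E : sets B" by simp
  have "em ze E + em (distr \<Pi>2' B fst) E = em ze E + em ze' E"
   using ze2_sum[OF E] ze_sum[OF E] ze2 by simp
  thus "em (distr \<Pi>2' B fst) E = em ze' E"
   using zefin[OF E] by (simp add: ennreal_add_left_cancel)
 qed simp
 have cp1: "\<Pi>1 : cpl al ze" unfolding al_def ze_def by (rule couplings_distr[OF s(1)])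
 have cp1': "\<Pi>1' : cpl al' ze'" unfolding al'_def ze'_def by (rule couplings_distr[OF s(2)])
 have cp2: "\<Pi>2 : cpl ze be" unfolding be_def ze2[symmetric] by (rule couplings_distr[OF s(3)])
 have cp2': "\<Pi>2' : cpl ze' be'" unfolding be'_def ze'2[symmetric] by (rule couplings_distr[OF s(4)])

 have tot1: "?c \<Pi>1 + ?c \<Pi>1' = en ((t*?W)^2)"
  unfolding sp1[OF measurable_cost] g1(2) TC_W2[OF TC_finite[OF P(1,3)]] W(1) ..
 have tot2: "?c \<Pi>2 + ?c \<Pi>2' = en (((1 - t)*?W)^2)"
  unfolding sp2[OF measurable_cost] g2(2) TC_W2[OF TC_finite[OF P(3,2)]] W(2) ..
 have cfin: "?c \<Pi>1 < top" "?c \<Pi>1' < top" "?c \<Pi>2 < top" "?c \<Pi>2' < top"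
 proof -
  have "?c \<Pi>1 + ?c \<Pi>1' < top" "?c \<Pi>2 + ?c \<Pi>2' < top" unfolding tot1 tot2 by simp_all
  thus "?c \<Pi>1 < top" "?c \<Pi>1' < top" "?c \<Pi>2 < top" "?c \<Pi>2' < top"
   by (simp_all add: ennreal_add_less_top)
 qed
 obtain x1 where x1: "?c \<Pi>1 = en x1" "0 <= x1" using cfin(1) by (cases "?c \<Pi>1") auto
 obtain x1' where x1': "?c \<Pi>1' = en x1'" "0 <= x1'" using cfin(2) by (cases "?c \<Pi>1'") auto
 obtain x2 where x2: "?c \<Pi>2 = en x2" "0 <= x2" using cfin(3) by (cases "?c \<Pi>2") auto
 obtain x2' where x2': "?c \<Pi>2' = en x2'" "0 <= x2'" using cfin(4) by (cases "?c \<Pi>2'") auto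
 have sum1: "x1 + x1' = (t*?W)^2"
  using tot1 unfolding x1(1) x1'(1) using x1(2) x1'(2) by (simp add: ennreal_plus[symmetric] del: ennreal_plus)
 have sum2: "x2 + x2' = ((1 - t)*?W)^2"
  using tot2 unfolding x2(1) x2'(1) using x2(2) x2'(2) by (simp add: ennreal_plus[symmetric] del: ennreal_plus)
 have a: "TC al ze <= en x1" "TC ze be <= en x2" "TC al' ze' <= en x1'" "TC ze' be' <= en x2'"
  using TC_le[OF cp1] TC_le[OF cp2] TC_le[OF cp1'] TC_le[OF cp2'] x1 x2 x1' x2' by simp_all
 have afin: "TC al ze < top" "TC ze be < top" "TC al' ze' < top" "TC ze' be' < top"
  using a by (auto intro: le_less_trans)
 have ze'fin: "em ze' S < top"
  using ze_sum[of S] MT.emeasure_finite[of S] by (metis S_in_B ennreal_add_eq_top infinity_ennreal_def less_top)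
 have zefinS: "em ze S < top" using zefin[of S] by (simp add: less_top)
 have abfin: "TC al be < top" by (rule W2_triangle(1)[OF zefinS afin(1,2)])
 have abtri: "W2 X al be <= W2 X al ze + W2 X ze be" by (rule W2_triangle(2)[OF zefinS afin(1,2)])
 define D a1 a2 where "D = W2 X al be" and "a1 = W2 X al ze" and "a2 = W2 X ze be"
 have DD: "D^2 <= a1^2/t + a2^2/(1 - t)"
 proof -
  have "en (D^2) <= en (1/t)*en (a1^2) + en (1/(1 - t))*en (a2^2)"
   using TC_split[OF zefinS t, of al be] unfolding TC_W2[OF abfin] TC_W2[OF afin(1)] TC_W2[OF afin(2)] D_def a1_def a2_def .
  also have "... = en (a1^2/t + a2^2/(1 - t))"
   using t by (simp add: ennreal_mult'[symmetric] ennreal_plus[symmetric] del: ennreal_plus)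
  finally show ?thesis using t by (subst (asm) ennreal_le_iff) auto
 qed
 have ax: "a1^2 <= x1" "a2^2 <= x2"
  using a(1,2) x1 x2 unfolding TC_W2[OF afin(1)] TC_W2[OF afin(2)] a1_def a2_def by simp_all
 \<comment> \<open>Lower bound for \<open>D\<close>: the original marginals are coupled by adding a
   coupling of the kept ends to one of the discarded ends, the latter passing through
   \<open>ze'\<close>.\<close>
 have WW: "?W^2 <= D^2 + (x1'/t + x2'/(1 - t))"
 proof -
  have m0: "madd al al' = mu0" by (rule measure_eqI) (simp_all add: p0(1) emeasure_madd al_sum)
  have m1: "madd be be' = mu1" by (rule measure_eqI) (simp_all add: p1(1) emeasure_madd be_sum)
  have "en (?W^2) = TC (madd al al') (madd be be')" unfolding m0 m1 using TC_W2[OF TC_finite[OF P(1,2)]] by simp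
  also have "... <= TC al be + TC al' be'" by (rule TC_madd) simp_all
  also have "... <= en (D^2) + (en (1/t)*TC al' ze' + en (1/(1 - t))*TC ze' be')"
   unfolding TC_W2[OF abfin] D_def by (intro add_left_mono TC_split ze'fin t)
  also have "... <= en (D^2) + (en (1/t)*en x1' + en (1/(1 - t))*en x2')"
   using a by (intro add_left_mono add_mono mult_left_mono) auto
  also have "... = en (D^2 + (x1'/t + x2'/(1 - t)))"
   using t x1' x2' by (simp add: ennreal_mult'[symmetric] ennreal_plus[symmetric] del: ennreal_plus)
  finally show ?thesis using t x1' x2' by (subst (asm) ennreal_le_iff) auto
 qed
 \<comment> \<open>The two optimal plans have costs \<open>(t * W)^2\<close> and
   \<open>((1 - t) * W)^2\<close>, so the weighted costs add up to exactly \<open>W^2\<close>;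
   together with \<open>WW\<close> this leaves no room in \<open>DD\<close>.\<close>
 have div: "(x1 + x1')/t + (x2 + x2')/(1 - t) = ?W^2"
  unfolding sum1 sum2 using t by (simp add: power2_eq_square field_simps)
 have "a1^2/t <= x1/t" "a2^2/(1 - t) <= x2/(1 - t)" using ax t by (simp_all add: divide_right_mono)
 hence D2: "D^2 = a1^2/t + a2^2/(1 - t)"
  using DD WW div by (simp add: add_divide_distrib)
 have eqs: "a1 = t*D" "a2 = (1 - t)*D"
 proof -
  have pos: "0 <= D" "D <= a1 + a2" "0 <= a1" "0 <= a2" using abtri by (simp_all add: D_def a1_def a2_def)
  show "a1 = t*D" by (rule square_split_eq(1)[OF t D2 pos])
  show "a2 = (1 - t)*D" by (rule square_split_eq(2)[OF t D2 pos])
 qed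

 define ka where "ka = measure ze S"
 have ka: "em ze S = en ka" unfolding ka_def measure_def using zefinS by (simp add: less_top)
 have kage: "1 - 2*e <= ka"
 proof -
  have mass: "(II x. 1 - f x ||muta) <= en e" "(II x. 1 - g x ||muta) <= en e" unfolding f(3) g(3) by fact+
  have "1 = (II x. 1 ||muta)" using pt by simp
  also have "... <= (II x. f x*g x + ((1 - f x) + (1 - g x)) ||muta)"
   by (intro nn_integral_mono ennreal_product_defect f(2) g(2))
  also have "... = (II x. f x*g x ||muta) + ((II x. 1 - f x ||muta) + (II x. 1 - g x ||muta))"
   by (simp add: nn_integral_add)
  also have "(II x. f x*g x ||muta) = em ze S"
   unfolding ze_eq[OF S_in_B] using pt(2) by (intro nn_integral_cong) simp
  also have "em ze S + ((II x. 1 - f x ||muta) + (II x. 1 - g x ||muta)) <= en ka + (en e + en e)"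
   unfolding ka by (intro add_mono mass order_refl)
  also have "... = en (ka + (e + e))"
  proof -
   have "0 <= ka" by (simp add: ka_def)
   thus ?thesis using e by (simp only: ennreal_plus add_nonneg_nonneg)
  qed
  finally have "en 1 <= en (ka + (e + e))" by simp
  thus ?thesis using e by (subst (asm) ennreal_le_iff) (auto simp: ka_def)
 qed
 have kale: "ka <= 1"
 proof -
  have "em ze S <= em muta S" using ze_sum[OF S_in_B] by (metis le_iff_add)
  hence "en ka <= en 1" using ka pt(4) by simp
  thus ?thesis by (subst (asm) ennreal_le_iff) auto
 qed
 \<comment> \<open>\<open>e <= 1/4\<close> leaves at least half of the mass, so that normalising at
   most doubles it.\<close>
 have kapos: "1/2 <= ka" "0 < ka" using kage e by linarith+
 define r where "r = 1/ka"
 have r: "0 < r" "r <= 2" "1 <= r" "r * ka = 1" using kapos kale by (auto simp: r_def divide_simps)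
 define nu0 where "nu0 = scale_measure (en r) al"
 define nu1 where "nu1 = scale_measure (en r) be"
 define nuta where "nuta = scale_measure (en r) ze"
 have WN: "W2 X nu0 nuta = t*W2 X nu0 nu1" "W2 X nuta nu1 = (1 - t)*W2 X nu0 nu1"
  unfolding nu0_def nu1_def nuta_def W2_scale[OF r(1) abfin] W2_scale[OF r(1) afin(1)] W2_scale[OF r(1) afin(2)]
  using eqs by (simp_all add: D_def a1_def a2_def)
 have mal: "em al S = en ka" using couplingsD(7,8)[OF cp1, of S] ka by simp
 have mbe: "em be S = en ka" using couplingsD(7,8)[OF cp2, of S] ka by simp
 have rka: "en r*en ka = 1" using r kapos by (simp flip: ennreal_mult)
 have r2: "en r <= 2" using r ennreal_leI[of r 2] by simp
 have le0: "em nu0 E <= 2*em mu0 E" if "E : sets B" for E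
 proof -
  have "em al E <= em mu0 E" using al_sum[OF that] by (metis le_iff_add)
  thus ?thesis unfolding nu0_def by (simp add: mult_mono r2)
 qed
 have le1: "em nu1 E <= 2*em mu1 E" if "E : sets B" for E
 proof -
  have "em be E <= em mu1 E" using be_sum[OF that] by (metis le_iff_add)
  thus ?thesis unfolding nu1_def by (simp add: mult_mono r2)
 qed
 have zele: "em ze E <= em muta E" if "E : sets B" for E
  using ze_sum[OF that] by (metis le_iff_add)
 have leT: "em nuta E <= 2*em muta E" if "E : sets B" for E
  unfolding nuta_def using zele[OF that] by (simp add: mult_mono r2)
 have P2n: "nu0 : P2 X" "nu1 : P2 X" "nuta : P2 X"
 proof -
  show "nu0 : P2 X" by (rule P2_le_scale[OF P(1) _ _ le0]) (simp_all add: nu0_def mal rka)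
  show "nu1 : P2 X" by (rule P2_le_scale[OF P(2) _ _ le1]) (simp_all add: nu1_def mbe rka)
  show "nuta : P2 X" by (rule P2_le_scale[OF P(3) _ _ leT]) (simp_all add: nuta_def ka rka)
 qed
 have acn: "nu0 : P2ac" "nu1 : P2ac" "nuta : P2ac"
  using P2_ac_le[OF ac(1) P2n(1) le0] P2_ac_le[OF ac(2) P2n(2) le1] P2_ac_le[OF ac(3) P2n(3) leT] by simp_all
 obtain et1 where et1: "W2_geodesic X nu0 nuta et1" using ex[OF acn(1,3)] by blast
 obtain et2 where et2: "W2_geodesic X nuta nu1 et2" using ex[OF acn(3,2)] by blast
 define et where "et = (%s. if s <= t then et1 (s/t) else et2 ((s - t)/(1 - t)))"
 have geo: "W2_geodesic X nu0 nu1 et"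
  unfolding et_def by (rule W2_geodesic_concat[OF et1 et2 t WN])
 have ett: "et t = nuta" unfolding et_def using et1 t by (simp add: W2_geodesic_def)
 have z0: "em nu0 (S - A) = 0"
 proof -
  have "em al (S - A) = (II z. w1 z*ind (S - A) (fst z) ||ga1)"
   unfolding al_def using A distr_marginal(1)[OF s(1), of "S - A"] unfolding \<Pi>1_def by (simp add: nn_integral_density)
  also have "... = (II z. 0 ||ga1)" by (intro nn_integral_cong) (auto simp: w1_def indicator_def)
  finally show ?thesis by (simp add: nu0_def)
 qed
 have z1: "em nu1 (S - A) = 0"
 proof -
  have "em be (S - A) = (II z. w2 z*ind (S - A) (snd z) ||ga2)"
   unfolding be_def using A distr_marginal(2)[OF s(3), of "S - A"] unfolding \<Pi>2_def by (simp add: nn_integral_density)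
  also have "... = (II z. 0 ||ga2)" by (intro nn_integral_cong) (auto simp: w2_def indicator_def)
  finally show ?thesis by (simp add: nu1_def)
 qed
 have ge: "en (1 - 2*e)*em (et t) E <= em muta E" if "E : sets B" for E
 proof -
  have "en (1 - 2*e)*em (et t) E <= en ka*(en r*em ze E)"
   unfolding ett nuta_def using kage by (simp add: mult_right_mono ennreal_leI)
  also have "... = em ze E" using rka by (simp add: mult.assoc[symmetric] mult.commute[of "en ka"])
  also have "... <= em muta E" by (rule zele[OF that])
  finally show ?thesis .
 qed
 show ?thesis
  using geo acn z0 z1 le0 le1 ge by blast
qed

end

section \<open>Regular sets and tightness of intermediate measures\<close>

definition sing_nbhd :: "'a pgmms => nat => 'a set" where
 "sing_nbhd X k = {x : mspace (metr X). EX s:sing X. mdist (metr X) x s < 1/2^(k + 1)}"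

lemma regular_set_alt:
 "reg X k = {x : mspace (metr X). mdist (metr X) (pnt X) x <= 2^(k + 1)} - sing_nbhd X k"
 by (simp add: regular_set_def sing_nbhd_def)

locale pgm =
 fixes X :: "'a pgmms"
 assumes pg: "pgmm_space X"
begin

lemma pgD:
 shows "mcomplete_of (metr X)" "separable_space (mtopology_of (metr X))"
  "meas X : meas_off (metr X) (sing X)" "closedin (mtopology_of (metr X)) (sing X)"
  "em (meas X) (sing X) = 0" "pnt X : mspace (metr X)"
proof -
 from pg have 1: "mcomplete_of (metr X) & separable_space (mtopology_of (metr X)) &
   closedin (mtopology_of (metr X)) (sing X) & em (meas X) (sing X) = 0 &
   sing X = singular_set (mtopology_of (metr X)) (meas X) & meas X : meas_qR (metr X) &
   pnt X : msupport (mtopology_of (metr X)) (meas X)"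
  unfolding pgmm_space_def Let_def by blast
 thus "mcomplete_of (metr X)" "separable_space (mtopology_of (metr X))"
  "closedin (mtopology_of (metr X)) (sing X)" "em (meas X) (sing X) = 0" by blast+
 from 1 have "meas X : meas_off (metr X) (singular_set (mtopology_of (metr X)) (meas X))"
  unfolding meas_qR_def by blast
 with 1 show "meas X : meas_off (metr X) (sing X)" by simp
 from 1 show "pnt X : mspace (metr X)" by (simp add: msupport_def)
qed

lemma polish_metr: "polish (metr X)"
 using pgD by unfold_locales auto

sublocale polish "metr X" by (rule polish_metr)

lemma meas_cb: "space (meas X) = S" "sets B <= sets (meas X)"
 using pgD(3) by (auto simp: meas_off_def quasi_radon_measure_def complete_borel_measure_def)

lemma sing_sub: "sing X <= S"
 using closedin_subset[OF pgD(4)] by simp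

lemma sing_nbhd_open: "openin T (sing_nbhd X k)"
proof -
 have "sing_nbhd X k = (\<Union>s\<in>sing X. MS.mball s (1/2^(k + 1)))"
 proof (intro set_eqI iffI)
  fix x assume "x : sing_nbhd X k"
  then obtain s where "x : S" "s : sing X" "d x s < 1/2^(k + 1)" by (auto simp: sing_nbhd_def)
  hence "s : sing X" "x : MS.mball s (1/2^(k + 1))"
   using sing_sub d_commute[of x s] by (auto simp: MS.in_mball)
  thus "x : (\<Union>s\<in>sing X. MS.mball s (1/2^(k + 1)))" by blast
 next
  fix x assume "x : (\<Union>s\<in>sing X. MS.mball s (1/2^(k + 1)))"
  then obtain s where "s : sing X" "x : S" "d s x < 1/2^(k + 1)" by (auto simp: MS.in_mball)
  hence "x : S" "s : sing X" "d x s < 1/2^(k + 1)" using d_commute[of x s] by simp_all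
  thus "x : sing_nbhd X k" unfolding sing_nbhd_def by blast
 qed
 thus ?thesis using openin_ball by auto
qed

lemma regular_closed: "closedin T (reg X k)"
proof -
 have "closedin T (MS.mcball (pnt X) (2^(k + 1)))"
  unfolding mtop by (rule MS.closedin_mcball)
 moreover have "reg X k = MS.mcball (pnt X) (2^(k + 1)) - sing_nbhd X k"
  using pgD(6) by (auto simp: regular_set_alt MS.in_mcball)
 ultimately show ?thesis using sing_nbhd_open by (simp add: closedin_diff)
qed

lemma regular_in_B [measurable, simp]: "reg X k : sets B"
 by (rule borel_of_closed[OF regular_closed])

lemma regular_sub: "reg X k <= S"
 by (auto simp: regular_set_def)

lemma regular_mono: "k <= l ==> reg X k <= reg X l"
proof -
 assume kl: "k <= l"
 have 1: "(2::real)^(k + 1) <= 2^(l + 1)" using kl by (intro power_increasing) auto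
 hence 2: "1/(2::real)^(l + 1) <= 1/2^(k + 1)" by (intro divide_left_mono) auto
 show ?thesis
 proof
  fix x assume "x : reg X k"
  hence x: "x : S" "d (pnt X) x <= 2^(k + 1)" "!!s. s : sing X ==> ~ d x s < 1/2^(k + 1)"
   by (auto simp: regular_set_def)
  have "d (pnt X) x <= 2^(l + 1)" using x(2) 1 by (rule order_trans)
  moreover have "~ d x s < 1/2^(l + 1)" if "s : sing X" for s
   using x(3)[OF that] 2 by linarith
  ultimately show "x : reg X l" using x(1) unfolding regular_set_def by blast
 qed
qed

lemma sing_in_B [simp, measurable]: "sing X : sets B"
 by (rule borel_of_closed[OF pgD(4)])

text \<open>The singular set is closed, so a point outside it has a ball around it free of singular
  points; level \<open>k\<close> contains the point once \<open>2^k\<close> exceeds its distance to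
  the base point and the inverse radius of that ball.\<close>

lemma UN_regular: "(UN k. reg X k) = S - sing X"
proof (intro equalityI subsetI)
 fix x assume "x : (UN k. reg X k)"
 then obtain k where x: "x : S" "!!s. s : sing X ==> ~ d x s < 1/2^(k + 1)"
  by (auto simp: regular_set_def)
 have "x ~: sing X" using x(2)[of x] x(1) by auto
 thus "x : S - sing X" using x by auto
next
 fix x assume x: "x : S - sing X"
 have "openin T (S - sing X)" using pgD(4) by (auto simp: closedin_def)
 then obtain r where r: "0 < r" "MS.mball x r <= S - sing X"
  using x unfolding mtop MS.openin_mtopology by blast
 obtain k1 where k1: "1/2^k1 < r" using real_arch_pow_inv[of r "1/2"] r by (auto simp: power_one_over)
 obtain k2 where k2: "d (pnt X) x < 2^k2" using real_arch_pow[of 2] by auto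
 define k where "k = max k1 k2"
 have "(2::real)^k2 <= 2^(k + 1)" "(2::real)^k1 <= 2^(k + 1)"
  by (intro power_increasing; simp add: k_def)+
 moreover from this have "1/(2::real)^(k + 1) <= 1/2^k1" by (intro divide_left_mono) auto
 ultimately have *: "d (pnt X) x <= 2^(k + 1)" "1/(2::real)^(k + 1) < r" using k1 k2 by linarith+
 have "~ d x s < 1/2^(k + 1)" if s: "s : sing X" for s
 proof
  assume "d x s < 1/2^(k + 1)"
  hence "s : MS.mball x r" using * x s sing_sub by (auto simp: MS.in_mball)
  thus False using r s by auto
 qed
 hence "x : reg X k" using * x by (auto simp: regular_set_def)
 thus "x : (UN k. reg X k)" by auto
qed

text \<open>\<open>sing_nbhd X k\<close> is an admissible neighbourhood of the singular set, so off
  it the measure is Radon and finite on bounded sets. The regular set of level \<open>k\<close> lies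
  there.\<close>

lemma radon_off:
 "radon_measure (subtopology T (S - sing_nbhd X k)) (restrict_space (meas X) (S - sing_nbhd X k))"
 "!!A. A : sets (restrict_space (meas X) (S - sing_nbhd X k)) ==> MS.mbounded A ==>
   em (restrict_space (meas X) (S - sing_nbhd X k)) A < \<infinity>"
proof -
 have nb: "borel_nbhd T (sing X) (sing_nbhd X k)"
  unfolding borel_nbhd_def
 proof (intro conjI exI[of _ "sing_nbhd X k"])
  show "sing X <= sing_nbhd X k"
  proof
   fix s assume "s : sing X"
   thus "s : sing_nbhd X k" using sing_sub unfolding sing_nbhd_def by (auto intro!: bexI[of _ s])
  qed
 qed (auto intro: borel_of_open sing_nbhd_open)
 from pgD(3) have "ALL U. borel_nbhd T (sing X) U -->
    (let R = restrict_space (meas X) (S - U) in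
      radon_measure (subtopology T (S - U)) R &
      (ALL A:sets R. MS.mbounded A --> em R A < \<infinity>))"
  by (simp add: meas_off_def)
 from this[rule_format, OF nb] show
  "radon_measure (subtopology T (S - sing_nbhd X k)) (restrict_space (meas X) (S - sing_nbhd X k))"
  "!!A. A : sets (restrict_space (meas X) (S - sing_nbhd X k)) ==> MS.mbounded A ==>
   em (restrict_space (meas X) (S - sing_nbhd X k)) A < \<infinity>"
  by (simp_all add: Let_def)
qed

lemma off_in_B: "S - sing_nbhd X k : sets B"
 by (intro sets.Diff S_in_B borel_of_open[OF sing_nbhd_open])

lemma sets_off:
 assumes "A : sets B" "A <= reg X k"
 shows "A : sets (restrict_space (meas X) (S - sing_nbhd X k))"
  "em (restrict_space (meas X) (S - sing_nbhd X k)) A = em (meas X) A"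
proof -
 have sub: "A <= S - sing_nbhd X k" using assms by (auto simp: regular_set_alt)
 have "(S - sing_nbhd X k) Int space (meas X) = S - sing_nbhd X k" using meas_cb(1) by auto
 hence o: "(S - sing_nbhd X k) Int space (meas X) : sets (meas X)"
  using off_in_B[of k] meas_cb(2) by (simp add: subsetD)
 thus "A : sets (restrict_space (meas X) (S - sing_nbhd X k))"
  using assms sub meas_cb by (subst sets_restrict_space_iff) auto
 show "em (restrict_space (meas X) (S - sing_nbhd X k)) A = em (meas X) A"
  using o sub by (rule emeasure_restrict_space)
qed

lemma regular_finite: "em (meas X) (reg X k) < top"
proof -
 have "reg X k <= MS.mcball (pnt X) (2^(k + 1))"
  using pgD(6) by (auto simp: regular_set_def MS.in_mcball)
 hence "MS.mbounded (reg X k)" by (meson MS.mbounded_mcball MS.mbounded_subset)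
 thus ?thesis
  using radon_off(2)[of "reg X k" k] sets_off[of "reg X k" k] by simp
qed

lemma sigma_finite_part: "sigma_finite_measure (borel_part (metr X) (meas X))"
proof
 have sub: "subalgebra (meas X) B" using meas_cb by (simp add: subalgebra_def)
 let ?M = "borel_part (metr X) (meas X)"
 have sM: "sets ?M = sets B" unfolding borel_part_def by (rule sets_restr_to_subalg[OF sub])
 have eM: "em ?M A = em (meas X) A" if "A : sets B" for A
  unfolding borel_part_def by (rule emeasure_restr_to_subalg[OF sub that])
 show "EX A. countable A & A <= sets ?M & \<Union> A = space ?M & (ALL a:A. em ?M a ~= \<infinity>)"
 proof (intro exI[of _ "insert (sing X) (range (reg X))"] conjI ballI)
  show "\<Union>(insert (sing X) (range (reg X))) = space ?M"
   using UN_regular sing_sub sets_eq_imp_space_eq[OF sM] by auto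
  show "insert (sing X) (range (reg X)) <= sets ?M"
   unfolding sM using sing_in_B regular_in_B by blast
  show "countable (insert (sing X) (range (reg X)))" by simp
  fix a assume "a : insert (sing X) (range (reg X))"
  then consider "a = sing X" | k where "a = reg X k" by blast
  thus "em ?M a ~= \<infinity>"
  proof cases
   case 1
   show ?thesis unfolding 1 eM[OF sing_in_B] pgD(5) by simp
  next
   case 2
   show ?thesis unfolding 2 eM[OF regular_in_B] using regular_finite[of k] by simp
  qed
 qed
qed

sublocale mms "metr X" "meas X"
 by (rule mms.intro[OF polish_metr mms_axioms.intro]) (rule meas_cb sigma_finite_part)+

lemma M_regular: "em M (reg X k) < top"
 using regular_finite emeasure_M by simp

lemma M_sing: "em M (sing X) = 0"
 using pgD(5) emeasure_M by simp

text \<open>Inner regularity is given for the subspace measure off \<open>sing_nbhd X k\<close>,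
  which agrees with the original measure on subsets of \<open>reg X k\<close>. Finiteness turns the
  supremum into smallness of the difference set.\<close>

lemma compact_approx:
 assumes A: "A : sets B" "A <= reg X k" and e: "0 < e"
 shows "EX K<=A. K : sets B & compactin T K & em M (A - K) <= en e"
proof -
 let ?R = "restrict_space (meas X) (S - sing_nbhd X k)"
 have eA: "em (meas X) A < top"
  using A regular_finite[of k] meas_cb by (intro le_less_trans[OF emeasure_mono regular_finite[of k]]) auto
 have ir: "inner_regular (compactin (subtopology T (S - sing_nbhd X k))) ?R"
  using radon_off(1)[of k] by (simp add: radon_measure_def)
 have sup: "em (meas X) A = (SUP F\<in>{F\<in>sets ?R. compactin (subtopology T (S - sing_nbhd X k)) F & F <= A}. em ?R F)"
  unfolding sets_off(2)[OF A, symmetric]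
  by (rule bspec[OF ir[unfolded inner_regular_def] sets_off(1)[OF A]])
 have ne: "{F:sets ?R. compactin (subtopology T (S - sing_nbhd X k)) F & F <= A} ~= {}"
  by (auto intro!: exI[of _ "{}"])
 obtain F where F: "F : sets ?R" "compactin (subtopology T (S - sing_nbhd X k)) F" "F <= A"
   "em (meas X) A <= em ?R F + en e"
 proof (cases "em (meas X) A = 0")
  case True
  thus thesis by (intro that[of "{}"]) auto
 next
  case False
  obtain a where a: "em (meas X) A = en a" "0 <= a" using eA by (cases "em (meas X) A") auto
  hence "0 < a" using False by (cases "a = 0") auto
  hence "em (meas X) A - en e < em (meas X) A"
   unfolding a(1) using e by (simp add: ennreal_minus ennreal_lessI)
  then obtain F where F: "F:sets ?R" "compactin (subtopology T (S - sing_nbhd X k)) F" "F <= A"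
    "em (meas X) A - en e < em ?R F"
   unfolding sup less_SUP_iff by blast
  have "em (meas X) A <= en e + em ?R F"
   using less_imp_le[OF F(4)] by (simp add: ennreal_minus_le_iff)
  thus thesis using F(1-3) by (intro that[of F]) (simp_all add: add.commute)
 qed
 have cF: "compactin T F" using F(2) by (simp add: compactin_subtopology)
 have "Hausdorff_space T" unfolding mtop by (rule MS.Hausdorff_space_mtopology)
 hence FB: "F : sets B" using cF by (intro borel_of_closed compactin_imp_closedin)
 have eF: "em ?R F = em M F"
  using sets_off(2)[OF FB, of k] F(3) A(2) emeasure_M[OF FB] by auto
 have fF: "em M F < top"
  using emeasure_mono[OF F(3), of M] A(1) eA emeasure_M[OF A(1)] by auto
 have "em M F + em M (A - F) = em M A"
  using FB A F(3) by (subst plus_emeasure) (auto intro!: arg_cong[where f="em M"])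
 also have "... <= em M F + en e" using F(4) eF emeasure_M[OF A(1)] by simp
 finally have "em M (A - F) <= en e"
  using fF by (subst (asm) ennreal_add_left_cancel_le) auto
 thus ?thesis using F(3) FB cF by blast
qed

lemma ac_regular_tendsto:
 assumes "absolutely_continuous M mu" "sets mu = sets B" "em mu S < top"
 shows "(%k. em mu (S - reg X k)) ----> 0"
proof -
 have "(%k. em mu (S - reg X k)) ----> em mu (INT k. S - reg X k)"
 proof (rule Lim_emeasure_decseq)
  show "range (%k. S - reg X k) <= sets mu"
   unfolding assms(2) image_subset_iff by (intro ballI sets.Diff S_in_B regular_in_B)
  show "decseq (%k. S - reg X k)"
   unfolding decseq_def by (intro allI impI Diff_mono order_refl regular_mono)
  show "em mu (S - reg X k) ~= \<infinity>" for k
  proof -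
   have "em mu (S - reg X k) <= em mu S"
    using assms(2) by (intro emeasure_mono) simp_all
   hence "em mu (S - reg X k) < top" using assms(3) by (rule le_less_trans)
   thus ?thesis by simp
  qed
 qed
 also have "(INT k. S - reg X k) = S - (UN k. reg X k)" by blast
 also have "... = sing X" unfolding UN_regular using sing_sub by blast
 also have "em mu (sing X) = 0"
 proof -
  have "sing X : null_sets M" using M_sing by (simp add: null_sets_def)
  hence "sing X : null_sets mu" using assms(1) unfolding absolutely_continuous_def by blast
  thus ?thesis by (simp add: null_sets_def)
 qed
 finally show ?thesis .
qed

text \<open>\<open>restrict_geodesic\<close> supplies marginals supported in \<open>reg X l\<close>
  that have at most twice the original mass on each set, so their entropies grow at most by the
  factor \<open>2 powr ((N - 1)/N)\<close>; this is the bound inserted into \<omega>. Uniform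
  convexity controls the resulting geodesic at \<open>t\<close>, and \<open>1 - 2*e\<close> times
  that measure is dominated by the original one.\<close>

lemma uniform_tight:
 assumes CD: "CD_space K N (metr X) (meas X)" and uc: "uniformly_convex_space N \<omega> X" and N: "N < 0"
  and ac: "mu0 : P2ac" "mu1 : P2ac" "et' t : P2ac"
  and t: "0 < t" "t < 1" and geo: "W2_geodesic (metr X) mu0 mu1 et'"
  and R: "ren N mu0 <= en M0" "ren N mu1 <= en M0" "0 < M0"
  and e: "0 <= e" "e <= 1/4"
  and mA: "em mu0 (S - reg X l) <= en e" "em mu1 (S - reg X l) <= en e"
 shows "em (et' t) (S - reg X h) <= en (2*e + \<omega> l h (2 powr ((N - 1)/N)*M0))"
proof -
 have ex: "(EX pl. W2_optimal (metr X) mu nu pl) & (EX et. W2_geodesic (metr X) mu nu et)"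
  if "mu : P2ac" "nu : P2ac" for mu nu
  using CD that unfolding CD_space_def by blast
 have Wt: "W2 (metr X) mu0 (et' t) = t*W2 (metr X) mu0 mu1" "W2 (metr X) (et' t) mu1 = (1 - t)*W2 (metr X) mu0 mu1"
 proof -
  have g: "et' 0 = mu0" "et' 1 = mu1"
   "!!s r. s : {0..1} ==> r : {0..1} ==> W2 (metr X) (et' s) (et' r) = \<bar>s - r\<bar>*W2 (metr X) mu0 mu1"
   using geo unfolding W2_geodesic_def by blast+
  have t01: "t : {0..1}" using t by simp
  show "W2 (metr X) mu0 (et' t) = t*W2 (metr X) mu0 mu1"
   using g(3)[of 0 t] t01 t unfolding g(1) by simp
  show "W2 (metr X) (et' t) mu1 = (1 - t)*W2 (metr X) mu0 mu1"
   using g(3)[of t 1] t01 t unfolding g(2) by simp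
 qed
 obtain nu0 nu1 et where n: "W2_geodesic (metr X) nu0 nu1 et" "nu0 : P2ac" "nu1 : P2ac"
   "em nu0 (S - reg X l) = 0" "em nu1 (S - reg X l) = 0"
  and le: "!!E. E : sets B ==> em nu0 E <= 2*em mu0 E"
   "!!E. E : sets B ==> em nu1 E <= 2*em mu1 E"
   "!!E. E : sets B ==> en (1 - 2*e)*em (et t) E <= em (et' t) E"
  using restrict_geodesic[OF ex ac t Wt regular_in_B e mA] by blast
 let ?M = "2 powr ((N - 1)/N)*M0"
 have M: "0 < ?M" using R(3) by simp
 have P: "nu0 : P2 (metr X)" "nu1 : P2 (metr X)" using n by (auto simp: P2_ac_def)
 have two: "epowr 2 a = en (2 powr a)" for a using epowr_ennreal[of 2 a] by simp
 have r: "ren N nu <= en ?M"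
  if "mu : P2ac" "nu : P2ac" "!!E. E : sets B ==> em nu E <= 2*em mu E"
   and R: "ren N mu <= en M0" for mu nu
 proof -
  have "ren N nu <= epowr 2 ((N - 1)/N)*ren N mu"
   by (rule renyi_le_scale[OF that(1-3) _ N]) auto
  also have "... <= epowr 2 ((N - 1)/N)*en M0" by (intro mult_left_mono R) auto
  also have "... = en ?M" using \<open>0 < M0\<close> by (simp add: two ennreal_mult)
  finally show ?thesis .
 qed
 note r01 = r[OF ac(1) n(2) le(1) R(1)] r[OF ac(2) n(3) le(2) R(2)]
 have op: "openin T (S - reg X l)" using regular_closed[of l] by (simp add: closedin_def)
 have sup: "msupport T nu <= reg X l" if z: "em nu (S - reg X l) = 0" for nu
 proof
  fix x assume x: "x : msupport T nu"
  show "x : reg X l"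
  proof (rule ccontr)
   assume "x ~: reg X l"
   hence "0 < em nu (S - reg X l)" using x op by (auto simp: msupport_def)
   thus False using z by simp
  qed
 qed
 have om: "\<omega> l h ?M : {0..1}" using uc M unfolding uniformly_convex_space_def by blast
 from uc have "ALL k h. ALL M>0. ALL mu\<^sub>0:P2 (metr X). ALL mu\<^sub>1:P2 (metr X). ALL mut.
    ren N mu\<^sub>0 <= en M & ren N mu\<^sub>1 <= en M &
    msupport T mu\<^sub>0 <= reg X k & msupport T mu\<^sub>1 <= reg X k &
    W2_geodesic (metr X) mu\<^sub>0 mu\<^sub>1 mut -->
    (ALL t:{0..1}. measure (mut t) (reg X h) >= 1 - \<omega> k h M)"
  unfolding uniformly_convex_space_def by blast
 from this[rule_format, OF M P, of l et t h] have m: "1 - \<omega> l h ?M <= measure (et t) (reg X h)"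
  using r01 sup[OF n(4)] sup[OF n(5)] n(1) t by auto
 have Pt: "et t : P2 (metr X)" using n(1) t by (simp add: W2_geodesic_def)
 have Pt': "et' t : P2 (metr X)" using ac(3) by (simp add: P2_ac_def)
 interpret E: prob_space "et t" by (rule P2D(3)[OF Pt])
 interpret E': prob_space "et' t" by (rule P2D(3)[OF Pt'])
 have "en ((1 - 2*e) * measure (et t) (reg X h)) <= en (measure (et' t) (reg X h))"
  using le(3)[OF regular_in_B, of h] e by (simp add: E.emeasure_eq_measure E'.emeasure_eq_measure ennreal_mult')
 hence "(1 - 2*e) * measure (et t) (reg X h) <= measure (et' t) (reg X h)"
  by (subst (asm) ennreal_le_iff) auto
 moreover have "(1 - 2*e)*(1 - \<omega> l h ?M) <= (1 - 2*e) * measure (et t) (reg X h)"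
  using m e by (intro mult_left_mono) auto
 moreover have "1 - (2*e + \<omega> l h ?M) <= (1 - 2*e)*(1 - \<omega> l h ?M)"
  using e om by (simp add: algebra_simps)
 ultimately have "1 - (2*e + \<omega> l h ?M) <= measure (et' t) (reg X h)" by linarith
 moreover have "measure (et' t) (S - reg X h) = 1 - measure (et' t) (reg X h)"
  using E'.prob_compl[of "reg X h"] P2D(1,2)[OF Pt'] by simp
 ultimately show ?thesis
  unfolding E'.emeasure_eq_measure by (intro ennreal_leI) linarith
qed

end

subsection \<open>Transfer kernels from near-optimal couplings of cuts\<close>

lemma isometric_embedding_measurable:
 assumes "isometric_embedding X Z i"
 shows "i : borel_of (mtopology_of X) \<rightarrow>\<^sub>M borel_of (mtopology_of Z)"
proof (rule measurable_continuous_map)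
 interpret MX: Metric_space "mspace X" "mdist X" by (rule Metric_space_mspace_mdist)
 interpret MZ: Metric_space "mspace Z" "mdist Z" by (rule Metric_space_mspace_mdist)
 have i: "!!x. x : mspace X ==> i x : mspace Z"
  "!!x y. x : mspace X ==> y : mspace X ==> mdist Z (i x) (i y) = mdist X x y"
  using assms by (auto simp: isometric_embedding_def)
 show "continuous_map (mtopology_of X) (mtopology_of Z) i"
  unfolding continuous_map_def
 proof (intro conjI allI impI)
  show "i : topspace (mtopology_of X) \<rightarrow> topspace (mtopology_of Z)" using i(1) by simp
  fix U assume U: "openin (mtopology_of Z) U"
  have "openin MX.mtopology {x : mspace X. i x : U}"
   unfolding MX.openin_mtopology
  proof (intro conjI ballI allI impI)
   fix x assume x: "x : {x : mspace X. i x : U}"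
   then obtain r where r: "0 < r" "MZ.mball (i x) r <= U"
    using U unfolding mtopology_of_def MZ.openin_mtopology by blast
   have "MX.mball x r <= {x : mspace X. i x : U}"
   proof
    fix y assume "y : MX.mball x r"
    hence y: "y : mspace X" "mdist X x y < r" using x by (auto simp: MX.in_mball)
    hence "i y : MZ.mball (i x) r" using x i by (simp add: MZ.in_mball)
    thus "y : {x : mspace X. i x : U}" using y r by auto
   qed
   thus "EX r>0. MX.mball x r <= {x : mspace X. i x : U}" using r by blast
  qed auto
  thus "openin (mtopology_of X) {x : topspace (mtopology_of X). i x : U}"
   by (simp add: mtopology_of_def)
 qed
qed

text \<open>The profile is Lipschitz only on \<open>{0..}\<close>; composing it with
  \<open>max 0\<close> gives a continuous function on the line that agrees with it on
  distances.\<close>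

lemma cut_profile_measurable:
 assumes "cut_profile f" "g : bm M" "!!x. 0 <= g x"
 shows "(%x. f (g x)) : bm M"
proof -
 obtain L where L: "L-lipschitz_on {0..} f" using assms(1) by (auto simp: cut_profile_def)
 hence "continuous_on {0..} f" by (rule lipschitz_on_continuous_on)
 hence "continuous_on UNIV (%s. f (max 0 s))"
  by (rule continuous_on_compose2) (auto intro!: continuous_intros)
 hence "(%s. f (max 0 s)) : bm borel" by (rule borel_measurable_continuous_onI)
 hence "(%x. f (max 0 (g x))) : bm M" using assms(2) by (rule measurable_compose[rotated])
 thus ?thesis using assms(3) by (simp add: max_absorb2)
qed

section \<open>Cuts of a space\<close>

context pgm
begin

lemma dist_sing_continuous:
 assumes "sing X ~= {}"
 shows "(%x. INF s\<in>sing X. d x s) : bm B"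
proof (rule borel_measurableI_less)
 fix y :: real
 have bdd: "bdd_below ((%s. d x s) ` sing X)" for x by (intro bdd_belowI[of _ 0]) auto
 have "{x : S. (INF s\<in>sing X. d x s) < y} = (\<Union>s\<in>sing X. MS.mball s y)"
 proof (intro set_eqI iffI)
  fix x assume "x : {x : S. (INF s\<in>sing X. d x s) < y}"
  hence x: "x : S" "(INF s\<in>sing X. d x s) < y" by auto
  then obtain s where "s : sing X" "d x s < y" unfolding cINF_less_iff[OF assms bdd] by blast
  hence "s : sing X" "x : MS.mball s y" using x sing_sub d_commute[of x s] by (auto simp: MS.in_mball)
  thus "x : (\<Union>s\<in>sing X. MS.mball s y)" by blast
 next
  fix x assume "x : (\<Union>s\<in>sing X. MS.mball s y)"
  then obtain s where s: "s : sing X" "x : S" "d s x < y" by (auto simp: MS.in_mball)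
  hence "d x s < y" using d_commute[of x s] by simp
  hence "(INF s\<in>sing X. d x s) < y" unfolding cINF_less_iff[OF assms bdd] using s(1) by blast
  thus "x : {x : S. (INF s\<in>sing X. d x s) < y}" using s by simp
 qed
 moreover have "openin T (\<Union>s\<in>sing X. MS.mball s y)" using openin_ball by auto
 ultimately show "{x : space B. (INF s\<in>sing X. d x s) < y} : sets B"
  using borel_of_open[of T "\<Union>s\<in>sing X. MS.mball s y"] by simp
qed

lemma dist_sing_nonneg: "sing X ~= {} ==> 0 <= (INF s\<in>sing X. d x s)"
 by (intro cINF_greatest) auto

lemma cut_fun_measurable:
 assumes "cut_profile f" shows "cut_fun f X k : bm B"
proof -
 have p: "pnt X : S" by (rule pgD(6))
 have [measurable]: "(%x. f (d x (pnt X)/2^k)) : bm B"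
 proof (rule cut_profile_measurable[OF assms])
  have "(%x. d x (pnt X)) : bm B" by (rule measurable_mdist) (use p in simp_all)
  thus "(%x. d x (pnt X)/2^k) : bm B" by simp
 qed simp
 show ?thesis
 proof (cases "sing X = {}")
  case True thus ?thesis unfolding cut_fun_def by simp
 next
  case False
  have [measurable]: "(%x. f ((INF s\<in>sing X. d x s)*2^k)) : bm B"
   using dist_sing_continuous[OF False] dist_sing_nonneg[OF False]
   by (intro cut_profile_measurable[OF assms] borel_measurable_times) auto
  show ?thesis unfolding cut_fun_def using False by simp
 qed
qed

lemma cut_fun_range:
 assumes "cut_profile f" shows "0 <= cut_fun f X k x" "cut_fun f X k x <= 1"
proof -
 have f: "0 <= f s & f s <= 1" if "0 <= s" for s using assms that by (auto simp: cut_profile_def)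
 have 1: "0 <= f (d x (pnt X)/2^k) & f (d x (pnt X)/2^k) <= 1" by (rule f) simp
 have 2: "sing X ~= {} ==> 0 <= f ((INF s\<in>sing X. d x s)*2^k) & f ((INF s\<in>sing X. d x s)*2^k) <= 1"
  using dist_sing_nonneg[of x] by (intro f) auto
 show "0 <= cut_fun f X k x" "cut_fun f X k x <= 1"
  unfolding cut_fun_def using 1 2 by (cases "sing X = {}"; simp add: mult_le_one)+
qed

text \<open>A point of \<open>reg X l\<close> has distance at least \<open>1/2^(l + 1)\<close> from
  the singular set. Multiplied by \<open>2^k\<close> this must reach 2, where the profile vanishes;
  hence the gap of two between \<open>l\<close> and \<open>k\<close>.\<close>

lemma cut_fun_eq_1:
 assumes f: "cut_profile f" and x: "x : reg X l" and l: "l + 2 <= k"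
 shows "cut_fun f X k x = 1"
proof -
 have "d (pnt X) x <= 2^(l + 1)" using x by (auto simp: regular_set_def)
 also have "(2::real)^(l + 1) <= 2^k" using l by (intro power_increasing) auto
 finally have "d x (pnt X)/2^k <= 1" by (simp add: d_commute[of x] divide_le_eq)
 hence 1: "f (d x (pnt X)/2^k) = 1" using f by (auto simp: cut_profile_def)
 have 2: "f ((INF s\<in>sing X. d x s)*2^k) = 0" if ne: "sing X ~= {}"
 proof -
  have "1/2^(l + 1) <= (INF s\<in>sing X. d x s)"
   using x ne by (intro cINF_greatest) (auto simp: regular_set_def not_less)
  hence "1/2^(l + 1)*2^k <= (INF s\<in>sing X. d x s)*2^k" by (intro mult_right_mono) auto
  moreover have "(2::real) <= 1/2^(l + 1)*2^k"
  proof -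
   have "(2::real)^(l + 2) <= 2^k" using l by (intro power_increasing) auto
   thus ?thesis by (simp add: field_simps)
  qed
  ultimately show ?thesis using f by (auto simp: cut_profile_def)
 qed
 show ?thesis unfolding cut_fun_def using 1 2 by simp
qed

lemma cut_fun_support:
 assumes f: "cut_profile f" and x: "x : S" "cut_fun f X k x ~= 0"
 shows "x : reg X k"
proof -
 have 1: "f (d x (pnt X)/2^k) ~= 0" using x(2) by (auto simp: cut_fun_def)
 have "d x (pnt X)/2^k < 2"
 proof (rule ccontr)
  assume "~ ?thesis"
  thus False using 1 f by (auto simp: cut_profile_def)
 qed
 hence d: "d (pnt X) x <= 2^(k + 1)" by (simp add: d_commute[of x] divide_less_eq)
 have "~ d x s < 1/2^(k + 1)" if s: "s : sing X" for s
 proof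
  assume lt: "d x s < 1/2^(k + 1)"
  have ne: "sing X ~= {}" using s by auto
  have "(INF s\<in>sing X. d x s) <= d x s"
   using s by (intro cINF_lower bdd_belowI[of _ 0]) auto
  hence "(INF s\<in>sing X. d x s)*2^k <= d x s*2^k" by (intro mult_right_mono) auto
  also have "... <= 1" using lt by (simp add: field_simps)
  finally have "f ((INF s\<in>sing X. d x s)*2^k) = 1"
   using f dist_sing_nonneg[OF ne, of x] by (auto simp: cut_profile_def)
  thus False using x(2) ne by (simp add: cut_fun_def)
 qed
 thus ?thesis using x(1) d unfolding regular_set_def by blast
qed

lemma nn_integral_M: "g : bm B ==> (II x. g x ||M) = (II x. g x ||meas X)"
 unfolding borel_part_def by (rule nn_integral_subalgebra2[OF subalg])

lemma measurable_meas: "g : B \<rightarrow>\<^sub>M N ==> g : meas X \<rightarrow>\<^sub>M N"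
 using subalg by (rule measurable_from_subalg)

definition cut_mass :: "(real => real) => nat => ennreal" where
 "cut_mass f k = em (meas (cut f X k)) (space (meas (cut f X k)))"

lemma cut_mass_eq:
 assumes "cut_profile f"
 shows "cut_mass f k = (II x. en (cut_fun f X k x) ||M)"
proof -
 have m: "(%x. en (cut_fun f X k x)) : bm B" using cut_fun_measurable[OF assms] by simp
 have "cut_mass f k = (II x. en (cut_fun f X k x)*ind (space (meas X)) x ||meas X)"
  unfolding cut_mass_def cut_def using measurable_meas[OF m] by (simp add: emeasure_density)
 also have "... = (II x. en (cut_fun f X k x) ||meas X)" by (intro nn_integral_cong) simp
 finally show ?thesis using nn_integral_M[OF m] by simp
qed

lemma cut_mass_finite:
 assumes "cut_profile f" shows "cut_mass f k < top"
proof -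
 have "cut_mass f k <= (II x. ind (reg X k) x ||M)"
  unfolding cut_mass_eq[OF assms]
 proof (rule nn_integral_mono)
  fix x assume "x : space M"
  thus "en (cut_fun f X k x) <= ind (reg X k) x"
   using cut_fun_range[OF assms, of k x] cut_fun_support[OF assms, of x k]
   by (cases "cut_fun f X k x = 0") (auto simp: ennreal_le_1)
 qed
 also have "... = em M (reg X k)" by simp
 also have "... < top" by (rule M_regular)
 finally show ?thesis .
qed

text \<open>Multiplication by the cut mass undoes the normalisation and leaves an integral over the
  original space.\<close>

lemma nn_integral_cut_distr:
 assumes f: "cut_profile f" and pos: "0 < cut_mass f k"
  and i: "i : B \<rightarrow>\<^sub>M N" and g: "g : bm N"
 shows "cut_mass f k*(II z. g z ||distr (normalized (meas (cut f X k))) N i) =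
  (II x. en (cut_fun f X k x)*g (i x) ||M)"
proof -
 let ?m = "density (meas X) (%x. en (cut_fun f X k x))"
 have m: "(%x. en (cut_fun f X k x)) : bm B" using cut_fun_measurable[OF f] by simp
 have gi: "(%x. g (i x)) : bm B" using i g by simp
 have n: "normalized (meas (cut f X k)) = scale_measure (inverse (cut_mass f k)) ?m"
  by (simp add: normalized_def cut_mass_def cut_def)
 have i': "i : scale_measure (inverse (cut_mass f k)) ?m \<rightarrow>\<^sub>M N"
  using measurable_meas[OF i] by (simp cong: measurable_cong_sets)
 have "(II z. g z ||distr (normalized (meas (cut f X k))) N i) = (II x. g (i x) ||scale_measure (inverse (cut_mass f k)) ?m)"
  unfolding n using g by (intro nn_integral_distr[OF i']) simp
 also have "... = inverse (cut_mass f k)*(II x. g (i x) ||?m)"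
  using measurable_meas[OF gi] by (intro nn_integral_scale_measure) (simp cong: measurable_cong_sets)
 also have "(II x. g (i x) ||?m) = (II x. en (cut_fun f X k x)*g (i x) ||meas X)"
  using measurable_meas[OF gi] measurable_meas[OF m] by (intro nn_integral_density)
 also have "... = (II x. en (cut_fun f X k x)*g (i x) ||M)"
  by (intro nn_integral_M[symmetric] borel_measurable_times_ennreal m gi)
 finally have "cut_mass f k*(II z. g z ||distr (normalized (meas (cut f X k))) N i) =
   (cut_mass f k*inverse (cut_mass f k))*(II x. en (cut_fun f X k x)*g (i x) ||M)"
  by (simp only: mult.assoc)
 also have "cut_mass f k*inverse (cut_mass f k) = 1"
 proof -
  obtain z where z: "cut_mass f k = en z" "0 < z"
   using pos cut_mass_finite[OF f, of k] by (cases "cut_mass f k") auto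
  show ?thesis unfolding z(1) using z(2) by (simp add: inverse_ennreal ennreal_mult'[symmetric])
 qed
 finally show ?thesis by simp
qed

text \<open>The profile need not be monotone, so cuts are compared across a gap of two levels: where
  the \<open>k\<close>-th cut function is positive the \<open>l\<close>-th one equals 1.\<close>

lemma cut_mass_mono_pos:
 assumes f: "cut_profile f" and pos: "0 < cut_mass f k" and kl: "k + 2 <= l"
 shows "0 < cut_mass f l"
proof -
 have "cut_mass f k <= cut_mass f l"
  unfolding cut_mass_eq[OF f]
 proof (rule nn_integral_mono)
  fix x assume "x : space M"
  hence x: "x : S" by simp
  show "en (cut_fun f X k x) <= en (cut_fun f X l x)"
  proof (cases "cut_fun f X k x = 0")
   case False
   hence "cut_fun f X l x = 1" using cut_fun_eq_1[OF f cut_fun_support[OF f x] kl] by blast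
   thus ?thesis using cut_fun_range[OF f, of k x] by (intro ennreal_leI) simp
  qed simp
 qed
 thus ?thesis using pos by simp
qed

end

text \<open>What remains of a near-optimal coupling once the ambient space is forgotten.
  \<open>h i\<close> is the density on \<open>Y\<close> of the mass coming from the cell
  \<open>C i\<close>, and \<open>c\<close> is the ratio of the two cut masses, so that
  \<open>h i\<close> integrates to almost \<open>c\<close> times the measure of \<open>C i\<close>.
  Linked points have nearly equal mutual distances, and their regularity levels differ by at most
  one. The defect on the side of \<open>Y\<close> is measured on \<open>reg Y (L - 1)\<close>,
  because nearby partners of its points lie in \<open>reg X L\<close>.\<close>

definition transfer :: "'a pgmms => 'b pgmms => nat => real => (nat => 'a set) => (nat => 'b => ennreal) => real => bool" where
 "transfer X Y L de C h c \<longleftrightarrow>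
  (ALL i. C i : sets (borel_of (mtopology_of (metr X)))) & disjoint_family C & (UN i. C i) = reg X L &
  (ALL i. h i : bm (borel_of (mtopology_of (metr Y)))) & (ALL y. (\<Sum>i. h i y) <= 1) &
  1 - de <= c & c <= 1 + de &
  (ALL i. (II y. h i y ||borel_part (metr Y) (meas Y)) <= en c*em (borel_part (metr X) (meas X)) (C i)) &
  (\<Sum>i. en c*em (borel_part (metr X) (meas X)) (C i) - (II y. h i y ||borel_part (metr Y) (meas Y))) <= en de &
  (II y. (1 - (\<Sum>i. h i y))*ind (reg Y (L - 1)) y ||borel_part (metr Y) (meas Y)) <= en de &
  (ALL i i' x x' y y'. x : C i --> x' : C i' --> y : mspace (metr Y) --> y' : mspace (metr Y) -->
    h i y ~= 0 --> h i' y' ~= 0 --> \<bar>mdist (metr X) x x' - mdist (metr Y) y y'\<bar> <= de) &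
  (ALL i x y l. l <= L --> x : C i --> y : mspace (metr Y) --> h i y ~= 0 -->
    (x : reg X l --> y : reg Y (Suc l)) & (y : reg Y l --> x : reg X (Suc l)))"

text \<open>A displacement of \<open>3*r\<close> is small against both radii defining level
  \<open>l\<close>, and the next level doubles the ball and halves the excluded
  neighbourhood.\<close>

lemma regular_set_transfer:
 assumes x: "x : reg X l" and r: "3*r <= 2^(l + 1)" "3*r <= 1/2^(l + 2)"
  and y: "y : mspace (metr Y)" "mdist (metr Y) (pnt Y) y <= 3*r + mdist (metr X) (pnt X) x"
  and s: "!!s'. s' : sing Y ==> EX s:sing X. mdist (metr X) x s <= 3*r + mdist (metr Y) y s'"
 shows "y : reg Y (Suc l)"
proof -
 have x': "mdist (metr X) (pnt X) x <= 2^(l + 1)" "!!s. s : sing X ==> ~ mdist (metr X) x s < 1/2^(l + 1)"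
  using x unfolding regular_set_def by blast+
 have p2: "(2::real)^(Suc l + 1) = 2^(l + 1) + 2^(l + 1)" "1/2^(l + 2) + 1/2^(l + 2) = 1/(2::real)^(l + 1)"
  by (simp_all add: field_simps)
 have "mdist (metr Y) (pnt Y) y <= 2^(Suc l + 1)" using y(2) x'(1) r(1) p2 by linarith
 moreover have "1/2^(l + 2) <= mdist (metr Y) y s'" if "s' : sing Y" for s'
  using s[OF that] x'(2) r(2) p2 by fastforce
 hence "~ mdist (metr Y) y s' < 1/2^(Suc l + 1)" if "s' : sing Y" for s' using that by (simp add: not_less)
 ultimately show ?thesis using y(1) unfolding regular_set_def by blast
qed

text \<open>The coupling is cut along a partition of \<open>Z\<close> into cells of diameter below
  \<open>r\<close>, restricted to the trace of \<open>reg X L\<close>; from each cell only mass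
  landing in its \<open>r\<close>-neighbourhood is kept. The second marginal of this piece has a
  density relative to the cut of \<open>Y\<close>, and multiplying by the cut function gives
  \<open>h\<close>. All losses are paid by the set \<open>bd\<close> of pairs at distance at least
  \<open>r\<close>.\<close>

lemma transfer_core:
 fixes X :: "'a pgmms" and Y :: "'b pgmms" and Z :: "'c metric"
 assumes pX: "pgm X" and pY: "pgm Y" and pZ: "polish Z"
  and i: "isometric_embedding (metr X) Z i" and j: "isometric_embedding (metr Y) Z j"
  and f: "cut_profile f"
  and zx: "0 < pgm.cut_mass X f k" and zy: "0 < pgm.cut_mass Y f k"
  and G: "Ga : couplings Z (distr (normalized (meas (cut f X k))) (borel_of (mtopology_of Z)) i)
    (distr (normalized (meas (cut f Y k))) (borel_of (mtopology_of Z)) j)"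
  and r: "0 < r" "4*r <= de" "3*r <= 1/2^(L + 2)" and L: "1 <= L" "L + 2 <= k"
  and pp: "mdist Z (i (pnt X)) (j (pnt Y)) < r"
  and ss1: "!!s. s : sing X ==> EX s':sing Y. mdist Z (i s) (j s') < r"
  and ss2: "!!s'. s' : sing Y ==> EX s:sing X. mdist Z (i s) (j s') < r"
  and bad: "pgm.cut_mass Y f k*em Ga {z : mspace Z \<times> mspace Z. r <= mdist Z (fst z) (snd z)} <= en de"
  and c: "pgm.cut_mass Y f k = en c*pgm.cut_mass X f k" "1 - de <= c" "c <= 1 + de"
 shows "EX C h. transfer X Y L de C h c"
proof -
 interpret X: pgm X by fact
 interpret Y: pgm Y by fact
 interpret Z: polish Z by fact
 have pow1: "1/2^n <= (1::real)" for n :: nat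
  using one_le_power[of "2::real" n] by (simp add: divide_le_eq)
 have iS: "!!x. x : X.S ==> i x : Z.S" "!!x y. x : X.S ==> y : X.S ==> Z.d (i x) (i y) = X.d x y"
  using i unfolding isometric_embedding_def by auto
 have jS: "!!x. x : Y.S ==> j x : Z.S" "!!x y. x : Y.S ==> y : Y.S ==> Z.d (j x) (j y) = Y.d x y"
  using j unfolding isometric_embedding_def by auto
 have im: "i : X.B \<rightarrow>\<^sub>M Z.B" and jm: "j : Y.B \<rightarrow>\<^sub>M Z.B"
  using isometric_embedding_measurable[OF i] isometric_embedding_measurable[OF j] .
 note [measurable] = im jm
 define al where "al = distr (normalized (meas (cut f X k))) Z.B i"
 define be where "be = distr (normalized (meas (cut f Y k))) Z.B j"
 define zX where "zX = X.cut_mass f k"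
 define zY where "zY = Y.cut_mass f k"
 have G': "Ga : couplings Z al be" using G unfolding al_def be_def .
 note cp = Z.couplingsD[OF G']
 have zYfin: "zY < top" unfolding zY_def by (rule Y.cut_mass_finite[OF f])
 have Ia: "zX*(II z. g z ||al) = (II x. en (cut_fun f X k x)*g (i x) ||X.M)" if "g : bm Z.B" for g
  unfolding zX_def al_def by (rule X.nn_integral_cut_distr[OF f zx im that])
 have Ib: "zY*(II z. g z ||be) = (II y. en (cut_fun f Y k y)*g (j y) ||Y.M)" if "g : bm Z.B" for g
  unfolding zY_def be_def by (rule Y.nn_integral_cut_distr[OF f zy jm that])
 have [measurable_cong]: "sets al = sets Z.B" "sets be = sets Z.B" "sets Ga = sets Z.BB" by (rule cp)+
 have bS: "em be Z.S < top"
 proof -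
  have "zY*em be Z.S = zY*(II z. ind Z.S z ||be)" using cp by simp
  also have "... = (II y. en (cut_fun f Y k y)*ind Z.S (j y) ||Y.M)" by (rule Ib) simp
  also have "... <= (II y. en (cut_fun f Y k y) ||Y.M)" by (intro nn_integral_mono) (auto simp: indicator_def)
  also have "... = zY" unfolding zY_def by (rule Y.cut_mass_eq[OF f, symmetric])
  finally have "zY*em be Z.S <= zY" .
  thus ?thesis using zYfin zy unfolding zY_def[symmetric] by (metis ennreal_mult_top less_top not_gr_zero top.not_eq_extremum top_unique)
 qed
 have GS: "em Ga E < top" for E
 proof -
  have "em Ga E <= em Ga (space Ga)" by (rule emeasure_space)
  also have "... = em be Z.S" using cp(2) cp(8)[of Z.S] by simp
  finally show ?thesis using bS by (rule le_less_trans)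
 qed
 have finbe: "finite_measure be" using bS cp(6) by (intro finite_measureI) (simp add: less_top)
 interpret be: finite_measure be by fact

 \<comment> \<open>Borel sets of \<open>Z\<close> whose traces on the embedded spaces are
   \<open>reg X L\<close> and \<open>reg Y (L - 1)\<close>. Using traces instead of images keeps
   measurability immediate.\<close>
 define RR where "RR = Z.MS.mcball (i (pnt X)) (2^(L + 1)) - (\<Union>s\<in>sing X. Z.MS.mball (i s) (1/2^(L + 1)))"
 define RR' where "RR' = Z.MS.mcball (j (pnt Y)) (2^L) - (\<Union>s\<in>sing Y. Z.MS.mball (j s) (1/2^L))"
 have RRm [measurable]: "RR : sets Z.B" "RR' : sets Z.B"
 proof -
  have cl: "closedin Z.T (Z.MS.mcball a b)" for a b unfolding Z.mtop by (rule Z.MS.closedin_mcball)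
  have o1: "openin Z.T (\<Union>s\<in>sing X. Z.MS.mball (i s) b)" for b
   by (rule openin_Union) (auto intro: Z.openin_ball)
  have o2: "openin Z.T (\<Union>s\<in>sing Y. Z.MS.mball (j s) b)" for b
   by (rule openin_Union) (auto intro: Z.openin_ball)
  show "RR : sets Z.B" unfolding RR_def by (intro borel_of_closed closedin_diff cl o1)
  show "RR' : sets Z.B" unfolding RR'_def by (intro borel_of_closed closedin_diff cl o2)
 qed
 have RRi: "i x : RR \<longleftrightarrow> x : reg X L" if x: "x : X.S" for x
 proof -
  have "i x : Z.MS.mcball (i (pnt X)) (2^(L + 1)) \<longleftrightarrow> X.d (pnt X) x <= 2^(L + 1)"
   using iS x X.pgD(6) by (simp add: Z.MS.in_mcball)
  moreover have "i x : Z.MS.mball (i s) (1/2^(L + 1)) \<longleftrightarrow> X.d x s < 1/2^(L + 1)" if "s : sing X" for s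
  proof -
   have "s : X.S" using that X.sing_sub by blast
   thus ?thesis using iS x X.d_commute[of x s] by (simp add: Z.MS.in_mball)
  qed
  ultimately show ?thesis unfolding RR_def regular_set_def using x by blast
 qed
 have L1: "L - 1 + 1 = L" using L by simp
 have RRj: "j y : RR' \<longleftrightarrow> y : reg Y (L - 1)" if y: "y : Y.S" for y
 proof -
  have "j y : Z.MS.mcball (j (pnt Y)) (2^L) \<longleftrightarrow> Y.d (pnt Y) y <= 2^L"
   using jS y Y.pgD(6) by (simp add: Z.MS.in_mcball)
  moreover have "j y : Z.MS.mball (j s) (1/2^L) \<longleftrightarrow> Y.d y s < 1/2^L" if "s : sing Y" for s
  proof -
   have "s : Y.S" using that Y.sing_sub by blast
   thus ?thesis using jS y Y.d_commute[of y s] by (simp add: Z.MS.in_mball)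
  qed
  ultimately show ?thesis unfolding RR'_def regular_set_def L1 using y by blast
 qed

 obtain D :: "nat => 'c set" where D: "!!q. D q : sets Z.B" "disjoint_family D" "(UN q. D q) = Z.S"
  "!!q x y. x : D q ==> y : D q ==> Z.d x y < r"
  using Z.small_partition[OF r(1)] by blast
 define E where "E q = D q Int RR" for q
 define Gn where "Gn q = (\<Union>w\<in>E q. Z.MS.mball w r)" for q
 have E [measurable]: "E q : sets Z.B" for q unfolding E_def using D(1) RRm by auto
 have Gn [measurable]: "Gn q : sets Z.B" for q unfolding Gn_def by (intro borel_of_open openin_Union) (auto intro: Z.openin_ball)
 have dE: "disjoint_family E" using D(2) unfolding E_def disjoint_family_on_def by blast
 define C where "C q = {x : X.S. i x : E q}" for q
 have Cm: "C q : sets X.B" for q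
 proof -
  have "C q = i -` E q Int space X.B" unfolding C_def by auto
  thus ?thesis using measurable_sets[OF im E] by simp
 qed
 define Gaq where "Gaq q = distr (density Ga (ind (E q \<times> Gn q))) Z.B snd" for q
 have Gq: "em (Gaq q) A = em Ga (E q \<times> (A Int Gn q))" if A [measurable]: "A : sets Z.B" for q A
 proof -
  have "em (Gaq q) A = (II z. ind A (snd z) ||density Ga (ind (E q \<times> Gn q)))"
   unfolding Gaq_def using cp(1) A by (intro Z.distr_marginal(2)) simp_all
  also have "... = (II z. ind (E q \<times> Gn q) z*ind A (snd z) ||Ga)"
   by (rule nn_integral_density) measurable
  also have "... = (II z. ind (E q \<times> (A Int Gn q)) z ||Ga)"
   by (intro nn_integral_cong) (auto simp: indicator_def)
  also have "... = em Ga (E q \<times> (A Int Gn q))" by (rule nn_integral_indicator) measurable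
  finally show ?thesis .
 qed
 have "EX g:bm be. (ALL x. g x <= 1) & Gaq q = density be g" for q
 proof (rule bounded_Radon_Nikodym[OF finbe])
  show "sets (Gaq q) = sets be" unfolding Gaq_def using cp(4) by simp
  fix A assume "A : sets be"
  hence A: "A : sets Z.B" using cp(4) by simp
  have "em Ga (E q \<times> (A Int Gn q)) <= em Ga (Z.S \<times> A)"
   using A sets.sets_into_space[OF E[of q]] by (intro emeasure_mono) (auto simp: cp(1))
  thus "em (Gaq q) A <= em be A" unfolding Gq[OF A] cp(8)[OF A] .
 qed
 hence "ALL q. EX g. g : bm be & Gaq q = density be g" by blast
 from choice[OF this] obtain g where g: "!!q. g q : bm be" "!!q. Gaq q = density be (g q)" by blast
 have gm [measurable]: "g q : bm Z.B" for q using g(1)[of q] cp(4) by (simp cong: measurable_cong_sets)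
 define gs where "gs z = (\<Sum>q. g q z)" for z
 have gsm [measurable]: "gs : bm Z.B" unfolding gs_def by measurable
 have gle: "AE z in be. gs z <= 1"
 proof -
  have sg: "sets (density be gs) = sets be" by simp
  have "EX g:bm be. (ALL x. g x <= 1) & density be gs = density be g"
  proof (rule bounded_Radon_Nikodym[OF finbe sg])
   fix A assume "A : sets be"
   hence A [measurable]: "A : sets Z.B" using cp(4) by simp
   have "em (density be gs) A = (II z. (\<Sum>q. g q z*ind A z) ||be)"
    unfolding gs_def by (subst emeasure_density) auto
   also have "... = (\<Sum>q. em (Gaq q) A)"
    unfolding g(2) by (subst nn_integral_suminf) (auto simp: emeasure_density)
   also have "... = (\<Sum>q. em Ga (E q \<times> (A Int Gn q)))" unfolding Gq[OF A] ..
   also have "... = em Ga (UN q. E q \<times> (A Int Gn q))"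
    using dE by (intro suminf_emeasure) (auto simp: disjoint_family_on_def cp(1))
   also have "... <= em Ga (Z.S \<times> A)"
    using A sets.sets_into_space[OF E] by (intro emeasure_mono) (auto simp: cp(1))
   also have "... = em be A" by (rule cp(8)[OF A])
   finally show "em (density be gs) A <= em be A" .
  qed
  then obtain g' where g': "g' : bm be" "!!x. g' x <= 1" "density be gs = density be g'" by blast
  have "AE z in be. gs z = g' z" by (rule be.density_unique[OF _ g'(1,3)]) measurable
  thus ?thesis by eventually_elim (simp add: g'(2))
 qed
 \<comment> \<open>Modification on a null set, after which support in \<open>Gn q\<close> and the
   bound on the sum over \<open>q\<close> hold at every point; distances and levels are compared
   pointwise below.\<close>
 define hz where "hz q z = (if z : Gn q & gs z <= 1 then g q z else 0)" for q z
 have hzm [measurable]: "hz q : bm Z.B" for q unfolding hz_def by measurable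
 have hzint: "(II z. hz q z*ind A z ||be) = em Ga (E q \<times> (A Int Gn q))" if A [measurable]: "A : sets Z.B" for q A
 proof -
  have "(II z. hz q z*ind A z ||be) = (II z. g q z*ind (A Int Gn q) z ||be)"
   using gle by (intro nn_integral_cong_AE) (auto elim!: eventually_mono simp: hz_def indicator_def)
  also have "... = em (Gaq q) (A Int Gn q)" unfolding g(2) by (subst emeasure_density) auto
  also have "... = em Ga (E q \<times> ((A Int Gn q) Int Gn q))" by (rule Gq) measurable
  finally show ?thesis by (simp add: Int_assoc)
 qed
 have hzsum: "(\<Sum>q. hz q z) <= 1" for z
 proof (cases "gs z <= 1")
  case True
  have "(\<Sum>q. hz q z) <= gs z" unfolding gs_def by (intro suminf_le) (auto simp: hz_def)
  thus ?thesis using True by (rule order_trans)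
 next
  case False thus ?thesis by (simp add: hz_def)
 qed
 define h where "h q y = en (cut_fun f Y k y)*hz q (j y)" for q y
 have hm: "h q : bm Y.B" for q
  unfolding h_def using Y.cut_fun_measurable[OF f, of k] by measurable
 have hint: "(II y. h q y ||Y.M) = zY*em Ga (E q \<times> Gn q)" for q
 proof -
  have "(II y. h q y ||Y.M) = zY*(II z. hz q z ||be)" unfolding h_def by (rule Ib[symmetric]) measurable
  also have "(II z. hz q z ||be) = (II z. hz q z*ind Z.S z ||be)"
   using cp(6) by (intro nn_integral_cong) simp
  also have "... = em Ga (E q \<times> (Z.S Int Gn q))" by (rule hzint) simp
  also have "Z.S Int Gn q = Gn q" using sets.sets_into_space[OF Gn[of q]] by auto
  finally show ?thesis .
 qed
 have Cmass: "en c*em X.M (C q) = zY*em Ga (E q \<times> Z.S)" for q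
 proof -
  have "zX*em al (E q) = zX*(II z. ind (E q) z ||al)" using cp(3) by simp
  also have "... = (II x. en (cut_fun f X k x)*ind (E q) (i x) ||X.M)" by (rule Ia) measurable
  \<comment> \<open>On \<open>reg X L\<close> the cut function is 1 because
    \<open>L + 2 <= k\<close>, so the cut gives the cell its original measure.\<close>
  also have "... = (II x. ind (C q) x ||X.M)"
  proof (rule nn_integral_cong)
   fix x assume "x : space X.M"
   hence x: "x : X.S" by simp
   show "en (cut_fun f X k x)*ind (E q) (i x) = ind (C q) x"
   proof (cases "i x : E q")
    case True
    hence "x : reg X L" using RRi[OF x] by (auto simp: E_def)
    hence "cut_fun f X k x = 1" by (rule X.cut_fun_eq_1[OF f _ L(2)])
    thus ?thesis using True x by (simp add: C_def)
   next
    case False thus ?thesis by (simp add: C_def)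
   qed
  qed
  also have "... = em X.M (C q)" using Cm by simp
  finally have "en c*em X.M (C q) = (en c*zX)*em al (E q)" by (simp add: mult.assoc)
  also have "en c*zX = zY" unfolding zX_def zY_def by (rule c(1)[symmetric])
  finally show ?thesis unfolding cp(7)[OF E] .
 qed
 define bd where "bd = {z : Z.S \<times> Z.S. r <= Z.d (fst z) (snd z)}"
 have bdm: "bd : sets Ga"
 proof -
  have "{z : space Z.BB. r <= Z.d (fst z) (snd z)} : sets Z.BB" by measurable
  thus ?thesis unfolding bd_def cp(1) by (simp add: space_pair_measure)
 qed
 \<comment> \<open>One \<open>r\<close> for the diameter of the cell and one for its neighbourhood.
   Two linked pairs then distort a distance by less than \<open>4*r <= de\<close>.\<close>
 have near: "Z.d (i x) (j y) < 2*r" if x: "x : C q" and y: "y : Y.S" and h: "h q y ~= 0" for x y q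
 proof -
  have "j y : Gn q" using h unfolding h_def hz_def by (auto split: if_splits)
  then obtain w where w: "w : E q" "j y : Z.MS.mball w r" unfolding Gn_def by blast
  hence w': "w : D q" "w : Z.S" "Z.d w (j y) < r" by (auto simp: E_def Z.MS.in_mball)
  have x': "x : X.S" "i x : D q" using x by (auto simp: C_def E_def)
  have "Z.d (i x) (j y) <= Z.d (i x) w + Z.d w (j y)" using iS(1)[OF x'(1)] jS(1)[OF y] w'(2) by (intro Z.d_triangle)
  thus ?thesis using D(4)[OF x'(2) w'(1)] w'(3) by linarith
 qed
 have CX: "x : X.S" if "x : C q" for x q using that by (simp add: C_def)
 show ?thesis
  unfolding transfer_def
 proof (intro exI conjI allI impI)
  show "C q : sets X.B" for q by (rule Cm)
  show "disjoint_family C" using dE unfolding C_def disjoint_family_on_def by blast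
  show "(UN q. C q) = reg X L"
  proof (intro set_eqI iffI)
   fix x assume "x : (UN q. C q)"
   thus "x : reg X L" using RRi by (auto simp: C_def E_def)
  next
   fix x assume x: "x : reg X L"
   hence xS: "x : X.S" using X.regular_sub by blast
   then obtain q where "i x : D q" using iS(1) D(3) by blast
   thus "x : (UN q. C q)" using RRi[OF xS] x xS by (auto simp: C_def E_def)
  qed
  show "h q : bm Y.B" for q by (rule hm)
  show "(\<Sum>q. h q y) <= 1" for y
  proof -
   have "(\<Sum>q. h q y) <= (\<Sum>q. hz q (j y))"
   proof (intro suminf_le)
    fix q
    have "en (cut_fun f Y k y)*hz q (j y) <= 1*hz q (j y)"
     using Y.cut_fun_range[OF f, of k y] by (intro mult_right_mono) (auto simp: ennreal_le_1)
    thus "h q y <= hz q (j y)" unfolding h_def by simp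
   qed auto
   thus ?thesis using hzsum by (rule order_trans)
  qed
  show "1 - de <= c" "c <= 1 + de" by fact+
  show "(II y. h q y ||Y.M) <= en c*em X.M (C q)" for q
   unfolding hint Cmass using sets.sets_into_space[OF Gn[of q]]
   by (intro mult_left_mono emeasure_mono) (auto simp: cp(1))
  show "(\<Sum>q. en c*em X.M (C q) - (II y. h q y ||Y.M)) <= en de"
  proof -
   have "en c*em X.M (C q) - (II y. h q y ||Y.M) = zY*em Ga (E q \<times> (Z.S - Gn q))" for q
   proof -
    have "E q \<times> Z.S = E q \<times> Gn q Un E q \<times> (Z.S - Gn q)" using sets.sets_into_space[OF Gn[of q]] by auto
    hence "em Ga (E q \<times> Z.S) = em Ga (E q \<times> Gn q) + em Ga (E q \<times> (Z.S - Gn q))"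
     by (simp only:, intro plus_emeasure[symmetric]) (auto simp: cp(1))
    hence "zY*em Ga (E q \<times> Z.S) = zY*em Ga (E q \<times> Gn q) + zY*em Ga (E q \<times> (Z.S - Gn q))"
     by (simp add: distrib_left)
    moreover have "zY*em Ga (E q \<times> Gn q) ~= top" using zYfin GS[of "E q \<times> Gn q"] by (auto simp: ennreal_mult_eq_top_iff dest: less_imp_neq)
    ultimately show ?thesis unfolding hint Cmass by simp
   qed
   hence "(\<Sum>q. en c*em X.M (C q) - (II y. h q y ||Y.M)) = zY*(\<Sum>q. em Ga (E q \<times> (Z.S - Gn q)))"
    by simp
   also have "(\<Sum>q. em Ga (E q \<times> (Z.S - Gn q))) = em Ga (UN q. E q \<times> (Z.S - Gn q))"
    using dE by (intro suminf_emeasure) (auto simp: disjoint_family_on_def cp(1))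
   also have "... <= em Ga bd"
   proof (rule emeasure_mono[OF _ bdm], rule subsetI)
    fix z assume "z : (UN q. E q \<times> (Z.S - Gn q))"
    then obtain q where z: "fst z : E q" "snd z : Z.S" "snd z ~: Gn q" by auto
    hence "fst z : Z.S" using sets.sets_into_space[OF E[of q]] by auto
    moreover have "snd z ~: Z.MS.mball (fst z) r" using z unfolding Gn_def by blast
    ultimately show "z : bd" using z unfolding bd_def by (auto simp: Z.MS.in_mball mem_Times_iff)
   qed
   finally show ?thesis using bad unfolding zY_def[symmetric] bd_def[symmetric]
    by (meson mult_left_mono order_trans zero_le)
  qed
  show "(II y. (1 - (\<Sum>q. h q y))*ind (reg Y (L - 1)) y ||Y.M) <= en de"
  proof -
   have "(II y. (1 - (\<Sum>q. h q y))*ind (reg Y (L - 1)) y ||Y.M) =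
     (II y. en (cut_fun f Y k y)*((1 - (\<Sum>q. hz q (j y)))*ind RR' (j y)) ||Y.M)"
   proof (rule nn_integral_cong)
    fix y assume "y : space Y.M"
    hence y: "y : Y.S" by simp
    show "(1 - (\<Sum>q. h q y))*ind (reg Y (L - 1)) y =
     en (cut_fun f Y k y)*((1 - (\<Sum>q. hz q (j y)))*ind RR' (j y))"
    proof (cases "y : reg Y (L - 1)")
     case True
     hence "cut_fun f Y k y = 1" using L by (intro Y.cut_fun_eq_1[OF f True]) linarith
     thus ?thesis using True RRj[OF y] by (simp add: h_def)
    next
     case False thus ?thesis using RRj[OF y] by simp
    qed
   qed
   also have "... = zY*(II z. (1 - (\<Sum>q. hz q z))*ind RR' z ||be)" by (rule Ib[symmetric]) measurable
   also have "(II z. (1 - (\<Sum>q. hz q z))*ind RR' z ||be) <= em Ga bd"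
   proof -
    let ?V = "UN q. E q \<times> (RR' Int Gn q)"
    have V: "?V : sets Ga" by (auto simp: cp(1))
    have "em Ga ?V = (\<Sum>q. em Ga (E q \<times> (RR' Int Gn q)))"
     using dE by (intro suminf_emeasure[symmetric]) (auto simp: disjoint_family_on_def cp(1))
    also have "... = (\<Sum>q. II z. hz q z*ind RR' z ||be)" by (simp add: hzint)
    also have "... = (II z. (\<Sum>q. hz q z)*ind RR' z ||be)"
     by (subst nn_integral_suminf[symmetric]) auto
    finally have "em Ga ?V + (II z. (1 - (\<Sum>q. hz q z))*ind RR' z ||be) =
      (II z. (\<Sum>q. hz q z)*ind RR' z + (1 - (\<Sum>q. hz q z))*ind RR' z ||be)"
     by (subst nn_integral_add) auto
    also have "... = (II z. ind RR' z ||be)"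
     using hzsum by (intro nn_integral_cong) (simp add: distrib_right[symmetric] add_diff_inverse_ennreal)
    also have "... = em Ga (Z.S \<times> RR')" using cp(8)[OF RRm(2)] cp(4) by simp
    \<comment> \<open>A pair with second point in \<open>RR'\<close> either is moved by at least
      \<open>r\<close> or has its first point in \<open>RR\<close>: between the levels
      \<open>L - 1\<close> and \<open>L\<close> there is room for base points and singular sets that
      agree only up to \<open>r\<close>.\<close>
    also have "... <= em Ga (?V Un bd)"
    proof (rule emeasure_mono, rule subsetI)
     fix z assume "z : Z.S \<times> RR'"
     then obtain z1 z2 where z: "z = (z1, z2)" "z1 : Z.S" "z2 : RR'" by auto
     have z2: "z2 : Z.S" using z(3) sets.sets_into_space[OF RRm(2)] by auto
     show "z : ?V Un bd"
     proof (cases "Z.d z1 z2 < r")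
      case False
      thus ?thesis using z z2 by (auto simp: bd_def)
     next
      case True
      have "z1 : RR"
       unfolding RR_def
      proof (rule DiffI)
       have p: "i (pnt X) : Z.S" "j (pnt Y) : Z.S" using iS jS X.pgD(6) Y.pgD(6) by auto
       have "Z.d (j (pnt Y)) z2 <= 2^L" using z(3) by (auto simp: RR'_def Z.MS.in_mcball)
       moreover have "Z.d (i (pnt X)) z1 <= Z.d (i (pnt X)) (j (pnt Y)) + Z.d (j (pnt Y)) z2 + Z.d z1 z2"
        using Z.d_triangle[OF p(1,2) z(2)] Z.d_triangle[OF p(2) z2 z(2)] Z.d_commute[of z2 z1] by linarith
       moreover have "3*r <= 1"
       proof -
        have "1/2^(L + 2) <= (1::real)" by (rule pow1)
        thus ?thesis using r(3) by linarith
       qed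
       moreover have "1 <= (2::real)^L" "(2::real)^(L + 1) = 2*2^L" by simp_all
       ultimately have "Z.d (i (pnt X)) z1 <= 2^(L + 1)" using pp True r(1) by linarith
       thus "z1 : Z.MS.mcball (i (pnt X)) (2^(L + 1))" using p z(2) by (simp add: Z.MS.in_mcball)
       show "z1 ~: (\<Union>s\<in>sing X. Z.MS.mball (i s) (1/2^(L + 1)))"
       proof
        assume "z1 : (\<Union>s\<in>sing X. Z.MS.mball (i s) (1/2^(L + 1)))"
        then obtain s where s: "s : sing X" "Z.d (i s) z1 < 1/2^(L + 1)" by (auto simp: Z.MS.in_mball)
        obtain s' where s': "s' : sing Y" "Z.d (i s) (j s') < r" using ss1[OF s(1)] by blast
        have q: "i s : Z.S" "j s' : Z.S" using s s' X.sing_sub Y.sing_sub iS jS by auto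
        have "Z.d (j s') z2 <= Z.d (i s) (j s') + Z.d (i s) z1 + Z.d z1 z2"
         using Z.d_triangle[OF q(2,1) z2] Z.d_triangle[OF q(1) z(2) z2] Z.d_commute[of "j s'" "i s"] by linarith
        moreover have "1/2^(L + 1) + 1/2^(L + 2) <= 1/(2::real)^L" by (simp add: field_simps)
        ultimately have "Z.d (j s') z2 < 1/2^L" using s s' True r by linarith
        hence "z2 : Z.MS.mball (j s') (1/2^L)" using q z2 by (simp add: Z.MS.in_mball)
        thus False using z(3) s'(1) by (auto simp: RR'_def)
       qed
      qed
      moreover obtain q where q: "z1 : D q" using z(2) D(3) by blast
      ultimately have "z1 : E q" by (simp add: E_def)
      moreover from this have "z2 : Gn q" unfolding Gn_def using True z(2) z2 by (auto simp: Z.MS.in_mball)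
      ultimately show ?thesis using z by auto
     qed
    qed (use V bdm in auto)
    also have "... <= em Ga ?V + em Ga bd" by (rule emeasure_subadditive[OF V bdm])
    finally show ?thesis using GS[of ?V] by (subst (asm) ennreal_add_left_cancel_le) auto
   qed
   finally show ?thesis using bad unfolding zY_def[symmetric] bd_def[symmetric]
    by (meson mult_left_mono order_trans zero_le)
  qed
  show "\<bar>X.d x x' - Y.d y y'\<bar> <= de" if "x : C q" "x' : C q'" "y : Y.S" "y' : Y.S" "h q y ~= 0" "h q' y' ~= 0" for q q' x x' y y'
  proof -
   have n: "Z.d (i x) (j y) < 2*r" "Z.d (i x') (j y') < 2*r" using near that by blast+
   have S: "i x : Z.S" "i x' : Z.S" "j y : Z.S" "j y' : Z.S" using that CX iS(1) jS(1) by blast+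
   have e: "Z.d (i x) (i x') = X.d x x'" "Z.d (j y) (j y') = Y.d y y'" using that CX iS(2) jS(2) by blast+
   have "Z.d (i x) (i x') <= Z.d (i x) (j y) + Z.d (j y) (j y') + Z.d (i x') (j y')"
    "Z.d (j y) (j y') <= Z.d (i x) (j y) + Z.d (i x) (i x') + Z.d (i x') (j y')"
    using Z.d_triangle[OF S(1,3,2)] Z.d_triangle[OF S(3,4,2)] Z.d_triangle[OF S(3,1,4)] Z.d_triangle[OF S(1,2,4)]
     Z.d_commute[of "j y'" "i x'"] Z.d_commute[of "j y" "i x"] by linarith+
   thus ?thesis using n r(2) unfolding e by linarith
  qed
  fix q x y l assume *: "l <= L" "x : C q" "y : Y.S" "h q y ~= 0"
  have n: "Z.d (i x) (j y) < 2*r" using near[OF *(2-4)] .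
  have S: "x : X.S" "i x : Z.S" "j y : Z.S" using * CX iS(1) jS(1) by blast+
  have p: "pnt X : X.S" "pnt Y : Y.S" "i (pnt X) : Z.S" "j (pnt Y) : Z.S" using iS jS X.pgD(6) Y.pgD(6) by auto
  have r3: "3*r <= 1/2^(l + 2)"
  proof -
   have "(2::real)^(l + 2) <= 2^(L + 2)" using *(1) by (intro power_increasing) auto
   hence "1/(2::real)^(L + 2) <= 1/2^(l + 2)" by (intro divide_left_mono) auto
   thus ?thesis using r(3) by linarith
  qed
  have r1: "3*r <= 2^(l + 1)"
  proof -
   have "1/2^(l + 2) <= (1::real)" "(1::real) <= 2^(l + 1)" by (rule pow1, rule one_le_power) simp
   thus ?thesis using r3 by linarith
  qed
  have dp: "Y.d (pnt Y) y <= 3*r + X.d (pnt X) x" "X.d (pnt X) x <= 3*r + Y.d (pnt Y) y"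
   using Z.d_triangle[OF p(4,3) S(3)] Z.d_triangle[OF p(3) S(2,3)] Z.d_triangle[OF p(3,4) S(2)] Z.d_triangle[OF p(4) S(3,2)]
    Z.d_commute[of "j (pnt Y)" "i (pnt X)"] Z.d_commute[of "j y" "i x"] pp n
    iS(2)[OF p(1) S(1)] jS(2)[OF p(2) *(3)] by linarith+
  have ds: "X.d x s <= 3*r + Y.d y s' & Y.d y s' <= 3*r + X.d x s"
   if s: "s : sing X" "s' : sing Y" "Z.d (i s) (j s') < r" for s s'
  proof -
   have q: "s : X.S" "s' : Y.S" "i s : Z.S" "j s' : Z.S" using s X.sing_sub Y.sing_sub iS jS by auto
   show ?thesis
    using Z.d_triangle[OF S(2,3) q(3)] Z.d_triangle[OF S(3) q(4,3)] Z.d_triangle[OF S(3,2) q(4)] Z.d_triangle[OF S(2) q(3,4)]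
     Z.d_commute[of "j s'" "i s"] Z.d_commute[of "j y" "i x"] s(3) n iS(2)[OF S(1) q(1)] jS(2)[OF *(3) q(2)] by linarith
  qed
  show "y : reg Y (Suc l)" if "x : reg X l"
   using that r1 r3 *(3) dp(1) by (rule regular_set_transfer) (meson ds ss2)
  show "x : reg X (Suc l)" if "y : reg Y l"
   using that r1 r3 S(1) dp(2) by (rule regular_set_transfer) (meson ds ss1)
 qed
qed

text \<open>A concave function on the half-line with a finite limit and value 0 at 0 cannot become
  negative, since it would then fall at least linearly; being nonnegative and concave, it cannot
  decrease either. It is positive somewhere as it is not constant, hence by concavity everywhere off
  0. So a small cost forces little mass at distance at least \<open>r\<close>.\<close>

lemma cost_profile_lower:
 assumes c: "cost_profile c" and r: "0 < r"
 obtains ka where "0 < ka" "!!s. r <= s ==> ka <= c s"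
proof -
 have conv: "convex_on {0..} (%x. - c x)" and c0: "c 0 = 0" and nc: "~ c constant_on {0..}"
  using c by (auto simp: cost_profile_def concave_on_def)
 obtain l where l: "(c ---> l) at_top" using c by (auto simp: cost_profile_def)
 have conc: "(1 - t) * c x + t * c y <= c ((1 - t)*x + t*y)" if "0 <= t" "t <= 1" "0 <= x" "0 <= y" for t x y
  using convex_onD[OF conv that(1,2), of x y] that by simp
 have scale: "t * c y <= c (t*y)" if "0 <= t" "t <= 1" "0 <= y" for t y
  using conc[OF that(1,2), of 0 y] that c0 by simp
 have nonneg: "0 <= c t" if t: "0 <= t" for t
 proof (rule ccontr)
  assume "~ 0 <= c t"
  hence neg: "c t < 0" and t0: "0 < t" using c0 t by (auto simp: less_le)
  have "eventually (%s. l - 1 < c s) at_top" using l by (rule order_tendstoD) simp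
  then obtain s1 where s1: "!!s. s1 <= s ==> l - 1 < c s" unfolding eventually_at_top_linorder by blast
  \<comment> \<open>At this point the limit keeps \<open>c\<close> above \<open>l - 1\<close>, while
    the chord from the origin through \<open>t\<close> has already pushed it below.\<close>
  define s where "s = max (max s1 t) ((\<bar>l - 1\<bar> + 1)*t / - c t)"
  have s: "s1 <= s" "t <= s" "(\<bar>l - 1\<bar> + 1)*t / - c t <= s" "0 < s" using t0 by (auto simp: s_def)
  have "t/s * c s <= c (t/s * s)" using s t0 by (intro scale) auto
  hence "t * c s <= s * c t" using s t0 by (simp add: field_simps)
  also have "s * c t <= - ((\<bar>l - 1\<bar> + 1)*t)"
  proof -
   have "(\<bar>l - 1\<bar> + 1)*t <= s * - c t" using s(3) neg by (subst (asm) pos_divide_le_eq) auto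
   thus ?thesis by simp
  qed
  also have "... = t * - (\<bar>l - 1\<bar> + 1)" by (simp add: algebra_simps)
  finally have "c s <= - (\<bar>l - 1\<bar> + 1)" using t0 by (rule mult_left_le_imp_le)
  thus False using s1[OF s(1)] by linarith
 qed
 obtain s0 where s0: "0 < s0" "0 < c s0"
 proof -
  have "EX s:{0..}. c s ~= 0" using nc unfolding constant_on_def by blast
  then obtain s where s: "0 <= s" "c s ~= 0" by auto
  hence "0 < s" "0 < c s" using c0 nonneg[of s] by (auto simp: less_le)
  thus thesis by (rule that)
 qed
 have mono: "c s <= c t" if st: "0 <= s" "s < t" for s t
 proof -
  have le: "(u - t) * c s <= (u - s) * c t" if u: "t < u" for u
  proof -
   define a where "a = (t - s)/(u - s)"
   have us: "0 < u - s" using u st by simp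
   have a: "0 <= a" "a <= 1" unfolding a_def using us u st by auto
   have e: "1 - a = (u - t)/(u - s)" unfolding a_def using us by (simp add: field_simps)
   have "a*(u - s) = t - s" unfolding a_def using us by simp
   hence "(1 - a) * s + a*u = t" by (simp add: algebra_simps)
   hence "(1 - a) * c s + a * c u <= c t" using conc[OF a, of s u] st u by simp
   moreover have "0 <= a * c u" using a nonneg[of u] u st by simp
   ultimately have "(u - t)/(u - s) * c s <= c t" unfolding e by linarith
   thus ?thesis using us by (simp add: field_simps)
  qed
  show ?thesis
  proof (rule ccontr)
   assume "~ c s <= c t"
   hence g: "0 < c s - c t" by simp
   \<comment> \<open>Large enough for the chord inequality \<open>le\<close> to fail if
     \<open>c s\<close> exceeded \<open>c t\<close>.\<close>
   define u where "u = max (t + 1) ((t * c s - s * c t)/(c s - c t) + 1)"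
   have u: "t < u" "(t * c s - s * c t)/(c s - c t) < u" by (auto simp: u_def)
   have "t * c s - s * c t < u*(c s - c t)" using u(2) g by (subst (asm) pos_divide_less_eq) auto
   thus False using le[OF u(1)] by (simp add: algebra_simps)
  qed
 qed
 define u where "u = min r s0"
 have u: "0 < u" "u <= s0" "u <= r" using r s0 by (auto simp: u_def)
 have "u/s0 * c s0 <= c (u/s0 * s0)" using u s0 by (intro scale) auto
 hence "u/s0 * c s0 <= c u" using s0 by simp
 moreover have "0 < u/s0 * c s0" using u s0 by simp
 ultimately have "0 < c u" by linarith
 show thesis
 proof (rule that[OF \<open>0 < c u\<close>])
  fix s assume "r <= s"
  hence "u <= s" using u by simp
  thus "c u <= c s" using mono[of u s] u by (cases "u = s") auto
 qed
qed

text \<open>Each term of the series is at most the whole sum; a bound below 1 on the truncated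
  distance removes the truncation.\<close>

lemma iKRW_fm_eventually:
 assumes lim: "(%n. iKRW f c kb (X n) Y) ----> 0" and k: "kb <= k" and e: "0 < e"
 shows "eventually (%n. iKRW_fm c (cut f (X n) k) (cut f Y k) < en e) sequentially"
proof -
 let ?a = "%n k. enn2real (min 1 (iKRW_fm c (cut f (X n) (k + kb)) (cut f Y (k + kb))))"
 have a: "0 <= ?a n q" "?a n q <= 1" for n q
  using enn2real_mono[of "min 1 (iKRW_fm c (cut f (X n) (q + kb)) (cut f Y (q + kb)))" 1] by auto
 have summ: "summable (%q. 1/2^(q + kb)*?a n q)" for n
 proof (rule summable_comparison_test')
  show "summable (%q. 1/2^kb*(1/2)^q :: real)" by (intro summable_mult summable_geometric) simp
  fix q
  have "1/2^(q + kb)*?a n q <= 1/2^(q + kb)*1" using a by (intro mult_left_mono) auto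
  thus "norm (1/2^(q + kb)*?a n q) <= 1/2^kb*(1/2)^q"
   using a[of n q] by (simp add: power_add power_one_over field_simps)
 qed
 define e' where "e' = min e 1/2^k"
 have e': "0 < e'" using e by (simp add: e'_def)
 have "eventually (%n. iKRW f c kb (X n) Y < e') sequentially"
  using lim e' by (rule order_tendstoD)
 thus ?thesis
 proof eventually_elim
  case (elim n)
  let ?x = "iKRW_fm c (cut f (X n) k) (cut f Y k)"
  have "(\<Sum>q\<in>{k - kb}. 1/2^(q + kb)*?a n q) <= (\<Sum>q. 1/2^(q + kb)*?a n q)"
   by (rule sum_le_suminf[OF summ]) (use a in auto)
  hence "1/2^k*enn2real (min 1 ?x) <= iKRW f c kb (X n) Y"
   using k by (simp add: iKRW_def)
  hence "enn2real (min 1 ?x) < min e 1" using elim unfolding e'_def by (simp add: field_simps)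
  moreover have "en (enn2real (min 1 ?x)) = min 1 ?x"
   by (intro ennreal_enn2real) (simp add: min_less_iff_disj)
  ultimately have "min 1 ?x < en (min e 1)" using ennreal_lessI[of "min e 1" "enn2real (min 1 ?x)"] e by simp
  also have "en (min e 1) <= 1" using ennreal_leI[of "min e 1" 1] by simp
  finally have "min 1 ?x < 1" .
  hence "min 1 ?x = ?x" by (auto simp: min_def split: if_splits)
  hence "?x < en (min e 1)" using \<open>min 1 ?x < en (min e 1)\<close> by simp
  also have "... <= en e" by (intro ennreal_leI) simp
  finally show ?case .
 qed
qed

text \<open>The infimum gives one ambient space in which base points and singular sets are closer
  than \<open>r\<close>, and Markov's inequality with the lower bound \<open>ka\<close> of the cost
  beyond \<open>r\<close> bounds the mass of far pairs. The logarithmic term keeps the mass ratio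
  \<open>c'\<close> near 1. The conditions on \<epsilon> match these in turn.\<close>

lemma transfer_of_iKRW_fm:
 fixes X :: "'a pgmms" and Y :: "'b pgmms"
 assumes pX: "pgm X" and pY: "pgm Y" and f: "cut_profile f"
  and zx: "0 < pgm.cut_mass X f k" and zy: "0 < pgm.cut_mass Y f k"
  and r: "0 < r" "4*r <= de" "3*r <= 1/2^(L + 2)" and L: "1 <= L" "L + 2 <= k"
  and ka: "0 < ka" "!!s. r <= s ==> ka <= c s"
  and zY: "pgm.cut_mass Y f k = en zY" "0 < zY"
  and \<epsilon>: "\<epsilon> <= r" "\<epsilon> <= ln (1 + de)" "\<epsilon> <= de" "\<epsilon> <= ka*de/zY" "0 < de"
  and fm: "iKRW_fm c (cut f X k) (cut f Y k) < en \<epsilon>"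
 shows "EX C h c'. transfer X Y L de C h c'"
proof -
 interpret X: pgm X by fact
 interpret Y: pgm Y by fact
 have cutsimps: "metr (cut f V k) = metr V" "sing (cut f V k) = sing V" "pnt (cut f V k) = pnt V" for V :: "'d pgmms"
  by (simp_all add: cut_def)
 have cutsimps': "metr (cut f V k) = metr V" "sing (cut f V k) = sing V" "pnt (cut f V k) = pnt V" for V :: "'e pgmms"
  by (simp_all add: cut_def)
 obtain zX where zX: "X.cut_mass f k = en zX" "0 < zX"
  using zx X.cut_mass_finite[OF f, of k] by (cases "X.cut_mass f k") auto
 have mX: "measure (meas (cut f X k)) (space (meas (cut f X k))) = zX"
  using zX unfolding measure_def X.cut_mass_def by simp
 have mY: "measure (meas (cut f Y k)) (space (meas (cut f Y k))) = zY"
  using zY unfolding measure_def Y.cut_mass_def by simp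
 let ?A = "{(Z :: real metric, i, j). mcomplete_of Z & separable_space (mtopology_of Z) &
    isometric_embedding (metr X) Z i & isometric_embedding (metr Y) Z j}"
 let ?F = "%(Z :: real metric, i, j). en (mdist Z (i (pnt X)) (j (pnt Y))) +
    hausdorff_dist Z (i ` sing X) (j ` sing Y) +
    transport_cost Z c
     (distr (normalized (meas (cut f X k))) (borel_of (mtopology_of Z)) i)
     (distr (normalized (meas (cut f Y k))) (borel_of (mtopology_of Z)) j)"
 have fm': "en \<bar>ln (zX/zY)\<bar> + (INF q\<in>?A. ?F q) < en \<epsilon>"
  using fm unfolding iKRW_fm_def mX mY by (simp add: cut_def)
 have ln: "\<bar>ln (zX/zY)\<bar> < \<epsilon>"
 proof -
  have "en \<bar>ln (zX/zY)\<bar> <= en \<bar>ln (zX/zY)\<bar> + (INF q\<in>?A. ?F q)" by simp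
  hence "en \<bar>ln (zX/zY)\<bar> < en \<epsilon>" using fm' by (rule le_less_trans)
  thus ?thesis by (simp add: ennreal_less_iff)
 qed
 have "(INF q\<in>?A. ?F q) <= en \<bar>ln (zX/zY)\<bar> + (INF q\<in>?A. ?F q)" by simp
 hence "(INF q\<in>?A. ?F q) < en \<epsilon>" using fm' by (rule le_less_trans)
 then obtain q where q: "q : ?A" "?F q < en \<epsilon>" unfolding INF_less_iff by blast
 obtain Z i j where qz: "q = (Z, i, j)" by (cases q) auto
 have Z: "mcomplete_of Z" "separable_space (mtopology_of Z)" "isometric_embedding (metr X) Z i" "isometric_embedding (metr Y) Z j"
  using q(1) unfolding qz by auto
 have "i (pnt X) : mspace Z" using Z(3) X.pgD(6) by (auto simp: isometric_embedding_def)
 hence pZ: "polish Z" using Z by unfold_locales auto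
 interpret Z: polish Z by fact
 define t1 t2 t3 where "t1 = en (mdist Z (i (pnt X)) (j (pnt Y)))" and "t2 = hausdorff_dist Z (i ` sing X) (j ` sing Y)"
  and "t3 = transport_cost Z c
     (distr (normalized (meas (cut f X k))) (borel_of (mtopology_of Z)) i)
     (distr (normalized (meas (cut f Y k))) (borel_of (mtopology_of Z)) j)"
 have s: "t1 + t2 + t3 < en \<epsilon>" using q(2) unfolding qz t1_def t2_def t3_def by simp
 have le: "t1 <= t1 + t2 + t3" "t2 <= t1 + t2 + t3" "t3 <= t1 + t2 + t3"
  by (simp_all add: add_increasing add_increasing2)
 have t: "t1 < en \<epsilon>" "t2 < en \<epsilon>" "t3 < en \<epsilon>"
  using le_less_trans[OF le(1) s] le_less_trans[OF le(2) s] le_less_trans[OF le(3) s] .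
 have pp: "mdist Z (i (pnt X)) (j (pnt Y)) < r"
  using t(1) \<epsilon>(1) unfolding t1_def by (simp add: ennreal_less_iff)
 have t2r: "t2 < en r" using t(2) ennreal_leI[OF \<epsilon>(1)] by (rule less_le_trans)
 have ss1: "EX s':sing Y. mdist Z (i s) (j s') < r" if "s : sing X" for s
 proof -
  have "(INF b\<in>j ` sing Y. en (mdist Z (i s) b)) <= t2"
   unfolding t2_def hausdorff_dist_def using that by (intro max.coboundedI1 SUP_upper) auto
  hence "(INF b\<in>j ` sing Y. en (mdist Z (i s) b)) < en r" using t2r by (rule le_less_trans)
  thus ?thesis unfolding INF_less_iff by (auto simp: ennreal_less_iff)
 qed
 have ss2: "EX s:sing X. mdist Z (i s) (j s') < r" if "s' : sing Y" for s'
 proof -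
  have "(INF a\<in>i ` sing X. en (mdist Z a (j s'))) <= t2"
   unfolding t2_def hausdorff_dist_def using that by (intro max.coboundedI2 SUP_upper) auto
  hence "(INF a\<in>i ` sing X. en (mdist Z a (j s'))) < en r" using t2r by (rule le_less_trans)
  thus ?thesis unfolding INF_less_iff by (auto simp: ennreal_less_iff)
 qed
 obtain Ga where G: "Ga : couplings Z (distr (normalized (meas (cut f X k))) (borel_of (mtopology_of Z)) i)
    (distr (normalized (meas (cut f Y k))) (borel_of (mtopology_of Z)) j)" "plan_cost Z c Ga < en \<epsilon>"
  using t(3) unfolding t3_def transport_cost_def INF_less_iff by blast
 note cp = Z.couplingsD[OF G(1)]
 let ?bd = "{z : Z.S \<times> Z.S. r <= Z.d (fst z) (snd z)}"
 have bdm: "?bd : sets Ga"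
 proof -
  have "{z : space Z.BB. r <= Z.d (fst z) (snd z)} : sets Z.BB" by measurable
  thus ?thesis unfolding cp(1) by (simp add: space_pair_measure)
 qed
 have "en ka*em Ga ?bd = (II z. en ka*ind ?bd z ||Ga)"
  using bdm by (simp add: nn_integral_cmult_indicator)
 also have "... <= plan_cost Z c Ga"
  unfolding plan_cost_def
  by (intro nn_integral_mono) (auto simp: indicator_def intro!: ennreal_leI ka(2))
 finally have kb: "en ka*em Ga ?bd <= en \<epsilon>" using G(2) by simp
 have bad: "Y.cut_mass f k*em Ga ?bd <= en de"
 proof -
  have "en zY*em Ga ?bd = en (zY/ka)*(en ka*em Ga ?bd)"
   using ka(1) zY(2) by (simp add: mult.assoc[symmetric] ennreal_mult'[symmetric])
  also have "... <= en (zY/ka)*en \<epsilon>" by (intro mult_left_mono kb) simp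
  also have "... <= en (zY/ka)*en (ka*de/zY)" by (intro mult_left_mono ennreal_leI \<epsilon>) simp
  also have "... = en de" using ka(1) zY(2) by (simp add: ennreal_mult'[symmetric])
  finally show ?thesis unfolding zY(1) .
 qed
 define c' where "c' = zY/zX"
 have c'0: "0 < c'" using zX zY by (simp add: c'_def)
 have lnc: "ln c' = - ln (zX/zY)" using zX zY by (simp add: c'_def ln_div)
 have c': "Y.cut_mass f k = en c'*X.cut_mass f k"
  unfolding zX(1) zY(1) c'_def using zX(2) zY(2) by (simp add: ennreal_mult'[symmetric])
 have cle: "c' <= 1 + de"
 proof -
  have "ln c' <= ln (1 + de)" using ln lnc \<epsilon>(2) by linarith
  thus ?thesis using c'0 \<epsilon>(5) by simp
 qed
 have cge: "1 - de <= c'"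
 proof -
  have "- de <= ln c'" using ln lnc \<epsilon>(3) by linarith
  also have "ln c' <= c' - 1" using c'0 by (rule ln_le_minus_one)
  finally show ?thesis by simp
 qed
 have "EX C h. transfer X Y L de C h c'"
  by (rule transfer_core[OF pX pY pZ Z(3,4) f zx zy G(1) r L pp ss1 ss2 bad c' cge cle])
 thus ?thesis by blast
qed

lemma transfer_eventually:
 fixes X :: "nat => 'a pgmms" and Y :: "'b pgmms"
 assumes f: "cut_profile f" and c: "cost_profile c"
  and X: "!!n. X n : pgmm_class f kb" and Y: "Y : pgmm_class f kb"
  and lim: "(%n. iKRW f c kb (X n) Y) ----> 0" and L: "1 <= L" and de: "0 < de"
 shows "eventually (%n. EX C h c'. transfer (X n) Y L de C h c') sequentially"
proof -
 have pX: "pgm (X n)" for n using X[of n] by (simp add: pgm_def pgmm_class_def)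
 have pY: "pgm Y" using Y by (simp add: pgm_def pgmm_class_def)
 \<comment> \<open>Two levels above \<open>kb\<close> the cut has positive mass, and two levels
   above \<open>L\<close> the cut function is 1 on the \<open>L\<close>-regular sets.\<close>
 define k where "k = max (kb + 2) (L + 2)"
 have k: "kb + 2 <= k" "L + 2 <= k" "kb <= k" by (auto simp: k_def)
 have posX: "0 < pgm.cut_mass (X n) f k" for n
 proof (rule pgm.cut_mass_mono_pos[OF pX f _ k(1)])
  have "space (meas (cut f (X n) kb)) = mspace (metr (X n))" using pgm.meas_cb(1)[OF pX[of n]] by (simp add: cut_def)
  thus "0 < pgm.cut_mass (X n) f kb" using X[of n] by (simp add: pgm.cut_mass_def[OF pX] pgmm_class_def)
 qed
 have posY: "0 < pgm.cut_mass Y f k"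
 proof (rule pgm.cut_mass_mono_pos[OF pY f _ k(1)])
  have "space (meas (cut f Y kb)) = mspace (metr Y)" using pgm.meas_cb(1)[OF pY] by (simp add: cut_def)
  thus "0 < pgm.cut_mass Y f kb" using Y by (simp add: pgm.cut_mass_def[OF pY] pgmm_class_def)
 qed
 obtain zY where zY: "pgm.cut_mass Y f k = en zY" "0 < zY"
  using posY pgm.cut_mass_finite[OF pY f, of k] by (cases "pgm.cut_mass Y f k") auto
 define r where "r = min (de/4) (1/2^(L + 2)/3)"
 have r: "0 < r" "4*r <= de" "3*r <= 1/2^(L + 2)" using de by (auto simp: r_def min_def)
 obtain ka where ka: "0 < ka" "!!s. r <= s ==> ka <= c s" using cost_profile_lower[OF c r(1)] by blast
 define \<epsilon> where "\<epsilon> = min (min r (ln (1 + de))) (min de (ka*de/zY))"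
 have \<epsilon>: "\<epsilon> <= r" "\<epsilon> <= ln (1 + de)" "\<epsilon> <= de" "\<epsilon> <= ka*de/zY" "0 < \<epsilon>"
  using r ka de zY by (auto simp: \<epsilon>_def)
 from iKRW_fm_eventually[OF lim k(3) \<epsilon>(5)] show ?thesis
 proof eventually_elim
  case (elim n)
  show ?case
   by (rule transfer_of_iKRW_fm[OF pX pY f posX posY r L k(2) ka zY \<epsilon>(1-4) de elim])
 qed
qed

subsection \<open>Distortion coefficients\<close>

text \<open>Infimal convolution with \<open>k * |x - y|\<close>. The minorants live on the whole
  line, although \<open>u\<close> is controlled only on \<open>A\<close>, and the third property
  compares values at two arguments: it is used for the distances of linked pairs in
  \<open>X n\<close> and in \<open>Y\<close>, which differ by at most \<open>de\<close>.\<close>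

lemma Lipschitz_minorants:
 fixes u :: "real => real"
 assumes A: "A ~= {}" and nonneg: "!!x. x : A ==> 0 <= u x" and cont: "continuous_on A u"
 obtains v :: "nat => real => real" where
  "!!k. continuous_on UNIV (v k)" "!!k x. 0 <= v k x"
  "!!k x y. y : A ==> v k x <= u y + real k*\<bar>x - y\<bar>"
  "!!x. incseq (%k. v k x)" "!!x. x : A ==> (%k. v k x) ----> u x"
proof -
 define v where "v k x = (INF y\<in>A. u y + real k*\<bar>x - y\<bar>)" for k x
 have bdd: "bdd_below ((%y. u y + real k*\<bar>x - y\<bar>) ` A)" for k x
  using nonneg by (intro bdd_belowI[of _ 0]) auto
 have le: "v k x <= u y + real k*\<bar>x - y\<bar>" if "y : A" for k x y
  unfolding v_def by (rule cINF_lower[OF bdd that])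
 have ge: "b <= v k x" if "!!y. y : A ==> b <= u y + real k*\<bar>x - y\<bar>" for b k x
  unfolding v_def by (rule cINF_greatest[OF A that])
 have lip: "v k x <= v k y + real k*\<bar>x - y\<bar>" for k x y
 proof -
  have "v k x - real k*\<bar>x - y\<bar> <= v k y"
  proof (rule ge)
   fix z assume "z : A"
   hence "v k x <= u z + real k*\<bar>x - z\<bar>" by (rule le)
   also have "real k*\<bar>x - z\<bar> <= real k*(\<bar>x - y\<bar> + \<bar>y - z\<bar>)" by (intro mult_left_mono) auto
   finally show "v k x - real k*\<bar>x - y\<bar> <= u z + real k*\<bar>y - z\<bar>" by (simp add: algebra_simps)
  qed
  thus ?thesis by simp
 qed
 show thesis
 proof (rule that[of v])
  show "continuous_on UNIV (v k)" for k
  proof (rule lipschitz_on_continuous_on[OF lipschitz_onI])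
   show "dist (v k x) (v k y) <= real k*dist x y" for x y
    using lip[of k x y] lip[of k y x] by (auto simp: dist_real_def abs_minus_commute abs_le_iff)
  qed simp
  show "0 <= v k x" for k x using nonneg by (intro ge) auto
  show "v k x <= u y + real k*\<bar>x - y\<bar>" if "y : A" for k x y by (rule le[OF that])
  show "incseq (%k. v k x)" for x
  proof (rule incseq_SucI, rule ge)
   fix k y assume "y : A"
   hence "v k x <= u y + real k*\<bar>x - y\<bar>" by (rule le)
   also have "... <= u y + real (Suc k)*\<bar>x - y\<bar>" by (intro add_left_mono mult_right_mono) auto
   finally show "v k x <= u y + real (Suc k)*\<bar>x - y\<bar>" .
  qed
  show "(%k. v k x) ----> u x" if x: "x : A" for x
  proof (rule LIMSEQ_I)
   fix e :: real assume e: "0 < e"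
   obtain r where r: "0 < r" "!!y. y : A ==> dist y x < r ==> dist (u y) (u x) < e/2"
    using cont x e unfolding continuous_on_iff by (metis half_gt_zero)
   obtain k0 where k0: "u x/r <= real k0" using real_arch_simple by blast
   show "EX no. ALL k>=no. norm (v k x - u x) < e"
   proof (intro exI[of _ k0] allI impI)
    fix k assume k: "k0 <= k"
    have "u x - e/2 <= v k x"
    proof (rule ge)
     fix y assume y: "y : A"
     show "u x - e/2 <= u y + real k*\<bar>x - y\<bar>"
     proof (cases "dist y x < r")
      case True
      hence "u x - e/2 <= u y" using r(2)[OF y True] unfolding dist_real_def by linarith
      thus ?thesis by (simp add: add_increasing2)
     next
      case False
      hence d: "r <= \<bar>x - y\<bar>" by (simp add: dist_real_def abs_minus_commute)
      have "u x <= real k0*r" using k0 r(1) by (simp add: divide_le_eq)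
      also have "... <= real k*\<bar>x - y\<bar>" using k d r(1) by (intro mult_mono) auto
      finally show ?thesis using nonneg[OF y] e by linarith
     qed
    qed
    moreover have "v k x <= u x" using le[OF x, of k x] by simp
    ultimately show "norm (v k x - u x) < e" using e by simp
   qed
  qed
 qed
qed

text \<open>Both \<open>F (t*x)/x\<close> and \<open>F x/x\<close> converge by the derivative at 0.
  This covers continuity of the coefficients at distance 0 for \<open>sin\<close> and
  \<open>sinh\<close> at once.\<close>

lemma tendsto_ratio_at_0:
 fixes F :: "real => real"
 assumes F: "(F has_real_derivative 1) (at 0)" "F 0 = 0"
 shows "((%x. F (t*x)/F x) ---> t) (at 0)"
proof -
 have 1: "((%x. F x/x) ---> 1) (at 0)"
  using F by (simp add: has_field_derivative_iff)
 have "((%x. F (t*x)) has_real_derivative (1*t)) (at 0)"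
 proof (rule DERIV_chain2[where f = F and g = "%x. t*x"])
  show "(F has_real_derivative 1) (at (t*0))" using F by simp
  show "((%x. t*x) has_real_derivative t) (at 0)" by (auto intro!: derivative_eq_intros)
 qed
 hence 2: "((%x. F (t*x)/x) ---> t) (at 0)"
  using F by (simp add: has_field_derivative_iff)
 have "((%x. (F (t*x)/x)/(F x/x)) ---> t/1) (at 0)"
  by (intro tendsto_divide 1 2) simp
 moreover have "eventually (%x. (F (t*x)/x)/(F x/x) = F (t*x)/F x) (at (0::real))"
  by (auto simp: eventually_at_filter)
 ultimately have "((%x. F (t*x)/F x) ---> t/1) (at 0)" by (rule Lim_transform_eventually)
 thus ?thesis by simp
qed

text \<open>The range of distances that occur: for negative \<open>K\<close> the diameter bound
  confines them to an interval on which the coefficients are finite.\<close>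

definition cdom :: "real => real => real set" where
 "cdom K D = (if K < 0 then {0..D} else {0..})"

lemma continuous_on_ratio:
 fixes F :: "real => real"
 assumes F: "(F has_real_derivative 1) (at 0)" "F 0 = 0" and cont: "continuous_on UNIV F"
  and pos: "!!x. x : A ==> x ~= 0 ==> F x ~= 0"
 shows "continuous_on A (%x. if x = 0 then t else F (t*x)/F x)" (is "continuous_on A ?g")
 unfolding continuous_on_eq_continuous_within
proof
 fix x assume x: "x : A"
 show "continuous (at x within A) ?g"
 proof (cases "x = 0")
  case True
  have "(?g ---> t) (at 0)"
   by (rule Lim_transform_eventually[OF tendsto_ratio_at_0[OF F, of t]]) (simp add: eventually_at_filter)
  hence "isCont ?g 0" by (simp add: isCont_def)
  thus ?thesis using True by (simp add: continuous_at_imp_continuous_within)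
 next
  case False
  have c: "isCont F y" for y using cont by (simp add: continuous_on_eq_continuous_at)
  have "isCont (%x. F (t*x)/F x) x"
   by (intro isCont_divide isCont_o2[of x "(*) t" F] c pos[OF x False]) simp
  moreover have "eventually (%y. ?g y = F (t*y)/F y) (nhds x)"
   using t1_space_nhds[OF False] by eventually_elim simp
  ultimately have "isCont ?g x" by (subst isCont_cong)
  thus ?thesis by (simp add: continuous_at_imp_continuous_within)
 qed
qed

lemma sigma_coeff_real:
 assumes N: "N < 0" and t: "0 < t" "t < 1" and D: "K < 0 ==> - K*D^2 < - N*pi^2"
 obtains s where "continuous_on (cdom K D) s"
  "!!x. x : cdom K D ==> sigma_coeff K N t x = en (s x)"
  "!!x. x : cdom K D ==> 0 <= s x" "!!x. x : cdom K D ==> sigma_coeff K N 1 x = 1"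
  "!!x. 0 <= K ==> x : cdom K D ==> s x <= 1"
proof -
 have Npi: "N*pi^2 < 0" using N by (simp add: mult_neg_pos)
 consider "K = 0" | "0 < K" | "K < 0" by linarith
 thus thesis
 proof cases
  case 1
  show thesis
   by (rule that[of "%_. t"]) (use 1 Npi t in \<open>auto simp: sigma_coeff_def\<close>)
 next
  case 2
  define b where "b = sqrt (- (K/N))"
  have b: "0 < b" using 2 N by (simp add: b_def divide_less_0_iff)
  define g where "g x = (if x = 0 then t else sinh (t*x)/sinh x)" for x :: real
  have gc: "continuous_on UNIV g"
   unfolding g_def
  proof (rule continuous_on_ratio)
   show "(sinh has_real_derivative 1) (at 0)" by (auto intro!: derivative_eq_intros)
   show "continuous_on UNIV (sinh :: real => real)" by (intro continuous_intros)
  qed auto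
  have eq: "sigma_coeff K N s x = en (if x = 0 then s else sinh (s*(x*b))/sinh (x*b))" for s x
  proof (cases "x = 0")
   case True thus ?thesis using Npi by (simp add: sigma_coeff_def)
  next
   case False
   have p: "0 < K*x^2" using 2 False by simp
   hence "~ K*x^2 <= N*pi^2" "~ K*x^2 < 0" "K*x^2 ~= 0" using Npi by linarith+
   thus ?thesis using False unfolding sigma_coeff_def b_def by (simp add: mult.assoc)
  qed
  have dom: "cdom K D = {0..}" using 2 by (simp add: cdom_def)
  show thesis
  proof (rule that[of "%x. g (x*b)"])
   show "continuous_on (cdom K D) (%x. g (x*b))"
    by (rule continuous_on_compose2[OF gc]) (auto intro!: continuous_intros)
   fix x assume x: "x : cdom K D"
   hence x0: "0 <= x" using dom by simp
   show "sigma_coeff K N t x = en (g (x*b))" unfolding eq g_def using b by auto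
   show "0 <= g (x*b)" unfolding g_def using t b x0 by (auto simp: zero_le_mult_iff)
   show "sigma_coeff K N 1 x = 1" unfolding eq using b by auto
   show "g (x*b) <= 1"
   proof (cases "x = 0")
    case False
    hence pos: "0 < x*b" using x0 b by simp
    hence "t*(x*b) <= 1*(x*b)" using t by (intro mult_right_mono) auto
    hence "sinh (t*(x*b)) <= sinh (x*b)" by (simp only: mult_1 sinh_real_le_iff)
    thus ?thesis using pos t by (simp add: g_def)
   qed (use t in \<open>simp add: g_def\<close>)
  qed
 next
  case 3
  define b where "b = sqrt (K/N)"
  have b: "0 < b" using 3 N by (simp add: b_def zero_less_divide_iff)
  have b2: "b^2 = K/N" using 3 N unfolding b_def by (simp add: zero_le_divide_iff)
  define A where "A = (%x. x*b) ` {0..D}"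
  have Api: "0 <= y & y < pi" if "y : A" for y
  proof -
   obtain x where "x : {0..D}" "y = x*b" using \<open>y : A\<close> unfolding A_def by blast
   hence x: "y = x*b" "0 <= x" "x <= D" by simp_all
   have "(x*b)^2 <= (D*b)^2" using x b by (intro power_mono mult_right_mono) auto
   also have "... = D^2*(K/N)" by (simp add: power_mult_distrib b2)
   also have "... < pi^2" using D[OF 3] N by (simp add: field_simps)
   finally have "x*b < pi" by (rule power_less_imp_less_base) simp
   thus ?thesis using x b by simp
  qed
  define g where "g x = (if x = 0 then t else sin (t*x)/sin x)" for x :: real
  have gc: "continuous_on A g"
   unfolding g_def
  proof (rule continuous_on_ratio)
   show "(sin has_real_derivative 1) (at 0)" using DERIV_sin[of 0] by simp
   show "continuous_on UNIV (sin :: real => real)" by (intro continuous_intros)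
   fix x assume "x : A" "x ~= 0"
   hence "0 < x" "x < pi" using Api[of x] by auto
   thus "sin x ~= 0" using sin_gt_zero[of x] by simp
  qed simp
  have dom: "cdom K D = {0..D}" using 3 by (simp add: cdom_def)
  have eq: "sigma_coeff K N s x = en (if x = 0 then s else sin (s*(x*b))/sin (x*b))" if x: "x : {0..D}" for s x
  proof (cases "x = 0")
   case True thus ?thesis using Npi by (simp add: sigma_coeff_def)
  next
   case False
   have "x*b : A" using x by (auto simp: A_def)
   hence "(x*b)^2 < pi^2" using Api[of "x*b"] by (intro power_strict_mono) auto
   hence "x^2*(K/N) < pi^2" by (simp add: power_mult_distrib b2)
   hence "N*pi^2 < K*x^2" using N by (simp add: field_simps)
   moreover have "K*x^2 < 0" using 3 False by (simp add: mult_neg_pos)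
   ultimately show ?thesis using False unfolding sigma_coeff_def b_def by (simp add: mult.assoc)
  qed
  show thesis
  proof (rule that[of "%x. g (x*b)"])
   show "continuous_on (cdom K D) (%x. g (x*b))"
    unfolding dom by (rule continuous_on_compose2[OF gc]) (auto intro!: continuous_intros simp: A_def)
   fix x assume "x : cdom K D"
   hence x: "x : {0..D}" using dom by simp
   have "x*b : A" unfolding A_def using x by (rule imageI)
   hence xb: "0 <= x*b" "x*b < pi" using Api[of "x*b"] by simp_all
   show "sigma_coeff K N t x = en (g (x*b))" unfolding eq[OF x] g_def using b by auto
   have "t*(x*b) <= 1*(x*b)" using t xb(1) by (intro mult_right_mono) auto
   hence "0 <= t*(x*b)" "t*(x*b) <= pi" using t xb by auto
   hence "0 <= sin (t*(x*b))" "0 <= sin (x*b)" using xb by (auto intro: sin_ge_zero)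
   thus "0 <= g (x*b)" unfolding g_def using t by auto
   show "sigma_coeff K N 1 x = 1"
   proof (cases "x = 0")
    case False
    hence "0 < x*b" using xb x b by auto
    hence "sin (x*b) ~= 0" using xb(2) sin_gt_zero[of "x*b"] by simp
    thus ?thesis unfolding eq[OF x] using False by simp
   qed (use eq[OF x, of 1] in simp)
  qed (use 3 in simp)
 qed
qed

text \<open>The coefficient is built from \<open>sigma_coeff\<close> with \<open>N - 1 < -1\<close>,
  so \<open>- K*D^2 < pi^2\<close> keeps it finite for every negative \<open>N\<close>; this is why
  the diameter bound does not involve the dimension. Boundedness comes from compactness if
  \<open>K < 0\<close>, and otherwise from values of \<open>sigma_coeff\<close> at most 1.\<close>

lemma tau_coeff_real:
 assumes N: "N < 0" and t: "0 < t" "t < 1" and D: "K < 0 ==> - K*D^2 < pi^2"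
 obtains s C where "continuous_on (cdom K D) s"
  "!!x. x : cdom K D ==> tau_coeff K N t x = en (s x)"
  "!!x. x : cdom K D ==> 0 <= s x" "!!x. x : cdom K D ==> s x <= C" "0 < C"
  "!!x. x : cdom K D ==> tau_coeff K N 1 x = 1"
proof -
 have D': "- K*D^2 < - (N - 1)*pi^2" if "K < 0"
 proof -
  have "1*pi^2 <= (- (N - 1))*pi^2" using N by (intro mult_right_mono) auto
  thus ?thesis using D[OF that] by linarith
 qed
 have N1: "N - 1 < 0" using N by simp
 obtain si where si: "continuous_on (cdom K D) si"
  "!!x. x : cdom K D ==> sigma_coeff K (N - 1) t x = en (si x)"
  "!!x. x : cdom K D ==> 0 <= si x" "!!x. x : cdom K D ==> sigma_coeff K (N - 1) 1 x = 1"
  "!!x. 0 <= K ==> x : cdom K D ==> si x <= 1"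
  using sigma_coeff_real[OF N1 t D'] by blast
 define p where "p = (N - 1)/N"
 have p: "0 < p" unfolding p_def using N by (simp add: zero_less_divide_iff)
 define s where "s x = t powr (1/N) * si x powr p" for x
 have sc: "continuous_on (cdom K D) s"
  unfolding s_def using si(1,3) p by (intro continuous_intros continuous_on_powr') auto
 have s0: "0 <= s x" for x by (simp add: s_def)
 have se: "tau_coeff K N t x = en (s x)" if x: "x : cdom K D" for x
  using t si(2,3)[OF x] unfolding tau_coeff_def tau_pos_def s_def p_def[symmetric]
  by (simp add: epowr_ennreal ennreal_mult)
 have one: "tau_coeff K N 1 x = 1" if x: "x : cdom K D" for x
  using si(4)[OF x] unfolding tau_coeff_def tau_pos_def by simp
 have "EX C>0. ALL x:cdom K D. s x <= C"
 proof (cases "K < 0")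
  case True
  hence "compact (cdom K D)" by (simp add: cdom_def)
  hence "compact (s ` cdom K D)" using sc by (rule compact_continuous_image[rotated])
  hence "bounded (s ` cdom K D)" by (rule compact_imp_bounded)
  then obtain C where "ALL y:s ` cdom K D. norm y <= C" "0 < C" by (auto simp: bounded_pos)
  thus ?thesis by (intro exI[of _ C]) auto
 next
  case False
  have "s x <= t powr (1/N)*1" if x: "x : cdom K D" for x
   unfolding s_def using si(5)[OF _ x] si(3)[OF x] False p powr_mono2[of p "si x" 1] by (intro mult_left_mono) auto
  thus ?thesis using t by (intro exI[of _ "t powr (1/N)*1"]) auto
 qed
 then obtain C where "0 < C" "!!x. x : cdom K D ==> s x <= C" by blast
 thus thesis using sc se s0 one by (intro that[of s C]) auto
qed

subsection \<open>Sub-Markov kernels\<close>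

text \<open>Densities of sub-Markov kernels from \<open>N\<close> to \<open>M\<close>.\<close>

definition push :: "'b measure => ('a => 'b => ennreal) => 'a measure => 'b measure" where
 "push M k nu = density M (%y. II x. k x y ||nu)"

definition push2 :: "'b measure => ('a => 'b => ennreal) => ('a => 'b => ennreal) => ('a \<times> 'a) measure => ('b \<times> 'b) measure" where
 "push2 M k k' P = density (M \<Otimes>\<^sub>M M) (%z. II u. k (fst u) (fst z) * k' (snd u) (snd z) ||P)"

lemma sets_push [simp, measurable_cong]: "sets (push M k nu) = sets M"
 by (simp add: push_def)

lemma sets_push2 [simp, measurable_cong]: "sets (push2 M k k' P) = sets (M \<Otimes>\<^sub>M M)"
 by (simp add: push2_def)

locale subkernel = sigma_finite_measure M for M :: "'b measure" +
 fixes N :: "'a measure" and k :: "'a => 'b => ennreal"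
 assumes k_measurable: "(%u. k (fst u) (snd u)) : bm (N \<Otimes>\<^sub>M M)"
  and k_le_1: "!!x. x : space N ==> (II y. k x y ||M) <= 1"
begin

lemma measurable_k [measurable (raw)]:
 assumes "f : L \<rightarrow>\<^sub>M N" "g : L \<rightarrow>\<^sub>M M"
 shows "(%w. k (f w) (g w)) : bm L"
 using measurable_compose[OF measurable_Pair[OF assms] k_measurable] by simp

lemma nn_integral_push:
 assumes nu: "sets nu = sets N" "sigma_finite_measure nu" and g [measurable]: "g : bm M"
 shows "(II y. g y ||push M k nu) = (II x. II y. k x y*g y ||M ||nu)"
proof -
 interpret V: sigma_finite_measure nu by fact
 interpret P: pair_sigma_finite nu M ..
 note [measurable_cong] = nu(1)
 have "(II y. g y ||push M k nu) = (II y. (II x. k x y ||nu)*g y ||M)"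
  unfolding push_def by (rule nn_integral_density) measurable
 also have "... = (II y. II x. k x y*g y ||nu ||M)"
  by (intro nn_integral_cong nn_integral_multc[symmetric]) measurable
 also have "... = (II x. II y. k x y*g y ||M ||nu)"
  by (rule P.Fubini') measurable
 finally show ?thesis .
qed

lemma emeasure_push:
 assumes nu: "sets nu = sets N" "sigma_finite_measure nu" and A: "A : sets M"
 shows "em (push M k nu) A = (II x. II y. k x y*ind A y ||M ||nu)"
 using nn_integral_push[OF nu, of "ind A"] A by simp

lemma push_le:
 assumes nu: "sets nu = sets N" "sigma_finite_measure nu"
 shows "em (push M k nu) (space M) <= em nu (space nu)"
proof -
 have sp: "space nu = space N" using nu(1) by (rule sets_eq_imp_space_eq)
 have "em (push M k nu) (space M) = (II x. II y. k x y*ind (space M) y ||M ||nu)"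
  by (rule emeasure_push[OF nu]) simp
 also have "... <= (II x. 1 ||nu)"
 proof (rule nn_integral_mono)
  fix x assume "x : space nu"
  hence "(II y. k x y ||M) <= 1" using k_le_1 sp by simp
  moreover have "(II y. k x y*ind (space M) y ||M) = (II y. k x y ||M)"
   by (intro nn_integral_cong) simp
  ultimately show "(II y. k x y*ind (space M) y ||M) <= 1" by simp
 qed
 finally show ?thesis by simp
qed

end

lemma subkernel_pair_integral:
 assumes k: "subkernel M N k" and k': "subkernel M N k'"
  and P: "sets P = sets (N \<Otimes>\<^sub>M N)" "sigma_finite_measure P" and f: "f : bm (M \<Otimes>\<^sub>M M)"
 shows "(II z. f z ||push2 M k k' P) =
  (II u. II y. II y'. k (fst u) y * k' (snd u) y'*f (y, y') ||M ||M ||P)"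
proof -
 interpret K: subkernel M N k by fact
 have spP: "space P = space N \<times> space N"
  using sets_eq_imp_space_eq[OF P(1)] by (simp only: space_pair_measure)
 interpret K': subkernel M N k' by fact
 interpret V: sigma_finite_measure P by fact
 interpret MM: pair_sigma_finite M M ..
 interpret PM: pair_sigma_finite P "M \<Otimes>\<^sub>M M"
  using V.sigma_finite_measure_axioms MM.sigma_finite_measure_axioms by (rule pair_sigma_finite.intro)
 note [measurable_cong] = P(1)
 note [measurable] = f
 have "(II z. f z ||push2 M k k' P) = (II z. (II u. k (fst u) (fst z) * k' (snd u) (snd z) ||P)*f z ||(M \<Otimes>\<^sub>M M))"
  unfolding push2_def by (rule nn_integral_density) measurable
 also have "... = (II z. II u. k (fst u) (fst z) * k' (snd u) (snd z)*f z ||P ||(M \<Otimes>\<^sub>M M))"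
  by (intro nn_integral_cong nn_integral_multc[symmetric]) measurable
 also have "... = (II u. II z. k (fst u) (fst z) * k' (snd u) (snd z)*f z ||(M \<Otimes>\<^sub>M M) ||P)"
  by (rule PM.Fubini') measurable
 also have "... = (II u. II y. II y'. k (fst u) y * k' (snd u) y'*f (y, y') ||M ||M ||P)"
 proof (rule nn_integral_cong)
  fix u assume "u : space P"
  hence u: "fst u : space N" "snd u : space N"
   unfolding spP by (simp_all add: mem_Times_iff)
  have [measurable]: "(%z. k (fst u) (fst z) * k' (snd u) (snd z)*f z) : bm (M \<Otimes>\<^sub>M M)"
   using u by measurable
  show "(II z. k (fst u) (fst z) * k' (snd u) (snd z)*f z ||(M \<Otimes>\<^sub>M M)) = (II y. II y'. k (fst u) y * k' (snd u) y'*f (y, y') ||M ||M)"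
   by (subst K.nn_integral_fst[symmetric]) simp_all
 qed
 finally show ?thesis .
qed

lemma nn_integral_product:
 assumes [measurable]: "p : bm M" "q : bm M"
 shows "(II y. II y'. p y*q y' ||M ||M) = (II y. p y ||M)*(II y. q y ||M)"
 by (simp add: nn_integral_cmult nn_integral_multc)

text \<open>Under a product of two kernels a function of the image points is bounded by one of the
  source points as soon as the bound holds for all linked pairs. The weights \<open>g\<close> and
  \<open>g'\<close> carry densities in the two coordinates.\<close>

lemma push2_weighted:
 assumes k: "subkernel M N k" and k': "subkernel M N k'"
  and P: "sets P = sets (N \<Otimes>\<^sub>M N)" "sigma_finite_measure P"
  and f [measurable]: "f : bm (M \<Otimes>\<^sub>M M)" and g [measurable]: "g : bm M" "g' : bm M"
  and le: "!!x x' y y'. x : space N ==> x' : space N ==> y : space M ==> y' : space M ==>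
    k x y ~= 0 ==> k' x' y' ~= 0 ==> f (y, y') <= V (x, x')"
 shows "(II z. f z*(g (fst z)*g' (snd z)) ||push2 M k k' P) <=
  (II u. V u*((II y. k (fst u) y*g y ||M)*(II y. k' (snd u) y*g' y ||M)) ||P)"
proof -
 interpret K: subkernel M N k by fact
 interpret K': subkernel M N k' by fact
 have spP: "space P = space N \<times> space N"
  using sets_eq_imp_space_eq[OF P(1)] by (simp only: space_pair_measure)
 have "(II z. f z*(g (fst z)*g' (snd z)) ||push2 M k k' P) =
   (II u. II y. II y'. k (fst u) y * k' (snd u) y'*(f (y, y')*(g y*g' y')) ||M ||M ||P)"
  by (subst subkernel_pair_integral[OF k k' P]) simp_all
 also have "... <= (II u. V u*((II y. k (fst u) y*g y ||M)*(II y. k' (snd u) y*g' y ||M)) ||P)"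
 proof (rule nn_integral_mono)
  fix u assume "u : space P"
  hence u: "fst u : space N" "snd u : space N"
   unfolding spP by (simp_all add: mem_Times_iff)
  have [measurable]: "(%y. k (fst u) y) : bm M" "(%y. k' (snd u) y) : bm M"
   using u by measurable
  have "(II y. II y'. k (fst u) y * k' (snd u) y'*(f (y, y')*(g y*g' y')) ||M ||M)
    <= (II y. II y'. (V u*(k (fst u) y*g y))*(k' (snd u) y'*g' y') ||M ||M)"
  proof (intro nn_integral_mono)
   fix y y' assume y: "y : space M" "y' : space M"
   show "k (fst u) y * k' (snd u) y'*(f (y, y')*(g y*g' y')) <= (V u*(k (fst u) y*g y))*(k' (snd u) y'*g' y')"
   proof (cases "k (fst u) y = 0 | k' (snd u) y' = 0")
    case False
    hence "f (y, y') <= V u" using le[OF u y] by simp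
    hence "f (y, y')*(k (fst u) y * k' (snd u) y'*(g y*g' y')) <= V u*(k (fst u) y * k' (snd u) y'*(g y*g' y'))"
     by (rule mult_right_mono) simp
    thus ?thesis by (simp add: mult_ac)
   qed auto
  qed
  also have "... = V u*((II y. k (fst u) y*g y ||M)*(II y. k' (snd u) y*g' y ||M))"
   by (subst nn_integral_product) (simp_all add: nn_integral_cmult mult.assoc)
  finally show "(II y. II y'. k (fst u) y * k' (snd u) y'*(f (y, y')*(g y*g' y')) ||M ||M) <=
   V u*((II y. k (fst u) y*g y ||M)*(II y. k' (snd u) y*g' y ||M))" .
 qed
 finally show ?thesis .
qed

lemma
 assumes k: "subkernel M N k" and k': "subkernel M N k'"
  and P: "sets P = sets (N \<Otimes>\<^sub>M N)" "sigma_finite_measure P"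
  and f: "f : bm (M \<Otimes>\<^sub>M M)" and g: "g : bm M"
  and le: "!!x x' y y'. x : space N ==> x' : space N ==> y : space M ==> y' : space M ==>
    k x y ~= 0 ==> k' x' y' ~= 0 ==> f (y, y') <= V (x, x')"
 shows push2_weighted_le: "(II z. f z*g (fst z) ||push2 M k k' P) <= (II u. V u*(II y. k (fst u) y*g y ||M) ||P)"
  and push2_weighted_le_snd: "(II z. f z*g (snd z) ||push2 M k k' P) <= (II u. V u*(II y. k' (snd u) y*g y ||M) ||P)"
  and push2_le: "(II z. f z ||push2 M k k' P) <= (II u. V u ||P)"
proof -
 interpret K: subkernel M N k by fact
 interpret K': subkernel M N k' by fact
 have spP: "space P = space N \<times> space N"
  using sets_eq_imp_space_eq[OF P(1)] by (simp only: space_pair_measure)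
 have k1: "(II y. k (fst u) y ||M) <= 1" "(II y. k' (snd u) y ||M) <= 1" if "u : space P" for u
  using that K.k_le_1 K'.k_le_1 unfolding spP by (simp_all add: mem_Times_iff)
 have w: "V u*(a*b) <= V u*a" "V u*(b*a) <= V u*a" if "b <= 1" for u a b
  using mult_left_mono[OF that, of "V u*a"] by (simp_all add: mult_ac)
 note W = push2_weighted[where V=V and f=f, OF k k' P f _ _ le]
 show "(II z. f z*g (fst z) ||push2 M k k' P) <= (II u. V u*(II y. k (fst u) y*g y ||M) ||P)"
  using W[OF g, of "%_. 1"] by (simp add: order_trans[OF _ nn_integral_mono[OF w(1)[OF k1(2)]]])
 show "(II z. f z*g (snd z) ||push2 M k k' P) <= (II u. V u*(II y. k' (snd u) y*g y ||M) ||P)"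
  using W[OF _ g, of "%_. 1"] by (simp add: order_trans[OF _ nn_integral_mono[OF w(2)[OF k1(1)]]])
 have "V u*((II y. k (fst u) y ||M)*(II y. k' (snd u) y ||M)) <= V u" if "u : space P" for u
  using mult_left_mono[OF mult_mono[OF k1[OF that]], of "V u"] by simp
 thus "(II z. f z ||push2 M k k' P) <= (II u. V u ||P)"
  using W[of "%_. 1" "%_. 1"] by (simp add: order_trans[OF _ nn_integral_mono])
qed

lemma emeasure_push2:
 assumes k: "subkernel M N k" and k': "subkernel M N k'"
  and P: "sets P = sets (N \<Otimes>\<^sub>M N)" "sigma_finite_measure P" and [measurable]: "A : sets M" "A' : sets M"
 shows "em (push2 M k k' P) (A \<times> A') =
  (II u. (II y. k (fst u) y*ind A y ||M)*(II y. k' (snd u) y*ind A' y ||M) ||P)"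
proof -
 interpret K: subkernel M N k by fact
 interpret K': subkernel M N k' by fact
 have spP: "space P = space N \<times> space N"
  using sets_eq_imp_space_eq[OF P(1)] by (simp only: space_pair_measure)
 have "em (push2 M k k' P) (A \<times> A') = (II z. ind (A \<times> A') z ||push2 M k k' P)" by simp
 also have "... = (II u. II y. II y'. k (fst u) y * k' (snd u) y'*ind (A \<times> A') (y, y') ||M ||M ||P)"
  by (rule subkernel_pair_integral[OF k k' P]) measurable
 also have "... = (II u. (II y. k (fst u) y*ind A y ||M)*(II y. k' (snd u) y*ind A' y ||M) ||P)"
 proof (rule nn_integral_cong)
  fix u assume "u : space P"
  hence u: "fst u : space N" "snd u : space N"
   unfolding spP by (simp_all add: mem_Times_iff)
  have [measurable]: "(%y. k (fst u) y) : bm M" "(%y. k' (snd u) y) : bm M"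
   using u by measurable
  show "(II y. II y'. k (fst u) y * k' (snd u) y'*ind (A \<times> A') (y, y') ||M ||M) =
    (II y. k (fst u) y*ind A y ||M)*(II y. k' (snd u) y*ind A' y ||M)"
   by (subst nn_integral_product[symmetric]) (auto intro!: nn_integral_cong simp: indicator_def)
 qed
 finally show ?thesis .
qed

text \<open>The kernels may lose mass, so each marginal of the transported plan also misses what the
  other coordinate loses. The last two inequalities bound this deficit through
  \<open>x + y <= x*y + 1\<close>; they are written as sums to stay within
  \<open>ennreal\<close>.\<close>

lemma push2_marginals:
 assumes k: "subkernel M N k" and k': "subkernel M N k'"
  and P: "sets P = sets (N \<Otimes>\<^sub>M N)" "prob_space P"
  and nu: "sets nu = sets N" "sigma_finite_measure nu" "!!f. f : bm N ==> (II u. f (fst u) ||P) = (II x. f x ||nu)"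
  and nu': "sets nu' = sets N" "sigma_finite_measure nu'" "!!f. f : bm N ==> (II u. f (snd u) ||P) = (II x. f x ||nu')"
  and A: "A : sets M"
 shows "em (push2 M k k' P) (A \<times> space M) <= em (push M k nu) A"
  "em (push2 M k k' P) (space M \<times> A) <= em (push M k' nu') A"
  "em (push M k nu) A + em (push M k' nu') (space M) <= em (push2 M k k' P) (A \<times> space M) + 1"
  "em (push M k' nu') A + em (push M k nu) (space M) <= em (push2 M k k' P) (space M \<times> A) + 1"
proof -
 interpret K: subkernel M N k by fact
 have spP: "space P = space N \<times> space N"
  using sets_eq_imp_space_eq[OF P(1)] by (simp only: space_pair_measure)
 interpret K': subkernel M N k' by fact
 interpret P: prob_space P by fact
 note [measurable] = A
 note [measurable_cong] = P(1)
 have sP: "sigma_finite_measure P" ..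
 define a where "a E x = (II y. k x y*ind E y ||M)" for E x
 define b where "b E x = (II y. k' x y*ind E y ||M)" for E x
 have am [measurable]: "a E : bm N" if [measurable]: "E : sets M" for E
  unfolding a_def by measurable
 have bm [measurable]: "b E : bm N" if [measurable]: "E : sets M" for E
  unfolding b_def by measurable
 have a1: "a E x <= 1" if "x : space N" for E x
  unfolding a_def by (rule order_trans[OF nn_integral_mono K.k_le_1[OF that]]) (simp add: indicator_def)
 have b1: "b E x <= 1" if "x : space N" for E x
  unfolding b_def by (rule order_trans[OF nn_integral_mono K'.k_le_1[OF that]]) (simp add: indicator_def)
 have eP: "em (push M k nu) E = (II u. a E (fst u) ||P)" if E: "E : sets M" for E
  using K.emeasure_push[OF nu(1,2) E, folded a_def] nu(3)[OF am[OF E]] by simp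
 have eP': "em (push M k' nu') E = (II u. b E (snd u) ||P)" if E: "E : sets M" for E
  using K'.emeasure_push[OF nu'(1,2) E, folded b_def] nu'(3)[OF bm[OF E]] by simp
 have e2: "em (push2 M k k' P) (E \<times> E') = (II u. a E (fst u)*b E' (snd u) ||P)"
  if "E : sets M" "E' : sets M" for E E'
  unfolding a_def b_def by (rule emeasure_push2[OF k k' P(1) sP that])
 have inP: "fst u : space N" "snd u : space N" if "u : space P" for u
  using that unfolding spP by (simp_all add: mem_Times_iff)
 have W: "(II u. f u*g u ||P) <= (II u. f u ||P)"
   "(II u. f u ||P) + (II u. g u ||P) <= (II u. f u*g u ||P) + 1"
  if [measurable]: "f : bm P" "g : bm P"
   and le: "!!u. u : space P ==> f u <= 1" "!!u. u : space P ==> g u <= 1" for f g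
 proof -
  show "(II u. f u*g u ||P) <= (II u. f u ||P)"
   using mult_left_mono[OF le(2)] by (intro nn_integral_mono) fastforce
  have "(II u. f u ||P) + (II u. g u ||P) = (II u. f u + g u ||P)"
   by (rule nn_integral_add[symmetric]) measurable
  also have "... <= (II u. f u*g u + 1 ||P)"
   by (intro nn_integral_mono ennreal_product_defect le)
  also have "... = (II u. f u*g u ||P) + 1" by (subst nn_integral_add) (auto simp: P.emeasure_space_1)
  finally show "(II u. f u ||P) + (II u. g u ||P) <= (II u. f u*g u ||P) + 1" .
 qed
 have m: "(%u. a E (fst u)) : bm P" "(%u. b E (snd u)) : bm P" if [measurable]: "E : sets M" for E
  by measurable
 note W0 = W[OF m(1)[OF A] m(2)[OF sets.top] a1[OF inP(1)] b1[OF inP(2)]]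
  and W1 = W[OF m(2)[OF A] m(1)[OF sets.top] b1[OF inP(2)] a1[OF inP(1)]]
 show "em (push2 M k k' P) (A \<times> space M) <= em (push M k nu) A"
  "em (push M k nu) A + em (push M k' nu') (space M) <= em (push2 M k k' P) (A \<times> space M) + 1"
  unfolding e2[OF A sets.top] eP[OF A] eP'[OF sets.top] by (rule W0; assumption)+
 show "em (push2 M k k' P) (space M \<times> A) <= em (push M k' nu') A"
  "em (push M k' nu') A + em (push M k nu) (space M) <= em (push2 M k k' P) (space M \<times> A) + 1"
  unfolding e2[OF sets.top A] eP'[OF A] eP[OF sets.top] mult.commute[of "a (space M) _"] by (rule W1; assumption)+
qed

lemma emeasure_density_space:
 assumes [measurable]: "f : bm M"
 shows "em (density M f) (space M) = (II x. f x ||M)"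
 by (subst emeasure_density) (auto intro!: nn_integral_cong)

lemma weighted_Jensen:
 assumes p: "1 < p" and [measurable]: "w : bm M" "u : bm M" and fin: "(II x. w x ||M) < top"
 shows "epowr (II x. w x*u x ||M) p <= (II x. w x*epowr (u x) p ||M)*epowr (II x. w x ||M) (p - 1)"
proof -
 have e: "em (density M w) (space (density M w)) = (II x. w x ||M)"
  using emeasure_density_space[of w M] by simp
 have "epowr (II x. u x ||density M w) p <= (II x. epowr (u x) p ||density M w)*epowr (em (density M w) (space (density M w))) (p - 1)"
  using fin e by (intro epowr_Jensen p) auto
 thus ?thesis unfolding e by (simp add: nn_integral_density)
qed

text \<open>Weights of total at most 1 suffice, because the power of the total mass in
  \<open>weighted_Jensen\<close> is then at most 1.\<close>

lemma suminf_Jensen: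
 assumes p: "1 < p" and h: "(\<Sum>i. h i) <= (1 :: ennreal)"
 shows "epowr (\<Sum>i. h i * v i) p <= (\<Sum>i. h i*epowr (v i) p)"
proof -
 have "epowr (II i. h i * v i ||count_space UNIV) p <=
   (II i. h i*epowr (v i) p ||count_space UNIV)*epowr (II i. h i ||count_space UNIV) (p - 1)"
  using h by (intro weighted_Jensen p) (auto simp: nn_integral_count_space_nat intro: le_less_trans)
 also have "... <= (II i. h i*epowr (v i) p ||count_space UNIV)*1"
  using h p epowr_mono[of "p - 1" "\<Sum>i. h i" 1] by (intro mult_left_mono) (auto simp: nn_integral_count_space_nat)
 finally show ?thesis by (simp add: nn_integral_count_space_nat)
qed

text \<open>The value 0 at 0 makes cells of measure zero drop out of all sums.\<close>

definition inv0 :: "ennreal => ennreal" where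
 "inv0 z = (if z = 0 then 0 else inverse z)"

lemma inv0_mult: "z ~= 0 ==> z < top ==> inv0 z*z = 1"
proof -
 assume "z ~= 0" "z < top"
 then obtain r where r: "z = en r" "0 < r" by (cases z) (auto simp: less_le)
 thus ?thesis unfolding inv0_def by (simp add: inverse_ennreal ennreal_mult'[symmetric])
qed

lemma inv0_mult_le: "z < top ==> inv0 z*z <= 1"
 using inv0_mult[of z] by (cases "z = 0") auto

lemma inv0_0 [simp]: "inv0 0 = 0"
 by (simp add: inv0_def)

section \<open>Returning measures from \<open>X\<close> to \<open>Y\<close>\<close>

locale transfer_pair = X: pgm X + Y: pgm Y
 for X :: "'a pgmms" and Y :: "'b pgmms" +
 fixes L :: nat and de :: real and C :: "nat => 'a set" and h :: "nat => 'b => ennreal" and c :: real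
 assumes tr: "transfer X Y L de C h c" and de: "0 < de" "de <= 1/2" and L1: "1 <= L"
begin

lemma trD:
 shows C_in [measurable]: "C i : sets X.B" and C_disj: "disjoint_family C" and C_UN: "(UN i. C i) = reg X L"
  and h_meas [measurable]: "h i : bm Y.B" and h_sum: "(\<Sum>i. h i y) <= 1"
  and c_bounds: "1 - de <= c" "c <= 1 + de"
  and H_le: "(II y. h i y ||Y.M) <= en c*em X.M (C i)"
  and H_defect: "(\<Sum>i. en c*em X.M (C i) - (II y. h i y ||Y.M)) <= en de"
  and h_defect: "(II y. (1 - (\<Sum>i. h i y))*ind (reg Y (L - 1)) y ||Y.M) <= en de"
  and h_dist: "x : C i ==> x' : C i' ==> y : Y.S ==> y' : Y.S ==> h i y ~= 0 ==> h i' y' ~= 0 ==> \<bar>X.d x x' - Y.d y y'\<bar> <= de"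
  and h_reg1: "l <= L ==> x : C i ==> y : Y.S ==> h i y ~= 0 ==> x : reg X l ==> y : reg Y (Suc l)"
  and h_reg2: "l <= L ==> x : C i ==> y : Y.S ==> h i y ~= 0 ==> y : reg Y l ==> x : reg X (Suc l)"
 using tr unfolding transfer_def by blast+

definition m :: "nat => ennreal" where "m i = em X.M (C i)"
definition H :: "nat => ennreal" where "H i = (II y. h i y ||Y.M)"

lemma c_pos: "0 < c" "c <= 2" "1/2 <= c"
 using c_bounds de by linarith+

lemma m_fin: "m i < top"
proof -
 have "m i <= em X.M (reg X L)" unfolding m_def using C_UN by (intro emeasure_mono) auto
 thus ?thesis using X.M_regular by (rule le_less_trans)
qed

lemma H_le': "H i <= en c * m i"
 unfolding H_def m_def by (rule H_le)

lemma cm_fin: "en c * m i < top"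
 using m_fin by (simp add: ennreal_mult_less_top)

lemma H_fin: "H i < top"
 using H_le' cm_fin by (rule le_less_trans)

text \<open>Kernels out of \<open>X\<close> depend on the cell only, so a measure on
  \<open>X\<close> enters its image only through its masses on the cells, as in
  \<open>push_cellk\<close>.\<close>

definition cellk :: "(nat => 'b => ennreal) => 'a => 'b => ennreal" where
 "cellk ph x y = (\<Sum>i. ind (C i) x*ph i y)"

lemma indicator_C_suminf:
 assumes "x : C i" shows "(\<Sum>j. ind (C j) x*f j) = (f i :: ennreal)"
proof -
 have "x ~: C j" if "j ~= i" for j using C_disj assms that by (auto simp: disjoint_family_on_def)
 hence "(\<Sum>j. ind (C j) x*f j) = (\<Sum>j\<in>{i}. ind (C j) x*f j)" by (intro suminf_finite) auto
 thus ?thesis using assms by simp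
qed

lemma cellk_eq: "x : C i ==> cellk ph x y = ph i y"
 unfolding cellk_def by (rule indicator_C_suminf)

lemma cellk_0: "(!!i. x ~: C i) ==> cellk ph x y = 0"
 unfolding cellk_def by simp

lemma cellk_nonzero: "cellk ph x y ~= 0 ==> EX i. x : C i & ph i y ~= 0"
 using cellk_0[of x ph y] cellk_eq[of x _ ph y] by metis

lemma cellk_measurable:
 assumes [measurable]: "!!i. ph i : bm Y.B"
 shows "(%u. cellk ph (fst u) (snd u)) : bm (X.B \<Otimes>\<^sub>M Y.M)"
 unfolding cellk_def by measurable

lemma cellk_subkernel:
 assumes ph: "!!i. ph i : bm Y.B" and le: "!!i. (II y. ph i y ||Y.M) <= 1"
 shows "subkernel Y.M X.B (cellk ph)"
proof (rule subkernel.intro[OF Y.sf], unfold_locales)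
 show "(%u. cellk ph (fst u) (snd u)) : bm (X.B \<Otimes>\<^sub>M Y.M)" by (rule cellk_measurable[OF ph])
 fix x
 show "(II y. cellk ph x y ||Y.M) <= 1"
 proof (cases "EX i. x : C i")
  case True
  then obtain i where "x : C i" by blast
  thus ?thesis using le[of i] by (simp add: cellk_eq)
 next
  case False
  thus ?thesis by (simp add: cellk_0)
 qed
qed

lemma push_cellk:
 assumes ph [measurable]: "!!i. ph i : bm Y.B" and nu: "sets nu = sets X.B"
 shows "push Y.M (cellk ph) nu = density Y.M (%y. \<Sum>i. em nu (C i)*ph i y)"
proof -
 note [measurable_cong] = nu
 have "(II x. cellk ph x y ||nu) = (\<Sum>i. em nu (C i)*ph i y)" for y
  unfolding cellk_def by (subst nn_integral_suminf) (auto simp: nn_integral_multc nu)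
 thus ?thesis unfolding push_def by simp
qed

text \<open>The return kernel of intermediate times: what the coupling sends out of the cell, per
  unit of the mass \<open>c * m i\<close> that it finds there. It is sub-Markov since
  \<open>H i <= c * m i\<close>, and the differences of these masses sum to at most
  \<open>de\<close>.\<close>

definition kb :: "nat => 'b => ennreal" where "kb i y = inv0 (en c * m i)*h i y"

lemma kb_meas [measurable]: "kb i : bm Y.B"
 unfolding kb_def by measurable

lemma kb_int: "(II y. kb i y ||Y.M) = inv0 (en c * m i)*H i"
 unfolding kb_def H_def by (rule nn_integral_cmult) measurable

lemma kb_int_le: "(II y. kb i y ||Y.M) <= 1"
proof -
 have "inv0 (en c * m i)*H i <= inv0 (en c * m i)*(en c * m i)" by (intro mult_left_mono H_le') simp
 also have "... <= 1" by (rule inv0_mult_le[OF cm_fin])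
 finally show ?thesis unfolding kb_int .
qed

lemma kb_subkernel: "subkernel Y.M X.B (cellk kb)"
 by (rule cellk_subkernel[OF kb_meas kb_int_le])

lemma kb_nonzero: "kb i y ~= 0 ==> h i y ~= 0"
 by (auto simp: kb_def)

lemma X_set_Jensen:
 assumes p: "1 < p" and [measurable]: "s : bm X.B"
 shows "epowr (em (density X.M s) (C i)) p <= (II x. epowr (s x) p*ind (C i) x ||X.M)*epowr (m i) (p - 1)"
proof -
 have "epowr (II x. ind (C i) x * s x ||X.M) p <=
  (II x. ind (C i) x*epowr (s x) p ||X.M)*epowr (II x. ind (C i) x ||X.M) (p - 1)"
  using m_fin[of i] by (intro weighted_Jensen p) (auto simp: m_def)
 thus ?thesis by (simp add: emeasure_density m_def mult.commute)
qed

lemma sum_C_le: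
 assumes [measurable]: "f : bm X.B"
 shows "(\<Sum>i. II x. f x*ind (C i) x ||X.M) <= (II x. f x ||X.M)"
proof -
 have "(\<Sum>i. II x. f x*ind (C i) x ||X.M) = (II x. (\<Sum>i. ind (C i) x*f x) ||X.M)"
  by (subst nn_integral_suminf) (auto simp: mult.commute)
 moreover have "(\<Sum>i. ind (C i) x*f x) <= f x" for x
  using indicator_C_suminf[of x _ "%_. f x"] by (cases "EX i. x : C i") auto
 ultimately show ?thesis by (simp add: nn_integral_mono)
qed

text \<open>The returned density at \<open>y\<close> is an average, with weights
  \<open>h i y\<close> of total at most 1, of the mean densities on the cells divided by
  \<open>c\<close>. Jensen's inequality is used for this average and again on each cell;
  \<open>H i <= c * m i\<close> restores the cell measures and leaves the power \<open>1 - p\<close>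
  of \<open>c\<close>.\<close>

lemma back_entropy:
 assumes p: "1 < p" and s [measurable]: "s : bm X.B"
 shows "(II y. epowr (\<Sum>i. em (density X.M s) (C i) * kb i y) p ||Y.M) <=
   en (c powr (1 - p))*(II x. epowr (s x) p ||X.M)"
proof -
 define n where "n i = em (density X.M s) (C i)" for i
 define J where "J i = (II x. epowr (s x) p*ind (C i) x ||X.M)" for i
 define v where "v i = n i*inv0 (en c * m i)" for i
 have "(II y. epowr (\<Sum>i. n i * kb i y) p ||Y.M) <= (II y. (\<Sum>i. h i y*epowr (v i) p) ||Y.M)"
 proof (rule nn_integral_mono)
  fix y
  have "(\<Sum>i. n i * kb i y) = (\<Sum>i. h i y * v i)"
   by (intro suminf_cong) (simp add: kb_def v_def mult_ac)
  thus "epowr (\<Sum>i. n i * kb i y) p <= (\<Sum>i. h i y*epowr (v i) p)"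
   using suminf_Jensen[OF p h_sum[of y], of v] by simp
 qed
 also have "... = (\<Sum>i. H i*epowr (v i) p)"
  unfolding H_def by (subst nn_integral_suminf) (auto simp: nn_integral_multc)
 also have "... <= (\<Sum>i. en (c powr (1 - p))*J i)"
 proof (intro suminf_le)
  fix i
  show "H i*epowr (v i) p <= en (c powr (1 - p))*J i"
  proof (cases "m i = 0")
   case True thus ?thesis using H_le'[of i] by simp
  next
   case False
   obtain r where r: "m i = en r" "0 < r" using False m_fin[of i] by (cases "m i") (auto simp: less_le)
   have cr: "0 < c*r" using c_pos r by simp
   have v: "v i = n i*en (1/(c*r))"
    unfolding v_def r(1) inv0_def using c_pos r(2) cr
    by (simp add: ennreal_mult'[symmetric] inverse_ennreal inverse_eq_divide ennreal_eq_0_iff)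
   have "H i*epowr (v i) p <= (en c * m i)*(epowr (n i) p*epowr (en (1/(c*r))) p)"
    unfolding v using p H_le'[of i] by (subst epowr_mult) (auto intro!: mult_right_mono)
   also have "... <= (en c * m i)*((J i*epowr (m i) (p - 1))*epowr (en (1/(c*r))) p)"
    using X_set_Jensen[OF p s, of i] unfolding n_def J_def by (intro mult_left_mono mult_right_mono) auto
   also have "... = en (c*r*(r powr (p - 1)*(1/(c*r)) powr p))*J i"
    unfolding r(1) using c_pos r(2) by (simp add: epowr_ennreal ennreal_mult mult_ac)
   also have "c*r*(r powr (p - 1)*(1/(c*r)) powr p) = c powr (1 - p)"
   proof -
    have "c*r*(r powr (p - 1)*(1/(c*r)) powr p) = (c powr 1*r powr 1)*(r powr (p - 1)*(c powr - p*r powr - p))"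
     using c_pos r(2) by (simp add: powr_divide powr_mult powr_minus_divide)
    also have "... = c powr (1 + - p)*r powr (1 + (p - 1) + - p)"
     by (simp only: powr_add mult_ac)
    finally show ?thesis using r(2) by simp
   qed
   finally show ?thesis .
  qed
 qed auto
 also have "... = en (c powr (1 - p))*(\<Sum>i. J i)" by simp
 also have "(\<Sum>i. J i) <= (II x. epowr (s x) p ||X.M)" unfolding J_def by (rule sum_C_le) measurable
 finally show ?thesis unfolding n_def by (simp add: mult_left_mono)
qed

text \<open>Mass is lost outside \<open>reg X L\<close> and, in each cell, by the fraction
  \<open>D i/(c * m i)\<close>. The deficits \<open>D i\<close> are small only relative to the
  reference measure, so the mass of a cell is split at density level \<open>a\<close>: below it the
  loss is at most \<open>(a/c) * D i\<close>, above it the \<open>L^p\<close> norm bounds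
  everything.\<close>

lemma back_mass:
 assumes p: "1 < p" and s [measurable]: "s : bm X.B" and a: "0 < a"
 shows "em (density X.M s) X.S <= em (push Y.M (cellk kb) (density X.M s)) Y.S +
   em (density X.M s) (X.S - reg X L) +
   (en (a/c)*en de + en (a powr (1 - p))*(II x. epowr (s x) p ||X.M))"
proof -
 let ?nu = "density X.M s"
 define n where "n i = em ?nu (C i)" for i
 define J where "J i = (II x. epowr (s x) p*ind (C i) x ||X.M)" for i
 define D where "D i = en c * m i - H i" for i
 have HD: "H i + D i = en c * m i" for i
  unfolding D_def using H_le'[of i] by (rule add_diff_inverse_ennreal)
 have ni: "n i <= n i*(inv0 (en c * m i)*H i) + (en (a/c)*D i + en (a powr (1 - p))*J i)" for i
 proof (cases "m i = 0")
  case True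
  have "C i : null_sets X.M" using True by (simp add: m_def null_sets_def)
  hence "C i : null_sets ?nu"
   using absolutely_continuousI_density[of s X.M] s unfolding absolutely_continuous_def X.sets_M[symmetric] by (metis X.sets_M measurable_cong_sets subsetD)
  thus ?thesis by (simp add: n_def null_sets_def)
 next
  case False
  let ?q = "inv0 (en c * m i)"
  have cm0: "en c * m i ~= 0" using False c_pos by (simp add: ennreal_eq_0_iff)
  have q1: "?q*(en c * m i) = 1" by (rule inv0_mult[OF cm0 cm_fin])
  have qD: "?q*D i <= 1"
  proof -
   have "?q*D i <= ?q*(en c * m i)" unfolding HD[symmetric] by (intro mult_left_mono) (simp_all add: add_increasing)
   thus ?thesis unfolding q1 .
  qed
  have "n i = n i*(?q*(H i + D i))" unfolding HD q1 by simp
  also have "... = n i*(?q*H i) + n i*(?q*D i)" by (simp only: distrib_left)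
  also have "n i*(?q*D i) <= (en a * m i + en (a powr (1 - p))*J i)*(?q*D i)"
   unfolding n_def J_def m_def by (intro mult_right_mono emeasure_density_Lp_le[OF p a]) auto
  also have "... = (en a * m i*?q)*D i + en (a powr (1 - p))*J i*(?q*D i)"
   by (simp only: distrib_right mult.assoc)
  also have "... <= en (a/c)*D i + en (a powr (1 - p))*J i*1"
  proof (intro add_mono mult_right_mono mult_left_mono qD)
   have "en a * m i*?q = en (a/c)*(?q*(en c * m i))"
    using c_pos a by (simp add: mult_ac ennreal_mult'[symmetric] flip: mult.assoc)
   thus "en a * m i*?q <= en (a/c)" unfolding q1 by simp
  qed simp_all
  finally show ?thesis by (simp add: add_left_mono)
 qed
 have UN: "(UN i. C i) : sets X.B" by auto
 have "em ?nu X.S = em ?nu (X.S - reg X L) + em ?nu (UN i. C i)"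
  unfolding C_UN using X.regular_sub by (subst plus_emeasure) (auto intro!: arg_cong[where f="em ?nu"])
 also have "em ?nu (UN i. C i) = (\<Sum>i. n i)"
  unfolding n_def by (rule suminf_emeasure[symmetric]) (auto simp: C_disj)
 also have "(\<Sum>i. n i) <= (\<Sum>i. n i*(inv0 (en c * m i)*H i) + (en (a/c)*D i + en (a powr (1 - p))*J i))"
  by (intro suminf_le ni) auto
 also have "... = (\<Sum>i. n i*(inv0 (en c * m i)*H i)) + (en (a/c)*(\<Sum>i. D i) + en (a powr (1 - p))*(\<Sum>i. J i))"
  by (simp add: suminf_add[symmetric])
 also have "(\<Sum>i. n i*(inv0 (en c * m i)*H i)) = em (push Y.M (cellk kb) ?nu) Y.S"
 proof -
  have "em (push Y.M (cellk kb) ?nu) Y.S = (II y. (\<Sum>i. n i * kb i y)*ind Y.S y ||Y.M)"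
   unfolding push_cellk[OF kb_meas, of ?nu, simplified] n_def by (subst emeasure_density) auto
  also have "... = (II y. (\<Sum>i. n i * kb i y) ||Y.M)" by (intro nn_integral_cong) simp
  also have "... = (\<Sum>i. n i*(II y. kb i y ||Y.M))" by (subst nn_integral_suminf) (auto simp: nn_integral_cmult)
  finally show ?thesis by (simp add: kb_int)
 qed
 also have "(\<Sum>i. D i) <= en de" unfolding D_def m_def H_def by (rule H_defect)
 also have "(\<Sum>i. J i) <= (II x. epowr (s x) p ||X.M)" unfolding J_def by (rule sum_C_le) measurable
 finally show ?thesis by (simp add: add.commute add.left_commute add_left_mono mult_left_mono)
qed

lemma push_regular:
 assumes k: "subkernel Y.M X.B (cellk ph)" and nz: "!!i y. ph i y ~= 0 ==> h i y ~= 0"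
  and nu: "sets nu = sets X.B" "sigma_finite_measure nu" and l: "l <= L"
 shows "em (push Y.M (cellk ph) nu) (Y.S - reg Y (Suc l)) <= em nu (X.S - reg X l)"
proof -
 interpret K: subkernel Y.M X.B "cellk ph" by fact
 have "em (push Y.M (cellk ph) nu) (Y.S - reg Y (Suc l)) =
   (II x. II y. cellk ph x y*ind (Y.S - reg Y (Suc l)) y ||Y.M ||nu)"
  by (rule K.emeasure_push[OF nu]) simp
 also have "... <= (II x. ind (X.S - reg X l) x ||nu)"
 proof (rule nn_integral_mono)
  fix x assume "x : space nu"
  hence x: "x : X.S" using sets_eq_imp_space_eq[OF nu(1)] by simp
  show "(II y. cellk ph x y*ind (Y.S - reg Y (Suc l)) y ||Y.M) <= ind (X.S - reg X l) x"
  proof (cases "x : reg X l")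
   case True
   have "(II y. cellk ph x y*ind (Y.S - reg Y (Suc l)) y ||Y.M) = (II y. 0 ||Y.M)"
   proof (rule nn_integral_cong)
    fix y assume "y : space Y.M"
    hence y: "y : Y.S" by simp
    show "cellk ph x y*ind (Y.S - reg Y (Suc l)) y = 0"
    proof (cases "cellk ph x y = 0")
     case False
     then obtain i where "x : C i" "ph i y ~= 0" using cellk_nonzero by blast
     hence "y : reg Y (Suc l)" using h_reg1[OF l _ y nz True] by blast
     thus ?thesis by simp
    qed simp
   qed
   thus ?thesis by simp
  next
   case False
   have "(II y. cellk ph x y*ind (Y.S - reg Y (Suc l)) y ||Y.M) <= (II y. cellk ph x y ||Y.M)"
    by (intro nn_integral_mono) (simp add: indicator_def)
   also have "... <= 1" using K.k_le_1 x by simp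
   finally show ?thesis using False x by simp
  qed
 qed
 also have "... = em nu (X.S - reg X l)" using nu(1) by simp
 finally show ?thesis .
qed

end

section \<open>Sending measures from \<open>Y\<close> to \<open>X\<close>\<close>

context transfer_pair
begin

lemma m_inv0_le: "m i*(inv0 (m i)*z) <= z"
 using mult_right_mono[OF inv0_mult_le[OF m_fin[of i]], of z] by (simp add: mult_ac)

text \<open>The coupling read in the other direction: \<open>y\<close> chooses the cell
  \<open>C i\<close> with probability \<open>h i y\<close> and is spread uniformly over it. The
  total \<open>fmass y\<close> falls short of 1 where the coupling leaks.\<close>

definition fk :: "'b => 'a => ennreal" where
 "fk y x = (\<Sum>i. ind (C i) x*(inv0 (m i)*h i y))"

lemma fk_eq: "x : C i ==> fk y x = inv0 (m i)*h i y"
 unfolding fk_def by (rule indicator_C_suminf)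

lemma fk_nonzero: "fk y x ~= 0 ==> EX i. x : C i & h i y ~= 0"
proof (cases "EX i. x : C i")
 case True
 assume "fk y x ~= 0"
 thus ?thesis using True fk_eq[of x _ y] by force
next
 case False
 assume "fk y x ~= 0"
 thus ?thesis using False by (simp add: fk_def)
qed

definition fmass :: "'b => ennreal" where "fmass y = (II x. fk y x ||X.M)"

lemma fmass_eq: "fmass y = (\<Sum>i. m i*(inv0 (m i)*h i y))"
 unfolding fmass_def fk_def by (subst nn_integral_suminf) (auto simp: nn_integral_multc m_def)

lemma fmass_le: "fmass y <= 1"
proof -
 have "fmass y <= (\<Sum>i. h i y)" unfolding fmass_eq by (intro suminf_le m_inv0_le) auto
 thus ?thesis using h_sum by (rule order_trans)
qed

lemma fk_subkernel: "subkernel X.M Y.B fk"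
proof (rule subkernel.intro[OF X.sf], unfold_locales)
 show "(%u. fk (fst u) (snd u)) : bm (Y.B \<Otimes>\<^sub>M X.M)" unfolding fk_def by measurable
 show "(II x. fk y x ||X.M) <= 1" for y using fmass_le[of y] unfolding fmass_def .
qed

lemma fmass_measurable [measurable]: "fmass : bm Y.B"
proof -
 have "(%y. \<Sum>i. m i*(inv0 (m i)*h i y)) : bm Y.B" by measurable
 thus ?thesis using fmass_eq by (simp cong: measurable_cong)
qed

text \<open>A cell of measure zero receives nothing from \<open>fk\<close>, but then
  \<open>h i\<close> vanishes almost everywhere; so \<open>fmass\<close> agrees almost everywhere
  with the sum of the \<open>h i\<close>.\<close>

lemma fmass_defect: "(II y. (1 - fmass y)*ind (reg Y (L - 1)) y ||Y.M) <= en de"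
proof -
 have "AE y in Y.M. m i*(inv0 (m i)*h i y) = h i y" for i
 proof (cases "m i = 0")
  case True
  hence "H i = 0" using H_le'[of i] by simp
  hence "AE y in Y.M. h i y = 0" unfolding H_def by (subst (asm) nn_integral_0_iff_AE) auto
  thus ?thesis by eventually_elim simp
 next
  case False
  have "m i*(inv0 (m i)*h i y) = (inv0 (m i) * m i)*h i y" for y by (simp add: mult_ac)
  thus ?thesis using inv0_mult[OF False m_fin] by simp
 qed
 hence "AE y in Y.M. ALL i. m i*(inv0 (m i)*h i y) = h i y" by (subst AE_all_countable) blast
 hence "AE y in Y.M. (1 - fmass y)*ind (reg Y (L - 1)) y = (1 - (\<Sum>i. h i y))*ind (reg Y (L - 1)) y"
  by eventually_elim (simp add: fmass_eq)
 hence "(II y. (1 - fmass y)*ind (reg Y (L - 1)) y ||Y.M) =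
   (II y. (1 - (\<Sum>i. h i y))*ind (reg Y (L - 1)) y ||Y.M)"
  by (rule nn_integral_cong_AE)
 thus ?thesis using h_defect by simp
qed

end

section \<open>One transported marginal and its reversed kernel\<close>

locale transfer_marginal = transfer_pair X Y L de C h c
 for X :: "'a pgmms" and Y :: "'b pgmms" and L de C h c +
 fixes r rh :: "'b => ennreal" and w :: real
 assumes r_meas [measurable]: "r : bm Y.B" and rh_meas [measurable]: "rh : bm Y.B"
  and r_le: "!!y. r y <= rh y" and rh_int: "(II y. rh y ||Y.M) <= 1" and w: "0 < w"
begin

definition I :: "nat => ennreal" where "I i = (II y. h i y*r y ||Y.M)"

text \<open>Density of the image under \<open>fk\<close> of the part \<open>r\<close> of
  \<open>rh\<close> that survives truncation and leakage, divided by the surviving mass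
  \<open>w\<close>.\<close>

definition s :: "'a => ennreal" where
 "s x = (\<Sum>i. ind (C i) x*(inv0 (m i)*I i*en (1/w)))"

abbreviation al :: "'a measure" where "al == density X.M s"

lemma s_eq: "x : C i ==> s x = inv0 (m i)*I i*en (1/w)"
 unfolding s_def by (rule indicator_C_suminf)

lemma s_0: "(!!i. x ~: C i) ==> s x = 0"
 unfolding s_def by simp

lemma s_meas [measurable]: "s : bm X.B"
 unfolding s_def by measurable

lemma h_le_1: "h i y <= 1"
proof -
 have "(\<Sum>j\<in>{i}. h j y) <= (\<Sum>j. h j y)" by (rule sum_le_suminf) auto
 thus ?thesis using h_sum[of y] by simp
qed

lemma I_fin: "I i < top"
proof -
 have "I i <= (II y. 1*rh y ||Y.M)" unfolding I_def by (intro nn_integral_mono mult_mono h_le_1 r_le) auto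
 also have "... <= 1" using rh_int by simp
 finally show ?thesis by (rule le_less_trans) simp
qed

lemma s_integral: "f 0 = 0 ==> (II x. f (s x) ||X.M) = (\<Sum>i. m i*f (inv0 (m i)*I i*en (1/w)))"
 for f :: "ennreal => ennreal"
proof -
 assume f0: "f 0 = 0"
 have "f (s x) = (\<Sum>i. ind (C i) x*f (inv0 (m i)*I i*en (1/w)))" for x
 proof (cases "EX i. x : C i")
  case True
  then obtain i where "x : C i" by blast
  thus ?thesis using indicator_C_suminf[of x i "%i. f (inv0 (m i)*I i*en (1/w))"] s_eq[of x i] by simp
 next
  case False
  thus ?thesis using s_0[of x] f0 by simp
 qed
 thus ?thesis by (simp, subst nn_integral_suminf) (auto simp: nn_integral_multc m_def)
qed

lemma alpha_C: "em al (C i) = m i*(inv0 (m i)*(I i*en (1/w)))"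
proof -
 have "em al (C i) = (II x. (inv0 (m i)*I i*en (1/w))*ind (C i) x ||X.M)"
  by (subst emeasure_density) (auto intro!: nn_integral_cong simp: s_eq split: split_indicator)
 thus ?thesis by (subst (asm) nn_integral_cmult_indicator) (auto simp: m_def mult_ac)
qed

lemma alpha_push: "A : sets X.B ==> em al A = en (1/w)*em (push X.M fk (density Y.M r)) A"
proof -
 assume [measurable]: "A : sets X.B"
 have "(II y. fk y x ||density Y.M r)*en (1/w) = s x" for x
 proof (cases "EX i. x : C i")
  case True
  then obtain i where i: "x : C i" by blast
  have "(II y. fk y x ||density Y.M r) = inv0 (m i)*I i"
   unfolding I_def fk_eq[OF i] by (simp add: nn_integral_density nn_integral_cmult[symmetric] mult_ac)
  thus ?thesis using s_eq[OF i] by simp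
 next
  case False
  thus ?thesis by (simp add: s_0 fk_def)
 qed
 hence "em al A = (II x. en (1/w)*((II y. fk y x ||density Y.M r)*ind A x) ||X.M)"
  by (subst emeasure_density) (auto intro!: nn_integral_cong simp: mult_ac)
 moreover have "(%x. II y. fk y x ||density Y.M r) : bm X.M"
 proof -
  interpret K: subkernel X.M Y.B fk by (rule fk_subkernel)
  have "(%x. II y. r y*fk y x ||Y.M) : bm X.M" by measurable
  moreover have "(II y. fk y x ||density Y.M r) = (II y. r y*fk y x ||Y.M)" if "x : space X.M" for x
   using that by (intro nn_integral_density) measurable
  ultimately show ?thesis by (subst measurable_cong) auto
 qed
 ultimately show ?thesis unfolding push_def
  by (subst emeasure_density) (simp_all add: nn_integral_cmult)
qed

lemma Jensen_I:
 assumes p: "1 < p"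
 shows "epowr (I i) p <= (II y. h i y*epowr (r y) p ||Y.M)*epowr (en c * m i) (p - 1)"
proof -
 have "epowr (I i) p <= (II y. h i y*epowr (r y) p ||Y.M)*epowr (H i) (p - 1)"
  unfolding I_def H_def using H_fin[of i] by (intro weighted_Jensen p) (auto simp: H_def)
 also have "... <= (II y. h i y*epowr (r y) p ||Y.M)*epowr (en c * m i) (p - 1)"
  using p by (intro mult_left_mono epowr_mono H_le') auto
 finally show ?thesis .
qed

text \<open>On a cell, Jensen's inequality compares the constant value of \<open>s\<close> with the
  average of \<open>r^p\<close> under \<open>h i\<close>. The powers of \<open>m i\<close> cancel
  and those of \<open>c\<close> and \<open>1/w\<close> remain.\<close>

lemma entropy_le:
 assumes p: "1 < p"
 shows "(II x. epowr (s x) p ||X.M) <= en (c powr (p - 1)*(1/w) powr p)*(II y. epowr (rh y) p ||Y.M)"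
proof -
 define J where "J i = (II y. h i y*epowr (r y) p ||Y.M)" for i
 let ?c = "en (c powr (p - 1)*(1/w) powr p)"
 have "(II x. epowr (s x) p ||X.M) = (\<Sum>i. m i*epowr (inv0 (m i)*I i*en (1/w)) p)"
  by (rule s_integral) simp
 also have "... <= (\<Sum>i. ?c*J i)"
 proof (intro suminf_le)
  fix i
  show "m i*epowr (inv0 (m i)*I i*en (1/w)) p <= ?c*J i"
  proof (cases "m i = 0")
   case False
   then obtain q where q: "m i = en q" "0 < q" using m_fin[of i] by (cases "m i") (auto simp: less_le)
   have "m i*epowr (inv0 (m i)*I i*en (1/w)) p =
     (m i*epowr (inv0 (m i)) p*epowr (en (1/w)) p)*epowr (I i) p"
    using p by (simp add: epowr_mult mult_ac)
   also have "... <= (m i*epowr (inv0 (m i)) p*epowr (en (1/w)) p)*(J i*epowr (en c * m i) (p - 1))"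
    unfolding J_def by (intro mult_left_mono Jensen_I p) simp
   also have "... = en (q*(1/q) powr p*(1/w) powr p*(c*q) powr (p - 1))*J i"
   proof -
    have i0: "inv0 (en q) = en (1/q)"
     using q(2) by (simp add: inv0_def inverse_ennreal inverse_eq_divide)
    have cq: "en c*en q = en (c*q)" using c_pos q(2) by (simp add: ennreal_mult)
    have e: "epowr (en (1/q)) p = en ((1/q) powr p)" "epowr (en (1/w)) p = en ((1/w) powr p)"
     "epowr (en (c*q)) (p - 1) = en ((c*q) powr (p - 1))"
     using q(2) w c_pos by (simp_all only: epowr_ennreal divide_nonneg_nonneg mult_nonneg_nonneg less_imp_le zero_le_one)
    have g: "en q*en a*en b*(J i*en d) = en (q*a*b*d)*J i"
     if "0 <= a" "0 <= b" "0 <= d" for a b d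
     using that q(2) by (simp add: ennreal_mult mult_ac)
    show ?thesis unfolding q(1) i0 cq e by (rule g) simp_all
   qed
   also have "q*(1/q) powr p*(1/w) powr p*(c*q) powr (p - 1) = c powr (p - 1)*(1/w) powr p"
   proof -
    have "q*(1/q) powr p*(q powr (p - 1)) = q powr (1 + (- p) + (p - 1))"
     using q(2) by (simp only: powr_add) (simp add: powr_divide powr_minus_divide)
    hence "q*(1/q) powr p*(q powr (p - 1)) = 1" using q(2) by simp
    moreover have "q*(1/q) powr p*(1/w) powr p*(c*q) powr (p - 1) =
      (q*(1/q) powr p*(q powr (p - 1)))*(c powr (p - 1)*(1/w) powr p)"
     using q(2) c_pos by (simp add: powr_mult)
    ultimately show ?thesis by simp
   qed
   finally show ?thesis .
  qed simp
 qed auto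
 also have "... = ?c*(\<Sum>i. J i)" by simp
 also have "... <= ?c*(II y. epowr (rh y) p ||Y.M)"
 proof (rule mult_left_mono)
  have "(\<Sum>i. J i) = (II y. (\<Sum>i. h i y)*epowr (r y) p ||Y.M)"
   unfolding J_def by (subst nn_integral_suminf[symmetric]) auto
  also have "... <= (II y. 1*epowr (rh y) p ||Y.M)"
   using p by (intro nn_integral_mono mult_mono h_sum epowr_mono r_le) auto
  finally show "(\<Sum>i. J i) <= (II y. epowr (rh y) p ||Y.M)" by simp
 qed simp
 finally show ?thesis .
qed

lemma alpha_tight:
 assumes l: "l <= L"
 shows "em al (X.S - reg X (Suc l)) <= en (1/w)*em (density Y.M rh) (Y.S - reg Y l)"
proof -
 interpret K: subkernel X.M Y.B fk by (rule fk_subkernel)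
 let ?A = "X.S - reg X (Suc l)" and ?D = "Y.S - reg Y l"
 have fin: "finite_measure (density Y.M r)"
 proof
  have "(II y. r y ||Y.M) <= (II y. rh y ||Y.M)" by (intro nn_integral_mono r_le)
  hence "(II y. r y ||Y.M) <= 1" using rh_int by (rule order_trans)
  moreover have "em (density Y.M r) (space (density Y.M r)) = (II y. r y ||Y.M)"
   using emeasure_density_space[of r Y.M] by simp
  ultimately show "em (density Y.M r) (space (density Y.M r)) ~= \<infinity>" by (auto simp: top_unique)
 qed
 then interpret D: finite_measure "density Y.M r" .
 have "em (push X.M fk (density Y.M r)) ?A = (II y. II x. fk y x*ind ?A x ||X.M ||density Y.M r)"
  by (rule K.emeasure_push) (auto intro: D.sigma_finite_measure_axioms)
 also have "... <= (II y. ind ?D y ||density Y.M r)"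
 proof (rule nn_integral_mono)
  fix y assume "y : space (density Y.M r)"
  hence y: "y : Y.S" by simp
  show "(II x. fk y x*ind ?A x ||X.M) <= ind ?D y"
  proof (cases "y : reg Y l")
   case True
   have "fk y x*ind ?A x = 0" for x
   proof (cases "fk y x = 0")
    case False
    then obtain i where "x : C i" "h i y ~= 0" using fk_nonzero by blast
    hence "x : reg X (Suc l)" using h_reg2[OF l _ y _ True] by blast
    thus ?thesis by simp
   qed simp
   hence "(II x. fk y x*ind ?A x ||X.M) = (II x. 0 ||X.M)" by (simp only:)
   thus ?thesis by simp
  next
   case False
   have "(II x. fk y x*ind ?A x ||X.M) <= (II x. fk y x ||X.M)"
    by (intro nn_integral_mono) (simp add: indicator_def)
   also have "... <= 1" using fmass_le[of y] unfolding fmass_def .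
   finally show ?thesis using False y by simp
  qed
 qed
 also have "... <= em (density Y.M rh) ?D"
  by (simp add: emeasure_density) (intro nn_integral_mono mult_right_mono r_le, simp)
 finally show ?thesis by (subst alpha_push) (auto intro: mult_left_mono)
qed

text \<open>The reversal of \<open>fk\<close> on the surviving marginal: given the cell, the
  conditional density of the point of \<open>Y\<close> that was sent there. Sending
  \<open>al\<close> back by it loses no mass and yields a density at most \<open>rh/w\<close>, which
  is why the returned endpoints converge to the original marginals.\<close>

definition ph :: "nat => 'b => ennreal" where "ph i y = inv0 (I i)*(h i y*r y)"

lemma ph_meas [measurable]: "ph i : bm Y.B"
 unfolding ph_def by measurable

lemma ph_int: "(II y. ph i y ||Y.M) = inv0 (I i)*I i"
 unfolding ph_def I_def by (rule nn_integral_cmult) measurable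

lemma ph_subkernel: "subkernel Y.M X.B (cellk ph)"
 by (rule cellk_subkernel[OF ph_meas]) (simp add: ph_int inv0_mult_le[OF I_fin])

lemma ph_nonzero: "ph i y ~= 0 ==> h i y ~= 0"
 by (auto simp: ph_def)

lemma push_ph: "push Y.M (cellk ph) al = density Y.M (%y. \<Sum>i. em al (C i)*ph i y)"
 by (rule push_cellk) auto

lemma push_ph_le: "(\<Sum>i. em al (C i)*ph i y) <= en (1/w)*rh y"
proof -
 have "em al (C i)*ph i y <= en (1/w)*r y*h i y" for i
 proof -
  have "em al (C i)*ph i y <= (I i*en (1/w))*(inv0 (I i)*(h i y*r y))"
   unfolding alpha_C ph_def by (intro mult_right_mono m_inv0_le) simp
  also have "... = (inv0 (I i)*I i)*(en (1/w)*r y*h i y)" by (simp add: mult_ac)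
  also have "... <= 1*(en (1/w)*r y*h i y)" by (intro mult_right_mono inv0_mult_le I_fin) simp
  finally show ?thesis by simp
 qed
 hence "(\<Sum>i. em al (C i)*ph i y) <= (\<Sum>i. en (1/w)*r y*h i y)" by (intro suminf_le) auto
 also have "... = en (1/w)*r y*(\<Sum>i. h i y)" by simp
 also have "... <= en (1/w)*rh y*1" by (intro mult_mono h_sum r_le) auto
 finally show ?thesis by simp
qed

lemma push_ph_mass: "em (push Y.M (cellk ph) al) Y.S = em al X.S"
proof -
 have e: "em al (C i)*(inv0 (I i)*I i) = em al (C i)" for i
  by (cases "I i = 0") (simp_all add: alpha_C inv0_mult[OF _ I_fin])
 have "em (push Y.M (cellk ph) al) Y.S = (II y. (\<Sum>i. em al (C i)*ph i y) ||Y.M)"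
  unfolding push_ph by (subst emeasure_density) (auto intro!: nn_integral_cong)
 also have "... = (\<Sum>i. em al (C i)*(II y. ph i y ||Y.M))"
  by (subst nn_integral_suminf) (auto simp: nn_integral_cmult)
 also have "... = (\<Sum>i. em al (C i))" unfolding ph_int e ..
 also have "... = em al (UN i. C i)" by (rule suminf_emeasure) (auto simp: C_disj)
 also have "... = em al X.S"
 proof -
  have "em al X.S = (II x. s x*ind X.S x ||X.M)" by (subst emeasure_density) auto
  also have "... = (II x. s x*ind (UN i. C i) x ||X.M)"
   by (intro nn_integral_cong) (auto simp: s_0 split: split_indicator)
  also have "... = em al (UN i. C i)" by (subst emeasure_density) auto
  finally show ?thesis by simp
 qed
 finally show ?thesis .
qed

text \<open>Jensen's inequality for the exponent \<open>1 + a\<close> on one cell, divided by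
  \<open>I i\<close>, turns the weight \<open>h i * r/I i\<close> into \<open>ph\<close>. The power
  of the density on \<open>X\<close> that enters the distortion functional is thus bounded by the
  return kernel applied to the same power on \<open>Y\<close>. Raising the exponent to
  \<open>1 + a\<close> is what admits every \<open>a > 0\<close>, below 1 as well.\<close>

lemma s_powr_le:
 assumes a: "0 < a"
 shows "epowr (s x) a <= en ((c/w) powr a)*(II y. cellk ph x y*epowr (rh y) a ||Y.M)"
proof (cases "EX i. x : C i & m i ~= 0 & I i ~= 0")
 case True
 then obtain i where i: "x : C i" "m i ~= 0" "I i ~= 0" by blast
 obtain q where q: "m i = en q" "0 < q" using i(2) m_fin[of i] by (cases "m i") (auto simp: less_le)
 let ?J = "II y. h i y*(r y*epowr (rh y) a) ||Y.M"
 have J: "(II y. cellk ph x y*epowr (rh y) a ||Y.M) = inv0 (I i)*?J"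
  unfolding cellk_eq[OF i(1)] ph_def by (subst nn_integral_cmult[symmetric]) (auto simp: mult_ac)
 have "epowr (I i) (1 + a) <= (II y. h i y*epowr (r y) (1 + a) ||Y.M)*epowr (en c * m i) a"
  using Jensen_I[of "1 + a" i] a by simp
 also have "... <= ?J*epowr (en c * m i) a"
 proof (intro mult_right_mono nn_integral_mono mult_left_mono)
  fix y show "epowr (r y) (1 + a) <= r y*epowr (rh y) a"
   using a by (subst epowr_add) (auto intro!: mult_left_mono epowr_mono r_le)
 qed auto
 finally have I: "epowr (I i) (1 + a) <= ?J*epowr (en c * m i) a" .
 have "epowr (I i) a = (inv0 (I i)*I i)*epowr (I i) a" using inv0_mult[OF i(3) I_fin] by simp
 also have "... = inv0 (I i)*epowr (I i) (1 + a)" using a by (simp add: epowr_add mult_ac)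
 also have "... <= inv0 (I i)*(?J*epowr (en c * m i) a)" by (intro mult_left_mono I) simp
 finally have Ia: "epowr (I i) a <= inv0 (I i)*?J*epowr (en c * m i) a" by (simp add: mult_ac)
 have "epowr (s x) a = epowr (inv0 (m i)) a*epowr (en (1/w)) a*epowr (I i) a"
  unfolding s_eq[OF i(1)] using a by (simp add: epowr_mult mult_ac)
 also have "... <= epowr (inv0 (m i)) a*epowr (en (1/w)) a*(inv0 (I i)*?J*epowr (en c * m i) a)"
  by (intro mult_left_mono Ia) simp
 also have "... = epowr (inv0 (m i)*en (1/w)*(en c * m i)) a*(inv0 (I i)*?J)"
  using a by (simp add: epowr_mult mult_ac)
 also have "inv0 (m i)*en (1/w)*(en c * m i) = (inv0 (m i) * m i)*(en (1/w)*en c)"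
  by (simp add: mult_ac)
 also have "... = en (c/w)" unfolding inv0_mult[OF i(2) m_fin] using w by (simp add: ennreal_mult'[symmetric])
 finally show ?thesis unfolding J using w c_pos by (simp add: epowr_ennreal)
next
 case False
 have "s x = 0"
 proof (cases "EX i. x : C i")
  case True
  then obtain i where i: "x : C i" by blast
  hence "m i = 0 | I i = 0" using False by blast
  thus ?thesis unfolding s_eq[OF i] by auto
 qed (simp add: s_0)
 thus ?thesis by simp
qed

lemma alpha_P2_ac:
 assumes "em al X.S = 1"
 shows "al : X.P2ac"
proof (rule X.P2_ac_density)
 have "(II x. X.dd x (pnt X) ||al) = (II x. s x*X.dd x (pnt X) ||X.M)"
  using X.pgD(6) by (intro nn_integral_density) measurable
 also have "... <= (II x. en ((2^(L + 1))^2) * s x ||X.M)"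
 proof (rule nn_integral_mono)
  fix x assume "x : space X.M"
  show "s x*X.dd x (pnt X) <= en ((2^(L + 1))^2) * s x"
  proof (cases "EX i. x : C i")
   case True
   hence "x : reg X L" using C_UN by blast
   hence "X.d x (pnt X) <= 2^(L + 1)" by (simp add: regular_set_def X.d_commute)
   hence "X.dd x (pnt X) <= en ((2^(L + 1))^2)" by (intro ennreal_leI power_mono) auto
   from mult_left_mono[OF this, of "s x"] show ?thesis by (simp add: mult.commute)
  qed (simp add: s_0)
 qed
 also have "... = en ((2^(L + 1))^2)*(II x. s x ||X.M)" by (rule nn_integral_cmult) simp
 also have "(II x. s x ||X.M) = 1"
 proof -
  show ?thesis using emeasure_density_space[of s X.M] assms by simp
 qed
 finally show "al : P2 (metr X)" using assms X.pgD(6) by (intro X.P2I[of _ "pnt X"]) (auto simp: less_top[symmetric] top_unique)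
qed simp

end

subsection \<open>Transporting marginals, plans and geodesics\<close>

context transfer_pair
begin

text \<open>Everything that the limit argument uses of a transported marginal, freed from the choice
  of \<open>r\<close>; \<open>s\<close> is its density on \<open>X\<close> and \<open>k\<close> its
  return kernel.\<close>

definition endpoint :: "('b => ennreal) => real => ('a => ennreal) => (nat => 'b => ennreal) => bool" where
 "endpoint rh w s k \<longleftrightarrow> s : bm X.B & density X.M s : X.P2ac &
   (ALL p>1. (II x. epowr (s x) p ||X.M) <= en (c powr (p - 1)*(1/w) powr p)*(II y. epowr (rh y) p ||Y.M)) &
   (ALL l<=L. em (density X.M s) (X.S - reg X (Suc l)) <= en (1/w)*em (density Y.M rh) (Y.S - reg Y l)) &
   (ALL i. k i : bm Y.B) & subkernel Y.M X.B (cellk k) & (ALL i y. k i y ~= 0 --> h i y ~= 0) &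
   (ALL A:sets Y.B. em (push Y.M (cellk k) (density X.M s)) A <= en (1/w)*em (density Y.M rh) A) &
   em (push Y.M (cellk k) (density X.M s)) Y.S = 1 &
   (ALL a>0. ALL x. epowr (s x) a <= en ((c/w) powr a)*(II y. cellk k x y*epowr (rh y) a ||Y.M))"

lemma (in transfer_marginal) endpointI:
 assumes "em al X.S = 1"
 shows "endpoint rh w s ph"
proof -
 have "em (push Y.M (cellk ph) al) A <= en (1/w)*em (density Y.M rh) A" if [measurable]: "A : sets Y.B" for A
 proof -
  have "em (push Y.M (cellk ph) al) A <= (II y. en (1/w)*(rh y*ind A y) ||Y.M)"
   unfolding push_ph by (subst emeasure_density) (auto intro!: nn_integral_mono simp: push_ph_le split: split_indicator)
  thus ?thesis by (simp add: nn_integral_cmult emeasure_density)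
 qed
 thus ?thesis unfolding endpoint_def
  using s_meas alpha_P2_ac[OF assms] entropy_le alpha_tight ph_meas ph_subkernel ph_nonzero push_ph_mass assms s_powr_le
  by (intro conjI allI impI ballI) auto
qed

text \<open>The two marginals are transported together with a plan, so that their distance on
  \<open>X\<close> stays controlled. The plan is restricted to \<open>E0 \<times> E1\<close> and
  both coordinates are pushed by \<open>fk\<close>. As the kernel leaks, each marginal of the result
  carries the factor \<open>fmass\<close> of the other coordinate; \<open>r0\<close> and
  \<open>r1\<close> are the resulting sub-densities and \<open>w\<close> is the surviving mass. On
  \<open>E0\<close> and \<open>E1\<close> the densities are at most \<open>j\<close>, so leakage
  costs at most \<open>2*j*de\<close>.\<close>

lemma forward:
 assumes ac: "mu0 : Y.P2ac" "mu1 : Y.P2ac"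
  and g: "ga : Y.cpl mu0 mu1"
  and rh0: "rh0 : bm Y.B" "mu0 = density Y.M rh0" and rh1: "rh1 : bm Y.B" "mu1 = density Y.M rh1"
  and j: "0 <= j" and E: "E0 = {y : reg Y (L - 1). rh0 y <= en j}" "E1 = {y : reg Y (L - 1). rh1 y <= en j}"
  and e: "en (2*j*de) + em mu0 (Y.S - E0) + em mu1 (Y.S - E1) <= en e" "0 <= e" "e <= 1/2"
 obtains w s0 s1 k0 k1 where "1 - e <= w" "w <= 1" "endpoint rh0 w s0 k0" "endpoint rh1 w s1 k1"
  "X.TC (density X.M s0) (density X.M s1) <= en (1/w)*(II z. en ((Y.d (fst z) (snd z) + de)^2) ||ga)"
proof -
 note gD = Y.couplingsD[OF g]
 note [measurable] = rh0(1) rh1(1)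
 have [measurable]: "E0 : sets Y.B" "E1 : sets Y.B" unfolding E by measurable
 note [measurable_cong] = gD(1)
 have P2: "mu0 : P2 (metr Y)" "mu1 : P2 (metr Y)" using ac by (simp_all add: P2_ac_def)
 have mass1: "em mu0 Y.S = 1" "em mu1 Y.S = 1" using P2[THEN Y.P2D(4)] by auto
 have gS: "em ga (Y.S \<times> Y.S) = 1" using gD(7)[OF Y.S_in_B] mass1 by simp
 define R where "R = density ga (ind (E0 \<times> E1))"
 have sR [measurable_cong]: "sets R = sets Y.BB" by (simp add: R_def gD(1))
 have spR: "space R = Y.S \<times> Y.S" by (simp add: R_def gD(2))
 have intR: "(II z. f z ||R) = (II z. ind (E0 \<times> E1) z*f z ||ga)" if [measurable]: "f : bm Y.BB" for f
  unfolding R_def by (rule nn_integral_density) measurable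
 have R_le: "(II z. f z ||R) <= (II z. f z ||ga)" if "f : bm Y.BB" for f
  unfolding intR[OF that] by (intro nn_integral_mono) (simp split: split_indicator)
 have R1: "em R (space R) <= 1"
  using R_le[of "ind (Y.S \<times> Y.S)"] gS gD(1) by (simp add: spR sR)
 interpret R: finite_measure R by standard (use R1 in \<open>auto simp: top_unique\<close>)
 have sfR: "sigma_finite_measure R" ..
 define W where "W = (II z. fmass (fst z)*fmass (snd z) ||R)"
 have ff1: "fmass y*fmass y' <= 1" for y y' using mult_mono[OF fmass_le[of y] fmass_le[of y']] by simp
 have W1: "W <= 1"
 proof -
  have "W <= (II z. 1 ||R)" unfolding W_def by (intro nn_integral_mono ff1)
  thus ?thesis using R1 by simp
 qed
 have defect: "(II z. ind (E0 \<times> E1) z*(1 - fmass (fst z)) ||ga) <= en (j*de)" (is ?D0)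
  "(II z. ind (E0 \<times> E1) z*(1 - fmass (snd z)) ||ga) <= en (j*de)" (is ?D1)
 proof -
  have aux: "(II y. ind E y*(1 - fmass y) ||density Y.M rh) <= en (j*de)"
   if E': "E = {y : reg Y (L - 1). rh y <= en j}" and [measurable]: "rh : bm Y.B" "E : sets Y.B" for E rh
  proof -
   have "(II y. ind E y*(1 - fmass y) ||density Y.M rh) = (II y. rh y*(ind E y*(1 - fmass y)) ||Y.M)"
    by (rule nn_integral_density) measurable
   also have "... <= (II y. en j*((1 - fmass y)*ind (reg Y (L - 1)) y) ||Y.M)"
    by (intro nn_integral_mono) (auto simp: E' indicator_def intro: mult_right_mono)
   also have "... = en j*(II y. (1 - fmass y)*ind (reg Y (L - 1)) y ||Y.M)"
    by (rule nn_integral_cmult) measurable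
   also have "... <= en j*en de" by (intro mult_left_mono fmass_defect) simp
   finally show ?thesis using j de by (simp add: ennreal_mult)
  qed
  have "(II z. ind (E0 \<times> E1) z*(1 - fmass (fst z)) ||ga) <= (II z. ind E0 (fst z)*(1 - fmass (fst z)) ||ga)"
   by (intro nn_integral_mono mult_right_mono) (auto simp: indicator_def)
  also have "... = (II y. ind E0 y*(1 - fmass y) ||mu0)" by (rule gD(9)) measurable
  also have "... <= en (j*de)" unfolding rh0(2) by (rule aux[OF E(1)]) measurable
  finally show ?D0 .
  have "(II z. ind (E0 \<times> E1) z*(1 - fmass (snd z)) ||ga) <= (II z. ind E1 (snd z)*(1 - fmass (snd z)) ||ga)"
   by (intro nn_integral_mono mult_right_mono) (auto simp: indicator_def)
  also have "... = (II y. ind E1 y*(1 - fmass y) ||mu1)" by (rule gD(10)) measurable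
  also have "... <= en (j*de)" unfolding rh1(2) by (rule aux[OF E(2)]) measurable
  finally show ?D1 .
 qed
 have "1 <= W + en e"
 proof -
  have "1 = (II z. 1 ||ga)" using gS gD(2) by simp
  \<comment> \<open>Pairs outside \<open>E0 \<times> E1\<close> are paid by the last two terms,
    pairs inside by the product defect.\<close>
  also have "... <= (II z. (ind (E0 \<times> E1) z*(fmass (fst z)*fmass (snd z)) +
    (ind (E0 \<times> E1) z*(1 - fmass (fst z)) + ind (E0 \<times> E1) z*(1 - fmass (snd z)))) +
    (ind (Y.S - E0) (fst z) + ind (Y.S - E1) (snd z)) ||ga)"
  proof (rule nn_integral_mono)
   fix z assume "z : space ga"
   hence z: "fst z : Y.S" "snd z : Y.S" unfolding gD(2) by (simp_all add: mem_Times_iff)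
   show "1 <= (ind (E0 \<times> E1) z*(fmass (fst z)*fmass (snd z)) +
    (ind (E0 \<times> E1) z*(1 - fmass (fst z)) + ind (E0 \<times> E1) z*(1 - fmass (snd z)))) +
    (ind (Y.S - E0) (fst z) + ind (Y.S - E1) (snd z) :: ennreal)"
   proof (cases "z : E0 \<times> E1")
    case True
    thus ?thesis using ennreal_product_defect(1)[OF fmass_le fmass_le, of "fst z" "snd z"] by (simp add: add_increasing2)
   next
    case False
    hence "fst z ~: E0 | snd z ~: E1" by (simp add: mem_Times_iff)
    thus ?thesis using z by (auto simp: add_increasing2 add_increasing)
   qed
  qed
  also have "... = (W + ((II z. ind (E0 \<times> E1) z*(1 - fmass (fst z)) ||ga) + (II z. ind (E0 \<times> E1) z*(1 - fmass (snd z)) ||ga))) +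
    ((II z. ind (Y.S - E0) (fst z) ||ga) + (II z. ind (Y.S - E1) (snd z) ||ga))"
   unfolding W_def by (subst intR, measurable) (subst nn_integral_add[symmetric], measurable)+
  also have "(II z. ind (Y.S - E0) (fst z) ||ga) = em mu0 (Y.S - E0)"
   using gD(9)[of "ind (Y.S - E0)"] gD(3) by simp
  also have "(II z. ind (Y.S - E1) (snd z) ||ga) = em mu1 (Y.S - E1)"
   using gD(10)[of "ind (Y.S - E1)"] gD(4) by simp
  also have "(W + ((II z. ind (E0 \<times> E1) z*(1 - fmass (fst z)) ||ga) + (II z. ind (E0 \<times> E1) z*(1 - fmass (snd z)) ||ga))) +
    (em mu0 (Y.S - E0) + em mu1 (Y.S - E1)) <=
    (W + (en (j*de) + en (j*de))) + (em mu0 (Y.S - E0) + em mu1 (Y.S - E1))"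
   by (intro add_mono defect order_refl)
  also have "en (j*de) + en (j*de) = en (2*j*de)"
   using j de by (subst ennreal_plus[symmetric]) (auto simp: algebra_simps)
  also have "(W + en (2*j*de)) + (em mu0 (Y.S - E0) + em mu1 (Y.S - E1)) <= W + en e"
   using add_left_mono[OF e(1), of W] by (simp add: add_ac)
  finally show ?thesis .
 qed
 obtain w where w: "W = en w" "0 <= w" "w <= 1" using W1 by (cases W) (auto simp: top_unique)
 have "en 1 <= en (w + e)" using \<open>1 <= W + en e\<close> w e(2) by (simp add: ennreal_plus)
 hence we: "1 - e <= w" using w e(2) by (subst (asm) ennreal_le_iff) auto
 hence w0: "0 < w" using e(3) by linarith
 \<comment> \<open>Marginal of the restricted plan in one coordinate, weighted by the leakage in the
   other. It stays below \<open>rh\<close> since restriction and leakage only remove mass.\<close>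
 have marg: "EX r:bm Y.B. (ALL y. r y <= rh y) & (ALL f:bm Y.B. (II z. f (p z)*fmass (q z) ||R) = (II y. f y ||density Y.M r))"
  if [measurable]: "p : Y.BB \<rightarrow>\<^sub>M Y.B" "q : Y.BB \<rightarrow>\<^sub>M Y.B" "rh : bm Y.B"
   and gp: "!!f. f : bm Y.B ==> (II z. f (p z) ||ga) = (II y. f y ||density Y.M rh)"
   and rh: "em (density Y.M rh) Y.S = 1" for p q rh
 proof -
  let ?mu = "density Y.M rh"
  define R' where "R' = distr (density R (%z. fmass (q z))) Y.B p"
  have i: "(II y. f y ||R') = (II z. f (p z)*fmass (q z) ||R)" if [measurable]: "f : bm Y.B" for f
   unfolding R'_def by (simp add: nn_integral_distr nn_integral_density mult.commute)
  have le: "em R' A <= em ?mu A" if A: "A : sets ?mu" for A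
  proof -
   have [measurable]: "A : sets Y.B" using A by simp
   have "em R' A = (II y. ind A y ||R')" by (simp add: R'_def)
   also have "... = (II z. ind A (p z)*fmass (q z) ||R)" by (rule i) measurable
   also have "... <= (II z. ind A (p z) ||R)"
    by (intro nn_integral_mono) (simp add: fmass_le split: split_indicator)
   also have "... <= (II z. ind A (p z) ||ga)" by (rule R_le) measurable
   also have "... = (II y. ind A y ||?mu)" by (rule gp) measurable
   finally show ?thesis by simp
  qed
  have fin: "finite_measure ?mu" by standard (simp add: rh)
  have sR': "sets R' = sets ?mu" by (simp add: R'_def)
  obtain f where f: "f : bm ?mu" "ALL x. f x <= 1" "R' = density ?mu f"
   using bounded_Radon_Nikodym[OF fin sR' le] by blast
  have [measurable]: "f : bm Y.B" using f(1) by simp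
  have "R' = density Y.M (%y. rh y*f y)" unfolding f(3) by (rule density_density_eq) measurable
  moreover have "rh y*f y <= rh y" for y using mult_left_mono[of "f y" 1 "rh y"] f(2) by simp
  ultimately show ?thesis using i by (intro bexI[of _ "%y. rh y*f y"]) auto
 qed
 have m0: "em (density Y.M rh0) Y.S = 1" and m1: "em (density Y.M rh1) Y.S = 1"
  using mass1 rh0 rh1 by auto
 obtain r0 where r0: "r0 : bm Y.B" "ALL y. r0 y <= rh0 y"
  "ALL f:bm Y.B. (II z. f (fst z)*fmass (snd z) ||R) = (II y. f y ||density Y.M r0)"
  using marg[OF measurable_fst measurable_snd rh0(1) _ m0] gD(9) rh0(2) by blast
 obtain r1 where r1: "r1 : bm Y.B" "ALL y. r1 y <= rh1 y"
  "ALL f:bm Y.B. (II z. f (snd z)*fmass (fst z) ||R) = (II y. f y ||density Y.M r1)"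
  using marg[OF measurable_snd measurable_fst rh1(1) _ m1] gD(10) rh1(2) by blast
 have int1: "(II y. rh y ||Y.M) <= 1" if [measurable]: "rh : bm Y.B" and "em (density Y.M rh) Y.S = 1" for rh
  using that emeasure_density_space[of rh Y.M] by simp
 interpret M0: transfer_marginal X Y L de C h c r0 rh0 w
  using r0 w0 int1[OF rh0(1) m0] by unfold_locales auto
 interpret M1: transfer_marginal X Y L de C h c r1 rh1 w
  using r1 w0 int1[OF rh1(1) m1] by unfold_locales auto
 interpret K: subkernel X.M Y.B fk by (rule fk_subkernel)
 define P where "P = scale_measure (en (1/w)) (push2 X.M fk fk R)"
 have fin: "finite_measure (density Y.M r)" if r: "r : bm Y.B" "ALL y. r y <= rh y" "rh : bm Y.B" "em (density Y.M rh) Y.S = 1" for r rh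
 proof
  have "(II y. r y*ind Y.S y ||Y.M) <= (II y. rh y*ind Y.S y ||Y.M)"
   using r by (intro nn_integral_mono mult_right_mono) auto
  hence "em (density Y.M r) Y.S <= em (density Y.M rh) Y.S"
   using r by (simp only: emeasure_density Y.sets_M Y.S_in_B measurable_cong_sets[OF Y.sets_M refl])
  thus "em (density Y.M r) (space (density Y.M r)) ~= \<infinity>" using r(4) by (auto simp: top_unique)
 qed
 have sf0: "sigma_finite_measure (density Y.M r0)"
  using fin[OF r0(1,2) rh0(1) m0] by (rule finite_measure.sigma_finite_measure)
 have sf1: "sigma_finite_measure (density Y.M r1)"
  using fin[OF r1(1,2) rh1(1) m1] by (rule finite_measure.sigma_finite_measure)
 have fS: "(II x. fk y x*ind X.S x ||X.M) = fmass y" for y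
  unfolding fmass_def by (intro nn_integral_cong) simp
 note e2 = emeasure_push2[OF fk_subkernel fk_subkernel sR sfR, unfolded X.sets_M]
 have e0: "em (push2 X.M fk fk R) (A \<times> X.S) = em (push X.M fk (density Y.M r0)) A" if A [measurable]: "A : sets X.B" for A
 proof -
  have "em (push2 X.M fk fk R) (A \<times> X.S) = (II u. (II x. fk (fst u) x*ind A x ||X.M)*fmass (snd u) ||R)"
   unfolding e2[OF A X.S_in_B] fS ..
  also have "... = (II y. II x. fk y x*ind A x ||X.M ||density Y.M r0)"
   by (rule r0(3)[rule_format]) measurable
  also have "... = em (push X.M fk (density Y.M r0)) A"
   by (rule K.emeasure_push[symmetric]) (auto intro: sf0)
  finally show ?thesis .
 qed
 have e1: "em (push2 X.M fk fk R) (X.S \<times> A) = em (push X.M fk (density Y.M r1)) A" if A [measurable]: "A : sets X.B" for A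
 proof -
  have "em (push2 X.M fk fk R) (X.S \<times> A) = (II u. (II x. fk (snd u) x*ind A x ||X.M)*fmass (fst u) ||R)"
   unfolding e2[OF X.S_in_B A] fS by (simp only: mult.commute)
  also have "... = (II y. II x. fk y x*ind A x ||X.M ||density Y.M r1)"
   by (rule r1(3)[rule_format]) measurable
  also have "... = em (push X.M fk (density Y.M r1)) A"
   by (rule K.emeasure_push[symmetric]) (auto intro: sf1)
  finally show ?thesis .
 qed
 have sP: "sets P = sets X.BB" unfolding P_def by (simp cong: sets_pair_measure_cong)
 have P: "P : X.cpl M0.al M1.al"
 proof (rule X.couplingsI[OF sP])
  fix A assume A: "A : sets X.B"
  show "em P (A \<times> X.S) = em M0.al A" unfolding P_def using e0[OF A] M0.alpha_push[OF A] by simp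
  show "em P (X.S \<times> A) = em M1.al A" unfolding P_def using e1[OF A] M1.alpha_push[OF A] by simp
 qed simp_all
 have totP: "em P (X.S \<times> X.S) = 1"
 proof -
  have "em (push2 X.M fk fk R) (X.S \<times> X.S) = en w"
   unfolding e2[OF X.S_in_B X.S_in_B] fS w(1)[symmetric] W_def ..
  hence "em P (X.S \<times> X.S) = en (1/w)*en w" unfolding P_def by simp
  thus ?thesis using w0 by (simp add: ennreal_mult[symmetric])
 qed
 note PD = X.couplingsD[OF P]
 have a0: "em M0.al X.S = 1" using PD(7)[OF X.S_in_B] totP by simp
 have a1: "em M1.al X.S = 1" using PD(8)[OF X.S_in_B] totP by simp
 have c1: "(%z. X.sq z) : bm (X.M \<Otimes>\<^sub>M X.M)" by measurable
 have c2: "(%z. en ((Y.d (fst z) (snd z) + de)^2)) : bm Y.BB" by measurable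
 have "X.TC M0.al M1.al <= (X.cost P)" by (rule X.TC_le[OF P])
 also have "... = en (1/w)*(II z. X.sq z ||push2 X.M fk fk R)"
  unfolding P_def by (rule nn_integral_scale_measure) (simp cong: measurable_cong_sets sets_pair_measure_cong)
 also have "... <= en (1/w)*(II z. en ((Y.d (fst z) (snd z) + de)^2) ||R)"
 proof (intro mult_left_mono push2_le[where g="%_. 0", OF fk_subkernel fk_subkernel sR sfR c1])
  fix y y' x x' assume y: "y : space Y.B" "y' : space Y.B" "fk y x ~= 0" "fk y' x' ~= 0"
  obtain i where i: "x : C i" "h i y ~= 0" using fk_nonzero[OF y(3)] by blast
  obtain i' where i': "x' : C i'" "h i' y' ~= 0" using fk_nonzero[OF y(4)] by blast
  have "\<bar>X.d x x' - Y.d y y'\<bar> <= de" using h_dist[OF i(1) i'(1) _ _ i(2) i'(2)] y by simp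
  hence "(X.d x x')^2 <= (Y.d y y' + de)^2" by (intro power_mono) auto
  thus "en ((X.d (fst (x, x')) (snd (x, x')))^2) <= en ((Y.d (fst (y, y')) (snd (y, y')) + de)^2)"
   by (auto intro: ennreal_leI)
 qed simp_all
 also have "... <= en (1/w)*(II z. en ((Y.d (fst z) (snd z) + de)^2) ||ga)"
  by (intro mult_left_mono R_le c2) simp
 finally show ?thesis
  by (rule that[OF we w(3) M0.endpointI[OF a0] M1.endpointI[OF a1]])
qed

end

subsection \<open>Limits of plans and of the distortion functional\<close>

text \<open>A rational strictly below \<open>a\<close> separates the factors, so that a superlevel
  set of a product becomes a countable union of sets defined by one factor at a time.\<close>

lemma ennreal_less_mult_iff:
 fixes s b :: ennreal
 assumes a: "0 <= a" and s: "s < top"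
 shows "s < en a*b \<longleftrightarrow> (EX q. 0 < real_of_rat q & real_of_rat q < a & s/en (real_of_rat q) < b)"
proof -
 obtain si where si: "s = en si" "0 <= si" using s by (cases s) auto
 have div: "s/en r = en (si/r)" if "0 < r" for r
  using that si by (simp add: divide_ennreal)
 show ?thesis
 proof
  assume l: "s < en a*b"
  hence a0: "0 < a" using a by (cases "a = 0") auto
  show "EX q. 0 < real_of_rat q & real_of_rat q < a & s/en (real_of_rat q) < b"
  proof (cases b)
   case (real be)
   have ab: "si < a*be" using l si real a by (simp add: ennreal_mult[symmetric] ennreal_less_iff)
   hence b0: "0 < be" using si(2) a0 real by (cases "be = 0") auto
   have "si/be < a" using ab b0 by (simp add: field_simps)
   then obtain q where q: "max 0 (si/be) < real_of_rat q" "real_of_rat q < a"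
    using of_rat_dense[of "max 0 (si/be)" a] a0 by auto
   hence q0: "0 < real_of_rat q" by linarith
   have "si/be < real_of_rat q" using q(1) by linarith
   hence "si/real_of_rat q < be" using b0 q0 by (simp add: field_simps)
   hence "s/en (real_of_rat q) < b" unfolding div[OF q0] real(2) using si(2) q0 by (simp add: ennreal_less_iff)
   thus ?thesis using q(2) q0 by blast
  next
   case top
   obtain q where q: "0 < real_of_rat q" "real_of_rat q < a" using of_rat_dense[OF a0] by blast
   thus ?thesis using top by (intro exI[of _ q]) (simp add: div)
  qed
 next
  assume "EX q. 0 < real_of_rat q & real_of_rat q < a & s/en (real_of_rat q) < b"
  then obtain q where q: "0 < real_of_rat q" "real_of_rat q < a" "s/en (real_of_rat q) < b" by blast
  show "s < en a*b"
  proof (cases b)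
   case (real be)
   have "en (si/real_of_rat q) < en be" using q(3) unfolding div[OF q(1)] real(2) .
   hence "si/real_of_rat q < be" using si(2) q(1) by (subst (asm) ennreal_less_iff) auto
   hence "si < real_of_rat q*be" using q(1) by (simp add: field_simps)
   also have "... <= a*be" using q(2) real by (intro mult_right_mono) auto
   finally show ?thesis using si real a by (simp add: ennreal_mult[symmetric] ennreal_less_iff)
  next
   case top
   have "0 < a" using q(1,2) by linarith
   hence "en a*b = top" unfolding top by (simp add: ennreal_mult_top)
   thus ?thesis using s by simp
  qed
 qed
qed

context polish
begin

text \<open>For each rational, one condition puts the distance into an open set and the other puts a
  single coordinate into a Borel set.\<close>

lemma rect_union_superlevel:
 assumes v: "continuous_on UNIV v" "!!x. 0 <= v x" and g: "g : bm B" and p: "p = fst | p = snd" and s: "s < top"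
 shows "rect_union B B {z : S \<times> S. s < en (v (d (fst z) (snd z)))*g (p z)}"
proof -
 define G where "G q = {x. real_of_rat q < v x}" for q
 define H where "H q = {y : S. s/en (real_of_rat q) < g y}" for q
 have G: "open (G q)" for q unfolding G_def using v(1) by (intro open_Collect_less) auto
 have H: "H q : sets B" for q
 proof -
  have "H q = (g -` {s/en (real_of_rat q)<..}) Int space B" by (auto simp: H_def)
  thus ?thesis using measurable_sets[OF g, of "{s/en (real_of_rat q)<..}"] by simp
 qed
 define HH where "HH q = {z : S \<times> S. p z : H q}" for q
 have HH: "HH q = H q \<times> S | HH q = S \<times> H q" for q using p by (auto simp: HH_def H_def)
 define E where "E q = (if 0 < real_of_rat q then {z : S \<times> S. d (fst z) (snd z) : G q} Int HH q else {})" for q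
 have E: "rect_union B B (E q)" for q
 proof (cases "0 < real_of_rat q")
  case True
  thus ?thesis unfolding E_def using HH[of q] rect_union_Int[OF rect_union_dist[OF G] H S_in_B, of q q] rect_union_Int[OF rect_union_dist[OF G] S_in_B H, of q q] by auto
 next
  case False
  thus ?thesis unfolding E_def using rect_union_Times[OF sets.empty_sets sets.empty_sets, of B B] by simp
 qed
 have "{z : S \<times> S. s < en (v (d (fst z) (snd z)))*g (p z)} = (UN j. E (from_nat_into UNIV j))"
 proof -
  have r: "range (from_nat_into (UNIV :: rat set)) = UNIV" by (intro range_from_nat_into) auto
  have "(UN j. E (from_nat_into UNIV j)) = (UN q. E q)" using r by (metis image_image)
  also have "... = {z : S \<times> S. s < en (v (d (fst z) (snd z)))*g (p z)}"
   unfolding ennreal_less_mult_iff[OF v(2) s] using p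
   by (auto simp: E_def HH_def G_def H_def mem_Times_iff split: if_splits)
  finally show ?thesis by simp
 qed
 thus ?thesis using rect_union_UN[of B B "%j. E (from_nat_into UNIV j)"] E by simp
qed

text \<open>The mode of convergence that limits on rectangles provide. It applies to the quadratic
  cost and to nonnegative continuous functions of the distance times a Borel weight in one
  coordinate.\<close>

definition lsc_plans :: "nat filter => (nat => ('a \<times> 'a) measure) => ('a \<times> 'a) measure => bool" where
 "lsc_plans F Q Q' \<longleftrightarrow> (ALL ph. (ALL s<top. rect_union B B {z : S \<times> S. s < ph z}) -->
   (II z. ph z ||Q') <= Liminf F (%j. II z. ph z ||Q j))"

lemma lsc_plansD:
 assumes "lsc_plans F Q Q'" "continuous_on UNIV v" "!!x. 0 <= v x" "g : bm B" "p = fst | p = snd"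
 shows "(II z. en (v (d (fst z) (snd z)))*g (p z) ||Q') <= Liminf F (%j. II z. en (v (d (fst z) (snd z)))*g (p z) ||Q j)"
 using assms(1)[unfolded lsc_plans_def, rule_format, OF rect_union_superlevel[OF assms(2-5)]] by simp

lemma lsc_plans_cost:
 assumes "lsc_plans F Q Q'"
 shows "(cost Q') <= Liminf F (%j. II z. sq z ||Q j)"
 using lsc_plansD[OF assms, of "%x. x^2" "%_. 1" fst] by (simp add: continuous_on_power)

lemma tau_measurable:
 fixes ta :: "real => real"
 assumes ta: "continuous_on (cdom K D) ta" and d: "!!x y. x : S ==> y : S ==> d x y : cdom K D"
 shows "(%z. ta (d (fst z) (snd z))) : bm BB"
proof -
 have A: "cdom K D : sets borel" by (simp add: cdom_def)
 have m: "(%x. if x : cdom K D then ta x else 0) : bm borel"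
  by (rule borel_measurable_continuous_on_if[OF A ta]) simp
 have "(%z. if d (fst z) (snd z) : cdom K D then ta (d (fst z) (snd z)) else 0) : bm BB"
  using measurable_compose[OF measurable_mdist_pair m] .
 moreover have "(if d (fst z) (snd z) : cdom K D then ta (d (fst z) (snd z)) else 0) = ta (d (fst z) (snd z))"
  if "z : space BB" for z
  using that d by (auto simp: space_pair_measure)
 ultimately show ?thesis by (subst (asm) measurable_cong) auto
qed

text \<open>From \<open>2*x*de <= de*(x^2 + 1)\<close> and \<open>de^2 <= de\<close>: an additive
  error in the distance becomes a relative and an absolute error in the cost, both of order
  \<open>de\<close>.\<close>

lemma shift_cost:
 assumes de: "0 < de" "de <= 1/2" and ga: "sets ga = sets BB" "em ga (space ga) = 1"
 shows "(II z. en ((d (fst z) (snd z) + de)^2) ||ga) <= en (1 + de)*(cost ga) + en (2*de)"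
proof -
 note [measurable_cong] = ga(1)
 have "(II z. en ((d (fst z) (snd z) + de)^2) ||ga) <= (II z. en (1 + de) * sq z + en (2*de) ||ga)"
 proof (intro nn_integral_mono)
  fix z
  let ?x = "d (fst z) (snd z)"
  have "2*?x*de <= de*(?x^2 + 1)" using mult_left_mono[OF sum_squares_bound[of ?x 1], of de] de by (simp add: mult_ac)
  moreover have "de^2 <= de" using de by (simp add: power2_eq_square mult_left_le)
  ultimately have "(?x + de)^2 <= (1 + de)*?x^2 + 2*de" by (simp add: power2_sum distrib_left distrib_right)
  thus "en ((?x + de)^2) <= en (1 + de)*en (?x^2) + en (2*de)"
   using de by (simp add: ennreal_mult[symmetric] ennreal_plus[symmetric] ennreal_leI del: ennreal_plus)
 qed
 also have "... = en (1 + de)*(cost ga) + en (2*de)"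
  using ga(2) by (subst nn_integral_add) (simp_all add: nn_integral_cmult)
 finally show ?thesis .
qed

text \<open>Upper semicontinuity for a bounded coefficient \<open>ta\<close> from lower
  semicontinuity for \<open>C - ta\<close>. The numbers \<open>a j\<close> come from other spaces
  and meet the plans \<open>Q j\<close> only in hypothesis \<open>le\<close>, for Lipschitz
  minorants \<open>v\<close> of \<open>C - ta\<close>; the error depends on the Lipschitz constant
  and disappears in the limit of \<open>b k\<close>. After the limit in \<open>j\<close>,
  \<open>k\<close> tends to infinity by monotone convergence, and the integral of \<open>U\<close>,
  finite by \<open>fin\<close>, is cancelled.\<close>

lemma T_limit:
 assumes uf: "ultrafilter F" and lsc: "lsc_plans F Q Q'" and sQ: "sets Q' = sets BB"
  and g: "g : bm B" and p: "p = fst | p = snd"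
  and A: "!!x y. x : S ==> y : S ==> d x y : cdom K D"
  and ta: "continuous_on (cdom K D) ta" "!!x. x : cdom K D ==> 0 <= ta x" "!!x. x : cdom K D ==> ta x <= C"
  and fin: "(II z. g (p z) ||Q') < top"
  and le: "!!v k. continuous_on UNIV v ==> (!!x. 0 <= v x) ==> (!!x y. y : cdom K D ==> v x <= (C - ta y) + real k*\<bar>x - y\<bar>) ==>
    eventually (%j. a j + (II z. en (v (d (fst z) (snd z)))*g (p z) ||Q j) <= b k j) F"
  and b: "!!k. (b k ---> en C*(II z. g (p z) ||Q')) F"
 shows "Liminf F a <= (II z. en (ta (d (fst z) (snd z)))*g (p z) ||Q')"
proof -
 interpret ultrafilter F by fact
 have spQ: "space Q' = S \<times> S" using sets_eq_imp_space_eq[OF sQ] by (simp only: space_pair_measure space_B)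
 note [measurable_cong] = sQ
 note [measurable] = g
 have pm [measurable]: "p : BB \<rightarrow>\<^sub>M B" using p by auto
 obtain x0 where "x0 : S" using nonempty by blast
 hence Ane: "cdom K D ~= {}" using A by blast
 have Cont: "continuous_on (cdom K D) (%y. C - ta y)" using ta(1) by (intro continuous_intros)
 obtain v where v: "!!k. continuous_on UNIV (v k)" "!!k x. 0 <= v k x" "!!k x y. y : cdom K D ==> v k x <= (C - ta y) + real k*\<bar>x - y\<bar>"
  "!!x. incseq (%k. v k x)" "!!x. x : cdom K D ==> (%k. v k x) ----> C - ta x"
  using Lipschitz_minorants[OF Ane _ Cont] ta(3) by (metis diff_ge_0_iff_ge)
 have [measurable]: "v k : bm borel" for k using v(1) by (rule borel_measurable_continuous_onI)
 define V where "V k z = en (v k (d (fst z) (snd z)))*g (p z)" for k z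
 have V [measurable]: "V k : bm BB" for k unfolding V_def by measurable
 have step: "Liminf F a + (II z. V k z ||Q') <= en C*(II z. g (p z) ||Q')" for k
 proof -
  have "(II z. V k z ||Q') <= Liminf F (%j. II z. V k z ||Q j)"
   unfolding V_def by (rule lsc_plansD[OF lsc v(1) v(2) g p])
  hence "Liminf F a + (II z. V k z ||Q') <= Liminf F a + Liminf F (%j. II z. V k z ||Q j)"
   by (rule add_left_mono)
  also have "... = Liminf F (%j. a j + (II z. V k z ||Q j))" by (rule ulim_add[symmetric])
  also have "... <= Liminf F (b k)"
   unfolding V_def by (rule ulim_mono, rule le) (fact v(1), fact v(2), rule v(3))
  also have "... = en C*(II z. g (p z) ||Q')" by (rule ulimI[OF b])
  finally show ?thesis .
 qed
 define U where "U z = en (C - ta (d (fst z) (snd z)))*g (p z)" for z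
 have SUPV: "(SUP k. V k z) = U z" if "z : space Q'" for z
 proof -
  have z: "d (fst z) (snd z) : cdom K D" using that A unfolding spQ by (auto simp: mem_Times_iff)
  have "(%k. en (v k (d (fst z) (snd z)))) ----> en (C - ta (d (fst z) (snd z)))"
   by (intro tendsto_ennrealI v(5) z)
  moreover have "incseq (%k. en (v k (d (fst z) (snd z))))" using v(4) by (auto simp: incseq_def intro: ennreal_leI)
  ultimately have "(SUP k. en (v k (d (fst z) (snd z)))) = en (C - ta (d (fst z) (snd z)))"
   using LIMSEQ_unique LIMSEQ_SUP by blast
  thus ?thesis unfolding V_def U_def by (subst SUP_mult_right_ennreal[symmetric]) simp_all
 qed
 have "(II z. U z ||Q') = (II z. (SUP k. V k z) ||Q')" using SUPV by (intro nn_integral_cong) simp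
 also have "... = (SUP k. II z. V k z ||Q')"
 proof (rule nn_integral_monotone_convergence_SUP)
  show "incseq V" using v(4) by (auto simp: incseq_def le_fun_def V_def intro!: mult_right_mono ennreal_leI)
 qed measurable
 finally have "Liminf F a + (II z. U z ||Q') = (SUP k. Liminf F a + (II z. V k z ||Q'))"
  by (simp add: ennreal_SUP_add_right)
 also have "... <= en C*(II z. g (p z) ||Q')" by (intro SUP_least step)
 also have "... = (II z. en C*g (p z) ||Q')" by (rule nn_integral_cmult[symmetric]) measurable
 also have "... = (II z. en (ta (d (fst z) (snd z)))*g (p z) + U z ||Q')"
 proof (rule nn_integral_cong)
  fix z assume "z : space Q'"
  hence z: "d (fst z) (snd z) : cdom K D" using A unfolding spQ by (auto simp: mem_Times_iff)
  have "en C = en (ta (d (fst z) (snd z))) + en (C - ta (d (fst z) (snd z)))"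
   using ta(2,3)[OF z] by (subst ennreal_plus[symmetric]) auto
  thus "en C*g (p z) = en (ta (d (fst z) (snd z)))*g (p z) + U z"
   unfolding U_def by (simp add: distrib_right)
 qed
 finally have le1: "Liminf F a + (II z. U z ||Q') <= (II z. en (ta (d (fst z) (snd z)))*g (p z) + U z ||Q')" .
 note [measurable] = tau_measurable[OF ta(1) A] tau_measurable[OF Cont A]
 have tm: "(%z. en (ta (d (fst z) (snd z)))*g (p z)) : bm Q'" and Um: "U : bm Q'"
  unfolding U_def by measurable
 have Ufin: "(II z. U z ||Q') < top"
 proof -
  have "(II z. U z ||Q') <= (II z. en C*g (p z) ||Q')"
  proof (rule nn_integral_mono)
   fix z assume "z : space Q'"
   hence z: "d (fst z) (snd z) : cdom K D" using A unfolding spQ by (auto simp: mem_Times_iff)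
   show "U z <= en C*g (p z)" unfolding U_def using ta(2)[OF z] by (intro mult_right_mono ennreal_leI) auto
  qed
  also have "... = en C*(II z. g (p z) ||Q')" by (rule nn_integral_cmult) measurable
  also have "... < top" using fin by (simp add: ennreal_mult_less_top)
  finally show ?thesis .
 qed
 have "Liminf F a + (II z. U z ||Q') <= (II z. en (ta (d (fst z) (snd z)))*g (p z) ||Q') + (II z. U z ||Q')"
  using le1 unfolding nn_integral_add[OF tm Um] .
 thus ?thesis using Ufin by (auto simp: ennreal_add_left_cancel_le add.commute[of _ "II z. U z ||Q'"])
qed

end

section \<open>Existence of limit plans and of optimal plans\<close>

context pgm
begin

text \<open>Compact sets are taken with errors \<open>1/(n + 1)\<close> in the reference measure.
  What all of them miss is null for it, hence for \<open>nu\<close>, and continuity from above makes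
  a finite stage sufficient. The part outside a large regular set is small because the singular set
  is null.\<close>

lemma ac_compact_approx:
 assumes ac: "absolutely_continuous M nu" and s: "sets nu = sets B" and fin: "em nu S < top" and A: "A : sets B" and e: "0 < e"
 shows "EX K<=A. K : sets B & compactin T K & em nu (A - K) <= en e"
proof -
 have e2: "0 < en (e/2)" using e by simp
 have [measurable]: "A : sets nu" using A s by simp
 have "eventually (%k. em nu (S - reg X k) < en (e/2)) sequentially"
  using order_tendstoD(2)[OF ac_regular_tendsto[OF ac s fin]] e2 by simp
 then obtain k where k: "em nu (S - reg X k) < en (e/2)"
  by (auto simp: eventually_sequentially)
 let ?A = "A Int reg X k"
 have A': "?A : sets B" "?A <= reg X k" using A by auto
 have "ALL n. EX K. K <= ?A & K : sets B & compactin T K & em M (?A - K) <= en (1/Suc n)"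
  using compact_approx[OF A'] by (metis divide_pos_pos of_nat_0_less_iff zero_less_Suc zero_less_one)
 then obtain K where K: "!!n. K n <= ?A" "!!n. K n : sets B" "!!n. compactin T (K n)" "!!n. em M (?A - K n) <= en (1/Suc n)"
  by (subst (asm) choice_iff) blast
 define D where "D n = ?A - (\<Union>i\<le>n. K i)" for n
 have D: "D n : sets B" for n unfolding D_def using A' K(2) by auto
 have "em M (INT n. D n) <= en (1/Suc n)" for n
 proof -
  have "em M (INT n. D n) <= em M (?A - K n)"
   using A' K(2) by (intro emeasure_mono) (auto simp: D_def)
  thus ?thesis using K(4)[of n] by (rule order_trans)
 qed
 moreover have "(%n. en (1/Suc n)) ----> en 0"
  by (intro tendsto_ennrealI LIMSEQ_inverse_real_of_nat[unfolded inverse_eq_divide])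
 ultimately have "em M (INT n. D n) <= en 0" by (intro LIMSEQ_le_const) auto
 hence "(INT n. D n) : null_sets M" using D by (simp add: null_sets_def)
 hence "(INT n. D n) : null_sets nu" using ac unfolding absolutely_continuous_def by blast
 hence z: "em nu (INT n. D n) = 0" by (simp add: null_sets_def)
 have finD: "em nu (D n) ~= \<infinity>" for n
 proof -
  have "D n <= S" using A' regular_sub[of k] unfolding D_def by blast
  hence "em nu (D n) <= em nu S" using s by (intro emeasure_mono) auto
  thus ?thesis using fin by (auto simp: top_unique)
 qed
 have "(%n. em nu (D n)) ----> em nu (INT n. D n)"
  using D s finD by (intro Lim_emeasure_decseq) (auto simp: decseq_def D_def)
 hence "eventually (%n. em nu (D n) < en (e/2)) sequentially" using order_tendstoD(2) z e2 by fastforce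
 then obtain n where n: "em nu (D n) < en (e/2)" by (auto simp: eventually_sequentially)
 have Km [measurable]: "(\<Union>i\<le>n. K i) : sets nu" using K(2) s by auto
 have [measurable]: "D n : sets nu" "S - reg X k : sets nu" using D s by auto
 have AS: "A <= S" using sets.sets_into_space[OF A] by simp
 have m: "D n Un (S - reg X k) : sets nu" by measurable
 have "em nu (A - (\<Union>i\<le>n. K i)) <= em nu (D n Un (S - reg X k))"
  by (rule emeasure_mono[OF _ m]) (use AS in \<open>auto simp: D_def\<close>)
 also have "... <= em nu (D n) + em nu (S - reg X k)" by (rule emeasure_subadditive) auto
 also have "... <= en (e/2) + en (e/2)" using n k by (intro add_mono) auto
 also have "... = en e" using e by (simp add: ennreal_plus[symmetric] del: ennreal_plus)
 finally have "em nu (A - (\<Union>i\<le>n. K i)) <= en e" .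
 moreover have "compactin T (\<Union>i\<le>n. K i)" using K(3) by (intro compactin_Union) auto
 moreover have "(\<Union>i\<le>n. K i) <= A" using K(1) by blast
 ultimately show ?thesis using Km s by blast
qed

text \<open>Compact approximation of the two limit marginals supplies the tightness hypotheses of
  \<open>bimeasure_limit\<close>, as the mass of a plan over a difference set converges to that of
  the limit marginal.\<close>

lemma plan_limit:
 assumes uf: "ultrafilter F" and sQ: "!!j. sets (Q j) = sets BB"
  and nu: "absolutely_continuous M nu" "sets nu = sets B" "em nu S < top"
  and nu': "absolutely_continuous M nu'" "sets nu' = sets B" "em nu' S < top"
  and l1: "!!A. A : sets B ==> Liminf F (%j. em (Q j) (A \<times> S)) = em nu A"
  and l2: "!!A. A : sets B ==> Liminf F (%j. em (Q j) (S \<times> A)) = em nu' A"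
 obtains Q' where "Q' : cpl nu nu'" "lsc_plans F Q Q'"
proof -
 interpret ultrafilter F by fact
 have H: "Hausdorff_space T" unfolding mtop by (rule MS.Hausdorff_space_mtopology)
 have fin: "ulim (%j. em (Q j) (space B \<times> space B)) < top" using l1[OF S_in_B] nu(3) by simp
 have t1: "EX K<=A. K : sets B & compactin T K & ulim (%j. em (Q j) ((A - K) \<times> space B)) <= en e" if A: "A : sets B" and e: "0 < e" for A e
 proof -
  obtain K where K: "K <= A" "K : sets B" "compactin T K" "em nu (A - K) <= en e" using ac_compact_approx[OF nu A e] by blast
  thus ?thesis using l1[of "A - K"] A by (intro exI[of _ K]) auto
 qed
 have t2: "EX K<=A. K : sets B & compactin T K & ulim (%j. em (Q j) (space B \<times> (A - K))) <= en e" if A: "A : sets B" and e: "0 < e" for A e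
 proof -
  obtain K where K: "K <= A" "K : sets B" "compactin T K" "em nu' (A - K) <= en e" using ac_compact_approx[OF nu' A e] by blast
  thus ?thesis using l2[of "A - K"] A by (intro exI[of _ K]) auto
 qed
 obtain Q' where Q': "sets Q' = sets BB"
  "!!A A'. A : sets B ==> A' : sets B ==> em Q' (A \<times> A') = ulim (%n. em (Q n) (A \<times> A'))"
  "!!E. rect_union B B E ==> em Q' E <= ulim (%n. em (Q n) E)"
  by (rule bimeasure_limit[OF H H sQ fin t1 t2]) (assumption+, rule that)
 have spQ: "space Q' = S \<times> S" using sets_eq_imp_space_eq[OF Q'(1)] by (simp only: space_pair_measure space_B)
 have "Q' : cpl nu nu'"
  using Q'(1) nu(2) nu'(2) l1 l2 Q'(2) by (intro couplingsI) auto
 moreover have "lsc_plans F Q Q'"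
  unfolding lsc_plans_def
 proof (intro allI impI)
  fix ph :: "'a \<times> 'a => ennreal" assume ph: "ALL s<top. rect_union B B {z : S \<times> S. s < ph z}"
  have finQ: "em Q' (space Q') < top" using Q'(2)[OF S_in_B S_in_B] l1[OF S_in_B] nu(3) spQ by simp
  show "(II z. ph z ||Q') <= ulim (%j. II z. ph z ||Q j)"
   by (rule rect_lsc_integral[OF sQ Q'(1) Q'(3) finQ]) (use ph in simp_all)
 qed
 ultimately show ?thesis by (rule that)
qed

text \<open>A minimising sequence has constant marginals, so \<open>plan_limit\<close> applies, and
  the squared distance is an admissible integrand.\<close>

lemma optimal_plan_exists:
 assumes ac: "mu : P2ac" "nu : P2ac"
 shows "EX pl. W2_optimal (metr X) mu nu pl"
proof -
 have P: "mu : P2 (metr X)" "nu : P2 (metr X)" and a: "absolutely_continuous M mu" "absolutely_continuous M nu"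
  using ac by (auto simp: P2_ac_def)
 have fin: "TC mu nu < top" by (rule TC_finite[OF P])
 have "EX ga. ga : cpl mu nu & (cost ga) <= TC mu nu + en (1/Suc j)" for j
 proof -
  have "TC mu nu < TC mu nu + en (1/Suc j)" using fin by (cases "TC mu nu") (simp_all add: ennreal_plus[symmetric] ennreal_less_iff del: ennreal_plus)
  then obtain ga where "ga : cpl mu nu" "(cost ga) < TC mu nu + en (1/Suc j)"
   by (rule TC_approx)
  thus ?thesis by (intro exI[of _ ga]) auto
 qed
 then obtain Q where Q: "!!j. Q j : cpl mu nu" "!!j. (II z. sq z ||Q j) <= TC mu nu + en (1/Suc j)"
  by metis
 obtain F where uf: "ultrafilter F" using ex_ultrafilter_nat by blast
 interpret ultrafilter F by fact
 have f1: "em mu S < top" "em nu S < top" using P[THEN P2D(4)] by auto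
 obtain Q' where Q': "Q' : cpl mu nu" "lsc_plans F Q Q'"
 proof (rule plan_limit[OF uf couplingsD(1)[OF Q(1)] a(1) P2D(1)[OF P(1)] f1(1) a(2) P2D(1)[OF P(2)] f1(2)])
  show "ulim (%j. em (Q j) (A \<times> S)) = em mu A" "ulim (%j. em (Q j) (S \<times> A)) = em nu A" if A: "A : sets B" for A
   using couplingsD(7,8)[OF Q(1) A] by (simp_all add: ulim_const)
 qed
 have l: "(%j. TC mu nu + en (1/Suc j)) ----> TC mu nu + en 0"
  by (intro tendsto_add tendsto_const tendsto_ennrealI LIMSEQ_inverse_real_of_nat[unfolded inverse_eq_divide])
 have "(cost Q') <= ulim (%j. II z. sq z ||Q j)"
  by (rule lsc_plans_cost[OF Q'(2)])
 also have "... <= ulim (%j. TC mu nu + en (1/Suc j))" using Q(2) by (intro ulim_mono always_eventually) simp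
 also have "... = TC mu nu" using ulimI[OF ulim_sequentially[OF l]] by simp
 finally have "(cost Q') = TC mu nu" using TC_le[OF Q'(1)] by (rule antisym)
 thus ?thesis using Q'(1) unfolding W2_optimal_def plan_cost_sq by blast
qed

end

lemma exponent:
 assumes "N' < 0"
 shows "1 < (N' - 1)/N'" "(N' - 1)/N' - 1 = - 1/N'" "0 < - 1/(N' :: real)" "(N' - 1)/N' = 1 + - 1/N'"
 using assms by (auto simp: field_simps)

section \<open>The curvature condition on one space of the sequence\<close>

definition tau_repr :: "real => real => real => real => (real => real) => real => bool" where
 "tau_repr K D N t ta C \<longleftrightarrow> continuous_on (cdom K D) ta & 0 < C &
   (ALL x:cdom K D. tau_coeff K N t x = en (ta x) & 0 <= ta x & ta x <= C)"

lemma tau_repr_exists: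
 assumes "N < 0" "0 < t" "t < 1" "K < 0 ==> - K*D^2 < pi^2"
 shows "EX ta C. tau_repr K D N t ta C"
 using tau_coeff_real[OF assms] unfolding tau_repr_def by metis

text \<open>For linked pairs, \<open>v\<close> at the distance in \<open>Y\<close> is at most
  \<open>Ct - ta\<close> at the distance in \<open>X\<close> plus \<open>n*de\<close>. Adding the
  integral of \<open>ta\<close> leaves a constant times the weight, which is the form required by
  \<open>T_limit\<close>. Hypothesis \<open>W\<close> leaves open which coordinate carries the
  weight.\<close>

lemma (in transfer_pair) weighted_cost_le:
 assumes P: "sets P = sets X.BB" and G [measurable]: "G : bm X.BB"
  and W: "!!f V. f : bm (Y.M \<Otimes>\<^sub>M Y.M) ==> V : bm X.BB ==>
   (!!x x' y y'. x : space X.B ==> x' : space X.B ==> y : space Y.M ==> y' : space Y.M ==>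
    cellk k x y ~= 0 ==> cellk k' x' y' ~= 0 ==> f (y, y') <= V (x, x')) ==>
   (II z. f z*g z ||Q) <= (II u. V u*G u ||P)"
  and k: "!!i y. k i y ~= 0 ==> h i y ~= 0" and k': "!!i y. k' i y ~= 0 ==> h i y ~= 0"
  and d: "!!x y. x : X.S ==> y : X.S ==> X.d x y : cdom K D"
  and ta: "tau_repr K D N t ta Ct" and v: "continuous_on UNIV v" "!!x. 0 <= v x"
  and vle: "!!x y. y : cdom K D ==> v x <= (Ct - ta y) + real n*\<bar>x - y\<bar>"
 shows "(II u. en (ta (X.d (fst u) (snd u)))*G u ||P) + (II z. en (v (Y.d (fst z) (snd z)))*g z ||Q)
  <= en (Ct + real n*de)*(II u. G u ||P)"
proof -
 note [measurable_cong] = P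
 have tD: "continuous_on (cdom K D) ta" "0 < Ct" and tb: "!!x. x : cdom K D ==> 0 <= ta x & ta x <= Ct"
  using ta by (auto simp: tau_repr_def)
 have spP: "space P = X.S \<times> X.S" using sets_eq_imp_space_eq[OF P] by (simp only: space_pair_measure X.space_B)
 have [measurable]: "v : bm borel" using v(1) by (rule borel_measurable_continuous_onI)
 have vm: "(%z. en (v (Y.d (fst z) (snd z)))) : bm (Y.M \<Otimes>\<^sub>M Y.M)" by measurable
 note tm [measurable] = X.tau_measurable[OF tD(1) d]
 have Vm: "(%z. en ((Ct - ta (X.d (fst z) (snd z))) + real n*de)) : bm X.BB" by measurable
 have "(II z. en (v (Y.d (fst z) (snd z)))*g z ||Q) <= (II u. en ((Ct - ta (X.d (fst u) (snd u))) + real n*de)*G u ||P)"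
 proof (rule W[OF vm Vm])
  fix x x' y y' assume x: "x : space X.B" "x' : space X.B" and y: "y : space Y.M" "y' : space Y.M"
   and nz: "cellk k x y ~= 0" "cellk k' x' y' ~= 0"
  obtain i where i: "x : C i" "k i y ~= 0" using cellk_nonzero[OF nz(1)] by blast
  obtain i' where i': "x' : C i'" "k' i' y' ~= 0" using cellk_nonzero[OF nz(2)] by blast
  have "\<bar>X.d x x' - Y.d y y'\<bar> <= de" using h_dist[OF i(1) i'(1) _ _ k[OF i(2)] k'[OF i'(2)]] y by simp
  hence "real n*\<bar>Y.d y y' - X.d x x'\<bar> <= real n*de" by (intro mult_left_mono) auto
  hence "v (Y.d y y') <= (Ct - ta (X.d x x')) + real n*de" using vle[of "X.d x x'" "Y.d y y'"] d x by force
  thus "en (v (Y.d (fst (y, y')) (snd (y, y')))) <= en ((Ct - ta (X.d (fst (x, x')) (snd (x, x')))) + real n*de)"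
   by (auto intro: ennreal_leI)
 qed
 hence "(II u. en (ta (X.d (fst u) (snd u)))*G u ||P) + (II z. en (v (Y.d (fst z) (snd z)))*g z ||Q) <=
   (II u. en (ta (X.d (fst u) (snd u)))*G u ||P) + (II u. en ((Ct - ta (X.d (fst u) (snd u))) + real n*de)*G u ||P)"
  by (rule add_left_mono)
 also have "... = (II u. en (ta (X.d (fst u) (snd u)))*G u + en ((Ct - ta (X.d (fst u) (snd u))) + real n*de)*G u ||P)"
  by (intro nn_integral_add[symmetric]) measurable
 also have "... = (II u. en (Ct + real n*de)*G u ||P)"
 proof (rule nn_integral_cong)
  fix u assume "u : space P"
  hence "X.d (fst u) (snd u) : cdom K D" using d unfolding spP by (auto simp: mem_Times_iff)
  hence "0 <= ta (X.d (fst u) (snd u))" "ta (X.d (fst u) (snd u)) <= Ct" using tb by auto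
  hence "en (ta (X.d (fst u) (snd u))) + en ((Ct - ta (X.d (fst u) (snd u))) + real n*de) = en (Ct + real n*de)"
   using de by (subst ennreal_plus[symmetric]) auto
  thus "en (ta (X.d (fst u) (snd u)))*G u + en ((Ct - ta (X.d (fst u) (snd u))) + real n*de)*G u = en (Ct + real n*de)*G u"
   by (simp only: distrib_right[symmetric])
 qed
 also have "... = en (Ct + real n*de)*(II u. G u ||P)" by (rule nn_integral_cmult) measurable
 finally show ?thesis .
qed

text \<open>The data attached to one space \<open>X\<close> of the sequence: marginals transported to \<open>X\<close>, an optimal plan
 and a geodesic supplied by the curvature condition there.\<close>
locale cd_step = transfer_pair X Y L de C h c
 for X :: "'a pgmms" and Y :: "'b pgmms" and L de C h c +
 fixes K N D M0 J :: real and \<omega> and rh0 rh1 :: "'b => ennreal" and w :: real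
  and s0 s1 k0 k1 pl et
 assumes N: "N < 0" and CD: "CD_space K N (metr X) (meas X)" and uc: "uniformly_convex_space N \<omega> X"
  and dX: "!!x y. x : X.S ==> y : X.S ==> X.d x y : cdom K D" and KD: "K < 0 ==> - K*D^2 < pi^2"
  and rhm [measurable]: "rh0 : bm Y.B" "rh1 : bm Y.B"
  and ep: "endpoint rh0 w s0 k0" "endpoint rh1 w s1 k1" and w: "1/2 <= w" "w <= 1"
  and fin: "(II y. epowr (rh0 y) ((N - 1)/N) ||Y.M) <= en M0" "(II y. epowr (rh1 y) ((N - 1)/N) ||Y.M) <= en M0" "0 < M0"
  and opt: "W2_optimal (metr X) (density X.M s0) (density X.M s1) pl"
  and geo: "W2_geodesic (metr X) (density X.M s0) (density X.M s1) et"
  and ineq: "!!t N'. t : {0..1} ==> N' : {N..<0} ==>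
    X.ren N' (density X.M s0) < \<infinity> ==> X.ren N' (density X.M s1) < \<infinity> ==>
    X.ren N' (et t) <= T_fun (metr X) (meas X) K N' t (density X.M s0) (density X.M s1) pl"
  and TCb: "X.TC (density X.M s0) (density X.M s1) <= en (1/w*((1 + de)*J + 2*de))" and J: "0 <= J"
begin

lemma epD0:
 shows s0m [measurable]: "s0 : bm X.B" and a0_ac: "density X.M s0 : X.P2ac"
  and k0m [measurable]: "k0 i : bm Y.B" and k0s: "subkernel Y.M X.B (cellk k0)"
 using ep(1) unfolding endpoint_def by simp_all

lemma epD1:
 shows s1m [measurable]: "s1 : bm X.B" and a1_ac: "density X.M s1 : X.P2ac"
  and k1m [measurable]: "k1 i : bm Y.B" and k1s: "subkernel Y.M X.B (cellk k1)"
 using ep(2) unfolding endpoint_def by simp_all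

lemma w_pos: "0 < w" "1/w <= 2"
 using w by (auto simp: field_simps)



text \<open>From \<open>c <= 2\<close> and \<open>1/w <= 2\<close>; the constant is the same for all
  members of the sequence.\<close>

lemma endpoint_renyi:
 assumes ep: "endpoint rh w s k" and N': "N' < 0"
 shows "X.ren N' (density X.M s) <= en (4 powr ((N' - 1)/N'))*(II y. epowr (rh y) ((N' - 1)/N') ||Y.M)"
proof -
 let ?p = "(N' - 1)/N'"
 have p: "1 < ?p" by (rule exponent[OF N'])
 have sm: "s : bm X.B" using ep by (simp add: endpoint_def)
 have "X.ren N' (density X.M s) <= en (c powr (?p - 1)*(1/w) powr ?p)*(II y. epowr (rh y) ?p ||Y.M)"
  using ep p unfolding X.renyi_density[OF sm] endpoint_def by blast
 also have "c powr (?p - 1)*(1/w) powr ?p <= 2 powr ?p*2 powr ?p"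
 proof (intro mult_mono)
  have "c powr (?p - 1) <= 2 powr (?p - 1)" using c_pos p by (intro powr_mono2) auto
  also have "... <= 2 powr ?p" by (intro powr_mono) auto
  finally show "c powr (?p - 1) <= 2 powr ?p" .
  show "(1/w) powr ?p <= 2 powr ?p" using w_pos p by (intro powr_mono2) auto
 qed auto
 also have "2 powr ?p*2 powr ?p = (4 :: real) powr ?p" using powr_mult[of 2 2 ?p] by simp
 finally show ?thesis by (simp add: mult_right_mono ennreal_leI)
qed

definition M1 :: real where "M1 = 4 powr ((N - 1)/N)*M0"

lemma M1: "0 < M1" "X.ren N (density X.M s0) <= en M1" "X.ren N (density X.M s1) <= en M1"
proof -
 show "0 < M1" using fin(3) by (simp add: M1_def)
 have e: "en M1 = en (4 powr ((N - 1)/N))*en M0" unfolding M1_def using fin(3) by (simp add: ennreal_mult)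
 show "X.ren N (density X.M s0) <= en M1"
  unfolding e by (rule order_trans[OF endpoint_renyi[OF ep(1) N]]) (intro mult_left_mono fin(1), simp)
 show "X.ren N (density X.M s1) <= en M1"
  unfolding e by (rule order_trans[OF endpoint_renyi[OF ep(2) N]]) (intro mult_left_mono fin(2), simp)
qed

lemma pl: "pl : X.cpl (density X.M s0) (density X.M s1)"
 using opt by (simp add: W2_optimal_def)

lemmas plD = X.couplingsD[OF pl]

lemma prob_pl: "prob_space pl"
proof
 have "density X.M s0 : P2 (metr X)" using a0_ac by (simp add: P2_ac_def)
 hence "em (density X.M s0) X.S = 1" by (rule X.P2D(4))
 thus "em pl (space pl) = 1" using plD(7)[OF X.S_in_B] plD(2) by simp
qed

text \<open>\<open>T_fun\<close> is formed with Radon-Nikodym derivatives, which agree with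
  \<open>s0\<close> and \<open>s1\<close> almost everywhere for the marginals and hence for the
  plan. The bounds on the powers are kept general: \<open>eta_bound\<close> inserts the powers
  themselves, \<open>nu_entropy\<close> their pull-backs from \<open>Y\<close>.\<close>

lemma T_le:
 assumes N': "N' < 0" and t: "tau_repr K D N' (1 - t) ta0 C0" "tau_repr K D N' t ta1 C1"
  and G: "G0 : bm X.B" "G1 : bm X.B"
  and le: "!!x. epowr (s0 x) (- 1/N') <= b*G0 x" "!!x. epowr (s1 x) (- 1/N') <= b*G1 x"
 shows "T_fun (metr X) (meas X) K N' t (density X.M s0) (density X.M s1) pl <=
  b*((II u. en (ta0 (X.d (fst u) (snd u)))*G0 (fst u) ||pl) + (II u. en (ta1 (X.d (fst u) (snd u)))*G1 (snd u) ||pl))"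
proof -
 note [measurable] = G
 note [measurable_cong] = plD(1)
 let ?a = "- 1/N'"
 have d0: "AE u in pl. X.dns (density X.M s0) (fst u) = s0 (fst u)"
 proof -
  have eq: "density X.M s0 = distr pl X.B fst" using pl by (simp add: couplings_def Let_def)
  have *: "AE u in pl. f (fst u) = s0 (fst u)" if "AE x in density X.M s0. f x = s0 x" and [measurable]: "f : bm X.B" for f
   using that(1) unfolding eq by (subst (asm) AE_distr_iff) auto
  show ?thesis using X.dens_density[OF s0m] by (intro *) (auto simp: AE_density elim!: eventually_mono)
 qed
 have d1: "AE u in pl. X.dns (density X.M s1) (snd u) = s1 (snd u)"
 proof -
  have eq: "density X.M s1 = distr pl X.B snd" using pl by (simp add: couplings_def Let_def)
  have *: "AE u in pl. f (snd u) = s1 (snd u)" if "AE x in density X.M s1. f x = s1 x" and [measurable]: "f : bm X.B" for f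
   using that(1) unfolding eq by (subst (asm) AE_distr_iff) auto
  show ?thesis using X.dens_density[OF s1m] by (intro *) (auto simp: AE_density elim!: eventually_mono)
 qed
 have c: "continuous_on (cdom K D) ta0" "continuous_on (cdom K D) ta1"
  using t by (simp_all add: tau_repr_def)
 note [measurable] = X.tau_measurable[OF c(1) dX] X.tau_measurable[OF c(2) dX]
 have "T_fun (metr X) (meas X) K N' t (density X.M s0) (density X.M s1) pl <=
   (II u. b*(en (ta0 (X.d (fst u) (snd u)))*G0 (fst u) + en (ta1 (X.d (fst u) (snd u)))*G1 (snd u)) ||pl)"
  unfolding T_fun_def
 proof (rule nn_integral_mono_AE)
  show "AE u in pl. (case u of (x, y) => tau_coeff K N' (1 - t) (X.d x y)*epowr (X.dns (density X.M s0) x) ?a +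
    tau_coeff K N' t (X.d x y)*epowr (X.dns (density X.M s1) y) ?a) <=
    b*(en (ta0 (X.d (fst u) (snd u)))*G0 (fst u) + en (ta1 (X.d (fst u) (snd u)))*G1 (snd u))"
   using d0 d1 AE_space
  proof eventually_elim
   case (elim u)
   hence "fst u : X.S" "snd u : X.S" unfolding plD(2) by (simp_all add: mem_Times_iff)
   hence "X.d (fst u) (snd u) : cdom K D" by (rule dX)
   hence e: "tau_coeff K N' (1 - t) (X.d (fst u) (snd u)) = en (ta0 (X.d (fst u) (snd u)))"
    "tau_coeff K N' t (X.d (fst u) (snd u)) = en (ta1 (X.d (fst u) (snd u)))"
    using t by (auto simp: tau_repr_def)
   have "en (ta0 (X.d (fst u) (snd u)))*epowr (s0 (fst u)) ?a + en (ta1 (X.d (fst u) (snd u)))*epowr (s1 (snd u)) ?a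
     <= en (ta0 (X.d (fst u) (snd u)))*(b*G0 (fst u)) + en (ta1 (X.d (fst u) (snd u)))*(b*G1 (snd u))"
    by (intro add_mono mult_left_mono le) auto
   thus ?case unfolding case_prod_unfold e elim(1,2) by (simp add: distrib_left mult_ac)
  qed
 qed
 also have "... = b*(II u. en (ta0 (X.d (fst u) (snd u)))*G0 (fst u) + en (ta1 (X.d (fst u) (snd u)))*G1 (snd u) ||pl)"
  by (rule nn_integral_cmult) measurable
 also have "(II u. en (ta0 (X.d (fst u) (snd u)))*G0 (fst u) + en (ta1 (X.d (fst u) (snd u)))*G1 (snd u) ||pl) =
   (II u. en (ta0 (X.d (fst u) (snd u)))*G0 (fst u) ||pl) + (II u. en (ta1 (X.d (fst u) (snd u)))*G1 (snd u) ||pl)"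
  by (rule nn_integral_add) measurable
 finally show ?thesis .
qed

end

lemma nn_integral_le_scale:
 assumes s: "sets mu = sets nu" and le: "!!A. A : sets nu ==> em mu A <= r*em nu A" and f: "f : bm nu"
 shows "(II x. f x ||mu) <= r*(II x. f x ||nu)"
proof -
 have sp: "space mu = space nu" using s by (rule sets_eq_imp_space_eq)
 have "mu <= scale_measure r nu" using s le sp by (subst le_measure) auto
 hence "(II x. f x ||mu) <= (II x. f x ||scale_measure r nu)" using s by (intro nn_integral_mono_measure) auto
 thus ?thesis using f by (simp add: nn_integral_scale_measure)
qed

context cd_step
begin

lemma geoD:
 shows "et 0 = density X.M s0" "et 1 = density X.M s1" "t : {0..1} ==> et t : P2 (metr X)"
  "s : {0..1} ==> t : {0..1} ==> W2 (metr X) (et s) (et t) = \<bar>s - t\<bar>*W2 (metr X) (density X.M s0) (density X.M s1)"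
 using geo unfolding W2_geodesic_def by blast+

text \<open>Bounding the coefficients by constants turns the curvature inequality into an entropy
  bound that does not depend on the member of the sequence. It is the source of compactness at
  intermediate times.\<close>

lemma eta_bound:
 assumes t: "0 < t" "t < 1" and ta: "tau_repr K D N (1 - t) ta0 C0" "tau_repr K D N t ta1 C1"
 shows "X.ren N (et t) <= en ((C0 + C1)*M1)"
proof -
 let ?a = "- 1/N" and ?p = "(N - 1)/N"
 note [measurable_cong] = plD(1)
 have pos: "0 < C0" "0 < C1" and ub: "!!x. x : cdom K D ==> ta0 x <= C0 & ta1 x <= C1" using ta by (auto simp: tau_repr_def)
 have fin': "X.ren N (density X.M s0) < \<infinity>" "X.ren N (density X.M s1) < \<infinity>"
  using M1 by (auto intro: le_less_trans)
 have aux: "(II x. epowr (s x) ?a ||density X.M s) = X.ren N (density X.M s)" if [measurable]: "s : bm X.B" for s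
 proof -
  have "(II x. epowr (s x) ?a ||density X.M s) = (II x. s x*epowr (s x) ?a ||X.M)" by (rule nn_integral_density) measurable
  also have "... = (II x. epowr (s x) ?p ||X.M)"
   unfolding exponent(4)[OF N] by (simp only: epowr_add[OF zero_less_one exponent(3)[OF N]] epowr_one_right)
  finally show ?thesis using X.renyi_density[OF that] by simp
 qed
 have "X.ren N (et t) <= T_fun (metr X) (meas X) K N t (density X.M s0) (density X.M s1) pl"
  using t N by (intro ineq fin') auto
 also have "... <= 1*((II u. en (ta0 (X.d (fst u) (snd u)))*epowr (s0 (fst u)) ?a ||pl) + (II u. en (ta1 (X.d (fst u) (snd u)))*epowr (s1 (snd u)) ?a ||pl))"
  by (rule T_le[OF N ta]) simp_all
 also have "... <= (II u. en C0*epowr (s0 (fst u)) ?a ||pl) + (II u. en C1*epowr (s1 (snd u)) ?a ||pl)"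
 proof -
  have "X.d (fst u) (snd u) : cdom K D" if "u : space pl" for u
   using that dX unfolding plD(2) by (auto simp: mem_Times_iff)
  hence "en (ta0 (X.d (fst u) (snd u))) <= en C0" "en (ta1 (X.d (fst u) (snd u))) <= en C1" if "u : space pl" for u
   using ub that by (auto intro: ennreal_leI)
  thus ?thesis unfolding mult_1 by (intro add_mono nn_integral_mono mult_right_mono) auto
 qed
 also have "... = en C0*(II u. epowr (s0 (fst u)) ?a ||pl) + en C1*(II u. epowr (s1 (snd u)) ?a ||pl)"
  by (subst (1 2) nn_integral_cmult) simp_all
 also have "... = en C0*X.ren N (density X.M s0) + en C1*X.ren N (density X.M s1)"
 proof -
  have "(II u. epowr (s0 (fst u)) ?a ||pl) = (II x. epowr (s0 x) ?a ||density X.M s0)" by (rule plD(9)) measurable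
  moreover have "(II u. epowr (s1 (snd u)) ?a ||pl) = (II x. epowr (s1 x) ?a ||density X.M s1)" by (rule plD(10)) measurable
  ultimately show ?thesis by (simp only: aux[OF s0m] aux[OF s1m])
 qed
 also have "... <= en C0*en M1 + en C1*en M1" by (intro add_mono mult_left_mono M1) simp_all
 also have "... = en ((C0 + C1)*M1)" using pos M1(1) by (simp add: ennreal_mult ennreal_plus distrib_right)
 finally show ?thesis .
qed

lemma eta_ac:
 assumes t: "t : {0..1}" shows "et t : X.P2ac"
proof -
 consider "t = 0" | "t = 1" | "0 < t" "t < 1" using t by force
 thus ?thesis
 proof cases
  case 3
  obtain ta0 C0 where t0: "tau_repr K D N (1 - t) ta0 C0" using tau_repr_exists[OF N _ _ KD, of "1 - t"] 3 by auto
  obtain ta1 C1 where t1: "tau_repr K D N t ta1 C1" using tau_repr_exists[OF N 3 KD] by auto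
  show ?thesis using eta_bound[OF 3 t0 t1] geoD(3)[OF t] by (intro X.renyi_finite_P2_ac) (auto intro: le_less_trans)
 qed (simp_all add: geoD(1,2) a0_ac a1_ac)
qed

text \<open>Reversed kernels at the two ends, where the limit is prescribed, and the general one in
  between, where only bounds are available.\<close>

definition kap :: "real => nat => 'b => ennreal" where
 "kap t = (if t = 0 then k0 else if t = 1 then k1 else kb)"

lemma kap_meas [measurable]: "kap t i : bm Y.B"
 unfolding kap_def by simp

lemma kap_subkernel: "subkernel Y.M X.B (cellk (kap t))"
 unfolding kap_def using k0s k1s kb_subkernel by simp

lemma kap_nonzero: "kap t i y ~= 0 ==> h i y ~= 0"
 using ep unfolding kap_def endpoint_def by (auto split: if_splits dest: kb_nonzero)

text \<open>For the pair \<open>(0, 1)\<close> it has to be the plan for which the curvature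
  inequality holds; for other pairs any optimal plan serves, as only distances are compared.\<close>

definition plan :: "real => real => ('a \<times> 'a) measure" where
 "plan s t = (if s = 0 & t = 1 then pl else SOME P. W2_optimal (metr X) (et s) (et t) P)"

lemma plan:
 assumes "s : {0..1}" "t : {0..1}" shows "W2_optimal (metr X) (et s) (et t) (plan s t)"
proof (cases "s = 0 & t = 1")
 case True
 thus ?thesis using opt by (simp add: plan_def geoD(1,2))
next
 case False
 have "EX P. W2_optimal (metr X) (et s) (et t) P"
  using CD eta_ac[OF assms(1)] eta_ac[OF assms(2)] unfolding CD_space_def by blast
 thus ?thesis unfolding plan_def using False by (auto intro: someI_ex)
qed

definition nu :: "real => 'b measure" where "nu t = push Y.M (cellk (kap t)) (et t)"
definition Q :: "real => real => ('b \<times> 'b) measure" where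
 "Q s t = push2 Y.M (cellk (kap s)) (cellk (kap t)) (plan s t)"

lemma sets_nu [simp]: "sets (nu t) = sets Y.B"
 by (simp add: nu_def)

lemma sets_Q: "sets (Q s t) = sets Y.BB"
 by (simp add: Q_def cong: sets_pair_measure_cong)

lemma eta_sf: "t : {0..1} ==> sigma_finite_measure (et t)"
 using X.P2D(3)[OF geoD(3)] by (meson finite_measure.sigma_finite_measure prob_space.axioms(1))

lemma plan_prob:
 assumes "s : {0..1}" "t : {0..1}" shows "prob_space (plan s t)"
proof
 have c: "plan s t : X.cpl (et s) (et t)" using plan[OF assms] by (simp add: W2_optimal_def)
 show "em (plan s t) (space (plan s t)) = 1"
  using X.couplingsD(7)[OF c X.S_in_B] X.couplingsD(2)[OF c] X.P2D(4)[OF geoD(3)[OF assms(1)]] by simp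
qed

lemma Q_marginals:
 assumes st: "s : {0..1}" "t : {0..1}" and A: "A : sets Y.B"
 shows "em (Q s t) (A \<times> Y.S) <= em (nu s) A" "em (Q s t) (Y.S \<times> A) <= em (nu t) A"
  "em (nu s) A + em (nu t) Y.S <= em (Q s t) (A \<times> Y.S) + 1"
  "em (nu t) A + em (nu s) Y.S <= em (Q s t) (Y.S \<times> A) + 1"
proof -
 have c: "plan s t : X.cpl (et s) (et t)" using plan[OF st] by (simp add: W2_optimal_def)
 note cD = X.couplingsD[OF c]
 have A': "A : sets Y.M" using A by simp
 note pm = push2_marginals[OF kap_subkernel[of s] kap_subkernel[of t] cD(1) plan_prob[OF st] cD(3) eta_sf[OF st(1)] cD(9) cD(4) eta_sf[OF st(2)] cD(10) A',
   folded Q_def nu_def, unfolded Y.space_M]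
 show "em (Q s t) (A \<times> Y.S) <= em (nu s) A" "em (Q s t) (Y.S \<times> A) <= em (nu t) A"
  "em (nu s) A + em (nu t) Y.S <= em (Q s t) (A \<times> Y.S) + 1"
  "em (nu t) A + em (nu s) Y.S <= em (Q s t) (Y.S \<times> A) + 1"
  by (rule pm; assumption)+
qed

lemma Q_cost:
 assumes st: "s : {0..1}" "t : {0..1}"
 shows "(II z. Y.sq z ||Q s t) <=
  en ((1 + de)*((s - t)^2*(1/w*((1 + de)*J + 2*de))) + 2*de)"
proof -
 let ?W = "W2 (metr X) (density X.M s0) (density X.M s1)" and ?B = "1/w*((1 + de)*J + 2*de)"
 have c: "plan s t : X.cpl (et s) (et t)" using plan[OF st] by (simp add: W2_optimal_def)
 note cD = X.couplingsD[OF c]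
 interpret P: prob_space "plan s t" by (rule plan_prob[OF st])
 note [measurable_cong] = cD(1)
 have sfP: "sigma_finite_measure (plan s t)" ..
 have B0: "0 <= ?B" using w_pos J de by simp
 have c1: "(%z. Y.sq z) : bm (Y.M \<Otimes>\<^sub>M Y.M)" by measurable
 have "(II z. Y.sq z ||Q s t) <= (II z. en ((X.d (fst z) (snd z) + de)^2) ||plan s t)"
  unfolding Q_def
 proof (rule push2_le[where g="%_. 0", OF kap_subkernel kap_subkernel cD(1) sfP c1])
  fix x x' y y' assume y: "y : space Y.M" "y' : space Y.M" and nz: "cellk (kap s) x y ~= 0" "cellk (kap t) x' y' ~= 0"
  obtain i where i: "x : C i" "kap s i y ~= 0" using cellk_nonzero[OF nz(1)] by blast
  obtain i' where i': "x' : C i'" "kap t i' y' ~= 0" using cellk_nonzero[OF nz(2)] by blast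
  have "\<bar>X.d x x' - Y.d y y'\<bar> <= de"
   using h_dist[OF i(1) i'(1) _ _ kap_nonzero[OF i(2)] kap_nonzero[OF i'(2)]] y by simp
  hence "(Y.d y y')^2 <= (X.d x x' + de)^2" by (intro power_mono) auto
  thus "en ((Y.d (fst (y, y')) (snd (y, y')))^2) <= en ((X.d (fst (x, x')) (snd (x, x')) + de)^2)"
   by (auto intro: ennreal_leI)
 qed simp
 also have "... <= en (1 + de)*(II z. X.sq z ||plan s t) + en (2*de)"
  by (rule X.shift_cost[OF de cD(1) P.emeasure_space_1])
 also have "(II z. X.sq z ||plan s t) = X.TC (et s) (et t)"
  using plan[OF st] by (simp add: W2_optimal_def X.plan_cost_sq)
 also have "... = en ((\<bar>s - t\<bar>*?W)^2)"
  unfolding geoD(4)[OF st, symmetric] by (rule X.TC_W2[OF X.TC_finite[OF geoD(3)[OF st(1)] geoD(3)[OF st(2)]]])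
 also have "(\<bar>s - t\<bar>*?W)^2 <= (s - t)^2*?B"
 proof -
  have "X.TC (density X.M s0) (density X.M s1) < top" using TCb by (rule le_less_trans) simp
  from X.TC_W2[OF this] have "en (?W^2) <= en ?B" using TCb by simp
  hence "?W^2 <= ?B" using B0 by (subst (asm) ennreal_le_iff) auto
  thus ?thesis by (simp only: power_mult_distrib power2_abs mult_left_mono zero_le_power2)
 qed
 finally have "(II z. Y.sq z ||Q s t) <= en (1 + de)*en ((s - t)^2*?B) + en (2*de)"
  by (simp add: add_right_mono mult_left_mono ennreal_leI)
 also have "... = en ((1 + de)*((s - t)^2*?B) + 2*de)"
 proof -
  have "en (1 + de)*en ((s - t)^2*?B) = en ((1 + de)*((s - t)^2*?B))" using de by (intro ennreal_mult'[symmetric]) simp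
  moreover have "0 <= (1 + de)*((s - t)^2*?B)"       by (intro mult_nonneg_nonneg[OF _ mult_nonneg_nonneg[OF zero_le_power2 B0]]) (use de in simp)
  ultimately show ?thesis using de by (simp only: ennreal_plus[symmetric] mult_nonneg_nonneg less_imp_le zero_le_numeral)
 qed
 finally show ?thesis .
qed

definition snu :: "real => 'b => ennreal" where
 "snu t y = (\<Sum>i. em (et t) (C i) * kap t i y)"

lemma snu_meas [measurable]: "snu t : bm Y.B"
 unfolding snu_def by measurable

lemma nu_density: "t : {0..1} ==> nu t = density Y.M (snu t)"
 unfolding nu_def snu_def by (rule push_cellk[OF kap_meas X.P2D(1)[OF geoD(3)]])

lemma nu_mass_le: "t : {0..1} ==> em (nu t) Y.S <= 1"
proof -
 assume t: "t : {0..1}"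
 interpret K: subkernel Y.M X.B "cellk (kap t)" by (rule kap_subkernel)
 have "em (nu t) (space Y.M) <= em (et t) (space (et t))"
  unfolding nu_def by (rule K.push_le[OF X.P2D(1)[OF geoD(3)[OF t]] eta_sf[OF t]])
 thus ?thesis using X.P2D(2,4)[OF geoD(3)[OF t]] by simp
qed

lemma nu_endpoint:
 shows "A : sets Y.B ==> em (nu 0) A <= en (1/w)*em (density Y.M rh0) A" "em (nu 0) Y.S = 1"
  "A : sets Y.B ==> em (nu 1) A <= en (1/w)*em (density Y.M rh1) A" "em (nu 1) Y.S = 1"
 using ep unfolding endpoint_def nu_def kap_def by (simp_all add: geoD(1,2))

text \<open>Tails of the marginals on \<open>Y\<close> at level \<open>l\<close> control those of
  the transported marginals at level \<open>l + 1\<close>, with a factor \<open>1/w <= 2\<close>;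
  this explains \<open>e/2\<close> in the hypotheses and \<open>Suc l\<close> in the
  conclusion.\<close>

lemma eta_tight:
 assumes t: "0 < t" "t < 1" and l: "l <= L" and e: "0 <= e" "e <= 1/4"
  and tail: "em (density Y.M rh0) (Y.S - reg Y l) <= en (e/2)" "em (density Y.M rh1) (Y.S - reg Y l) <= en (e/2)"
 shows "em (et t) (X.S - reg X hh) <= en (2*e + \<omega> (Suc l) hh (2 powr ((N - 1)/N)*M1))"
proof -
 have t': "t : {0..1}" using t by simp
 have e2: "en (1/w)*en (e/2) <= en e"
 proof -
  have "1/w*(e/2) <= 2*(e/2)" using w_pos e by (intro mult_right_mono) auto
  thus ?thesis using w_pos e by (simp add: ennreal_mult[symmetric] ennreal_leI)
 qed
 have "em (density X.M s0) (X.S - reg X (Suc l)) <= en (1/w)*em (density Y.M rh0) (Y.S - reg Y l)"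
  using ep(1) l unfolding endpoint_def by blast
 also have "... <= en (1/w)*en (e/2)" by (intro mult_left_mono tail) simp
 finally have m0: "em (density X.M s0) (X.S - reg X (Suc l)) <= en e" using e2 by (rule order_trans)
 have "em (density X.M s1) (X.S - reg X (Suc l)) <= en (1/w)*em (density Y.M rh1) (Y.S - reg Y l)"
  using ep(2) l unfolding endpoint_def by blast
 also have "... <= en (1/w)*en (e/2)" by (intro mult_left_mono tail) simp
 finally have m1: "em (density X.M s1) (X.S - reg X (Suc l)) <= en e" using e2 by (rule order_trans)
 show ?thesis
  by (rule X.uniform_tight[OF CD uc N a0_ac a1_ac eta_ac[OF t'] t geo M1(2,3,1) e m0 m1])
qed

lemma nu_tight:
 assumes t: "t : {0..1}" and hh: "hh <= L"
 shows "em (nu t) (Y.S - reg Y (Suc hh)) <= em (et t) (X.S - reg X hh)"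
 unfolding nu_def by (rule push_regular[OF kap_subkernel kap_nonzero X.P2D(1)[OF geoD(3)[OF t]] eta_sf[OF t] hh])

lemma nu_mass:
 assumes t: "0 < t" "t < 1" and b: "0 < b"
 shows "1 <= em (nu t) Y.S + em (et t) (X.S - reg X L) +
   (en (b/c)*en de + en (b powr (1 - (N - 1)/N))*X.ren N (et t))"
proof -
 have t': "t : {0..1}" using t by simp
 have d: "density X.M (X.dns (et t)) = et t" by (rule X.density_dens[OF eta_ac[OF t']])
 have k: "kap t = kb" using t by (simp add: kap_def)
 show ?thesis
  using back_mass[OF exponent(1)[OF N] X.measurable_dens[of "et t"] b] X.P2D(4)[OF geoD(3)[OF t']]
  unfolding d X.renyi_eq[OF eta_ac[OF t']] nu_def k by simp
qed

text \<open>Integrating the pulled-back weight over the marginal on \<open>X\<close> is integrating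
  the weight over the returned marginal, which is at most \<open>1/w\<close> times the original
  one.\<close>

lemma endpoint_weight:
 assumes "endpoint rh w s k" and rh [measurable]: "rh : bm Y.B" and N': "N' < 0"
 shows "(%x. II y. cellk k x y*epowr (rh y) (- 1/N') ||Y.M) : bm X.B"
  "(II x. (II y. cellk k x y*epowr (rh y) (- 1/N') ||Y.M) ||density X.M s) <=
   en (1/w)*(II y. epowr (rh y) ((N' - 1)/N') ||Y.M)"
proof -
 have k: "subkernel Y.M X.B (cellk k)" and s [measurable]: "s : bm X.B" and ac: "density X.M s : X.P2ac"
  and le: "!!A. A : sets Y.B ==> em (push Y.M (cellk k) (density X.M s)) A <= en (1/w)*em (density Y.M rh) A"
  using assms(1) unfolding endpoint_def by blast+
 interpret K: subkernel Y.M X.B "cellk k" by fact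
 show "(%x. II y. cellk k x y*epowr (rh y) (- 1/N') ||Y.M) : bm X.B" by measurable
 have "density X.M s : P2 (metr X)" using ac by (simp add: P2_ac_def)
 from X.P2D(3)[OF this] have sf: "sigma_finite_measure (density X.M s)"
  by (meson finite_measure.sigma_finite_measure prob_space.axioms(1))
 have "(II x. (II y. cellk k x y*epowr (rh y) (- 1/N') ||Y.M) ||density X.M s) = (II y. epowr (rh y) (- 1/N') ||push Y.M (cellk k) (density X.M s))"
  by (rule K.nn_integral_push[symmetric]) (auto intro: sf)
 also have "... <= en (1/w)*(II y. epowr (rh y) (- 1/N') ||density Y.M rh)"
  by (rule nn_integral_le_scale) (auto intro: le)
 also have "(II y. epowr (rh y) (- 1/N') ||density Y.M rh) = (II y. rh y*epowr (rh y) (- 1/N') ||Y.M)"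
  by (rule nn_integral_density) measurable
 also have "... = (II y. epowr (rh y) ((N' - 1)/N') ||Y.M)"
  unfolding exponent(4)[OF N'] by (simp only: epowr_add[OF zero_less_one exponent(3)[OF N']] epowr_one_right)
 finally show "(II x. (II y. cellk k x y*epowr (rh y) (- 1/N') ||Y.M) ||density X.M s) <=
   en (1/w)*(II y. epowr (rh y) ((N' - 1)/N') ||Y.M)" .
qed

text \<open>One half of the distortion functional on \<open>X\<close>, with the power of the density
  there replaced by the pull-back of the power on \<open>Y\<close>.\<close>

definition A0 :: "real => (real => real) => ennreal" where
 "A0 N' ta = (II u. en (ta (X.d (fst u) (snd u)))*(II y. cellk k0 (fst u) y*epowr (rh0 y) (- 1/N') ||Y.M) ||pl)"

definition A1 :: "real => (real => real) => ennreal" where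
 "A1 N' ta = (II u. en (ta (X.d (fst u) (snd u)))*(II y. cellk k1 (snd u) y*epowr (rh1 y) (- 1/N') ||Y.M) ||pl)"

lemma A0_le:
 assumes N': "N' < 0" and ta: "tau_repr K D N'' t ta Ct" and v: "continuous_on UNIV v" "!!x. 0 <= v x"
  and vle: "!!x y. y : cdom K D ==> v x <= (Ct - ta y) + real n*\<bar>x - y\<bar>"
 shows "A0 N' ta + (II z. en (v (Y.d (fst z) (snd z)))*epowr (rh0 (fst z)) (- 1/N') ||Q 0 1)
  <= en (Ct + real n*de)*(en (1/w)*(II y. epowr (rh0 y) ((N' - 1)/N') ||Y.M))"
proof -
 let ?G = "%x. II y. cellk k0 x y*epowr (rh0 y) (- 1/N') ||Y.M"
 note w0 = endpoint_weight[OF ep(1) rhm(1) N']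
 have Gm: "(%u. ?G (fst u)) : bm X.BB" using w0(1) by measurable
 interpret P: prob_space pl by (rule prob_pl)
 have sf: "sigma_finite_measure pl" ..
 have Q: "Q 0 1 = push2 Y.M (cellk k0) (cellk k1) pl" by (simp add: Q_def kap_def plan_def)
 have gm: "(%y. epowr (rh0 y) (- 1/N')) : bm Y.M" by measurable
 have "A0 N' ta + (II z. en (v (Y.d (fst z) (snd z)))*epowr (rh0 (fst z)) (- 1/N') ||Q 0 1) <=
   en (Ct + real n*de)*(II u. ?G (fst u) ||pl)"
  unfolding A0_def
  by (rule weighted_cost_le[where k=k0 and k'=k1, OF plD(1) Gm _ _ _ dX ta v vle])
   (unfold Q, rule push2_weighted_le[OF k0s k1s plD(1) sf _ gm], use kap_nonzero[of 0] kap_nonzero[of 1] in \<open>simp_all add: kap_def\<close>)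
 also have "(II u. ?G (fst u) ||pl) = (II x. ?G x ||density X.M s0)" by (rule plD(9)[OF w0(1)])
 also have "en (Ct + real n*de) * ... <= en (Ct + real n*de)*(en (1/w)*(II y. epowr (rh0 y) ((N' - 1)/N') ||Y.M))"
  by (intro mult_left_mono w0(2)) simp
 finally show ?thesis .
qed

lemma A1_le:
 assumes N': "N' < 0" and ta: "tau_repr K D N'' t ta Ct" and v: "continuous_on UNIV v" "!!x. 0 <= v x"
  and vle: "!!x y. y : cdom K D ==> v x <= (Ct - ta y) + real n*\<bar>x - y\<bar>"
 shows "A1 N' ta + (II z. en (v (Y.d (fst z) (snd z)))*epowr (rh1 (snd z)) (- 1/N') ||Q 0 1)
  <= en (Ct + real n*de)*(en (1/w)*(II y. epowr (rh1 y) ((N' - 1)/N') ||Y.M))"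
proof -
 let ?G = "%x. II y. cellk k1 x y*epowr (rh1 y) (- 1/N') ||Y.M"
 note w0 = endpoint_weight[OF ep(2) rhm(2) N']
 have Gm: "(%u. ?G (snd u)) : bm X.BB" using w0(1) by measurable
 interpret P: prob_space pl by (rule prob_pl)
 have sf: "sigma_finite_measure pl" ..
 have Q: "Q 0 1 = push2 Y.M (cellk k0) (cellk k1) pl" by (simp add: Q_def kap_def plan_def)
 have gm: "(%y. epowr (rh1 y) (- 1/N')) : bm Y.M" by measurable
 have "A1 N' ta + (II z. en (v (Y.d (fst z) (snd z)))*epowr (rh1 (snd z)) (- 1/N') ||Q 0 1) <=
   en (Ct + real n*de)*(II u. ?G (snd u) ||pl)"
  unfolding A1_def
  by (rule weighted_cost_le[where k=k0 and k'=k1, OF plD(1) Gm _ _ _ dX ta v vle])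
   (unfold Q, rule push2_weighted_le_snd[OF k0s k1s plD(1) sf _ gm], use kap_nonzero[of 0] kap_nonzero[of 1] in \<open>simp_all add: kap_def\<close>)
 also have "(II u. ?G (snd u) ||pl) = (II x. ?G x ||density X.M s1)" by (rule plD(10)[OF w0(1)])
 also have "en (Ct + real n*de) * ... <= en (Ct + real n*de)*(en (1/w)*(II y. epowr (rh1 y) ((N' - 1)/N') ||Y.M))"
  by (intro mult_left_mono w0(2)) simp
 finally show ?thesis .
qed

text \<open>Returning to \<open>Y\<close> costs a power of \<open>c\<close>, and replacing densities
  on \<open>X\<close> by pulled-back weights a power of \<open>c/w\<close>; both factors tend to 1
  along the sequence.\<close>

lemma nu_entropy:
 assumes t: "0 < t" "t < 1" and N': "N' : {N..<0}" and ta: "tau_repr K D N' (1 - t) ta0 C0" "tau_repr K D N' t ta1 C1"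
  and fin: "(II y. epowr (rh0 y) ((N' - 1)/N') ||Y.M) < top" "(II y. epowr (rh1 y) ((N' - 1)/N') ||Y.M) < top"
 shows "(II y. epowr (snu t y) ((N' - 1)/N') ||Y.M) <=
  en (c powr (1 - (N' - 1)/N')*(c/w) powr (- 1/N'))*(A0 N' ta0 + A1 N' ta1)"
proof -
 have t': "t : {0..1}" and n: "N' < 0" using t N' by auto
 have d: "density X.M (X.dns (et t)) = et t" by (rule X.density_dens[OF eta_ac[OF t']])
 have k: "kap t = kb" using t by (simp add: kap_def)
 have f: "X.ren N' (density X.M s0) < \<infinity>" "X.ren N' (density X.M s1) < \<infinity>"
  using le_less_trans[OF endpoint_renyi[OF ep(1) n]] le_less_trans[OF endpoint_renyi[OF ep(2) n]] fin by (simp_all add: ennreal_mult_less_top)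
 have "(II y. epowr (snu t y) ((N' - 1)/N') ||Y.M) <= en (c powr (1 - (N' - 1)/N'))*X.ren N' (et t)"
  using back_entropy[OF exponent(1)[OF n] X.measurable_dens[of "et t"]] unfolding d snu_def k X.renyi_eq[OF eta_ac[OF t']] .
 also have "... <= en (c powr (1 - (N' - 1)/N'))*T_fun (metr X) (meas X) K N' t (density X.M s0) (density X.M s1) pl"
  by (intro mult_left_mono ineq f t' N') simp
 also have "... <= en (c powr (1 - (N' - 1)/N'))*(en ((c/w) powr (- 1/N'))*(A0 N' ta0 + A1 N' ta1))"
 proof -
  have a: "0 < - 1/N'" by (rule exponent(3)[OF n])
  have le: "epowr (s0 x) (- 1/N') <= en ((c/w) powr (- 1/N'))*(II y. cellk k0 x y*epowr (rh0 y) (- 1/N') ||Y.M)"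
   "epowr (s1 x) (- 1/N') <= en ((c/w) powr (- 1/N'))*(II y. cellk k1 x y*epowr (rh1 y) (- 1/N') ||Y.M)" for x
   using ep a unfolding endpoint_def by blast+
  show ?thesis unfolding A0_def A1_def
   by (intro mult_left_mono T_le[OF n ta endpoint_weight(1)[OF ep(1) rhm(1) n] endpoint_weight(1)[OF ep(2) rhm(2) n] le]) simp
 qed
 finally show ?thesis by (simp add: ennreal_mult mult.assoc)
qed

end

subsection \<open>The limit for marginals of finite entropy\<close>

lemma (in cd_step) nu_Lp:
 assumes t: "0 < t" "t < 1"
 shows "(II y. epowr (snu t y) ((N - 1)/N) ||Y.M) <= en (2 powr ((N - 1)/N))*X.ren N (et t)"
proof -
 let ?p = "(N - 1)/N"
 have t': "t : {0..1}" using t by simp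
 have d: "density X.M (X.dns (et t)) = et t" by (rule X.density_dens[OF eta_ac[OF t']])
 have k: "kap t = kb" using t by (simp add: kap_def)
 have p: "1 < ?p" by (rule exponent(1)[OF N])
 have "c powr (1 - ?p) = (1/c) powr (?p - 1)" using c_pos by (simp add: powr_divide powr_diff)
 also have "... <= 2 powr (?p - 1)" using c_pos p by (intro powr_mono2) (auto simp: field_simps)
 also have "... <= 2 powr ?p" by (intro powr_mono) auto
 finally have c: "c powr (1 - ?p) <= 2 powr ?p" .
 have "(II y. epowr (snu t y) ?p ||Y.M) <= en (c powr (1 - ?p))*X.ren N (et t)"
  using back_entropy[OF p X.measurable_dens[of "et t"]] unfolding d snu_def k X.renyi_eq[OF eta_ac[OF t']] .
 also have "... <= en (2 powr ?p)*X.ren N (et t)" using c by (intro mult_right_mono ennreal_leI) auto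
 finally show ?thesis .
qed

section \<open>Limits of the returned measures and plans\<close>

locale cd_sequence = pgm Y + ultrafilter F
 for Y :: "'b pgmms" and F +
 fixes X :: "nat => 'a pgmms" and L de C h c and K N D M0 J :: real and \<omega> rh0 rh1 w s0 s1 k0 k1 pl et
 assumes st: "!!j. cd_step (X j) Y (L j) (de j) (C j) (h j) (c j) K N D M0 J \<omega> rh0 rh1 (w j) (s0 j) (s1 j) (k0 j) (k1 j) (pl j) (et j)"
  and L: "!!j. j < L j" and de_lim: "de ----> 0" and w_lim: "w ----> 1"
  and mu: "density M rh0 : P2ac" "density M rh1 : P2ac"
  and TCJ: "TC (density M rh0) (density M rh1) = en J"
  and dY: "!!x y. x : S ==> y : S ==> d x y : cdom K D"
begin

abbreviation nu :: "nat => real => 'b measure" where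
 "nu j == cd_step.nu (X j) Y (C j) (h j) (c j) (k0 j) (k1 j) (et j)"
abbreviation snu :: "nat => real => 'b => ennreal" where
 "snu j == cd_step.snu (X j) (C j) (h j) (c j) (k0 j) (k1 j) (et j)"
abbreviation QQ :: "nat => real => real => ('b \<times> 'b) measure" where
 "QQ j == cd_step.Q (X j) Y (C j) (h j) (c j) (k0 j) (k1 j) (pl j) (et j)"
abbreviation tail :: "nat => real => nat => ennreal" where
 "tail j t k == em (et j t) (mspace (metr (X j)) - reg (X j) k)"

lemmas tp = cd_step.axioms(1)[OF st]

lemma N: "N < 0" and M0: "0 < M0" and KD: "K < 0 ==> - K*D^2 < pi^2" and J: "0 <= J"
 and rhm [measurable]: "rh0 : bm B" "rh1 : bm B"
 using cd_step.N[OF st] cd_step.fin(3)[OF st] cd_step.KD[OF st] cd_step.J[OF st] cd_step.rhm[OF st] by blast+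

lemma de_bounds: "0 < de j" "de j <= 1/2"
 using transfer_pair.de[OF tp] by auto

lemma c_lim: "c ----> 1"
proof (rule tendsto_sandwich[of "%j. 1 - de j" _ _ "%j. 1 + de j"])
 show "(%j. 1 - de j) ----> 1" "(%j. 1 + de j) ----> 1"
  using tendsto_diff[OF tendsto_const[of 1] de_lim] tendsto_add[OF tendsto_const[of 1] de_lim] by simp_all
qed (use transfer_pair.c_bounds[OF tp] in auto)

text \<open>The entropy bound of the transported marginals times the factor that truncation to a
  regular set costs.\<close>

definition MM :: real where "MM = 2 powr ((N - 1)/N)*(4 powr ((N - 1)/N)*M0)"

lemma omega_lim: "(%k. \<omega> l k MM) ----> 0"
 using cd_step.uc[OF st[of 0]] M0 unfolding uniformly_convex_space_def MM_def by auto

text \<open>The level \<open>l\<close> is read off the tails of the two marginals on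
  \<open>Y\<close> and serves all \<open>j >= l\<close>. This uniformity matters because \<omega>
  tends to 0 only for a fixed first argument.\<close>

lemma eta_tail:
 assumes t: "0 < t" "t < 1" and e: "0 < e"
 shows "EX l. ALL j>=l. ALL k. tail j t k <= en (e/2 + \<omega> (Suc l) k MM)"
proof -
 define e' where "e' = min (e/4) (1/4)"
 have e': "0 < e'" "0 <= e'" "e' <= 1/4" "2*e' <= e/2" using e by (auto simp: e'_def)
 have t0: "(%k. em mu' (S - reg Y k)) ----> 0" if "mu' : P2ac" for mu'
 proof (rule ac_regular_tendsto)
  have P: "mu' : P2 (metr Y)" using that by (simp add: P2_ac_def)
  show "absolutely_continuous M mu'" using that by (simp add: P2_ac_def)
  show "sets mu' = sets B" "em mu' S < top" using P2D[OF P] by auto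
 qed
 have "eventually (%k. em (density M rh0) (S - reg Y k) < en (e'/2) & em (density M rh1) (S - reg Y k) < en (e'/2)) sequentially"
  using e'(1) by (intro eventually_conj order_tendstoD(2)[OF t0] mu) auto
 then obtain l where l: "em (density M rh0) (S - reg Y l) < en (e'/2)" "em (density M rh1) (S - reg Y l) < en (e'/2)"
  by (auto simp: eventually_sequentially)
 show ?thesis
 proof (intro exI[of _ l] allI impI)
  fix j k assume "l <= j"
  hence "l <= L j" using L[of j] by simp
  from cd_step.eta_tight[OF st t this e'(2,3) less_imp_le[OF l(1)] less_imp_le[OF l(2)], of k]
  have "tail j t k <= en (2*e' + \<omega> (Suc l) k MM)"
   unfolding cd_step.M1_def[OF st] MM_def .
  also have "... <= en (e/2 + \<omega> (Suc l) k MM)" using e'(4) by (intro ennreal_leI) simp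
  finally show "tail j t k <= en (e/2 + \<omega> (Suc l) k MM)" .
 qed
qed

definition limit_at :: "real => 'b measure => bool" where
 "limit_at t mu \<longleftrightarrow> sets mu = sets B & absolutely_continuous M mu & em mu S = 1 & (ALL A:sets B. ulim (%j. em (nu j t) A) = em mu A)"

text \<open>Domination by \<open>1/w j\<close> times the marginal gives one inequality on every set;
  on the complement, with total mass 1, it gives the other.\<close>

lemma limit_end:
 assumes rh [measurable]: "rh : bm B" and ac: "density M rh : P2ac"
  and le: "!!j A. A : sets B ==> em (nu j t) A <= en (1/w j)*em (density M rh) A"
  and one: "!!j. em (nu j t) S = 1"
 shows "limit_at t (density M rh)"
proof -
 have P: "density M rh : P2 (metr Y)" and a: "absolutely_continuous M (density M rh)" using ac by (auto simp: P2_ac_def)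
 have le': "ulim (%j. em (nu j t) A) <= em (density M rh) A" if A: "A : sets B" for A
 proof -
  have f: "em (density M rh) A ~= top"
  proof -
   have "em (density M rh) A <= em (density M rh) (space (density M rh))" by (rule emeasure_space)
   thus ?thesis using P2D(4)[OF P] by (auto simp: top_unique)
  qed
  have "(%j. en (1/w j)) ----> en (1/1)" by (intro tendsto_ennrealI tendsto_intros w_lim) simp
  hence "(%j. em (density M rh) A*en (1/w j)) ----> em (density M rh) A*en (1/1)"
   using f by (intro tendsto_mult_ennreal tendsto_const) auto
  from ulimI[OF ulim_sequentially[OF this]] have "ulim (%j. em (density M rh) A*en (1/w j)) = em (density M rh) A" by simp
  moreover have "ulim (%j. em (nu j t) A) <= ulim (%j. em (density M rh) A*en (1/w j))"
   using le[OF A] by (intro ulim_mono always_eventually) (simp add: mult.commute)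
  ultimately show ?thesis by simp
 qed
 have "ulim (%j. em (nu j t) A) = em (density M rh) A" if A: "A : sets B" for A
 proof (rule antisym[OF le'[OF A]])
  have A': "S - A : sets B" and AS: "A <= S" using A sets.sets_into_space[OF A] by auto
  have split: "em m S = em m A + em m (S - A)" if "sets m = sets B" for m :: "'b measure"
   using plus_emeasure[of A m "S - A"] A A' AS that by (simp add: Un_absorb1)
  have "ulim (%j. em (nu j t) A) + ulim (%j. em (nu j t) (S - A)) = ulim (%j. em (nu j t) S)"
   using split[OF cd_step.sets_nu[OF st]] by (simp add: ulim_add)
  also have "... = 1" using one by (simp add: ulim_const)
  finally have "em (density M rh) A + em (density M rh) (S - A) = ulim (%j. em (nu j t) A) + ulim (%j. em (nu j t) (S - A))"
   using P2D(4)[OF P] split[of "density M rh"] by simp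
  also have "... <= ulim (%j. em (nu j t) A) + em (density M rh) (S - A)" by (intro add_left_mono le' A')
  finally show "em (density M rh) A <= ulim (%j. em (nu j t) A)"
  proof -
   assume l: "em (density M rh) A + em (density M rh) (S - A) <= ulim (%j. em (nu j t) A) + em (density M rh) (S - A)"
   have "em (density M rh) (S - A) <= em (density M rh) (space (density M rh))" by (rule emeasure_space)
   hence "em (density M rh) (S - A) ~= top" using P2D(4)[OF P] by (auto simp: top_unique)
   thus ?thesis using l by (auto simp: add.commute[of _ "em (density M rh) (S - A)"] ennreal_add_left_cancel_le)
  qed
 qed
 thus ?thesis using a P2D(4)[OF P] by (simp add: limit_at_def)
qed

lemma limit_0: "limit_at 0 (density M rh0)"
 by (rule limit_end[OF rhm(1) mu(1) cd_step.nu_endpoint(1)[OF st] cd_step.nu_endpoint(2)[OF st]])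

lemma limit_1: "limit_at 1 (density M rh1)"
 by (rule limit_end[OF rhm(2) mu(2) cd_step.nu_endpoint(3)[OF st] cd_step.nu_endpoint(4)[OF st]])

text \<open>Existence comes from \<open>Lp_setwise_limit\<close>. That the limit has mass 1 is a
  separate matter, since the return kernel loses mass; \<open>nu_mass\<close> bounds the loss by
  terms that become small.\<close>

lemma limit_interior:
 assumes t: "0 < t" "t < 1"
 shows "EX mu. limit_at t mu"
proof -
 let ?p = "(N - 1)/N"
 have p: "1 < ?p" by (rule exponent(1)[OF N])
 have t': "t : {0..1}" using t by simp
 obtain ta0 C0 where t0: "tau_repr K D N (1 - t) ta0 C0" using tau_repr_exists[OF N _ _ KD, of "1 - t"] t by auto
 obtain ta1 C1 where t1: "tau_repr K D N t ta1 C1" using tau_repr_exists[OF N t KD] by auto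
 define R where "R = (C0 + C1)*(4 powr ?p*M0)"
 have R: "0 < R" using t0 t1 M0 by (simp add: R_def tau_repr_def)
 have ren: "renyi (metr (X j)) (meas (X j)) N (et j t) <= en R" for j
  using cd_step.eta_bound[OF st t t0 t1, of j] unfolding cd_step.M1_def[OF st] R_def .
 have dens: "nu j t = density M (snu j t)" for j by (rule cd_step.nu_density[OF st t'])
 have sm: "snu j t : bm M" for j using cd_step.snu_meas[OF st] by simp
 have bound: "eventually (%j. (II y. epowr (snu j t y) ?p ||M) <= en (2 powr ?p * R)) F"
 proof (intro always_eventually allI)
  fix j
  have "(II y. epowr (snu j t y) ?p ||M) <= en (2 powr ?p)*en R"
   by (rule order_trans[OF cd_step.nu_Lp[OF st t]]) (intro mult_left_mono ren, simp)
  thus "(II y. epowr (snu j t y) ?p ||M) <= en (2 powr ?p * R)" using R by (simp add: ennreal_mult)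
 qed
 have le1: "em (nu j t) S <= 1" for j by (rule cd_step.nu_mass_le[OF st t'])
 have "ulim (%j. em (nu j t) S) <= ulim (%j. 1)" by (intro ulim_mono always_eventually) (simp add: le1)
 hence mass1: "ulim (%j. em (nu j t) S) <= 1" by (simp add: ulim_const)
 have tight: "EX k. ulim (%j. em (nu j t) (S - reg Y k)) <= en e" if e: "0 < e" for e
 proof -
  obtain l where l: "!!j k. l <= j ==> tail j t k <= en (e/2 + \<omega> (Suc l) k MM)" using eta_tail[OF t e] by blast
  have "eventually (%k. \<omega> (Suc l) k MM < e/2) sequentially" using e by (intro order_tendstoD(2)[OF omega_lim]) simp
  then obtain k where k: "\<omega> (Suc l) k MM < e/2" by (auto simp: eventually_sequentially)
  have "eventually (%j. em (nu j t) (S - reg Y (Suc k)) <= en e) F"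
  proof (rule eventually_sequentially_F[OF eventually_mono[OF eventually_ge_at_top[of "max l k"]]])
   fix j assume "max l k <= j"
   hence j: "l <= j" "k <= L j" using L[of j] by auto
   have "em (nu j t) (S - reg Y (Suc k)) <= tail j t k" by (rule cd_step.nu_tight[OF st t' j(2)])
   also have "... <= en (e/2 + \<omega> (Suc l) k MM)" by (rule l[OF j(1)])
   also have "... <= en e" using k by (intro ennreal_leI) simp
   finally show "em (nu j t) (S - reg Y (Suc k)) <= en e" .
  qed
  from ulim_mono[OF this] show ?thesis by (intro exI[of _ "Suc k"]) (simp add: ulim_const)
 qed
 have mass: "1 <= ulim (%j. em (nu j t) S) + en e" if e: "0 < e" for e
 proof -
  obtain l where l: "!!j k. l <= j ==> tail j t k <= en (e/2/2 + \<omega> (Suc l) k MM)" using eta_tail[OF t, of "e/2"] e by auto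
  \<comment> \<open>Density level above which the \<open>L^p\<close> bound contributes at most
    \<open>e/4\<close>. It does not depend on \<open>j\<close>, so the loss
    \<open>b/c j * de j\<close> below it tends to 0.\<close>
  define b where "b = max 1 (4 * R/e) powr (1/(?p - 1))"
  have b: "0 < b" by (simp add: b_def)
  have "b powr (1 - ?p) = max 1 (4 * R/e) powr (1/(?p - 1)*(1 - ?p))" unfolding b_def by (rule powr_powr)
  also have "1/(?p - 1)*(1 - ?p) = - 1" using p by (simp add: field_simps)
  also have "max 1 (4 * R/e) powr (- 1) = 1/max 1 (4 * R/e)" by (simp add: powr_minus_divide)
  also have "... * R <= e/4"
  proof -
   have "1/max 1 (4 * R/e) <= 1/(4 * R/e)" using R e by (intro divide_left_mono) auto
   hence "1/max 1 (4 * R/e) * R <= 1/(4 * R/e) * R" using R by (intro mult_right_mono) auto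
   thus ?thesis using R e by simp
  qed
  finally have bR: "b powr (1 - ?p) * R <= e/4" by (simp add: mult_right_mono)
  have Llim: "filterlim L at_top sequentially"
   by (rule filterlim_at_top_mono[OF filterlim_ident]) (simp add: less_imp_le[OF L])
  have ev: "eventually (%j. \<omega> (Suc l) (L j) MM < e/4 & de j < e/4/(2*b) & l <= j) sequentially"
   using e b by (intro eventually_conj order_tendstoD(2)[OF filterlim_compose[OF omega_lim Llim]] order_tendstoD(2)[OF de_lim] eventually_ge_at_top) auto
  have "eventually (%j. 1 <= em (nu j t) S + en e) F"
  proof (rule eventually_sequentially_F[OF eventually_mono[OF ev]])
   fix j assume j: "\<omega> (Suc l) (L j) MM < e/4 & de j < e/4/(2*b) & l <= j"
   have "tail j t (L j) <= en (e/2/2 + \<omega> (Suc l) (L j) MM)" using j by (intro l) simp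
   also have "... <= en (e/2)" using j by (intro ennreal_leI) simp
   finally have 1: "tail j t (L j) <= en (e/2)" .
   have c: "1/2 <= c j" using transfer_pair.c_pos[OF tp] by simp
   have "b/c j*de j <= 2*b*de j"
    using c b de_bounds[of j] by (intro mult_right_mono) (auto simp: field_simps)
   also have "... <= e/4" using j b by (simp add: field_simps)
   finally have 2: "en (b/c j)*en (de j) <= en (e/4)"
    using c b de_bounds[of j] by (simp add: ennreal_mult[symmetric] ennreal_leI)
   have "en (b powr (1 - ?p))*renyi (metr (X j)) (meas (X j)) N (et j t) <= en (b powr (1 - ?p))*en R"
    by (intro mult_left_mono ren) simp
   also have "... <= en (e/4)" using R bR by (simp add: ennreal_mult[symmetric] ennreal_leI)
   finally have 3: "en (b powr (1 - ?p))*renyi (metr (X j)) (meas (X j)) N (et j t) <= en (e/4)" .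
   have "1 <= em (nu j t) S + tail j t (L j) + (en (b/c j)*en (de j) + en (b powr (1 - ?p))*renyi (metr (X j)) (meas (X j)) N (et j t))"
    by (rule cd_step.nu_mass[OF st t b])
   also have "... <= em (nu j t) S + en (e/2) + (en (e/4) + en (e/4))"
    by (intro add_mono order_refl 1 2 3)
   also have "... = em (nu j t) S + en e" using e by (simp add: add.assoc ennreal_plus[symmetric] del: ennreal_plus)
   finally show "1 <= em (nu j t) S + en e" .
  qed
  from ulim_mono[OF this] show ?thesis by (simp add: ulim_const ulim_add)
 qed
 have Rin: "reg Y k : sets M" for k by simp
 have fin: "ulim (%j. em (density M (snu j t)) (space M)) < top"
  using mass1 unfolding dens[symmetric] space_M by (rule le_less_trans) simp
 obtain mu' where mu': "sets mu' = sets M" "!!A. A : sets M ==> em mu' A = ulim (%j. em (density M (snu j t)) A)"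
  "absolutely_continuous M mu'"
  using Lp_setwise_limit[OF p sm bound Rin M_regular fin tight[unfolded dens, folded space_M]] by blast
 have "em mu' S = 1"
 proof -
  have "em mu' S = ulim (%j. em (nu j t) S)" unfolding dens by (rule mu'(2)) simp
  moreover have "1 <= ulim (%j. em (nu j t) S)" by (rule ennreal_le_epsilon) (rule mass)
  ultimately show ?thesis using antisym[OF mass1] by (simp only:)
 qed
 hence "limit_at t mu'" unfolding limit_at_def dens using mu' by simp
 thus ?thesis by blast
qed

text \<open>A marginal of the returned plan lies below the returned measure, and its deficit is at
  most the mass missing from the other end, which tends to 0; so both have the same limit.\<close>

lemma limit_plan:
 assumes s: "s : {0..1}" "limit_at s mus" and t: "t : {0..1}" "limit_at t mut"
 shows "EX Q:cpl mus mut. lsc_plans F (%j. QQ j s t) Q &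
  (cost Q) <= en ((s - t)^2*J)"
proof -
 have ls: "sets mus = sets B" "absolutely_continuous M mus" "em mus S = 1" "!!A. A : sets B ==> ulim (%j. em (nu j s) A) = em mus A"
  and lt: "sets mut = sets B" "absolutely_continuous M mut" "em mut S = 1" "!!A. A : sets B ==> ulim (%j. em (nu j t) A) = em mut A"
  using s t by (auto simp: limit_at_def)
 note q = cd_step.Q_marginals[OF st s(1) t(1)]
 have cancel: "u = v" if "u <= v" "v + 1 <= u + 1" for u v :: ennreal
  using that by (auto simp: add.commute[of _ 1] ennreal_add_left_cancel_le)
 have l1: "ulim (%j. em (QQ j s t) (A \<times> S)) = em mus A" if A: "A : sets B" for A
 proof (rule cancel)
  show "ulim (%j. em (QQ j s t) (A \<times> S)) <= em mus A"
   unfolding ls(4)[OF A, symmetric] by (intro ulim_mono always_eventually allI q(1) A)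
  have "ulim (%j. em (nu j s) A + em (nu j t) S) <= ulim (%j. em (QQ j s t) (A \<times> S) + 1)"
   by (intro ulim_mono always_eventually allI q(3) A)
  thus "em mus A + 1 <= ulim (%j. em (QQ j s t) (A \<times> S)) + 1"
   unfolding ulim_add ls(4)[OF A] lt(4)[OF S_in_B] lt(3) ulim_const .
 qed
 have l2: "ulim (%j. em (QQ j s t) (S \<times> A)) = em mut A" if A: "A : sets B" for A
 proof (rule cancel)
  show "ulim (%j. em (QQ j s t) (S \<times> A)) <= em mut A"
   unfolding lt(4)[OF A, symmetric] by (intro ulim_mono always_eventually allI q(2) A)
  have "ulim (%j. em (nu j t) A + em (nu j s) S) <= ulim (%j. em (QQ j s t) (S \<times> A) + 1)"
   by (intro ulim_mono always_eventually allI q(4) A)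
  thus "em mut A + 1 <= ulim (%j. em (QQ j s t) (S \<times> A)) + 1"
   unfolding ulim_add lt(4)[OF A] ls(4)[OF S_in_B] ls(3) ulim_const .
 qed
 have f1: "em mus S < top" "em mut S < top" using ls(3) lt(3) by auto
 obtain Q where Q: "Q : cpl mus mut" "lsc_plans F (%j. QQ j s t) Q"
  using plan_limit[OF ultrafilter_axioms cd_step.sets_Q[OF st] ls(2,1) f1(1) lt(2,1) f1(2) l1 l2] by blast
 let ?b = "%j. (1 + de j)*((s - t)^2*(1/w j*((1 + de j)*J + 2*de j))) + 2*de j"
 have lim: "?b ----> (1 + 0)*((s - t)^2*(1/1*((1 + 0)*J + 2*0))) + 2*0"
  by (intro tendsto_intros de_lim w_lim) simp
 have "(cost Q) <= ulim (%j. II z. sq z ||QQ j s t)"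
  by (rule lsc_plans_cost[OF Q(2)])
 also have "... <= ulim (%j. en (?b j))" by (intro ulim_mono always_eventually allI cd_step.Q_cost[OF st s(1) t(1)])
 also have "... = en ((s - t)^2*J)" using ulimI[OF ulim_sequentially[OF tendsto_ennrealI[OF lim]]] by simp
 finally show ?thesis using Q by blast
qed

end

lemma tau_coeff_one:
 assumes "N < 0" "K < 0 ==> - K*D^2 < pi^2" "x : cdom K D"
 shows "tau_coeff K N 1 x = 1"
proof -
 have h: "0 < (1/2 :: real)" "(1/2 :: real) < 1" by auto
 show ?thesis by (rule tau_coeff_real[OF assms(1) h assms(2)]) (use assms(3) in blast)+
qed

context cd_sequence
begin

abbreviation mu0 where "mu0 == density M rh0"
abbreviation mu1 where "mu1 == density M rh1"

lemma weight_lim: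
 assumes fin: "x < top" and Ct: "0 < Ct"
 shows "((%j. en (Ct + real k*de j)*(en (1/w j)*x)) ---> en Ct*x) F"
proof -
 have "(%j. en (Ct + real k*de j)) ----> en (Ct + real k*0)" by (intro tendsto_ennrealI tendsto_intros de_lim)
 moreover have "(%j. en (1/w j)) ----> en (1/1)" by (intro tendsto_ennrealI tendsto_intros w_lim) simp
 ultimately have "(%j. en (Ct + real k*de j)*(en (1/w j)*x)) ----> en (Ct + real k*0)*(en (1/1)*x)"
  using fin by (intro tendsto_mult_ennreal tendsto_const) (auto simp: ennreal_mult_eq_top_iff)
 thus ?thesis by (intro ulim_sequentially) simp
qed

lemma weight_integral:
 assumes N': "N' < 0" and [measurable]: "rh : bm B"
 shows "(II y. epowr (rh y) (- 1/N') ||density M rh) = (II y. epowr (rh y) ((N' - 1)/N') ||M)"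
proof -
 have "(II y. epowr (rh y) (- 1/N') ||density M rh) = (II y. rh y*epowr (rh y) (- 1/N') ||M)"
  by (rule nn_integral_density) measurable
 thus ?thesis unfolding exponent(4)[OF N'] by (simp only: epowr_add[OF zero_less_one exponent(3)[OF N']] epowr_one_right)
qed

text \<open>Lower semicontinuity of the entropy meets upper semicontinuity of the two halves of the
  distortion functional. The plan \<open>Q\<close> depends neither on \<open>t\<close> nor on
  \<open>N'\<close>, as the curvature condition demands.\<close>

lemma entropy_limit:
 assumes t: "0 < t" "t < 1" and lim: "limit_at t mu" "mu : P2ac"
  and Q: "Q : cpl mu0 mu1" "lsc_plans F (%j. QQ j 0 1) Q"
  and N': "N' : {N..<0}" and fin: "ren N' mu0 < top" "ren N' mu1 < top"
  and dn: "dns mu0 = rh0" "dns mu1 = rh1"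
 shows "ren N' mu <= T_fun (metr Y) (meas Y) K N' t mu0 mu1 Q"
proof -
 let ?p = "(N' - 1)/N'" and ?a = "- 1/N'"
 have n: "N' < 0" using N' by simp
 have p: "1 < ?p" by (rule exponent(1)[OF n])
 have t': "t : {0..1}" using t by simp
 note QD = couplingsD[OF Q(1)]
 note [measurable_cong] = QD(1)
 obtain ta0 C0 where t0: "tau_repr K D N' (1 - t) ta0 C0" using tau_repr_exists[OF n _ _ KD, of "1 - t"] t by auto
 obtain ta1 C1 where t1: "tau_repr K D N' t ta1 C1" using tau_repr_exists[OF n t KD] by auto
 have c: "continuous_on (cdom K D) ta0" "continuous_on (cdom K D) ta1" "0 < C0" "0 < C1"
  and b0: "!!x. x : cdom K D ==> 0 <= ta0 x" "!!x. x : cdom K D ==> ta0 x <= C0"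
  and b1: "!!x. x : cdom K D ==> 0 <= ta1 x" "!!x. x : cdom K D ==> ta1 x <= C1"
  using t0 t1 by (auto simp: tau_repr_def)
 define a0 where "a0 j = cd_step.A0 (X j) Y (C j) rh0 (k0 j) (pl j) N' ta0" for j
 define a1 where "a1 j = cd_step.A1 (X j) Y (C j) rh1 (k1 j) (pl j) N' ta1" for j
 have S: "(II y. epowr (rh0 y) ?p ||M) < top" "(II y. epowr (rh1 y) ?p ||M) < top"
  using fin by (simp_all add: renyi_density[OF rhm(1)] renyi_density[OF rhm(2)])
 have gm: "(%y. epowr (rh0 y) ?a) : bm B" "(%y. epowr (rh1 y) ?a) : bm B" by measurable
 have I: "(II z. epowr (rh0 (fst z)) ?a ||Q) = (II y. epowr (rh0 y) ?p ||M)" "(II z. epowr (rh1 (snd z)) ?a ||Q) = (II y. epowr (rh1 y) ?p ||M)"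
  using QD(9)[OF gm(1)] QD(10)[OF gm(2)] weight_integral[OF n rhm(1)] weight_integral[OF n rhm(2)] by simp_all
 have L0: "ulim a0 <= (II z. en (ta0 (d (fst z) (snd z)))*epowr (rh0 (fst z)) ?a ||Q)"
 proof (rule T_limit[OF ultrafilter_axioms Q(2) QD(1) gm(1) _ dY c(1) b0, where b = "%k j. en (C0 + real k*de j)*(en (1/w j)*(II y. epowr (rh0 y) ?p ||M))"])
  fix v k assume "continuous_on UNIV v" "!!x. 0 <= v x" "!!x y. y : cdom K D ==> v x <= (C0 - ta0 y) + real k*\<bar>x - y\<bar>"
  from cd_step.A0_le[OF st n t0 this]
  show "eventually (%j. a0 j + (II z. en (v (d (fst z) (snd z)))*epowr (rh0 (fst z)) ?a ||QQ j 0 1) <= en (C0 + real k*de j)*(en (1/w j)*(II y. epowr (rh0 y) ?p ||M))) F"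
   unfolding a0_def by (intro always_eventually allI)
 qed (simp_all only: I S weight_lim[OF S(1) c(3)] simp_thms)
 have L1: "ulim a1 <= (II z. en (ta1 (d (fst z) (snd z)))*epowr (rh1 (snd z)) ?a ||Q)"
 proof (rule T_limit[OF ultrafilter_axioms Q(2) QD(1) gm(2) _ dY c(2) b1, where b = "%k j. en (C1 + real k*de j)*(en (1/w j)*(II y. epowr (rh1 y) ?p ||M))"])
  fix v k assume "continuous_on UNIV v" "!!x. 0 <= v x" "!!x y. y : cdom K D ==> v x <= (C1 - ta1 y) + real k*\<bar>x - y\<bar>"
  from cd_step.A1_le[OF st n t1 this]
  show "eventually (%j. a1 j + (II z. en (v (d (fst z) (snd z)))*epowr (rh1 (snd z)) ?a ||QQ j 0 1) <= en (C1 + real k*de j)*(en (1/w j)*(II y. epowr (rh1 y) ?p ||M))) F"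
   unfolding a1_def by (intro always_eventually allI)
 qed (simp_all only: I S weight_lim[OF S(2) c(4)] simp_thms)
 let ?b = "%j. c j powr (1 - ?p)*(c j/w j) powr ?a"
 have "?b ----> 1 powr (1 - ?p)*(1/1) powr ?a" by (intro tendsto_intros c_lim w_lim) simp_all
 hence b: "(%j. en (?b j)) ----> en 1" by (intro tendsto_ennrealI) simp
 have dm: "density M (dns mu) = mu" by (rule density_dens[OF lim(2)])
 have sm: "snu j t : bm M" for j using cd_step.snu_meas[OF st] by simp
 have dmm: "dns mu : bm M" by simp
 have "ren N' mu = (II y. epowr (dns mu y) ?p ||M)" by (rule renyi_eq[OF lim(2)])
 also have "... <= ulim (%j. II y. epowr (snu j t y) ?p ||M)"
 proof (rule Lp_lsc[OF p sm dmm])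
  show "(II y. dns mu y ||M) < top"
   using emeasure_density_space[OF dmm] lim(1) unfolding dm by (simp add: limit_at_def)
  fix A assume "A : sets M"
  thus "em (density M (dns mu)) A <= ulim (%j. em (density M (snu j t)) A)"
   unfolding dm cd_step.nu_density[OF st t', symmetric] using lim(1) by (simp add: limit_at_def)
 qed
 also have "... <= ulim (%j. en (?b j)*(a0 j + a1 j))"
  using cd_step.nu_entropy[OF st t N' t0 t1 S] unfolding a0_def a1_def by (intro ulim_mono always_eventually allI)
 also have "... = en 1*ulim (%j. a0 j + a1 j)"
  by (intro ulimI tendsto_mult_ennreal ulim ulim_sequentially[OF b]) simp
 also have "... = ulim a0 + ulim a1" by (simp add: ulim_add)
 also have "... <= (II z. en (ta0 (d (fst z) (snd z)))*epowr (rh0 (fst z)) ?a ||Q) + (II z. en (ta1 (d (fst z) (snd z)))*epowr (rh1 (snd z)) ?a ||Q)"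
  by (rule add_mono[OF L0 L1])
 also have "... = (II z. en (ta0 (d (fst z) (snd z)))*epowr (rh0 (fst z)) ?a + en (ta1 (d (fst z) (snd z)))*epowr (rh1 (snd z)) ?a ||Q)"
 proof -
  note [measurable] = tau_measurable[OF c(1) dY] tau_measurable[OF c(2) dY]
  show ?thesis by (rule nn_integral_add[symmetric]) measurable
 qed
 also have "... = T_fun (metr Y) (meas Y) K N' t mu0 mu1 Q"
  unfolding T_fun_def dn
 proof (rule nn_integral_cong)
  fix z assume "z : space Q"
  hence "d (fst z) (snd z) : cdom K D" using dY unfolding QD(2) by (auto simp: mem_Times_iff)
  thus "en (ta0 (d (fst z) (snd z)))*epowr (rh0 (fst z)) ?a + en (ta1 (d (fst z) (snd z)))*epowr (rh1 (snd z)) ?a =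
    (case z of (x, y) => tau_coeff K N' (1 - t) (d x y)*epowr (rh0 x) ?a + tau_coeff K N' t (d x y)*epowr (rh1 y) ?a)"
   using t0 t1 by (simp add: tau_repr_def case_prod_unfold)
 qed
 finally show ?thesis .
qed

text \<open>At an end the coefficient of the matching marginal is 1, and the other summand is
  nonnegative whatever the coefficient at \<open>t = 0\<close> is.\<close>

lemma entropy_ends:
 assumes Q: "Q : cpl mu0 mu1" and n: "N' < 0"
  and dn: "dns mu0 = rh0" "dns mu1 = rh1"
 shows "ren N' mu0 <= T_fun (metr Y) (meas Y) K N' 0 mu0 mu1 Q"
  "ren N' mu1 <= T_fun (metr Y) (meas Y) K N' 1 mu0 mu1 Q"
proof -
 let ?a = "- 1/N'"
 note QD = couplingsD[OF Q]
 have one: "tau_coeff K N' 1 (d (fst z) (snd z)) = 1" if "z : space Q" for z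
  using that dY unfolding QD(2) by (intro tau_coeff_one[OF n KD]) (auto simp: mem_Times_iff)
 have gm: "(%y. epowr (rh0 y) ?a) : bm B" "(%y. epowr (rh1 y) ?a) : bm B" by measurable
 have "ren N' mu0 = (II z. epowr (rh0 (fst z)) ?a ||Q)"
  unfolding QD(9)[OF gm(1)] weight_integral[OF n rhm(1)] by (rule renyi_density[OF rhm(1)])
 also have "... <= T_fun (metr Y) (meas Y) K N' 0 mu0 mu1 Q"
  unfolding T_fun_def dn by (rule nn_integral_mono) (simp add: case_prod_unfold one)
 finally show "ren N' mu0 <= T_fun (metr Y) (meas Y) K N' 0 mu0 mu1 Q" .
 have "ren N' mu1 = (II z. epowr (rh1 (snd z)) ?a ||Q)"
  unfolding QD(10)[OF gm(2)] weight_integral[OF n rhm(2)] by (rule renyi_density[OF rhm(2)])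
 also have "... <= T_fun (metr Y) (meas Y) K N' 1 mu0 mu1 Q"
  unfolding T_fun_def dn by (rule nn_integral_mono) (simp add: case_prod_unfold one)
 finally show "ren N' mu1 <= T_fun (metr Y) (meas Y) K N' 1 mu0 mu1 Q" .
qed

text \<open>For the pair \<open>(0, 1)\<close> the limit plan costs at most the optimal value
  \<open>J\<close>, so it is optimal. For other pairs the cost bound \<open>(s - t)^2 * J\<close> is
  all that \<open>W2_geodesicI\<close> asks for, and finite cost from \<open>mu0\<close> places the
  limits in \<open>P2\<close>.\<close>

lemma cd_pair:
 assumes dn: "dns mu0 = rh0" "dns mu1 = rh1"
 shows "EX Q mut. W2_optimal (metr Y) mu0 mu1 Q & W2_geodesic (metr Y) mu0 mu1 mut &
  (ALL t:{0..1}. ALL N':{N..<0}. ren N' mu0 < \<infinity> & ren N' mu1 < \<infinity> -->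
    ren N' (mut t) <= T_fun (metr Y) (meas Y) K N' t mu0 mu1 Q)"
proof -
 define mut where "mut t = (if t = 0 then mu0 else if t = 1 then mu1 else SOME mu. limit_at t mu)" for t
 have lim: "limit_at t (mut t)" if t: "t : {0..1}" for t
 proof -
  consider "t = 0" | "t = 1" | "0 < t" "t < 1" using t by force
  thus ?thesis
  proof cases
   case 3
   thus ?thesis using someI_ex[OF limit_interior[OF 3]] by (simp add: mut_def)
  qed (simp_all add: mut_def limit_0 limit_1)
 qed
 have e: "mut 0 = mu0" "mut 1 = mu1" by (simp_all add: mut_def)
 have P20: "mu0 : P2 (metr Y)" "mu1 : P2 (metr Y)" using mu by (simp_all add: P2_ac_def)
 have i: "(0::real) : {0..1}" "(1::real) : {0..1}" by auto
 have P2: "mut t : P2 (metr Y)" if t: "t : {0..1}" for t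
 proof -
  obtain Q where Q: "Q : cpl mu0 (mut t)" "(cost Q) <= en ((0 - t)^2*J)"
   using limit_plan[OF i(1) limit_0 t lim[OF t]] by blast
  show ?thesis by (rule P2_of_coupling[OF P20(1) Q(1) le_less_trans[OF Q(2)]]) simp
 qed
 have ac: "mut t : P2ac" if t: "t : {0..1}" for t
  using P2[OF t] lim[OF t] by (simp add: P2_ac_def limit_at_def)
 obtain Q where Q: "Q : cpl mu0 mu1" "lsc_plans F (%j. QQ j 0 1) Q"
  and Qc: "(cost Q) <= en ((0 - 1)^2*J)"
  using limit_plan[OF i(1) limit_0 i(2) limit_1] by blast
 have "(cost Q) = TC mu0 mu1"
  using Qc TC_le[OF Q(1)] unfolding TCJ by simp
 hence opt: "W2_optimal (metr Y) mu0 mu1 Q" using Q(1) by (simp add: W2_optimal_def plan_cost_sq)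
 let ?W = "W2 (metr Y) mu0 mu1"
 have "en J = en (?W^2)" using TC_W2[OF TC_finite[OF P20]] unfolding TCJ .
 hence JW: "J = ?W^2" using J by (subst (asm) ennreal_inj) auto
 have geo: "W2_geodesic (metr Y) mu0 mu1 mut"
 proof (rule W2_geodesicI[OF P2 e])
  fix s t :: real assume st: "0 <= s" "s < t" "t <= 1"
  hence s': "s : {0..1}" and t': "t : {0..1}" by auto
  obtain R where R: "R : cpl (mut s) (mut t)" "(cost R) <= en ((s - t)^2*J)"
   using limit_plan[OF s' lim[OF s'] t' lim[OF t']] by blast
  have "(s - t)^2*J = ((t - s)*?W)^2" unfolding JW by (simp add: power_mult_distrib power2_commute)
  hence "TC (mut s) (mut t) <= en (((t - s)*?W)^2)" using order_trans[OF TC_le[OF R(1)] R(2)] by simp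
  thus "W2 (metr Y) (mut s) (mut t) <= (t - s)*?W" using st by (intro W2_le) auto
 qed
 have ent: "ren N' (mut t) <= T_fun (metr Y) (meas Y) K N' t mu0 mu1 Q"
  if t: "t : {0..1}" and N': "N' : {N..<0}" and fin: "ren N' mu0 < \<infinity>" "ren N' mu1 < \<infinity>" for t N'
 proof -
  have n: "N' < 0" using N' by simp
  consider "t = 0" | "t = 1" | "0 < t" "t < 1" using t by force
  thus ?thesis
  proof cases
   case 1
   thus ?thesis using entropy_ends(1)[OF Q(1) n dn] by (simp add: e)
  next
   case 2
   thus ?thesis using entropy_ends(2)[OF Q(1) n dn] by (simp add: e)
  next
   case 3
   show ?thesis by (rule entropy_limit[OF 3 lim[OF t] ac[OF t] Q N' _ _ dn]) (use fin in simp_all)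
  qed
 qed
 show ?thesis using opt geo ent by blast
qed

end

section \<open>Choice of the sequence for marginals of finite entropy\<close>

locale cd_limit = pgm Y for Y :: "'b pgmms" +
 fixes X :: "nat => 'a pgmms" and K N D :: real and \<omega>
 assumes pgX: "!!n. pgmm_space (X n)" and N: "N < 0" and CD: "!!n. CD_space K N (metr (X n)) (meas (X n))"
  and uc: "!!n. uniformly_convex_space N \<omega> (X n)"
  and dX: "!!n x y. x : mspace (metr (X n)) ==> y : mspace (metr (X n)) ==> mdist (metr (X n)) x y : cdom K D"
  and dY: "!!x y. x : S ==> y : S ==> d x y : cdom K D" and KD: "K < 0 ==> - K*D^2 < pi^2"
  and tr: "!!L de. 1 <= L ==> 0 < de ==> EX n C h c. transfer (X n) Y L de C h c"
begin

text \<open>Regular points with density at most \<open>j\<close>: there a leak of reference mass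
  \<open>de\<close> costs at most \<open>j * de\<close>.\<close>

definition good :: "'b measure => nat => 'b set" where
 "good mu j = {y : reg Y j. dns mu y <= en (real j)}"

lemma good_in [measurable, simp]: "good mu j : sets B"
 unfolding good_def by measurable

lemma good_mono: "i <= j ==> good mu i <= good mu j"
 using regular_mono[of i j] unfolding good_def by (auto intro: order_trans ennreal_leI)

text \<open>A point in none of the sets is singular or has infinite density, and both sets of such
  points are null.\<close>

lemma good_exhaust:
 assumes "mu : P2ac"
 shows "(%j. em mu (S - good mu j)) ----> 0"
proof -
 let ?rh = "dns mu"
 have P: "mu : P2 (metr Y)" and ac: "absolutely_continuous M mu" using assms by (auto simp: P2_ac_def)
 have e: "density M ?rh = mu" by (rule density_dens[OF assms])
 have sm: "S - good mu j : sets mu" for j using P2D(1)[OF P] by simp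
 have "(INT j. S - good mu j) <= sing Y Un {y : S. ?rh y = top}"
 proof
  fix y assume y: "y : (INT j. S - good mu j)"
  show "y : sing Y Un {y : S. ?rh y = top}"
  proof (rule ccontr)
   assume n: "y ~: sing Y Un {y : S. ?rh y = top}"
   have yS: "y : S" using y by blast
   hence "y : (UN k. reg Y k)" using n UN_regular by blast
   then obtain k where k: "y : reg Y k" by blast
   obtain r where r: "?rh y = en r" "0 <= r" using n yS by (cases "?rh y") auto
   obtain i :: nat where i: "r <= real i" using real_arch_simple by blast
   have "y : good mu (max i k)"
    unfolding good_def using k r i regular_mono[of k "max i k"] by (auto intro!: ennreal_leI)
   thus False using y by blast
  qed
 qed
 moreover have "em mu (sing Y Un {y : S. ?rh y = top}) = 0"
 proof -
  have "sing Y : null_sets M" using M_sing by (simp add: null_sets_def)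
  hence s: "sing Y : null_sets mu" using ac unfolding absolutely_continuous_def by blast
  have "{y : S. ?rh y = top} : sets B"
  proof -
   have "{y : space B. ?rh y = top} : sets B" by measurable
   thus ?thesis by simp
  qed
  moreover have "AE y in M. ?rh y ~= top"
   unfolding infinity_ennreal_def[symmetric]
  proof (rule nn_integral_PInf_AE)
   show "(II y. ?rh y ||M) ~= \<infinity>" using emeasure_density_space[of ?rh M] P2D(4)[OF P] unfolding e by simp
  qed simp
  ultimately have "{y : S. ?rh y = top} : null_sets M"
   using AE_iff_null[of M "%y. ?rh y ~= top"] by simp
  hence "{y : S. ?rh y = top} : null_sets mu" using ac unfolding absolutely_continuous_def by blast
  hence "sing Y Un {y : S. ?rh y = top} : null_sets mu" using s by (rule null_sets.Un[rotated])
  thus ?thesis by (simp add: null_sets_def)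
 qed
 moreover have "sing Y Un {y : S. ?rh y = top} : sets mu"
 proof -
  have "{y : space B. ?rh y = top} : sets B" by measurable
  thus ?thesis using P2D(1)[OF P] by simp
 qed
 ultimately have z: "em mu (INT j. S - good mu j) = 0"
  by (metis emeasure_mono le_zero_eq)
 have "em mu (S - good mu j) ~= \<infinity>" for j
  using emeasure_space[of mu "S - good mu j"] P2D(2,4)[OF P] by (auto simp: top_unique)
 hence "(%j. em mu (S - good mu j)) ----> em mu (INT j. S - good mu j)"
  using sm by (intro Lim_emeasure_decseq) (auto simp: decseq_def dest: subsetD[OF good_mono])
 thus ?thesis unfolding z .
qed

lemma cd_finite:
 assumes ac: "mu0 : P2ac" "mu1 : P2ac"
  and fin: "ren N mu0 < \<infinity>" "ren N mu1 < \<infinity>"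
 shows "EX Q mut. W2_optimal (metr Y) mu0 mu1 Q & W2_geodesic (metr Y) mu0 mu1 mut &
  (ALL t:{0..1}. ALL N':{N..<0}. ren N' mu0 < \<infinity> & ren N' mu1 < \<infinity> -->
    ren N' (mut t) <= T_fun (metr Y) (meas Y) K N' t mu0 mu1 Q)"
proof -
 define rh0 where "rh0 = dns mu0"
 define rh1 where "rh1 = dns mu1"
 have e0: "mu0 = density M rh0" and e1: "mu1 = density M rh1" unfolding rh0_def rh1_def using density_dens ac by simp_all
 have rhm: "rh0 : bm B" "rh1 : bm B" by (simp_all add: rh0_def rh1_def)
 have P2: "mu0 : P2 (metr Y)" "mu1 : P2 (metr Y)" using ac by (simp_all add: P2_ac_def)
 obtain ga where ga: "W2_optimal (metr Y) mu0 mu1 ga" using optimal_plan_exists[OF ac] by blast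
 hence gc: "ga : cpl mu0 mu1" by (simp add: W2_optimal_def)
 note gD = couplingsD[OF gc]
 obtain J where J: "TC mu0 mu1 = en J" "0 <= J" using TC_finite[OF P2] by (cases "TC mu0 mu1") auto
 have costJ: "(cost ga) = en J"
  using ga J(1) by (simp add: W2_optimal_def plan_cost_sq)
 obtain M0 where M0: "0 < M0" "ren N mu0 <= en M0" "ren N mu1 <= en M0"
 proof -
  obtain a where a: "ren N mu0 = en a" "0 <= a" using fin(1) by (cases "ren N mu0") auto
  obtain b where b: "ren N mu1 = en b" "0 <= b" using fin(2) by (cases "ren N mu1") auto
  show ?thesis by (rule that[of "a + b + 1"]) (use a b in \<open>auto intro: ennreal_leI\<close>)
 qed
 \<comment> \<open>Accuracy of the \<open>j\<close>-th transfer, chosen so that the leakage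
   \<open>2*j*dl j\<close> at density level \<open>j\<close> still tends to 0.\<close>
 define dl where "dl j = 1/(2*(real (Suc j))^2)" for j
 have dl: "0 < dl j" "dl j <= 1/2" for j
 proof -
  have "1 <= (real (Suc j))^2" by (rule one_le_power) simp
  thus "0 < dl j" "dl j <= 1/2" unfolding dl_def by (auto simp: field_simps)
 qed
 have jdl: "2*real j*dl j <= 1/real (Suc j)" for j
 proof -
  have "2*real j*dl j = real j/real (Suc j)*(1/real (Suc j))" by (simp add: dl_def power2_eq_square)
  also have "... <= 1*(1/real (Suc j))" by (intro mult_right_mono) auto
  finally show ?thesis by simp
 qed
 have i0: "(%j. 1/real (Suc j)) ----> 0" using LIMSEQ_inverse_real_of_nat by (simp add: inverse_eq_divide)
 have jdl0: "(%j. 2*real j*dl j) ----> 0"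
 proof (rule tendsto_sandwich[OF _ _ tendsto_const i0])
  show "eventually (%j. 0 <= 2*real j*dl j) sequentially"
   by (intro always_eventually allI mult_nonneg_nonneg less_imp_le[OF dl(1)]) simp_all
 qed (intro always_eventually allI jdl)
 have dl0: "dl ----> 0"
 proof (rule tendsto_sandwich[OF _ _ tendsto_const i0])
  show "eventually (%j. dl j <= 1/real (Suc j)) sequentially"
  proof (intro always_eventually allI)
   fix j have "real (Suc j)*1 <= 2*(real (Suc j))^2" unfolding power2_eq_square mult.assoc[symmetric] by (intro mult_mono) auto
   thus "dl j <= 1/real (Suc j)" unfolding dl_def by (intro divide_left_mono) auto
  qed
 qed (use dl in \<open>auto intro!: always_eventually less_imp_le\<close>)
 define er where "er j = en (2*real j*dl j) + em mu0 (S - good mu0 j) + em mu1 (S - good mu1 j)" for j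
 have er0: "er ----> 0"
  unfolding er_def using tendsto_add[OF tendsto_add[OF tendsto_ennrealI[OF jdl0] good_exhaust[OF ac(1)]] good_exhaust[OF ac(2)]] by simp
 hence "eventually (%j. er j < en (1/2)) sequentially"
 proof (rule order_tendstoD(2))
  have "en 0 < en (1/2)" by (subst ennreal_less_iff) auto
  thus "0 < en (1/2)" by (simp only: ennreal_0)
 qed
 \<comment> \<open>From \<open>j0\<close> on the surviving mass is at least \<open>1/2\<close>, as
   \<open>forward\<close> and \<open>cd_step\<close> require.\<close>
 then obtain j0 where j0: "!!j. j0 <= j ==> er j < en (1/2)" by (auto simp: eventually_sequentially)
 have step: "ALL j. EX n C h c w s0 s1 k0 k1 pl et. cd_step (X n) Y (Suc (j + j0)) (dl (j + j0)) C h c K N D M0 J \<omega> rh0 rh1 w s0 s1 k0 k1 pl et &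
   1 - enn2real (er (j + j0)) <= w & w <= 1"
 proof
  fix j
  define i where "i = j + j0"
  define e where "e = enn2real (er i)"
  have eri: "er i < en (1/2)" using j0 by (simp add: i_def)
  hence er: "er i = en e" unfolding e_def by (simp add: less_top[symmetric] order.strict_implies_not_eq[OF less_trans[OF eri]])
  have e0': "0 <= e" by (simp add: e_def)
  have "e < 1/2" using eri unfolding er by (subst (asm) ennreal_less_iff[OF e0'])
  with e0' have e: "0 <= e" "e <= 1/2" by auto
  have "1 <= Suc i" by simp
  then obtain n C h c where T: "transfer (X n) Y (Suc i) (dl i) C h c" using tr dl(1) by blast
  interpret Xn: pgm "X n" by (rule pgm.intro[OF pgX])
  interpret T: transfer_pair "X n" Y "Suc i" "dl i" C h c
   using T dl by unfold_locales auto
  \<comment> \<open>The transfer is taken at level \<open>i + 1\<close>, so that its truncation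
    level \<open>L - 1\<close> is the one of \<open>good _ i\<close>.\<close>
  have s1: "Suc i - 1 = i" by simp
  obtain w s0 s1 k0 k1 where w: "1 - e <= w" "w <= 1" and ep: "T.endpoint rh0 w s0 k0" "T.endpoint rh1 w s1 k1"
   and tc: "Xn.TC (density Xn.M s0) (density Xn.M s1) <= en (1/w)*(II z. en ((d (fst z) (snd z) + dl i)^2) ||ga)"
  proof (rule T.forward[OF ac gc rhm(1) e0 rhm(2) e1, of "real i" "good mu0 i" "good mu1 i" e])
   show "good mu0 i = {y : reg Y (Suc i - 1). rh0 y <= en (real i)}" "good mu1 i = {y : reg Y (Suc i - 1). rh1 y <= en (real i)}"
    unfolding s1 good_def rh0_def rh1_def by (rule refl)+
   show "en (2*real i*dl i) + em mu0 (S - good mu0 i) + em mu1 (S - good mu1 i) <= en e"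
    unfolding er[symmetric] er_def by simp
  qed (use e in simp_all)
  have w2: "1/2 <= w" "0 < w" using w e by auto
  have acX: "density Xn.M s0 : P2_ac (metr (X n)) (meas (X n))" "density Xn.M s1 : P2_ac (metr (X n)) (meas (X n))"
   using ep by (simp_all add: T.endpoint_def)
  obtain pl et where po: "W2_optimal (metr (X n)) (density Xn.M s0) (density Xn.M s1) pl" and ge: "W2_geodesic (metr (X n)) (density Xn.M s0) (density Xn.M s1) et"
   and iq: "ALL t:{0..1}. ALL N':{N..<0}. renyi (metr (X n)) (meas (X n)) N' (density Xn.M s0) < \<infinity> & renyi (metr (X n)) (meas (X n)) N' (density Xn.M s1) < \<infinity> -->
    renyi (metr (X n)) (meas (X n)) N' (et t) <= T_fun (metr (X n)) (meas (X n)) K N' t (density Xn.M s0) (density Xn.M s1) pl"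
   using CD[of n, unfolded CD_space_def, rule_format, OF acX] by blast
  have ct: "(II z. en ((d (fst z) (snd z) + dl i)^2) ||ga) <= en ((1 + dl i)*J + 2*dl i)"
  proof -
   have "em ga (space ga) = 1" using gD(7)[OF S_in_B] gD(2) P2D(4)[OF P2(1)] by simp
   from shift_cost[OF dl gD(1) this, of i] show ?thesis
    using dl[of i] J(2) unfolding costJ by (simp add: ennreal_mult[symmetric] ennreal_plus[symmetric] del: ennreal_plus)
  qed
  have "cd_step (X n) Y (Suc i) (dl i) C h c K N D M0 J \<omega> rh0 rh1 w s0 s1 k0 k1 pl et"
  proof (rule cd_step.intro[OF T.transfer_pair_axioms], rule cd_step_axioms.intro)
   show "(II y. epowr (rh0 y) ((N - 1)/N) ||M) <= en M0" "(II y. epowr (rh1 y) ((N - 1)/N) ||M) <= en M0"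
    using M0(2,3) unfolding rh0_def rh1_def renyi_eq[OF ac(1)] renyi_eq[OF ac(2)] .
   have "en (1/w)*(II z. en ((d (fst z) (snd z) + dl i)^2) ||ga) <= en (1/w)*en ((1 + dl i)*J + 2*dl i)"
    by (intro mult_left_mono ct) simp
   also have "... = en (1/w*((1 + dl i)*J + 2*dl i))"
    using w2 by (intro ennreal_mult'[symmetric]) simp
   finally show "Xn.TC (density Xn.M s0) (density Xn.M s1) <= en (1/w*((1 + dl i)*J + 2*dl i))" using tc by (rule order_trans[rotated])
  qed (use N CD uc dX KD rhm ep w w2 M0 po ge iq J in \<open>simp_all\<close>)
  thus "EX n C h c w s0 s1 k0 k1 pl et. cd_step (X n) Y (Suc (j + j0)) (dl (j + j0)) C h c K N D M0 J \<omega> rh0 rh1 w s0 s1 k0 k1 pl et &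
   1 - enn2real (er (j + j0)) <= w & w <= 1"
   unfolding i_def[symmetric] e_def[symmetric] using w by blast
 qed
 obtain n C h c w s0 s1 k0 k1 pl et where all: "ALL j. cd_step (X (n j)) Y (Suc (j + j0)) (dl (j + j0)) (C j) (h j) (c j) K N D M0 J \<omega> rh0 rh1 (w j) (s0 j) (s1 j) (k0 j) (k1 j) (pl j) (et j) &
   1 - enn2real (er (j + j0)) <= w j & w j <= 1"
  using step unfolding choice_iff by (elim exE) (rule that)
 have st: "cd_step (X (n j)) Y (Suc (j + j0)) (dl (j + j0)) (C j) (h j) (c j) K N D M0 J \<omega> rh0 rh1 (w j) (s0 j) (s1 j) (k0 j) (k1 j) (pl j) (et j)"
  and w: "1 - enn2real (er (j + j0)) <= w j" "w j <= 1" for j using all by blast+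
 obtain F where F: "ultrafilter F" using ex_ultrafilter_nat by blast
 have "(%j. enn2real (er j)) ----> 0" by (rule tendsto_enn2real) (use er0 in simp_all)
 hence "(%j. 1 - enn2real (er (j + j0))) ----> 1 - 0" by (intro tendsto_diff tendsto_const LIMSEQ_ignore_initial_segment) simp
 hence w1: "w ----> 1"
  by (intro tendsto_sandwich[of "%j. 1 - enn2real (er (j + j0))" w sequentially "%_. 1"]) (use w in simp_all)
 have "cd_sequence Y F (%j. X (n j)) (%j. Suc (j + j0)) (%j. dl (j + j0)) C h c K N D M0 J \<omega> rh0 rh1 w s0 s1 k0 k1 pl et"
 proof (rule cd_sequence.intro[OF pgm_axioms F], rule cd_sequence_axioms.intro)
  show "(%j. dl (j + j0)) ----> 0" using dl0 by (rule LIMSEQ_ignore_initial_segment)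
  show "density M rh0 : P2ac" "density M rh1 : P2ac" using ac unfolding e0[symmetric] e1[symmetric] .
  show "TC (density M rh0) (density M rh1) = en J" using J(1) unfolding e0[symmetric] e1[symmetric] .
 qed (use st w1 dY in simp_all)
 then interpret CS: cd_sequence Y F "%j. X (n j)" "%j. Suc (j + j0)" "%j. dl (j + j0)" C h c K N D M0 J \<omega> rh0 rh1 w s0 s1 k0 k1 pl et .
 show ?thesis using CS.cd_pair unfolding e0[symmetric] e1[symmetric] by (simp add: rh0_def rh1_def)
qed

end

subsection \<open>Marginals of infinite entropy\<close>

text \<open>The \<open>i\<close>-th coupling is chosen with error \<open>e/2^(i + 1)\<close>, so the
  errors sum to \<open>e\<close>.\<close>

lemma (in polish) TC_msum:
 assumes fin: "(\<Sum>i. TC (al i) (be i)) < top"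
 shows "TC (msum al) (msum be) <= (\<Sum>i. TC (al i) (be i))"
proof (rule ennreal_le_epsilon)
 fix e :: real assume e: "0 < e"
 have le: "TC (al i) (be i) <= (\<Sum>i. TC (al i) (be i))" for i
  using sum_le_suminf[of "%i. TC (al i) (be i)" "{i}"] by simp
 have "EX g. g : cpl (al i) (be i) & (cost g) <= TC (al i) (be i) + en (e*(1/2)^Suc i)" for i
 proof -
  have "TC (al i) (be i) < top" using le fin by (rule le_less_trans)
  hence "TC (al i) (be i) < TC (al i) (be i) + en (e*(1/2)^Suc i)"
   using e by (cases "TC (al i) (be i)") (simp_all add: ennreal_plus[symmetric] ennreal_less_iff del: ennreal_plus)
  then obtain g where "g : cpl (al i) (be i)" "(cost g) < TC (al i) (be i) + en (e*(1/2)^Suc i)"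
   by (rule TC_approx)
  thus ?thesis by (intro exI[of _ g]) auto
 qed
 hence "EX g. ALL i. g i : cpl (al i) (be i) & (II z. sq z ||g i) <= TC (al i) (be i) + en (e*(1/2)^Suc i)"
  by (intro choice) blast
 then obtain g where g: "!!i. g i : cpl (al i) (be i)"
  "!!i. (II z. sq z ||g i) <= TC (al i) (be i) + en (e*(1/2)^Suc i)" by blast
 have sg: "sets (g i) = sets BB" for i by (rule couplingsD(1)[OF g(1)])
 have "TC (msum al) (msum be) <= (II z. sq z ||msum g)" by (rule TC_le[OF couplings_msum[OF g(1)]])
 also have "... = (\<Sum>i. II z. sq z ||g i)"
  using sg by (intro nn_integral_msum) (simp_all cong: measurable_cong_sets)
 also have "... <= (\<Sum>i. TC (al i) (be i) + en (e*(1/2)^Suc i))" by (intro suminf_le g(2)) auto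
 also have "... = (\<Sum>i. TC (al i) (be i)) + (\<Sum>i. en (e*(1/2)^Suc i))" by (rule suminf_add[symmetric]) auto
 also have "(\<Sum>i. en (e*(1/2)^Suc i)) = en (\<Sum>i. e*(1/2)^Suc i)"
  using e by (intro suminf_ennreal2 summable_mult sums_summable[OF power_half_series]) simp
 also have "(\<Sum>i. e*(1/2)^Suc i) = e" using sums_unique[OF sums_mult[OF power_half_series, of e]] by simp
 finally show "TC (msum al) (msum be) <= (\<Sum>i. TC (al i) (be i)) + en e" .
qed

context cd_limit
begin

text \<open>After normalisation the piece has density at most \<open>j/a\<close> and lives on
  \<open>reg Y j\<close>, which has finite measure; so its entropy is finite.\<close>

lemma bounded_piece:
 assumes ac: "mu : P2ac" and s: "sets ph = sets B" and a: "em ph S = en a" "0 < a"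
  and le: "!!A. A : sets B ==> em ph A <= em mu (A Int good mu j)"
 shows "scale_measure (en (1/a)) ph : P2ac" "ren N (scale_measure (en (1/a)) ph) < \<infinity>"
proof -
 let ?p = "(N - 1)/N" and ?al = "scale_measure (en (1/a)) ph" and ?rh = "dns mu"
 have P: "mu : P2 (metr Y)" using ac by (simp add: P2_ac_def)
 have dm: "density M ?rh = mu" by (rule density_dens[OF ac])
 have le2: "em ?al A <= en (1/a)*em mu A" if A: "A : sets B" for A
 proof -
  have "em mu (A Int good mu j) <= em mu A" using A P2D(1)[OF P] by (intro emeasure_mono) auto
  hence "em ph A <= em mu A" using le[OF A] by (rule order_trans[rotated])
  thus ?thesis by (simp add: mult_left_mono)
 qed
 have one: "em ?al S = 1" using a by (simp add: ennreal_mult[symmetric])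
 have P2: "?al : P2 (metr Y)" by (rule P2_le_scale[OF P _ one le2]) (simp_all add: s)
 show ac': "?al : P2ac" by (rule P2_ac_le[OF ac P2 le2])
 define g where "g y = en (j/a)*ind (reg Y j) y" for y
 have [measurable]: "g : bm B" unfolding g_def by measurable
 have leg: "em ?al A <= em (density M g) A" if A [measurable]: "A : sets B" for A
 proof -
  have "em mu (A Int good mu j) = em (density M ?rh) (A Int good mu j)" unfolding dm ..
  also have "... = (II y. ?rh y*ind (A Int good mu j) y ||M)" by (rule emeasure_density) simp_all
  also have "... <= (II y. en j*ind (reg Y j) y*ind A y ||M)"
   by (intro nn_integral_mono) (auto simp: good_def split: split_indicator)
  finally have "em ph A <= (II y. en j*ind (reg Y j) y*ind A y ||M)" using le[OF A] by (rule order_trans[rotated])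
  hence "em ?al A <= en (1/a)*(II y. en j*ind (reg Y j) y*ind A y ||M)" by (simp add: mult_left_mono)
  also have "... = (II y. en (1/a)*(en j*ind (reg Y j) y*ind A y) ||M)" by (rule nn_integral_cmult[symmetric]) measurable
  also have "... = (II y. g y*ind A y ||M)"
   unfolding g_def using a(2) by (intro nn_integral_cong) (simp add: ennreal_mult[symmetric] flip: mult.assoc)
  also have "... = em (density M g) A" by (rule emeasure_density[symmetric]) simp_all
  finally show ?thesis .
 qed
 have gp: "(II y. epowr (g y) q ||M) < top" if q: "0 < q" for q
 proof -
  have "(II y. epowr (g y) q ||M) = (II y. epowr (en (j/a)) q*ind (reg Y j) y ||M)"
   unfolding g_def epowr_indicator ..
  also have "... = epowr (en (j/a)) q*em M (reg Y j)" by (rule nn_integral_cmult_indicator) simp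
  also have "... < top" using M_regular[of j] by (simp add: ennreal_mult_less_top)
  finally show ?thesis .
 qed
 have fin: "finite_measure (density M g)"
 proof
  show "em (density M g) (space (density M g)) ~= \<infinity>" using emeasure_density_space[of g M] gp[of 1] by simp
 qed
 have sa: "sets ?al = sets (density M g)" by (simp add: s)
 obtain f where f: "f : bm (density M g)" "ALL x. f x <= 1" "?al = density (density M g) f"
  using bounded_Radon_Nikodym[OF fin sa] leg by auto
 have [measurable]: "f : bm B" using f(1) by simp
 have e: "?al = density M (%y. g y*f y)" unfolding f(3) by (rule density_density_eq) measurable
 have "ren N ?al = (II y. epowr (g y*f y) ?p ||M)" unfolding e by (rule renyi_density) measurable
 also have "... <= (II y. epowr (g y) ?p ||M)"
 proof (intro nn_integral_mono epowr_mono)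
  fix y show "g y*f y <= g y" using mult_left_mono[of "f y" 1 "g y"] f(2) by simp
 qed (use exponent(1)[OF N] in simp)
 also have "... < top" using exponent(1)[OF N] by (intro gp) simp
 finally show "ren N ?al < \<infinity>" by simp
qed

text \<open>An optimal plan is cut along the increasing rectangles
  \<open>good mu0 j \<times> good mu1 j\<close> into pieces whose marginals are covered by
  \<open>cd_finite\<close>. The costs of the pieces sum to the optimal cost, so the sum of their
  geodesics moves from time \<open>s\<close> to \<open>t\<close> at cost at most
  \<open>(s - t)^2\<close> times the optimal one, and such upper bounds suffice for a
  geodesic.\<close>

lemma geodesic_exists:
 assumes ac: "mu0 : P2ac" "mu1 : P2ac" and opt: "W2_optimal (metr Y) mu0 mu1 pl"
 shows "EX mut. W2_geodesic (metr Y) mu0 mu1 mut"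
proof -
 have P2: "mu0 : P2 (metr Y)" "mu1 : P2 (metr Y)" using ac by (simp_all add: P2_ac_def)
 have pl: "pl : cpl mu0 mu1" and plc: "(cost pl) = TC mu0 mu1"
  using opt by (auto simp: W2_optimal_def plan_cost_sq)
 have e: "distr pl B fst = mu0" "distr pl B snd = mu1" using pl by (auto simp: couplings_def Let_def)
 note pD = couplingsD[OF pl]
 note [measurable_cong] = pD(1)
 define A where "A = disjointed (%j. good mu0 j \<times> good mu1 j)"
 have Aj: "A j <= good mu0 j \<times> good mu1 j" for j unfolding A_def by (rule disjointed_subset)
 have Am [measurable]: "A j : sets BB" for j
 proof -
  have "range (%j. good mu0 j \<times> good mu1 j) <= sets BB" by (intro image_subsetI pair_measureI) simp_all
  from sets.range_disjointed_sets[OF this] show ?thesis unfolding A_def by blast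
 qed
 have dis: "disjoint_family A" unfolding A_def by (rule disjoint_family_disjointed)
 have UN: "(UN j. A j) = (UN j. good mu0 j \<times> good mu1 j)" unfolding A_def by (rule UN_disjointed_eq)
 have full: "AE z in pl. z : (UN j. A j)"
 proof -
  have n0: "em mu0 (INT j. S - good mu0 j) = 0" if "mu0 : P2ac" for mu0
  proof -
   have "em mu0 (INT j. S - good mu0 j) <= em mu0 (S - good mu0 j)" for j
    using that P2D(1)[of mu0] by (intro emeasure_mono) (auto simp: P2_ac_def)
   hence "em mu0 (INT j. S - good mu0 j) <= 0" by (intro LIMSEQ_le_const[OF good_exhaust[OF that]] exI allI impI)
   thus ?thesis by simp
  qed
  have a0: "AE x in mu0. x : (UN j. good mu0 j)" if "mu0 : P2ac" for mu0
  proof (rule AE_I[OF _ n0[OF that]])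
   have P: "mu0 : P2 (metr Y)" using that by (simp add: P2_ac_def)
   show "{x : space mu0. x ~: (UN j. good mu0 j)} <= (INT j. S - good mu0 j)" using P2D(2)[OF P] by auto
   show "(INT j. S - good mu0 j) : sets mu0" using P2D(1)[OF P] by auto
  qed
  have *: "AE z in pl. p z : E" if eq: "mu = distr pl B p" and ae: "AE x in mu. x : E" and "p : BB \<rightarrow>\<^sub>M B" "E : sets B" for mu p E
   using ae that(3,4) unfolding eq by (subst (asm) AE_distr_iff) auto
  have U: "(UN j. good mu j) : sets B" for mu by auto
  have "AE z in pl. fst z : (UN j. good mu0 j)" "AE z in pl. snd z : (UN j. good mu1 j)"
   by (rule *[OF e(1)[symmetric] a0[OF ac(1)] measurable_fst U]) (rule *[OF e(2)[symmetric] a0[OF ac(2)] measurable_snd U])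
  thus ?thesis
  proof eventually_elim
   case (elim z)
   then obtain i j where "fst z : good mu0 i" "snd z : good mu1 j" by blast
   hence "z : good mu0 (max i j) \<times> good mu1 (max i j)"
    using good_mono[of i "max i j" mu0] good_mono[of j "max i j" mu1] by (auto simp: mem_Times_iff)
   thus ?case unfolding UN by blast
  qed
 qed
 define ga where "ga j = density pl (ind (A j))" for j
 have sga [measurable_cong]: "sets (ga j) = sets BB" for j by (simp add: ga_def pD(1))
 have iga: "(II z. f z ||ga j) = (II z. ind (A j) z*f z ||pl)" if [measurable]: "f : bm BB" for f j
  unfolding ga_def by (rule nn_integral_density) measurable
 have sumga: "(\<Sum>j. II z. f z ||ga j) = (II z. f z ||pl)" if [measurable]: "f : bm BB" for f
 proof -
  have "(\<Sum>j. II z. f z ||ga j) = (II z. (\<Sum>j. ind (A j) z*f z) ||pl)"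
   unfolding iga[OF that] by (rule nn_integral_suminf[symmetric]) measurable
  also have "... = (II z. f z ||pl)"
  proof (rule nn_integral_cong_AE)
   show "AE z in pl. (\<Sum>j. ind (A j) z*f z) = f z"
    using full by eventually_elim (simp add: suminf_indicator[OF dis])
  qed
  finally show ?thesis .
 qed
 define al where "al j = distr (ga j) B fst" for j
 define be where "be j = distr (ga j) B snd" for j
 have cga: "ga j : cpl (al j) (be j)" for j unfolding al_def be_def by (rule couplings_distr[OF sga])
 note gD = couplingsD[OF cga]
 have le: "em (distr (ga j) B p) E <= em mu (E Int good mu j)"
  and eq: "(\<Sum>j. em (distr (ga j) B p) E) = em mu E"
  if "distr pl B p = mu" and [measurable]: "p : BB \<rightarrow>\<^sub>M B" "E : sets B" and A: "!!j. A j <= {z. p z : good mu j}" for p mu E j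
 proof -
  have I: "em mu E = (II z. ind E (p z) ||pl)" if [measurable]: "E : sets B" for E
   unfolding \<open>distr pl B p = mu\<close>[symmetric] by (simp flip: nn_integral_indicator add: nn_integral_distr)
  have J: "em (distr (ga j) B p) E = (II z. ind E (p z) ||ga j)" for j
   by (simp flip: nn_integral_indicator add: nn_integral_distr)
  have "em (distr (ga j) B p) E = (II z. ind (A j) z*ind E (p z) ||pl)" unfolding J by (rule iga) measurable
  also have "... <= (II z. ind (E Int good mu j) (p z) ||pl)"
   using A[of j] by (intro nn_integral_mono) (auto split: split_indicator)
  finally show "em (distr (ga j) B p) E <= em mu (E Int good mu j)" by (simp add: I)
  show "(\<Sum>j. em (distr (ga j) B p) E) = em mu E" unfolding J I[OF that(3)] by (rule sumga) measurable
 qed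
 have sub: "A j <= {z. fst z : good mu0 j}" "A j <= {z. snd z : good mu1 j}" for j using Aj[of j] by auto
 note leal = le[OF e(1) measurable_fst _ sub(1), folded al_def] and lebe = le[OF e(2) measurable_snd _ sub(2), folded be_def]
 define ct where "ct j = (II z. sq z ||ga j)" for j
 have sumc: "(\<Sum>j. ct j) = TC mu0 mu1" unfolding ct_def using sumga[OF measurable_cost] plc by simp
 \<comment> \<open>Stated without normalisation and with the cost \<open>ct j\<close> of the piece,
   so that pieces of mass zero are included.\<close>
 define piece where "piece j et \<longleftrightarrow> (ALL t:{0..1}. sets (et t) = sets B) & et 0 = al j & et 1 = be j &
   (ALL s:{0..1}. ALL t:{0..1}. TC (et s) (et t) <= en ((s - t)^2) * ct j)" for j and et :: "real => 'b measure"
 have "EX et. piece j et" for j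
 proof (cases "em (al j) S = 0")
  case True
  have b0: "em (be j) S = 0" using gD(7,8)[OF S_in_B, of j] True by simp
  have eq: "al j = be j"
  proof (rule measure_eqI)
   fix E assume "E : sets (al j)"
   hence "E <= S" using sets.sets_into_space gD(5) by metis
   hence "em (al j) E <= em (al j) S" "em (be j) E <= em (be j) S"
    using gD(3,4)[of j] by (auto intro!: emeasure_mono)
   thus "em (al j) E = em (be j) E" using True b0 by simp
  qed (simp add: gD(3,4))
  have "space (ga j) : null_sets (ga j)" using gD(7)[OF S_in_B, of j] True gD(2)[of j] by (simp add: null_sets_def)
  hence "AE z in ga j. False" by (intro AE_I'[of "space (ga j)"]) auto
  hence "ct j = (II z. 0 ||ga j)" unfolding ct_def by (intro nn_integral_cong_AE) auto
  hence "TC (al j) (al j) <= 0" using TC_le[OF cga[of j], folded ct_def] unfolding eq[symmetric] by simp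
  thus ?thesis using gD(3)[of j] eq unfolding piece_def by (intro exI[of _ "%_. al j"]) simp
 next
  case False
  have "em (al j) S <= em mu0 (S Int good mu0 j)" by (rule leal) simp
  also have "... <= em mu0 (space mu0)" by (rule emeasure_space)
  finally have "em (al j) S < top" using P2D(2,4)[OF P2(1)] by (simp add: le_less_trans)
  then obtain a where a: "em (al j) S = en a" "0 < a" using False by (cases "em (al j) S") (auto simp: less_le)
  have b: "em (be j) S = en a" using gD(7,8)[OF S_in_B, of j] a by simp
  let ?al = "scale_measure (en (1/a)) (al j)" and ?be = "scale_measure (en (1/a)) (be j)"
  note p0 = bounded_piece[OF ac(1) gD(3)[of j] a leal] and p1 = bounded_piece[OF ac(2) gD(4)[of j] b a(2) lebe]
  obtain et where et: "W2_geodesic (metr Y) ?al ?be et" using cd_finite[OF p0(1) p1(1) p0(2) p1(2)] by blast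
  have P: "et t : P2 (metr Y)" if "t : {0..1}" for t using et that unfolding W2_geodesic_def by blast
  have undo: "scale_measure (en a) (scale_measure (en (1/a)) m) = m" for m :: "'b measure"
   using a(2) by (simp add: ennreal_mult[symmetric])
  have "TC (scale_measure (en a) (et s)) (scale_measure (en a) (et t)) <= en ((s - t)^2) * ct j" if st: "s : {0..1}" "t : {0..1}" for s t
  proof -
   let ?W = "W2 (metr Y) ?al ?be"
   have W: "W2 (metr Y) (et s) (et t) = \<bar>s - t\<bar>*?W" using et st unfolding W2_geodesic_def by blast
   have Pab: "?al : P2 (metr Y)" "?be : P2 (metr Y)" using p0(1) p1(1) by (simp_all add: P2_ac_def)
   have a0: "0 < en a" "en a < top" using a(2) by simp_all
   have "TC (scale_measure (en a) (et s)) (scale_measure (en a) (et t)) = en a*en ((\<bar>s - t\<bar>*?W)^2)"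
    unfolding TC_scale[OF a0] W[symmetric] TC_W2[OF TC_finite[OF P[OF st(1)] P[OF st(2)]]] ..
   also have "... = en ((s - t)^2)*(en a*en (?W^2))" by (simp add: power_mult_distrib ennreal_mult mult_ac)
   also have "en a*en (?W^2) = TC (al j) (be j)"
    unfolding TC_W2[OF TC_finite[OF Pab], symmetric] TC_scale[OF a0, symmetric] undo ..
   also have "en ((s - t)^2)*TC (al j) (be j) <= en ((s - t)^2) * ct j"
    unfolding ct_def by (intro mult_left_mono TC_le[OF cga]) simp
   finally show ?thesis .
  qed
  moreover have "et 0 = ?al" "et 1 = ?be" using et by (simp_all add: W2_geodesic_def)
  hence "scale_measure (en a) (et 0) = al j" "scale_measure (en a) (et 1) = be j" by (simp_all only: undo)
  ultimately show ?thesis using P2D(1)[OF P] unfolding piece_def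
   by (intro exI[of _ "%t. scale_measure (en a) (et t)"] conjI ballI) (simp_all only: sets_scale_measure)
 qed
 hence "EX et. ALL j. piece j (et j)" by (intro choice allI)
 then obtain et where "ALL j. piece j (et j)" by blast
 hence et: "!!j t. t : {0..1} ==> sets (et j t) = sets B" "!!j. et j 0 = al j" "!!j. et j 1 = be j"
  "!!j s t. s : {0..1} ==> t : {0..1} ==> TC (et j s) (et j t) <= en ((s - t)^2) * ct j"
  unfolding piece_def by blast+
 define mut where "mut t = msum (%j. et j t)" for t
 have sm: "sets (mut t) = sets B" if "t : {0..1}" for t using et(1)[OF that] by (simp add: mut_def)
 have em: "em (mut t) E = (\<Sum>j. em (et j t) E)" if "t : {0..1}" "E : sets B" for t E
  unfolding mut_def using et(1)[OF that(1)] that(2) by (intro emeasure_msum) auto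
 have i: "(0::real) : {0..1}" "(1::real) : {0..1}" by auto
 have e0: "mut 0 = mu0"
  using eq[OF e(1) measurable_fst _ sub(1)] by (intro measure_eqI) (auto simp: sm[OF i(1)] em[OF i(1)] et(2) al_def pD(3))
 have e1: "mut 1 = mu1"
  using eq[OF e(2) measurable_snd _ sub(2)] by (intro measure_eqI) (auto simp: sm[OF i(2)] em[OF i(2)] et(3) be_def pD(4))
 let ?W = "W2 (metr Y) mu0 mu1"
 have TW: "TC mu0 mu1 = en (?W^2)" by (rule TC_W2[OF TC_finite[OF P2]])
 have TC: "TC (mut s) (mut t) <= en (((s - t)*?W)^2)" if st: "s : {0..1}" "t : {0..1}" for s t
 proof -
  have "(\<Sum>j. TC (et j s) (et j t)) <= (\<Sum>j. en ((s - t)^2) * ct j)" by (intro suminf_le et(4) st) auto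
  also have "... = en ((s - t)^2)*TC mu0 mu1" using sumc by simp
  also have "... = en (((s - t)*?W)^2)" unfolding TW by (simp add: power_mult_distrib ennreal_mult)
  finally have le: "(\<Sum>j. TC (et j s) (et j t)) <= en (((s - t)*?W)^2)" .
  hence "(\<Sum>j. TC (et j s) (et j t)) < top" by (rule le_less_trans) simp
  from order_trans[OF TC_msum[OF this] le] show ?thesis unfolding mut_def .
 qed
 have "W2_geodesic (metr Y) mu0 mu1 mut"
 proof (rule W2_geodesicI[OF _ e0 e1])
  fix t :: real assume t: "t : {0..1}"
  have "TC mu0 (mut t) < top" using TC[OF i(1) t] unfolding e0 by (rule le_less_trans) simp
  then obtain g where "g : cpl mu0 (mut t)" "(cost g) < top" by (rule TC_approx)
  thus "mut t : P2 (metr Y)" by (rule P2_of_coupling[OF P2(1)])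
 next
  fix s t :: real assume st: "0 <= s" "s < t" "t <= 1"
  have "((s - t)*?W)^2 = ((t - s)*?W)^2" by (simp add: power_mult_distrib power2_commute)
  hence "TC (mut s) (mut t) <= en (((t - s)*?W)^2)" using TC[of s t] st by simp
  thus "W2 (metr Y) (mut s) (mut t) <= (t - s)*?W" using st by (intro W2_le) auto
 qed
 thus ?thesis by blast
qed

text \<open>The exponent \<open>(N - 1)/N\<close> lies between 1 and \<open>(N' - 1)/N'\<close>, and
  the density has integral 1. Read by contraposition: infinite entropy for \<open>N\<close> makes
  the curvature inequality void for every admissible \<open>N'\<close>.\<close>

lemma renyi_finite_mono:
 assumes ac: "mu : P2ac" and N': "N' : {N..<0}" and fin: "ren N' mu < \<infinity>"
 shows "ren N mu < \<infinity>"
proof -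
 let ?rh = "dns mu"
 have P: "mu : P2 (metr Y)" using ac by (simp add: P2_ac_def)
 have pq: "1 <= (N - 1)/N" "(N - 1)/N <= (N' - 1)/N'" using N N' by (auto simp: field_simps)
 have le: "epowr u ((N - 1)/N) <= u + epowr u ((N' - 1)/N')" for u
 proof (cases u)
  case (real r)
  have "r powr ((N - 1)/N) <= r + r powr ((N' - 1)/N')"
  proof (cases "r <= 1")
   case True
   have "r powr ((N - 1)/N) <= r powr 1" using True real pq(1) by (intro powr_mono') simp_all
   hence "r powr ((N - 1)/N) <= r" using real by simp
   thus ?thesis by (rule add_increasing2[rotated]) simp
  next
   case False
   hence "r powr ((N - 1)/N) <= r powr ((N' - 1)/N')" using pq by (intro powr_mono) auto
   thus ?thesis using real by simp
  qed
  thus ?thesis using real by (simp add: epowr_ennreal ennreal_plus[symmetric] ennreal_leI del: ennreal_plus)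
 qed simp
 have "ren N mu <= (II y. ?rh y + epowr (?rh y) ((N' - 1)/N') ||M)"
  unfolding renyi_eq[OF ac] by (intro nn_integral_mono le)
 also have "... = (II y. ?rh y ||M) + ren N' mu"
  unfolding renyi_eq[OF ac] by (rule nn_integral_add) simp_all
 also have "(II y. ?rh y ||M) = 1"
  using emeasure_density_space[of ?rh M] P2D(4)[OF P] unfolding density_dens[OF ac] by simp
 finally show ?thesis using fin by (auto simp: less_top[symmetric] top_unique)
qed

theorem CD_Y: "CD_space K N (metr Y) (meas Y)"
 unfolding CD_space_def
proof (intro ballI)
 fix mu0 mu1 assume ac: "mu0 : P2ac" "mu1 : P2ac"
 show "EX pl mut. W2_optimal (metr Y) mu0 mu1 pl & W2_geodesic (metr Y) mu0 mu1 mut &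
   (ALL t:{0..1}. ALL N':{N..<0}. ren N' mu0 < \<infinity> & ren N' mu1 < \<infinity> -->
    ren N' (mut t) <= T_fun (metr Y) (meas Y) K N' t mu0 mu1 pl)"
 proof (cases "ren N mu0 < \<infinity> & ren N mu1 < \<infinity>")
  case True
  thus ?thesis using cd_finite[OF ac] by blast
 next
  case False
  \<comment> \<open>One of the two entropies is infinite for every \<open>N'\<close> in the range,
    so only an optimal plan and a geodesic have to be provided.\<close>
  obtain pl where pl: "W2_optimal (metr Y) mu0 mu1 pl" using optimal_plan_exists[OF ac] by blast
  obtain mut where "W2_geodesic (metr Y) mu0 mu1 mut" using geodesic_exists[OF ac pl] by blast
  thus ?thesis using pl False renyi_finite_mono[OF ac(1)] renyi_finite_mono[OF ac(2)] by blast
 qed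
qed

end

theorem theorem4p1:
  fixes K N :: real and kb :: nat
    and f_cut c :: "real \<Rightarrow> real"
    and X :: "nat \<Rightarrow> 'a pgmms" and Xinf :: "'b pgmms"
  assumes "cut_profile f_cut" and "cost_profile c"
    and "N < 0"
    and "\<And>n. X n \<in> pgmm_class f_cut kb"
    and "Xinf \<in> pgmm_class f_cut kb"
    and "(\<lambda>n. iKRW f_cut c kb (X n) Xinf) \<longlonglongrightarrow> 0"
    and "\<And>n. CD_space K N (metr (X n)) (meas (X n))"
    and "\<exists>\<omega>. \<forall>n. uniformly_convex_space N \<omega> (X n)"
    and "K < 0 \<Longrightarrow>
      sup (SUP n. mdiam (metr (X n))) (mdiam (metr Xinf)) < ennreal (pi * sqrt (1 / \<bar>K\<bar>))"
  shows "CD_space K N (metr Xinf) (meas Xinf)"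
proof -
 obtain \<omega> where uc: "!!n. uniformly_convex_space N \<omega> (X n)" using assms(8) by blast
 \<comment> \<open>For \<open>K < 0\<close> this is the supremum of all diameters, strictly below
   the critical value, so that one compact interval contains the distances of all spaces. Otherwise
   \<open>cdom\<close> does not involve \<open>D\<close>, and 0 serves.\<close>
 obtain D where D: "K < 0 ==> - K*D^2 < pi^2"
  "!!n x y. x : mspace (metr (X n)) ==> y : mspace (metr (X n)) ==> mdist (metr (X n)) x y : cdom K D"
  "!!x y. x : mspace (metr Xinf) ==> y : mspace (metr Xinf) ==> mdist (metr Xinf) x y : cdom K D"
 proof (cases "K < 0")
  case True
  let ?s = "sup (SUP n. mdiam (metr (X n))) (mdiam (metr Xinf))"
  have lt: "?s < en (pi * sqrt (1/\<bar>K\<bar>))" by (rule assms(9)[OF True])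
  then obtain D where D: "?s = en D" "0 <= D" by (cases ?s) auto
  have "D < pi * sqrt (1/\<bar>K\<bar>)" using lt D(2) unfolding D(1) by (subst (asm) ennreal_less_iff) auto
  hence "D^2 < (pi * sqrt (1/\<bar>K\<bar>))^2" using D(2) by (intro power_strict_mono) auto
  also have "... = pi^2/(- K)" using True by (simp add: power_mult_distrib)
  finally have KD: "- K*D^2 < pi^2" using True by (simp add: field_simps)
  have le: "mdist Z x y <= D" if "mdiam Z <= ?s" "x : mspace Z" "y : mspace Z" for Z :: "'z metric" and x y
  proof -
   have "en (mdist Z x y) <= mdiam Z" unfolding mdiam_def using that by (intro SUP_upper2[of x] SUP_upper2[of y]) auto
   hence "en (mdist Z x y) <= en D" using that(1) unfolding D(1) by (rule order_trans)
   thus ?thesis using D(2) by (simp add: ennreal_le_iff)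
  qed
  have "mdiam (metr (X n)) <= ?s" for n by (intro le_supI1 SUP_upper) simp
  from le[OF this] have 1: "mdist (metr (X n)) x y : cdom K D" if "x : mspace (metr (X n))" "y : mspace (metr (X n))" for n x y
   using that True by (simp add: cdom_def)
  have "mdiam (metr Xinf) <= ?s" by (rule sup_ge2)
  from le[OF this] have 2: "mdist (metr Xinf) x y : cdom K D" if "x : mspace (metr Xinf)" "y : mspace (metr Xinf)" for x y
   using that True by (simp add: cdom_def)
  show ?thesis by (rule that[of D]) (use KD 1 2 in auto)
 next
  case False
  show ?thesis by (rule that[of 0]) (use False in \<open>auto simp: cdom_def\<close>)
 qed
 have pg: "pgmm_space (X n)" "pgmm_space Xinf" for n using assms(4,5) by (auto simp: pgmm_class_def)
 \<comment> \<open>One index for each accuracy is enough, since \<open>cd_finite\<close> selects its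
   own sequence of spaces.\<close>
 have tr: "EX n C h c'. transfer (X n) Xinf L de C h c'" if "1 <= L" "0 < de" for L de
  using eventually_happens[OF transfer_eventually[OF assms(1,2,4,5,6) that]] by auto
 interpret cd_limit Xinf X K N D \<omega>
  by (rule cd_limit.intro[OF pgm.intro[OF pg(2)]], rule cd_limit_axioms.intro) (use pg assms(3,7) uc D tr in blast)+
 show ?thesis by (rule CD_Y)
qed

end
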